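(* Let $U\subset\mathbb{C}^m$ be a contractible open subset and $\ast$ be a nondegenerate star product with separation of variables of the anti-Wick type on $U\times\mathbb{C}^{0|d}$ determined by a nondegenerate formal potential $X=\nu^{-1}X_{-1}+X_0+\ldots$. Let $\mathcal{I}$ be the formal Berezin transform of $\ast$. Then the following statements hold. (a) There exists a nondegenerate formal potential $X'=\nu^{-1}X'_{-1}+X'_0+\ldots$ which determines the star product with separation of variables of the Wick type $$f\ast'g:=\mathcal{I}^{-1}(\mathcal{I}f\ast\mathcal{I}g)$$ and satisfies the equations $$\frac{\partial X'}{\partial z^k}=-\mathcal{I}^{-1}\Big(\frac{\partial X}{\partial z^k}\Big),\quad\frac{\partial X'}{\partial\theta^\alpha}=-\mathcal{I}^{-1}\Big(\frac{\partial X}{\partial\theta^\alpha}\Big),\quad\frac{\partial X'}{\partial\bar z^l}=-\mathcal{I}^{-1}\Big(\frac{\partial X}{\partial\bar z^l}\Big),\quad\frac{\partial X'}{\partial\bar\theta^\beta}=-\mathcal{I}^{-1}\Big(\frac{\partial X}{\partial\bar\theta^\beta}\Big)$$ for all $k,l,\alpha,\beta$. (b) For this $X'$, the Berezin density $$e^{X+X'}\,dz\,d\bar z\,d\theta\,d\bar\theta$$ is a supertrace density for the product $\ast$ on $U\times\mathbb{C}^{0|d}$.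
   Context: Notation. $U$ has coordinates $z^k,\bar z^l$; $\mathbb{C}^{0|d}$ has anticommuting odd coordinates $\theta^\alpha,\bar\theta^\beta$, $1\le\alpha,\beta\le d$. $[d]=\{1,\dots,d\}$; for $I=\{\alpha_1<\dots<\alpha_k\}\subset[d]$, $\theta^I=\theta^{\alpha_1}\cdots\theta^{\alpha_k}$, similarly $\bar\theta^J$. Functions on $U\times\mathbb{C}^{0|d}$ are $f=f_{IJ}\theta^I\bar\theta^J$ (summed), $f_{IJ}\in C^\infty(U)$ complex valued; holomorphic functions are $a_I\theta^I$ with $a_I$ holomorphic, antiholomorphic functions are $b_J\bar\theta^J$ with $b_J$ antiholomorphic. Formal functions are formal Laurent series in $\nu$ with finite principal part and coefficients in $C^\infty(U\times\mathbb{C}^{0|d})$; such a function has compact support if each $\nu$-coefficient does. Derivatives act from the left unless otherwise indicated by an arrow. Star products. A star product on $U\times\mathbb{C}^{0|d}$ is a $\nu$-linear, $\nu$-adically continuous, $\mathbb{Z}_2$-graded associative product $f\ast g=\sum_{r\ge0}\nu^rC_r(f,g)$ on formal functions with identity $1$, $C_0(f,g)=fg$, such that the operators $L_fg=f\ast g$ and $R_fg=(-1)^{|f||g|}g\ast f$ (homogeneous $f,g$) are formal differential operators. It has separation of variables of the anti-Wick type if $a\ast f=af$, $f\ast b=fb$ for all locally defined holomorphic $a$ and antiholomorphic $b$, and of the Wick type if $b\ast f=bf$, $f\ast a=fa$ for all such $a,b$. An anti-Wick type star product is nondegenerate if the matrices $(C_1(\bar z^l,z^k))$ and $(C_1(\bar\theta^\beta,\theta^\alpha))$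 are invertible at every point of $U$. Nondegenerate formal potential: an even formal function $X=\nu^{-1}X_{-1}+X_0+\ldots$ on $U\times\mathbb{C}^{0|d}$ such that, writing $Y$ for its nilpotent component (the part of degree $\ge1$ in $\theta,\bar\theta$) and $\Phi=X-Y$, the matrix $\big(\overrightarrow{\frac{\partial}{\partial\theta^\alpha}}Y_{-1}\overleftarrow{\frac{\partial}{\partial\bar\theta^\beta}}\big)$ is nondegenerate at every point of $U$ and $\Phi$ is a potential of a formal pseudo-Kähler form $\omega=i\partial\bar\partial\Phi=\nu^{-1}\omega_{-1}+\omega_0+\ldots$, i.e. $\big(\frac{\partial^2\Phi_{-1}}{\partial z^k\partial\bar z^l}\big)$ is nondegenerate at every point. (No reality condition is imposed.) The star product of anti-Wick type determined by $X$ is the unique star product with separation of variables of the anti-Wick type satisfying $L_{\partial X/\partial z^k}=\frac{\partial X}{\partial z^k}+\frac{\partial}{\partial z^k}$, $L_{\partial X/\partial\theta^\alpha}=\frac{\partial X}{\partial\theta^\alpha}+\frac{\partial}{\partial\theta^\alpha}$, $R_{\partial X/\partial\bar z^l}=\frac{\partial X}{\partial\bar z^l}+\frac{\partial}{\partial\bar z^l}$, $R_{\partial X/\partial\bar\theta^\beta}=\frac{\partial X}{\partial\bar\theta^\beta}+\frac{\partial}{\partial\bar\theta^\beta}$. Equivalently, it is given by $f\ast g=u^{-1}\big((uf)_{KQ}\star v^{QP}\star(ug)_{PL}\big)\theta^K\bar\theta^L$, where $u=e^Y=u_{PQ}\theta^P\bar\theta^Q$, $uf=(uf)_{KL}\theta^K\bar\theta^L$,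 $\star$ is the star product with separation of variables (anti-Wick type) on $U$ with $\frac{\partial\Phi}{\partial z^k}\star f=\frac{\partial\Phi}{\partial z^k}f+\frac{\partial f}{\partial z^k}$, and $(v^{QP})$ is the inverse matrix of $(u_{PQ})$ over $(C^\infty(U)[\nu^{-1},\nu]],\star)$. Similarly, the star product $\ast'$ of the Wick type is determined by $X'$ if its left and graded right multiplication operators satisfy $R'_{\partial X'/\partial z^k}=\frac{\partial X'}{\partial z^k}+\frac{\partial}{\partial z^k}$, $R'_{\partial X'/\partial\theta^\alpha}=\frac{\partial X'}{\partial\theta^\alpha}+\frac{\partial}{\partial\theta^\alpha}$, $L'_{\partial X'/\partial\bar z^l}=\frac{\partial X'}{\partial\bar z^l}+\frac{\partial}{\partial\bar z^l}$, $L'_{\partial X'/\partial\bar\theta^\beta}=\frac{\partial X'}{\partial\bar\theta^\beta}+\frac{\partial}{\partial\bar\theta^\beta}$. Formal Berezin transform of $\ast$: the unique formal differential operator $\mathcal{I}=1+\nu\mathcal{I}_1+\ldots$ with $\mathcal{I}(ba)=b\ast a$ for all local holomorphic $a$ and antiholomorphic $b$. Supertrace density: $dz\,d\bar z$ is a Lebesgue measure on $U$ and $\int f_{IJ}\theta^I\bar\theta^J\,d\theta\,d\bar\theta=f_{[d][d]}$; a Berezin density $\mu=\rho\,dz\,d\bar z\,d\theta\,d\bar\theta$ with formal $\rho$ is a supertrace density for $\ast$ if $\int(f\ast g)\mu=(-1)^{|f||g|}\int(g\ast f)\mu$ for homogeneous $f,g$, one of which has compact support. *)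

theory Defs
  imports
    "HOL-Analysis.Analysis"
    "HOL-Library.Function_Algebras"
    "HOL-Computational_Algebra.Formal_Laurent_Series"
begin

notation fls_nth (infixl "$$" 75)

section \<open>The Grassmann algebra in the generators theta, theta-bar\<close>

text \<open>
  An element is given by its coefficients: \<open>gcoeff x I J\<close> is the coefficient of the monomial
  theta\<open>\<^sup>I\<close> theta-bar\<open>\<^sup>J\<close>, each factor being taken in increasing order of the indices.
  The type \<open>'d\<close>, of class \<open>{finite, linorder}\<close>, plays the role of the ordered set
  \<open>{1 < \<dots> < d}\<close>.
\<close>

datatype 'd grass = Grass (gcoeff: "'d set \<Rightarrow> 'd set \<Rightarrow> complex")

lemma grass_eqI: "(\<And>I J. gcoeff x I J = gcoeff y I J) \<Longrightarrow> x = y"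
  by (cases x; cases y) (simp add: fun_eq_iff)

definition inversions :: "'d::linorder set \<Rightarrow> 'd set \<Rightarrow> nat" where
  "inversions I K = card {(i, k). i \<in> I \<and> k \<in> K \<and> k < i}"

text \<open>
  \<open>mono_sign I J K L\<close> is the sign in
  (theta\<open>\<^sup>I\<close> theta-bar\<open>\<^sup>J\<close>)(theta\<open>\<^sup>K\<close> theta-bar\<open>\<^sup>L\<close>) =
  \<open>\<plusminus>\<close> theta\<open>\<^sup>I\<^sup>\<union>\<^sup>K\<close> theta-bar\<open>\<^sup>J\<^sup>\<union>\<^sup>L\<close> for \<open>I \<inter> K = {}\<close>, \<open>J \<inter> L = {}\<close>; the product is
  \<open>0\<close> if \<open>I\<close>, \<open>K\<close> or \<open>J\<close>, \<open>L\<close> are not disjoint.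
\<close>

definition mono_sign :: "'d::linorder set \<Rightarrow> 'd set \<Rightarrow> 'd set \<Rightarrow> 'd set \<Rightarrow> complex" where
  "mono_sign I J K L = (- 1) ^ (card J * card K + inversions I K + inversions J L)"

lemma inversions_empty [simp]: "inversions {} K = 0" "inversions I {} = 0"
  by (simp_all add: inversions_def)

lemma inversions_Un_left:
  fixes I K M :: "'d::{finite,linorder} set"
  assumes "I \<inter> K = {}"
  shows "inversions (I \<union> K) M = inversions I M + inversions K M"
proof -
  have "{(i, k). i \<in> I \<union> K \<and> k \<in> M \<and> k < i}
      = {(i, k). i \<in> I \<and> k \<in> M \<and> k < i} \<union> {(i, k). i \<in> K \<and> k \<in> M \<and> k < i}"
    by auto
  then show ?thesis
    unfolding inversions_def using assms by (simp add: card_Un_disjoint disjoint_iff)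
qed

lemma inversions_Un_right:
  fixes I K M :: "'d::{finite,linorder} set"
  assumes "K \<inter> M = {}"
  shows "inversions I (K \<union> M) = inversions I K + inversions I M"
proof -
  have "{(i, k). i \<in> I \<and> k \<in> K \<union> M \<and> k < i}
      = {(i, k). i \<in> I \<and> k \<in> K \<and> k < i} \<union> {(i, k). i \<in> I \<and> k \<in> M \<and> k < i}"
    by auto
  then show ?thesis
    unfolding inversions_def using assms by (simp add: card_Un_disjoint disjoint_iff)
qed

lemma mono_sign_assoc:
  fixes I J K L M N :: "'d::{finite,linorder} set"
  assumes "I \<inter> K = {}" "I \<inter> M = {}" "K \<inter> M = {}" "J \<inter> L = {}" "J \<inter> N = {}" "L \<inter> N = {}"
  shows "mono_sign I J K L * mono_sign (I \<union> K) (J \<union> L) M N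
       = mono_sign I J (K \<union> M) (L \<union> N) * mono_sign K L M N"
  unfolding mono_sign_def power_add[symmetric] using assms
  by (simp add: inversions_Un_left inversions_Un_right card_Un_disjoint algebra_simps)

lemma sum_Pow_Pow_reindex:
  fixes F :: "'d::finite set \<Rightarrow> 'd set \<Rightarrow> 'd set \<Rightarrow> 'b::comm_monoid_add"
  shows "(\<Sum>P\<in>Pow A. \<Sum>I\<in>Pow P. F I (P - I) (A - P))
       = (\<Sum>I\<in>Pow A. \<Sum>K\<in>Pow (A - I). F I K (A - I - K))"
proof -
  have "(\<Sum>P\<in>Pow A. \<Sum>I\<in>Pow P. F I (P - I) (A - P))
      = (\<Sum>(P, I)\<in>(SIGMA P:Pow A. Pow P). F I (P - I) (A - P))"
    by (subst sum.Sigma) auto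
  also have "\<dots> = (\<Sum>(I, K)\<in>(SIGMA I:Pow A. Pow (A - I)). F I K (A - I - K))"
    by (rule sum.reindex_bij_witness[where i = "\<lambda>(I, K). (I \<union> K, I)" and j = "\<lambda>(P, I). (I, P - I)"])
      (auto intro!: arg_cong2[where f = "F _"])
  also have "\<dots> = (\<Sum>I\<in>Pow A. \<Sum>K\<in>Pow (A - I). F I K (A - I - K))"
    by (subst sum.Sigma) auto
  finally show ?thesis .
qed

instantiation grass :: ("{finite,linorder}") ring_1
begin

definition zero_grass :: "'a grass" where
  "0 = Grass (\<lambda>I J. 0)"

definition one_grass :: "'a grass" where
  "1 = Grass (\<lambda>I J. if I = {} \<and> J = {} then 1 else 0)"

definition plus_grass :: "'a grass \<Rightarrow> 'a grass \<Rightarrow> 'a grass" where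
  "x + y = Grass (\<lambda>I J. gcoeff x I J + gcoeff y I J)"

definition minus_grass :: "'a grass \<Rightarrow> 'a grass \<Rightarrow> 'a grass" where
  "x - y = Grass (\<lambda>I J. gcoeff x I J - gcoeff y I J)"

definition uminus_grass :: "'a grass \<Rightarrow> 'a grass" where
  "- x = Grass (\<lambda>I J. - gcoeff x I J)"

definition times_grass :: "'a grass \<Rightarrow> 'a grass \<Rightarrow> 'a grass" where
  "x * y = Grass (\<lambda>A B. \<Sum>I\<in>Pow A. \<Sum>J\<in>Pow B.
     mono_sign I J (A - I) (B - J) * (gcoeff x I J * gcoeff y (A - I) (B - J)))"

instance
proof
  fix x y z :: "'a grass"
  show "x + y + z = x + (y + z)" by (simp add: plus_grass_def add.assoc)
  show "x + y = y + x" by (simp add: plus_grass_def add.commute)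
  show "0 + x = x" by (simp add: plus_grass_def zero_grass_def)
  show "- x + x = 0" by (simp add: plus_grass_def zero_grass_def uminus_grass_def)
  show "x - y = x + - y" by (simp add: plus_grass_def minus_grass_def uminus_grass_def)
  show "(0::'a grass) \<noteq> 1"
    by (auto simp: zero_grass_def one_grass_def fun_eq_iff)
  show "(x + y) * z = x * z + y * z"
    by (simp add: plus_grass_def times_grass_def sum.distrib[symmetric] algebra_simps)
  show "x * (y + z) = x * y + x * z"
    by (simp add: plus_grass_def times_grass_def sum.distrib[symmetric] algebra_simps)
  show "1 * x = x"
  proof (rule grass_eqI)
    fix A B :: "'a set"
    have "gcoeff (1 * x) A B = (\<Sum>I\<in>Pow A. \<Sum>J\<in>Pow B. if I = {} then if J = {} then gcoeff x A B else 0 else 0)"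
      by (auto simp: times_grass_def one_grass_def mono_sign_def intro!: sum.cong)
    also have "\<dots> = (\<Sum>I\<in>Pow A. if I = {} then \<Sum>J\<in>Pow B. if J = {} then gcoeff x A B else 0 else 0)"
      by (intro sum.cong) auto
    also have "\<dots> = gcoeff x A B"
      by (simp add: sum.delta)
    finally show "gcoeff (1 * x) A B = gcoeff x A B" .
  qed
  show "x * 1 = x"
  proof (rule grass_eqI)
    fix A B :: "'a set"
    have "gcoeff (x * 1) A B = (\<Sum>I\<in>Pow A. \<Sum>J\<in>Pow B. if I = A then if J = B then gcoeff x A B else 0 else 0)"
      by (auto simp: times_grass_def one_grass_def mono_sign_def intro!: sum.cong)
    also have "\<dots> = (\<Sum>I\<in>Pow A. if I = A then \<Sum>J\<in>Pow B. if J = B then gcoeff x A B else 0 else 0)"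
      by (intro sum.cong) auto
    also have "\<dots> = gcoeff x A B"
      by (simp add: sum.delta)
    finally show "gcoeff (x * 1) A B = gcoeff x A B" .
  qed
  show "x * y * z = x * (y * z)"
  proof (rule grass_eqI)
    fix A B :: "'a set"
    define F where "F I K M J L N = mono_sign I J K L * mono_sign (I \<union> K) (J \<union> L) M N *
        (gcoeff x I J * gcoeff y K L * gcoeff z M N)" for I K M J L N
    have "gcoeff (x * y * z) A B = (\<Sum>P\<in>Pow A. \<Sum>Q\<in>Pow B. \<Sum>I\<in>Pow P. \<Sum>J\<in>Pow Q.
        F I (P - I) (A - P) J (Q - J) (B - Q))"
      by (auto simp: times_grass_def F_def sum_distrib_left sum_distrib_right Un_absorb1 algebra_simps
          intro!: sum.cong)
    also have "\<dots> = (\<Sum>P\<in>Pow A. \<Sum>I\<in>Pow P. \<Sum>Q\<in>Pow B. \<Sum>J\<in>Pow Q.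
        F I (P - I) (A - P) J (Q - J) (B - Q))"
      by (intro sum.cong sum.swap refl)
    also have "\<dots> = (\<Sum>I\<in>Pow A. \<Sum>K\<in>Pow (A - I). \<Sum>J\<in>Pow B. \<Sum>L\<in>Pow (B - J).
        F I K (A - I - K) J L (B - J - L))"
      by (subst sum_Pow_Pow_reindex[where F = "\<lambda>I K M. \<Sum>Q\<in>Pow B. \<Sum>J\<in>Pow Q. F I K M J (Q - J) (B - Q)"])
        (intro sum.cong refl sum_Pow_Pow_reindex)
    also have "\<dots> = (\<Sum>I\<in>Pow A. \<Sum>J\<in>Pow B. \<Sum>K\<in>Pow (A - I). \<Sum>L\<in>Pow (B - J).
        F I K (A - I - K) J L (B - J - L))"
      by (intro sum.cong sum.swap refl)
    also have "\<dots> = (\<Sum>I\<in>Pow A. \<Sum>J\<in>Pow B. \<Sum>K\<in>Pow (A - I). \<Sum>L\<in>Pow (B - J).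
        mono_sign I J (A - I) (B - J) * mono_sign K L (A - I - K) (B - J - L) *
        (gcoeff x I J * gcoeff y K L * gcoeff z (A - I - K) (B - J - L)))"
    proof (intro sum.cong refl)
      fix I J K L assume "I \<in> Pow A" "J \<in> Pow B" "K \<in> Pow (A - I)" "L \<in> Pow (B - J)"
      moreover from this have "K \<union> (A - I - K) = A - I" "L \<union> (B - J - L) = B - J" by auto
      moreover from calculation have "mono_sign I J K L * mono_sign (I \<union> K) (J \<union> L) (A - I - K) (B - J - L)
          = mono_sign I J (K \<union> (A - I - K)) (L \<union> (B - J - L)) * mono_sign K L (A - I - K) (B - J - L)"
        by (intro mono_sign_assoc) auto
      ultimately show "F I K (A - I - K) J L (B - J - L) =
        mono_sign I J (A - I) (B - J) * mono_sign K L (A - I - K) (B - J - L) *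
        (gcoeff x I J * gcoeff y K L * gcoeff z (A - I - K) (B - J - L))"
        by (simp add: F_def)
    qed
    also have "\<dots> = gcoeff (x * (y * z)) A B"
      by (auto simp: times_grass_def sum_distrib_left algebra_simps intro!: sum.cong)
    finally show "gcoeff (x * y * z) A B = gcoeff (x * (y * z)) A B" .
  qed
qed

end

definition gconst :: "complex \<Rightarrow> 'd grass" where
  "gconst c = Grass (\<lambda>I J. if I = {} \<and> J = {} then c else 0)"

definition gtheta :: "'d \<Rightarrow> 'd grass" where
  "gtheta \<alpha> = Grass (\<lambda>I J. if I = {\<alpha>} \<and> J = {} then 1 else 0)"

definition gthetabar :: "'d \<Rightarrow> 'd grass" where
  "gthetabar \<beta> = Grass (\<lambda>I J. if I = {} \<and> J = {\<beta>} then 1 else 0)"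

definition gnil :: "'d grass \<Rightarrow> 'd grass" where
  "gnil x = Grass (\<lambda>I J. if I = {} \<and> J = {} then 0 else gcoeff x I J)"

definition gpart :: "nat \<Rightarrow> 'd grass \<Rightarrow> 'd grass" where
  "gpart p x = Grass (\<lambda>I J. if (card I + card J) mod 2 = p mod 2 then gcoeff x I J else 0)"

text \<open>
  The derivatives acting from the left, and the derivative with respect to theta-bar acting from
  the right. The exponents count the generators that have to be passed; the left derivative in
  theta-bar passes all of theta\<open>\<^sup>I\<close>.
\<close>

definition gdtheta :: "'d::linorder \<Rightarrow> 'd grass \<Rightarrow> 'd grass" where
  "gdtheta \<alpha> x = Grass (\<lambda>I J. if \<alpha> \<in> I then 0
     else (- 1) ^ card {i \<in> I. i < \<alpha>} * gcoeff x (insert \<alpha> I) J)"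

definition gdthetabar :: "'d::linorder \<Rightarrow> 'd grass \<Rightarrow> 'd grass" where
  "gdthetabar \<beta> x = Grass (\<lambda>I J. if \<beta> \<in> J then 0
     else (- 1) ^ (card I + card {j \<in> J. j < \<beta>}) * gcoeff x I (insert \<beta> J))"

definition gdthetabar_right :: "'d::linorder \<Rightarrow> 'd grass \<Rightarrow> 'd grass" where
  "gdthetabar_right \<beta> x = Grass (\<lambda>I J. if \<beta> \<in> J then 0
     else (- 1) ^ card {j \<in> J. \<beta> < j} * gcoeff x I (insert \<beta> J))"


section \<open>Smooth, holomorphic and antiholomorphic functions\<close>

primrec diff_times_on :: "nat \<Rightarrow> 'a::real_normed_vector set \<Rightarrow> ('a \<Rightarrow> 'b::real_normed_vector) \<Rightarrow> bool" where
  "diff_times_on 0 S f \<longleftrightarrow> continuous_on S f"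
| "diff_times_on (Suc n) S f \<longleftrightarrow> (\<forall>x\<in>S. f differentiable (at x)) \<and>
     (\<forall>v. diff_times_on n S (\<lambda>x. frechet_derivative f (at x) v))"

definition smooth_on :: "'a::real_normed_vector set \<Rightarrow> ('a \<Rightarrow> 'b::real_normed_vector) \<Rightarrow> bool" where
  "smooth_on S f \<longleftrightarrow> (\<forall>n. diff_times_on n S f)"

definition hol_on :: "(complex^'m) set \<Rightarrow> (complex^'m \<Rightarrow> complex) \<Rightarrow> bool" where
  "hol_on V f \<longleftrightarrow> (\<forall>z\<in>V. \<exists>D. (f has_derivative D) (at z) \<and> (\<forall>c v. D (c *s v) = c * D v))"

definition antihol_on :: "(complex^'m) set \<Rightarrow> (complex^'m \<Rightarrow> complex) \<Rightarrow> bool" where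
  "antihol_on V f \<longleftrightarrow> hol_on V (\<lambda>z. cnj (f z))"

definition wirt :: "'m \<Rightarrow> (complex^'m \<Rightarrow> complex) \<Rightarrow> complex^'m \<Rightarrow> complex" where
  "wirt k f z = (frechet_derivative f (at z) (axis k 1)
     - \<i> * frechet_derivative f (at z) (axis k \<i>)) / 2"

definition wirt_bar :: "'m \<Rightarrow> (complex^'m \<Rightarrow> complex) \<Rightarrow> complex^'m \<Rightarrow> complex" where
  "wirt_bar l f z = (frechet_derivative f (at z) (axis l 1)
     + \<i> * frechet_derivative f (at z) (axis l \<i>)) / 2"


section \<open>Superfunctions and formal functions\<close>

text \<open>
  Functions on \<open>U\<close> are represented by functions on the whole of \<open>complex^'m\<close> of which only the
  restriction to the open set \<open>U\<close> matters: regularity is required on \<open>U\<close> only and two functions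
  are identified when they agree on \<open>U\<close>. The ring operations on \<open>('m, 'd) sfun\<close> are pointwise, and
  those on \<open>('m, 'd) formal\<close> are the ones of Laurent series in nu; the coefficient of the \<open>n\<close>-th
  power of nu is \<open>f $$ n\<close>.
\<close>

type_synonym ('m, 'd) sfun = "complex^'m \<Rightarrow> 'd grass"
type_synonym ('m, 'd) formal = "('m, 'd) sfun fls"

definition sf_coeff :: "('m::finite, 'd) sfun \<Rightarrow> 'd set \<Rightarrow> 'd set \<Rightarrow> complex^'m \<Rightarrow> complex" where
  "sf_coeff f I J = (\<lambda>z. gcoeff (f z) I J)"

definition sf_smooth :: "(complex^'m) set \<Rightarrow> ('m::finite, 'd) sfun set" where
  "sf_smooth U = {f. \<forall>I J. smooth_on U (sf_coeff f I J)}"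

definition sf_hol :: "(complex^'m) set \<Rightarrow> ('m::finite, 'd) sfun \<Rightarrow> bool" where
  "sf_hol V a \<longleftrightarrow> (\<forall>I. hol_on V (sf_coeff a I {})) \<and>
     (\<forall>I J. J \<noteq> {} \<longrightarrow> (\<forall>z\<in>V. sf_coeff a I J z = 0))"

definition sf_antihol :: "(complex^'m) set \<Rightarrow> ('m::finite, 'd) sfun \<Rightarrow> bool" where
  "sf_antihol V b \<longleftrightarrow> (\<forall>J. antihol_on V (sf_coeff b {} J)) \<and>
     (\<forall>I J. I \<noteq> {} \<longrightarrow> (\<forall>z\<in>V. sf_coeff b I J z = 0))"

definition sf_dz :: "'m::finite \<Rightarrow> ('m, 'd) sfun \<Rightarrow> ('m, 'd) sfun" where
  "sf_dz k f = (\<lambda>z. Grass (\<lambda>I J. wirt k (sf_coeff f I J) z))"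

definition sf_dzbar :: "'m::finite \<Rightarrow> ('m, 'd) sfun \<Rightarrow> ('m, 'd) sfun" where
  "sf_dzbar l f = (\<lambda>z. Grass (\<lambda>I J. wirt_bar l (sf_coeff f I J) z))"

definition sf_dtheta :: "'d::linorder \<Rightarrow> ('m::finite, 'd) sfun \<Rightarrow> ('m, 'd) sfun" where
  "sf_dtheta \<alpha> f = (\<lambda>z. gdtheta \<alpha> (f z))"

definition sf_dthetabar :: "'d::linorder \<Rightarrow> ('m::finite, 'd) sfun \<Rightarrow> ('m, 'd) sfun" where
  "sf_dthetabar \<beta> f = (\<lambda>z. gdthetabar \<beta> (f z))"

text \<open>Coefficientwise extension to Laurent series of an operator that maps \<open>0\<close> to \<open>0\<close>.\<close>

definition fls_map :: "('a::zero \<Rightarrow> 'b::zero) \<Rightarrow> 'a fls \<Rightarrow> 'b fls" where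
  "fls_map A f = Abs_fls (\<lambda>n. A (f $$ n))"

lemma fls_map_nth: "A 0 = 0 \<Longrightarrow> fls_map A f $$ n = A (f $$ n)"
  unfolding fls_map_def
  by (rule nth_Abs_fls, rule MOST_mono[OF MOST_fls_neg_nth_eq_0[of f]]) simp

definition f_dz :: "'m::finite \<Rightarrow> ('m, 'd::{finite,linorder}) formal \<Rightarrow> ('m, 'd) formal" where
  "f_dz k = fls_map (sf_dz k)"

definition f_dzbar :: "'m::finite \<Rightarrow> ('m, 'd::{finite,linorder}) formal \<Rightarrow> ('m, 'd) formal" where
  "f_dzbar l = fls_map (sf_dzbar l)"

definition f_dtheta :: "'d::{finite,linorder} \<Rightarrow> ('m::finite, 'd) formal \<Rightarrow> ('m, 'd) formal" where
  "f_dtheta \<alpha> = fls_map (sf_dtheta \<alpha>)"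

definition f_dthetabar :: "'d::{finite,linorder} \<Rightarrow> ('m::finite, 'd) formal \<Rightarrow> ('m, 'd) formal" where
  "f_dthetabar \<beta> = fls_map (sf_dthetabar \<beta>)"

definition f_part :: "nat \<Rightarrow> ('m::finite, 'd::{finite,linorder}) formal \<Rightarrow> ('m, 'd) formal" where
  "f_part p = fls_map (\<lambda>f z. gpart p (f z))"

lemma sf_op_zero:
  "sf_dz k (0 :: ('m::finite, 'd::{finite,linorder}) sfun) = 0"
  "sf_dzbar k (0 :: ('m, 'd) sfun) = 0"
  "sf_dtheta \<alpha> (0 :: ('m, 'd) sfun) = 0"
  "sf_dthetabar \<alpha> (0 :: ('m, 'd) sfun) = 0"
  "(\<lambda>z. gpart p ((0 :: ('m, 'd) sfun) z)) = 0"
  by (auto simp: fun_eq_iff sf_dz_def sf_dzbar_def sf_dtheta_def sf_dthetabar_def sf_coeff_def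
      wirt_def wirt_bar_def gdtheta_def gdthetabar_def gpart_def zero_grass_def frechet_derivative_const)

lemmas f_op_nth =
  sf_op_zero[THEN fls_map_nth, folded f_dz_def f_dzbar_def f_dtheta_def f_dthetabar_def f_part_def]

definition formal_funs :: "(complex^'m) set \<Rightarrow> ('m::finite, 'd::{finite,linorder}) formal set" where
  "formal_funs U = {f. \<forall>n. f $$ n \<in> sf_smooth U}"

definition eq_on :: "(complex^'m) set \<Rightarrow> ('m::finite, 'd::{finite,linorder}) formal \<Rightarrow> ('m, 'd) formal \<Rightarrow> bool" where
  "eq_on V f g \<longleftrightarrow> (\<forall>n. \<forall>z\<in>V. (f $$ n) z = (g $$ n) z)"

definition homogeneous_on ::
  "(complex^'m) set \<Rightarrow> nat \<Rightarrow> ('m::finite, 'd::{finite,linorder}) formal \<Rightarrow> bool" where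
  "homogeneous_on U p f \<longleftrightarrow> eq_on U (f_part p f) f"

definition compact_supp_on :: "(complex^'m) set \<Rightarrow> ('m::finite, 'd::{finite,linorder}) formal \<Rightarrow> bool" where
  "compact_supp_on U f \<longleftrightarrow> (\<forall>n. \<exists>K. compact K \<and> K \<subseteq> U \<and> (\<forall>z\<in>U - K. (f $$ n) z = 0))"

text \<open>Elements of \<open>complex fls\<close> are embedded as constant formal functions.\<close>

definition f_scalar :: "complex fls \<Rightarrow> ('m::finite, 'd::{finite,linorder}) formal" where
  "f_scalar = fls_map (\<lambda>c z. gconst c)"


section \<open>Formal differential operators\<close>

text \<open>
  The differential operators on \<open>U\<close> are the algebra of operators generated by multiplications
  with smooth functions and by the partial derivatives (all acting from the left).
\<close>

inductive diff_op ::
  "(complex^'m) set \<Rightarrow> (('m::finite, 'd::{finite,linorder}) sfun \<Rightarrow> ('m, 'd) sfun) \<Rightarrow> bool"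
  for U where
  "c \<in> sf_smooth U \<Longrightarrow> diff_op U (\<lambda>f. c * f)"
| "diff_op U (sf_dz k)"
| "diff_op U (sf_dzbar l)"
| "diff_op U (sf_dtheta \<alpha>)"
| "diff_op U (sf_dthetabar \<beta>)"
| "diff_op U A \<Longrightarrow> diff_op U B \<Longrightarrow> diff_op U (\<lambda>f. A f + B f)"
| "diff_op U A \<Longrightarrow> diff_op U B \<Longrightarrow> diff_op U (\<lambda>f. A (B f))"

text \<open>
  \<open>A\<close> acts on formal functions as the sum over \<open>r \<ge> r0\<close> of the \<open>r\<close>-th power of nu times \<open>D r\<close>.
\<close>

definition formal_expansion :: "(complex^'m) set \<Rightarrow> int
    \<Rightarrow> (int \<Rightarrow> ('m::finite, 'd::{finite,linorder}) sfun \<Rightarrow> ('m, 'd) sfun)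
    \<Rightarrow> (('m, 'd) formal \<Rightarrow> ('m, 'd) formal) \<Rightarrow> bool" where
  "formal_expansion U r0 D A \<longleftrightarrow> (\<forall>f\<in>formal_funs U. \<forall>n. \<forall>z\<in>U.
     (A f $$ n) z = (\<Sum>r = r0..n - fls_subdegree f. D r (f $$ (n - r)) z))"

definition formal_diff_op :: "(complex^'m) set
    \<Rightarrow> (('m::finite, 'd::{finite,linorder}) formal \<Rightarrow> ('m, 'd) formal) \<Rightarrow> bool" where
  "formal_diff_op U A \<longleftrightarrow> (\<exists>r0 D. (\<forall>r. diff_op U (D r)) \<and> formal_expansion U r0 D A)"

text \<open>A preimage, unique up to equality on \<open>U\<close> when \<open>A\<close> is bijective on formal functions on \<open>U\<close>.\<close>

definition op_inv :: "(complex^'m) set \<Rightarrow> (('m::finite, 'd::{finite,linorder}) formal \<Rightarrow> ('m, 'd) formal)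
    \<Rightarrow> ('m, 'd) formal \<Rightarrow> ('m, 'd) formal" where
  "op_inv U A f = (SOME g. g \<in> formal_funs U \<and> eq_on U (A g) f)"


section \<open>Star products\<close>

type_synonym ('m, 'd) prod = "('m, 'd) formal \<Rightarrow> ('m, 'd) formal \<Rightarrow> ('m, 'd) formal"

text \<open>The graded right multiplication \<open>R\<^sub>f g = (-1)\<^sup>|\<^sup>f\<^sup>|\<^sup>|\<^sup>g\<^sup>| g * f\<close>, extended bilinearly to
  inhomogeneous \<open>f\<close>, \<open>g\<close>.\<close>

definition right_mult :: "('m::finite, 'd::{finite,linorder}) prod \<Rightarrow> ('m, 'd) prod" where
  "right_mult star f g = (\<Sum>p\<in>{0,1}. \<Sum>q\<in>{0,1}. (- 1) ^ (p * q) * star (f_part q g) (f_part p f))"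

text \<open>The expansion with coefficients \<open>C r\<close>, restricted to \<open>U\<close>: nu-linearity and nu-adic
  continuity amount to its validity for all formal \<open>f\<close>, \<open>g\<close>.\<close>

definition star_expansion :: "(complex^'m) set
    \<Rightarrow> (nat \<Rightarrow> ('m::finite, 'd::{finite,linorder}) sfun \<Rightarrow> ('m, 'd) sfun \<Rightarrow> ('m, 'd) sfun)
    \<Rightarrow> ('m, 'd) prod \<Rightarrow> bool" where
  "star_expansion U C star \<longleftrightarrow> (\<forall>f\<in>formal_funs U. \<forall>g\<in>formal_funs U. \<forall>n. \<forall>z\<in>U.
     (star f g $$ n) z =
       (\<Sum>(i, j) | fls_subdegree f \<le> i \<and> fls_subdegree g \<le> j \<and> i + j \<le> n.
          C (nat (n - i - j)) (f $$ i) (g $$ j) z))"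

definition star_product :: "(complex^'m) set \<Rightarrow> ('m::finite, 'd::{finite,linorder}) prod \<Rightarrow> bool" where
  "star_product U star \<longleftrightarrow>
     (\<forall>f\<in>formal_funs U. \<forall>g\<in>formal_funs U. star f g \<in> formal_funs U) \<and>
     (\<forall>f\<in>formal_funs U. \<forall>g\<in>formal_funs U. \<forall>h\<in>formal_funs U.
        eq_on U (star (f + g) h) (star f h + star g h) \<and>
        eq_on U (star f (g + h)) (star f g + star f h) \<and>
        eq_on U (star (star f g) h) (star f (star g h))) \<and>
     (\<forall>f\<in>formal_funs U. \<forall>g\<in>formal_funs U. \<forall>c.
        eq_on U (star (f_scalar c * f) g) (f_scalar c * star f g) \<and>
        eq_on U (star f (f_scalar c * g)) (f_scalar c * star f g)) \<and>
     (\<exists>C. star_expansion U C star \<and>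
        (\<forall>f\<in>sf_smooth U. \<forall>g\<in>sf_smooth U. \<forall>z\<in>U. C 0 f g z = f z * g z)) \<and>
     (\<forall>f\<in>formal_funs U. \<forall>g\<in>formal_funs U. \<forall>p q.
        homogeneous_on U p f \<and> homogeneous_on U q g \<longrightarrow> homogeneous_on U (p + q) (star f g)) \<and>
     (\<forall>f\<in>formal_funs U. eq_on U (star 1 f) f \<and> eq_on U (star f 1) f) \<and>
     (\<forall>f\<in>formal_funs U. formal_diff_op U (star f) \<and> formal_diff_op U (right_mult star f))"

text \<open>
  A star product is local (its multiplication operators are differential operators), so it
  restricts to open \<open>V \<subseteq> U\<close>, and near any point of \<open>V\<close> a function given on \<open>V\<close> agrees with a
  function on \<open>U\<close> (multiply it by a cut-off function). Hence a condition on all locally defined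
  holomorphic \<open>a\<close> is expressed by quantifying over all \<open>a\<close> on \<open>U\<close> which are holomorphic on some
  open \<open>V \<subseteq> U\<close> and requiring the condition on \<open>V\<close> only.
\<close>

definition anti_wick :: "(complex^'m) set \<Rightarrow> ('m::finite, 'd::{finite,linorder}) prod \<Rightarrow> bool" where
  "anti_wick U star \<longleftrightarrow> (\<forall>V. open V \<and> V \<subseteq> U \<longrightarrow>
     (\<forall>a\<in>sf_smooth U. \<forall>f\<in>formal_funs U. sf_hol V a \<longrightarrow>
        eq_on V (star (fls_const a) f) (fls_const a * f)) \<and>
     (\<forall>b\<in>sf_smooth U. \<forall>f\<in>formal_funs U. sf_antihol V b \<longrightarrow>
        eq_on V (star f (fls_const b)) (f * fls_const b)))"

definition wick :: "(complex^'m) set \<Rightarrow> ('m::finite, 'd::{finite,linorder}) prod \<Rightarrow> bool" where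
  "wick U star \<longleftrightarrow> (\<forall>V. open V \<and> V \<subseteq> U \<longrightarrow>
     (\<forall>b\<in>sf_smooth U. \<forall>f\<in>formal_funs U. sf_antihol V b \<longrightarrow>
        eq_on V (star (fls_const b) f) (fls_const b * f)) \<and>
     (\<forall>a\<in>sf_smooth U. \<forall>f\<in>formal_funs U. sf_hol V a \<longrightarrow>
        eq_on V (star f (fls_const a)) (f * fls_const a)))"

definition star_C1 :: "('m::finite, 'd::{finite,linorder}) prod \<Rightarrow> ('m, 'd) sfun \<Rightarrow> ('m, 'd) sfun \<Rightarrow> ('m, 'd) sfun" where
  "star_C1 star f g = star (fls_const f) (fls_const g) $$ 1"

text \<open>A matrix of even superfunctions is invertible at a point iff the matrix of its components of
  degree \<open>0\<close> in the odd coordinates is.\<close>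

definition nondegenerate_star :: "(complex^'m) set \<Rightarrow> ('m::finite, 'd::{finite,linorder}) prod \<Rightarrow> bool" where
  "nondegenerate_star U star \<longleftrightarrow> (\<forall>x\<in>U.
     invertible ((\<chi> l k. sf_coeff (star_C1 star (\<lambda>z. gconst (cnj (z $ l))) (\<lambda>z. gconst (z $ k))) {} {} x)
       :: complex^'m^'m) \<and>
     invertible ((\<chi> \<beta> \<alpha>. sf_coeff (star_C1 star (\<lambda>z. gthetabar \<beta>) (\<lambda>z. gtheta \<alpha>)) {} {} x)
       :: ((complex, 'd) vec, 'd) vec))"


section \<open>Formal potentials and the star products determined by them\<close>

definition nondegenerate_potential :: "(complex^'m) set \<Rightarrow> ('m::finite, 'd::{finite,linorder}) formal \<Rightarrow> bool" where
  "nondegenerate_potential U X \<longleftrightarrow>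
     X \<in> formal_funs U \<and> homogeneous_on U 0 X \<and>
     (\<forall>n < - 1. \<forall>x\<in>U. (X $$ n) x = 0) \<and>
     (\<forall>x\<in>U. invertible ((\<chi> k l. wirt k (wirt_bar l (sf_coeff (X $$ (-1)) {} {})) x) :: complex^'m^'m)) \<and>
     (\<forall>x\<in>U. invertible ((\<chi> \<alpha> \<beta>.
        gcoeff (gdtheta \<alpha> (gdthetabar_right \<beta> (gnil ((X $$ (-1)) x)))) {} {}) :: ((complex, 'd) vec, 'd) vec))"

definition determines_anti_wick :: "(complex^'m) set \<Rightarrow> ('m::finite, 'd::{finite,linorder}) formal
    \<Rightarrow> ('m, 'd) prod \<Rightarrow> bool" where
  "determines_anti_wick U X star \<longleftrightarrow> star_product U star \<and> anti_wick U star \<and>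
     (\<forall>f\<in>formal_funs U.
        (\<forall>k. eq_on U (star (f_dz k X) f) (f_dz k X * f + f_dz k f)) \<and>
        (\<forall>\<alpha>. eq_on U (star (f_dtheta \<alpha> X) f) (f_dtheta \<alpha> X * f + f_dtheta \<alpha> f)) \<and>
        (\<forall>l. eq_on U (right_mult star (f_dzbar l X) f) (f_dzbar l X * f + f_dzbar l f)) \<and>
        (\<forall>\<beta>. eq_on U (right_mult star (f_dthetabar \<beta> X) f) (f_dthetabar \<beta> X * f + f_dthetabar \<beta> f)))"

definition determines_wick :: "(complex^'m) set \<Rightarrow> ('m::finite, 'd::{finite,linorder}) formal
    \<Rightarrow> ('m, 'd) prod \<Rightarrow> bool" where
  "determines_wick U X star \<longleftrightarrow> star_product U star \<and> wick U star \<and>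
     (\<forall>f\<in>formal_funs U.
        (\<forall>k. eq_on U (right_mult star (f_dz k X) f) (f_dz k X * f + f_dz k f)) \<and>
        (\<forall>\<alpha>. eq_on U (right_mult star (f_dtheta \<alpha> X) f) (f_dtheta \<alpha> X * f + f_dtheta \<alpha> f)) \<and>
        (\<forall>l. eq_on U (star (f_dzbar l X) f) (f_dzbar l X * f + f_dzbar l f)) \<and>
        (\<forall>\<beta>. eq_on U (star (f_dthetabar \<beta> X) f) (f_dthetabar \<beta> X * f + f_dthetabar \<beta> f)))"


section \<open>Berezin transform and supertrace densities\<close>

definition berezin_transform :: "(complex^'m) set \<Rightarrow> ('m::finite, 'd::{finite,linorder}) prod
    \<Rightarrow> (('m, 'd) formal \<Rightarrow> ('m, 'd) formal) \<Rightarrow> bool" where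
  "berezin_transform U star B \<longleftrightarrow>
     (\<exists>D. (\<forall>r. diff_op U (D r)) \<and> D 0 = id \<and> formal_expansion U 0 D B) \<and>
     (\<forall>V. open V \<and> V \<subseteq> U \<longrightarrow> (\<forall>a\<in>sf_smooth U. \<forall>b\<in>sf_smooth U. sf_hol V a \<and> sf_antihol V b \<longrightarrow>
        eq_on V (B (fls_const b * fls_const a)) (star (fls_const b) (fls_const a))))"

definition dual_star :: "(complex^'m) set \<Rightarrow> (('m::finite, 'd::{finite,linorder}) formal \<Rightarrow> ('m, 'd) formal)
    \<Rightarrow> ('m, 'd) prod \<Rightarrow> ('m, 'd) prod" where
  "dual_star U B star f g = op_inv U B (star (B f) (B g))"

text \<open>
  The exponential series, summed coefficientwise. It is a formal function only if the exponent \<open>Z\<close>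
  has no negative powers of nu (on the set of interest); then neither has any power of \<open>Z\<close>, and the
  series converges, for each power of nu and each monomial in the odd coordinates.
\<close>

definition formal_exp :: "('m::finite, 'd::{finite,linorder}) formal \<Rightarrow> ('m, 'd) formal" where
  "formal_exp Z = fps_to_fls (Abs_fps (\<lambda>n z. Grass (\<lambda>I J. \<Sum>k. gcoeff (((Z ^ k) $$ int n) z) I J / fact k)))"

text \<open>The integral over \<open>U\<close> and the odd coordinates, a Laurent series given by its coefficients.\<close>

definition berezin_integral :: "(complex^'m) set \<Rightarrow> ('m::finite, 'd::{finite,linorder}) formal \<Rightarrow> int \<Rightarrow> complex" where
  "berezin_integral U h n = (LINT z:U|lborel. sf_coeff (h $$ n) UNIV UNIV z)"

definition supertrace_density :: "(complex^'m) set \<Rightarrow> ('m::finite, 'd::{finite,linorder}) prod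
    \<Rightarrow> ('m, 'd) formal \<Rightarrow> bool" where
  "supertrace_density U star \<rho> \<longleftrightarrow> \<rho> \<in> formal_funs U \<and>
     (\<forall>f\<in>formal_funs U. \<forall>g\<in>formal_funs U. \<forall>p q n.
        homogeneous_on U p f \<and> homogeneous_on U q g \<and> (compact_supp_on U f \<or> compact_supp_on U g) \<longrightarrow>
        berezin_integral U (star f g * \<rho>) n = (- 1) ^ (p * q) * berezin_integral U (star g f * \<rho>) n)"

end

(*
  Write J for the inverse of Ber, w_i for the derivatives of X and y_i = J w_i. Since the dual product
  satisfies b *' f = b f and f *' a = f a, evaluating on products b a, which determine a differential
  operator, gives f *' y_i = f y_i - d_i f for holomorphic and y_i *' f = y_i f - d_i f for
  antiholomorphic directions i, up to parity signs. Associativity makes the y_i closed, and the super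
  Poincare lemma provides X' with d_i X' = - y_i.

  For (b), integration by parts gives a formal differential operator K with
  int (Ber h * g) rho = int K(h) g. It fixes rho = K(1), commutes with right multiplication by
  holomorphic functions and intertwines right *'-multiplication by y_i with right *-multiplication by
  w_i. So the leading term of K - rho commutes with the functions a and d_i X_{-1}, which are local
  coordinates by nondegeneracy, and kills 1; hence K(h) = h rho. With the mirrored statement for g * Ber h
  both int (f * g) rho and the sign times int (g * f) rho equal int (J f) g rho.
*)
theory Submission
 imports Defs
begin

text \<open>Smooth functions are not sums of products b a, so evaluation on such products passes
  through jets: an operator of finite order sees a finite jet, and Euler's identity, in place of
  Taylor's formula, produces a sum of products b a with any prescribed finite jet. The same
  filtration by order of vanishing carries the uniqueness argument for K, where the functions a and
  d_i X_{-1} only generate the maximal ideal of a point modulo its square; a Nakayama induction then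
  suffices.

  K exists because Ber h star g equals Ber (b J(a g)) for h = b a, which is bidifferential in h and
  g; an operator identity carries this over to all h.

  The equations leave a free constant in each coefficient of X'. As y_i and w_i agree at nu^(-1),
  the choice X'_{-1} = - X_{-1} is possible, and it frees X + X' of poles, so that the exponential
  makes sense.

  The contraction of U is merely continuous, so primitives are computed along polygons. Functions
  are defined everywhere but count only on U; hence equality is \<open>eq_on\<close>, and bounds by
  \<open>fls_subdegree\<close>, which sees values off U, give way to bounds on U.\<close>

abbreviation cst :: "'a::zero \<Rightarrow> 'a fls" where "cst \<equiv> fls_const"

section \<open>Smooth functions\<close>

text \<open>No differentiability is assumed: \<open>frechet_derivative\<close> is a choice among the
  derivatives at the point, and \<open>f\<close> and \<open>g\<close> have the same ones there,
  possibly none.\<close>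

lemma frechet_derivative_cong_open:
 assumes "open S" "x \<in> S" "!!y. y \<in> S ==> f y = g y"
 shows "frechet_derivative f (at x) = frechet_derivative g (at x)"
proof -
 have "(f has_derivative D) (at x) \<longleftrightarrow> (g has_derivative D) (at x)" for D
  using has_derivative_transform_within_open[OF _ assms(1,2)] assms(3) by metis
 then show ?thesis
  unfolding frechet_derivative_def by presburger
qed

lemma differentiable_cong_open:
 assumes "open S" "x \<in> S" "!!y. y \<in> S ==> f y = g y" "f differentiable (at x)"
 shows "g differentiable (at x)"
 using assms has_derivative_transform_within_open[OF _ assms(1,2)] unfolding differentiable_def by metis

lemma diff_times_on_cong:
 assumes "open S" "!!x. x \<in> S ==> f x = g x" "diff_times_on n S f"
 shows "diff_times_on n S g"
 using assms(2,3)
proof (induction n arbitrary: f g)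
 case 0
 then show ?case by (simp cong: continuous_on_cong)
next
 case (Suc n)
 have "diff_times_on n S (\<lambda>x. frechet_derivative g (at x) v)" for v
  by (rule Suc.IH[of "\<lambda>x. frechet_derivative f (at x) v"])
   (use Suc.prems in \<open>auto simp: frechet_derivative_cong_open[OF assms(1), of _ f g]\<close>)
 then show ?case
  using Suc.prems differentiable_cong_open[OF assms(1), of _ f g] by auto
qed

lemma smooth_on_cong:
 assumes "open S" "!!x. x \<in> S ==> f x = g x" "smooth_on S f"
 shows "smooth_on S g"
 using assms diff_times_on_cong unfolding smooth_on_def by blast

lemma diff_times_on_imp_continuous_on: "diff_times_on n S f ==> continuous_on S f"
 by (cases n) (simp, simp add: continuous_at_imp_continuous_on differentiable_imp_continuous_within)

lemma diff_times_on_SucD: "diff_times_on (Suc n) S f ==> diff_times_on n S f"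
proof (induction n arbitrary: f)
 case 0
 then show ?case using diff_times_on_imp_continuous_on[of "Suc 0" S f] by simp
next
 case (Suc n)
 then show ?case by (metis diff_times_on.simps(2))
qed

lemma smooth_on_differentiable: "smooth_on S f ==> x \<in> S ==> f differentiable (at x)"
 unfolding smooth_on_def by (metis diff_times_on.simps(2))

lemma smooth_on_has_derivative:
 "smooth_on S f ==> x \<in> S ==> (f has_derivative frechet_derivative f (at x)) (at x)"
 using frechet_derivative_works smooth_on_differentiable by blast

lemma smooth_on_frechet_derivative: "smooth_on S f ==> smooth_on S (\<lambda>x. frechet_derivative f (at x) v)"
 unfolding smooth_on_def by (metis diff_times_on.simps(2))

lemma smooth_on_continuous_on: "smooth_on S f ==> continuous_on S f"
 unfolding smooth_on_def using diff_times_on_imp_continuous_on by blast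

lemma diff_times_onI:
 assumes "open S" "!!x. x \<in> S ==> (f has_derivative f' x) (at x)"
  and "!!v. diff_times_on n S (\<lambda>x. f' x v)"
 shows "diff_times_on (Suc n) S f"
proof -
 have "f' x v = frechet_derivative f (at x) v" if "x \<in> S" for x v
  using assms(2)[OF that] frechet_derivative_at by metis
 then show ?thesis
  using assms(2) diff_times_on_cong[OF assms(1) _ assms(3)] by (auto simp: differentiable_def)
qed

lemma smooth_onI':
 assumes "open S" "!!x. x \<in> S ==> (f has_derivative f' x) (at x)"
  and "!!v. smooth_on S (\<lambda>x. f' x v)"
 shows "smooth_on S f"
 unfolding smooth_on_def
proof
 fix n show "diff_times_on n S f"
  by (rule diff_times_on_SucD, rule diff_times_onI[OF assms(1,2)]) (use assms(3) in \<open>auto simp: smooth_on_def\<close>)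
qed

lemma smooth_on_subset: "smooth_on S f ==> T \<subseteq> S ==> smooth_on T f"
proof -
 have "diff_times_on n S f ==> T \<subseteq> S ==> diff_times_on n T f" for n
  by (induction n arbitrary: f) (auto intro: continuous_on_subset)
 then show "smooth_on S f ==> T \<subseteq> S ==> smooth_on T f"
  unfolding smooth_on_def by blast
qed

lemma smooth_on_const [simp]: "smooth_on S (\<lambda>x. c)"
proof -
 have "diff_times_on n S (\<lambda>x. c)" for n
  by (induction n arbitrary: c) (auto simp: frechet_derivative_const)
 then show ?thesis by (simp add: smooth_on_def)
qed

lemma diff_times_on_add:
 assumes "open S" "diff_times_on n S f" "diff_times_on n S g"
 shows "diff_times_on n S (\<lambda>x. f x + g x)"
 using assms(2,3)
proof (induction n arbitrary: f g)
 case 0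
 then show ?case by (auto intro: continuous_intros)
next
 case (Suc n)
 show ?case
  by (rule diff_times_onI[OF assms(1), where f' = "\<lambda>x v. frechet_derivative f (at x) v + frechet_derivative g (at x) v"])
   (use Suc in \<open>auto intro!: has_derivative_add simp: frechet_derivative_works[symmetric]\<close>)
qed

lemma diff_times_on_mult:
 fixes f g :: "'a::real_normed_vector \<Rightarrow> 'b::real_normed_algebra"
 assumes "open S" "diff_times_on n S f" "diff_times_on n S g"
 shows "diff_times_on n S (\<lambda>x. f x * g x)"
 using assms(2,3)
proof (induction n arbitrary: f g)
 case 0
 then show ?case by (auto intro: continuous_intros)
next
 case (Suc n)
 have "diff_times_on n S (\<lambda>x. f x * frechet_derivative g (at x) v + frechet_derivative f (at x) v * g x)" for v
  using Suc.prems by (intro diff_times_on_add assms(1) Suc.IH) (auto intro: diff_times_on_SucD simp del: diff_times_on.simps, auto)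
 then show ?case
  by (intro diff_times_onI[OF assms(1), where f' = "\<lambda>x v. f x * frechet_derivative g (at x) v + frechet_derivative f (at x) v * g x"])
   (use Suc in \<open>auto intro!: has_derivative_mult simp: frechet_derivative_works[symmetric]\<close>)
qed

lemma smooth_on_add: "open S ==> smooth_on S f ==> smooth_on S g ==> smooth_on S (\<lambda>x. f x + g x)"
 by (simp add: smooth_on_def diff_times_on_add)

lemma smooth_on_mult:
 fixes f g :: "'a::real_normed_vector \<Rightarrow> 'b::real_normed_algebra"
 shows "open S ==> smooth_on S f ==> smooth_on S g ==> smooth_on S (\<lambda>x. f x * g x)"
 by (simp add: smooth_on_def diff_times_on_mult)

lemma smooth_on_bounded_linear_compose:
 assumes "open S" "bounded_linear h" "smooth_on S f"
 shows "smooth_on S (\<lambda>x. h (f x))"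
proof -
 interpret bounded_linear h by fact
 have "diff_times_on n S f ==> diff_times_on n S (\<lambda>x. h (f x))" for n
 proof (induction n arbitrary: f)
  case 0
  then show ?case by (auto intro: continuous_on)
 next
  case (Suc n)
  show ?case
   by (rule diff_times_onI[OF assms(1), where f' = "\<lambda>x v. h (frechet_derivative f (at x) v)"])
    (use Suc in \<open>auto intro!: has_derivative simp: frechet_derivative_works[symmetric]\<close>)
 qed
 then show ?thesis using assms(3) by (simp add: smooth_on_def)
qed

lemma smooth_on_bounded_linear:
 assumes "open S" "bounded_linear h"
 shows "smooth_on S h"
 by (rule smooth_onI'[OF assms(1) bounded_linear_imp_has_derivative[OF assms(2)]]) simp

lemma smooth_on_uminus: "open S ==> smooth_on S f ==> smooth_on S (\<lambda>x. - f x)"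
 by (rule smooth_on_bounded_linear_compose) (auto intro: bounded_linear_minus bounded_linear_ident)

lemma smooth_on_sum:
 "open S ==> (!!i. i \<in> I ==> smooth_on S (f i)) ==> smooth_on S (\<lambda>x. \<Sum>i\<in>I. f i x)"
 by (induction I rule: infinite_finite_induct) (auto intro: smooth_on_add)

text \<open>The family \<open>F\<close> is closed under differentiation, so the induction on the
  order of differentiability runs for all its members at once. It is applied to the singleton of
  \<open>exp\<close> and to the functions \<open>flat p\<close>.\<close>

lemma smooth_on_field_compose:
 fixes f :: "'a::real_normed_vector \<Rightarrow> 'k::real_normed_field"
 assumes "open S" "smooth_on S f" "u \<in> F"
  and "!!u. u \<in> F ==> \<exists>u'\<in>F. \<forall>y. (u has_field_derivative u' y) (at y)"
 shows "smooth_on S (\<lambda>x. u (f x))"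
proof -
 have "diff_times_on n S f ==> u \<in> F ==> diff_times_on n S (\<lambda>x. u (f x))" for n u
 proof (induction n arbitrary: u)
  case 0
  from assms(4)[OF \<open>u \<in> F\<close>] have "continuous_on UNIV u"
   by (metis DERIV_continuous continuous_at_imp_continuous_on)
  then show ?case using 0 by (auto intro: continuous_on_compose2)
 next
  case (Suc n)
  obtain u' where u': "u' \<in> F" "!!y. (u has_field_derivative u' y) (at y)"
   using assms(4) \<open>u \<in> F\<close> by blast
  show ?case
  proof (rule diff_times_onI[OF assms(1), where f' = "\<lambda>x v. u' (f x) * frechet_derivative f (at x) v"])
   fix x assume "x \<in> S"
   then have "(f has_derivative frechet_derivative f (at x)) (at x)"
    using Suc.prems by (auto simp: frechet_derivative_works[symmetric])
   then show "((\<lambda>x. u (f x)) has_derivative (\<lambda>v. u' (f x) * frechet_derivative f (at x) v)) (at x)"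
    using u'(2) by (auto intro: has_derivative_compose simp: has_field_derivative_def)
  next
   fix v show "diff_times_on n S (\<lambda>x. u' (f x) * frechet_derivative f (at x) v)"
    using Suc.prems Suc.IH[OF _ u'(1)] diff_times_on_SucD
    by (intro diff_times_on_mult assms(1)) (blast, auto)
  qed
 qed
 then show ?thesis using assms(2,3) by (simp add: smooth_on_def)
qed

lemma smooth_on_exp:
 fixes f :: "'a::real_normed_vector \<Rightarrow> complex"
 shows "open S ==> smooth_on S f ==> smooth_on S (\<lambda>x. exp (f x))"
 by (rule smooth_on_field_compose[where F = "{exp}"]) (auto intro: DERIV_exp)

text \<open>The second difference \<open>\<Delta>\<close> over a small parallelogram is symmetric in
  \<open>v\<close> and \<open>w\<close>. Two applications of the mean value theorem, in either
  order, express it by each of the two mixed derivatives at some nearby point, and these are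
  continuous at \<open>x\<close>.\<close>

lemma frechet_derivative_symmetric_real:
 fixes f :: "'a::real_normed_vector \<Rightarrow> real"
 assumes "open S" "x \<in> S" "diff_times_on 2 S f"
 shows "frechet_derivative (\<lambda>y. frechet_derivative f (at y) v) (at x) w
    = frechet_derivative (\<lambda>y. frechet_derivative f (at y) w) (at x) v"
proof -
 define D where "D v y = frechet_derivative f (at y) v" for v y
 define H where "H v w y = frechet_derivative (D v) (at y) w" for v w y
 have f': "(f has_derivative (\<lambda>v. D v y)) (at y)" if "y \<in> S" for y
  using assms(3) that by (auto simp: numeral_2_eq_2 D_def frechet_derivative_works[symmetric])
 have D': "(D v has_derivative (\<lambda>w. H v w y)) (at y)" if "y \<in> S" for y v
  using assms(3) that by (auto simp: numeral_2_eq_2 H_def frechet_derivative_works[symmetric] D_def[abs_def])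
 have H': "continuous_on S (H v w)" for v w
  using assms(3) by (auto simp: numeral_2_eq_2 H_def[abs_def] D_def[abs_def])
 have lim: "H v w x = H w v x" for v w
 proof (rule ccontr)
  assume ne: "H v w x \<noteq> H w v x"
  define e where "e = \<bar>H v w x - H w v x\<bar> / 2"
  have e: "e > 0" using ne by (simp add: e_def)
  obtain d1 where d1: "d1 > 0" "!!y. y \<in> S ==> dist y x < d1 ==> \<bar>H v w y - H v w x\<bar> < e"
   using H'[of v w] assms(2) e unfolding continuous_on_iff dist_real_def by metis
  obtain d2 where d2: "d2 > 0" "!!y. y \<in> S ==> dist y x < d2 ==> \<bar>H w v y - H w v x\<bar> < e"
   using H'[of w v] assms(2) e unfolding continuous_on_iff dist_real_def by metis
  obtain d3 where d3: "d3 > 0" "ball x d3 \<subseteq> S" using assms(1,2) open_contains_ball by blast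
  define d where "d = min d3 (min d1 d2)"
  \<comment> \<open>This keeps the whole parallelogram with sides \<open>s v\<close> and
    \<open>s w\<close> at \<open>x\<close> within distance \<open>d\<close>; the summand 1 avoids a
    division by zero.\<close>
  define s where "s = d / (norm v + norm w + 1)"
  have nn: "norm v + norm w + 1 > 0" by (smt (verit) norm_ge_zero)
  have s: "s > 0" using nn d1 d2 d3 by (simp add: s_def d_def)
  have near: "norm (a *\<^sub>R v + b *\<^sub>R w) < d" if "0 \<le> a" "a \<le> s" "0 \<le> b" "b \<le> s" for a b
  proof -
   have "norm (a *\<^sub>R v + b *\<^sub>R w) \<le> a * norm v + b * norm w"
    using norm_triangle_ineq[of "a *\<^sub>R v" "b *\<^sub>R w"] that by simp
   also have "\<dots> \<le> s * norm v + s * norm w" using that by (intro add_mono mult_right_mono) auto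
   also have "\<dots> < s * (norm v + norm w + 1)" using s by (simp add: algebra_simps)
   also have "\<dots> = d" using nn by (simp add: s_def)
   finally show ?thesis .
  qed
  have inS: "x + a *\<^sub>R v + b *\<^sub>R w \<in> S" "dist (x + a *\<^sub>R v + b *\<^sub>R w) x < d"
   if "0 \<le> a" "a \<le> s" "0 \<le> b" "b \<le> s" for a b
  proof -
   show "dist (x + a *\<^sub>R v + b *\<^sub>R w) x < d" using near[OF that] by (simp add: dist_norm add.assoc)
   then show "x + a *\<^sub>R v + b *\<^sub>R w \<in> S" using d3 by (auto simp: d_def dist_commute)
  qed
  have dv: "((\<lambda>a. F (x + a *\<^sub>R v + b *\<^sub>R w)) has_real_derivative F' (x + a *\<^sub>R v + b *\<^sub>R w) v) (at a)"
   if "(F has_derivative F' (x + a *\<^sub>R v + b *\<^sub>R w)) (at (x + a *\<^sub>R v + b *\<^sub>R w))" for F :: "'a \<Rightarrow> real" and F' a b v w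
  proof -
   have "((\<lambda>a. F (x + a *\<^sub>R v + b *\<^sub>R w)) has_derivative (\<lambda>h. F' (x + a *\<^sub>R v + b *\<^sub>R w) (h *\<^sub>R v))) (at a)"
    by (rule has_derivative_compose[where g = F and f = "\<lambda>a. x + a *\<^sub>R v + b *\<^sub>R w", OF _ that])
     (auto intro!: derivative_eq_intros)
   moreover have "F' (x + a *\<^sub>R v + b *\<^sub>R w) (h *\<^sub>R v) = F' (x + a *\<^sub>R v + b *\<^sub>R w) v * h" for h
    using has_derivative_bounded_linear[OF that] by (simp add: linear_simps)
   ultimately show ?thesis by (simp add: has_field_derivative_def mult_commute_abs)
  qed
  have dw: "((\<lambda>b. F (x + a *\<^sub>R v + b *\<^sub>R w)) has_real_derivative F' (x + a *\<^sub>R v + b *\<^sub>R w) w) (at b)"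
   if "(F has_derivative F' (x + a *\<^sub>R v + b *\<^sub>R w)) (at (x + a *\<^sub>R v + b *\<^sub>R w))" for F :: "'a \<Rightarrow> real" and F' a b v w
   using dv[of F F' b w a v] that by (simp add: ac_simps)
  define \<Delta> where "\<Delta> = f (x + s *\<^sub>R v + s *\<^sub>R w) - f (x + s *\<^sub>R v) - f (x + s *\<^sub>R w) + f x"
  have "\<exists>y\<in>S. dist y x < d \<and> \<Delta> = s * (s * H v w y)"
  proof -
   have "\<exists>a. 0 < a \<and> a < s \<and> (f (x + s *\<^sub>R v + s *\<^sub>R w) - f (x + s *\<^sub>R v + 0 *\<^sub>R w)) - (f (x + 0 *\<^sub>R v + s *\<^sub>R w) - f (x + 0 *\<^sub>R v + 0 *\<^sub>R w))
     = (s - 0) * (D v (x + a *\<^sub>R v + s *\<^sub>R w) - D v (x + a *\<^sub>R v + 0 *\<^sub>R w))"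
    using inS inS[of _ 0] inS[of 0] s by (intro MVT2[where f = "\<lambda>a. f (x + a *\<^sub>R v + s *\<^sub>R w) - f (x + a *\<^sub>R v + 0 *\<^sub>R w)"]
      DERIV_diff dv[where F' = "\<lambda>y v. D v y"] f') auto
   then obtain a where a: "0 < a" "a < s" "\<Delta> = s * (D v (x + a *\<^sub>R v + s *\<^sub>R w) - D v (x + a *\<^sub>R v + 0 *\<^sub>R w))"
    by (auto simp: \<Delta>_def)
   have "\<exists>b. 0 < b \<and> b < s \<and> D v (x + a *\<^sub>R v + s *\<^sub>R w) - D v (x + a *\<^sub>R v + 0 *\<^sub>R w)
     = (s - 0) * H v w (x + a *\<^sub>R v + b *\<^sub>R w)"
    using inS inS[of _ 0] a s by (intro MVT2[where f = "\<lambda>b. D v (x + a *\<^sub>R v + b *\<^sub>R w)"] dw[where F' = "\<lambda>y w. H v w y"] D') auto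
   then obtain b where "0 < b" "b < s" "\<Delta> = s * (s * H v w (x + a *\<^sub>R v + b *\<^sub>R w))"
    using a by auto
   then show ?thesis using inS[of a b] a by auto
  qed
  then obtain y1 where y1: "y1 \<in> S" "dist y1 x < d" "\<Delta> = s * (s * H v w y1)" by blast
  have "\<exists>y\<in>S. dist y x < d \<and> \<Delta> = s * (s * H w v y)"
  proof -
   have "\<exists>b. 0 < b \<and> b < s \<and> (f (x + s *\<^sub>R v + s *\<^sub>R w) - f (x + 0 *\<^sub>R v + s *\<^sub>R w)) - (f (x + s *\<^sub>R v + 0 *\<^sub>R w) - f (x + 0 *\<^sub>R v + 0 *\<^sub>R w))
     = (s - 0) * (D w (x + s *\<^sub>R v + b *\<^sub>R w) - D w (x + 0 *\<^sub>R v + b *\<^sub>R w))"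
    using inS inS[of _ 0] inS[of 0] s by (intro MVT2[where f = "\<lambda>b. f (x + s *\<^sub>R v + b *\<^sub>R w) - f (x + 0 *\<^sub>R v + b *\<^sub>R w)"]
      DERIV_diff dw[where F' = "\<lambda>y v. D v y"] f') auto
   then obtain b where b: "0 < b" "b < s" "\<Delta> = s * (D w (x + s *\<^sub>R v + b *\<^sub>R w) - D w (x + 0 *\<^sub>R v + b *\<^sub>R w))"
    by (auto simp: \<Delta>_def)
   have "\<exists>a. 0 < a \<and> a < s \<and> D w (x + s *\<^sub>R v + b *\<^sub>R w) - D w (x + 0 *\<^sub>R v + b *\<^sub>R w)
     = (s - 0) * H w v (x + a *\<^sub>R v + b *\<^sub>R w)"
    using inS inS[of 0] b s by (intro MVT2[where f = "\<lambda>a. D w (x + a *\<^sub>R v + b *\<^sub>R w)"] dv[where F' = "\<lambda>y w'. H w w' y"] D') auto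
   then obtain a where "0 < a" "a < s" "\<Delta> = s * (s * H w v (x + a *\<^sub>R v + b *\<^sub>R w))"
    using b by auto
   then show ?thesis using inS[of a b] b by auto
  qed
  then obtain y2 where y2: "y2 \<in> S" "dist y2 x < d" "\<Delta> = s * (s * H w v y2)" by blast
  have "H v w y1 = H w v y2" using y1(3) y2(3) s by simp
  moreover have "\<bar>H v w y1 - H v w x\<bar> < e" "\<bar>H w v y2 - H w v x\<bar> < e"
   using d1(2)[OF y1(1)] d2(2)[OF y2(1)] y1(2) y2(2) by (auto simp: d_def)
  ultimately show False unfolding e_def by argo
 qed
 then show ?thesis by (simp add: H_def D_def[abs_def])
qed

text \<open>The mean value theorem needs real values, so the real and imaginary parts are treated
  separately.\<close>

lemma frechet_derivative_symmetric:
 fixes f :: "'a::real_normed_vector \<Rightarrow> complex"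
 assumes "open S" "x \<in> S" "smooth_on S f"
 shows "frechet_derivative (\<lambda>y. frechet_derivative f (at y) v) (at x) w
    = frechet_derivative (\<lambda>y. frechet_derivative f (at y) w) (at x) v"
proof -
 have *: "frechet_derivative (\<lambda>y. frechet_derivative (\<lambda>z. h (f z)) (at y) v) (at x) w
   = h (frechet_derivative (\<lambda>y. frechet_derivative f (at y) v) (at x) w)"
  if "bounded_linear h" for h :: "complex \<Rightarrow> real" and v w
 proof -
  interpret bounded_linear h by fact
  have 1: "frechet_derivative (\<lambda>z. h (g z)) (at y) u = h (frechet_derivative g (at y) u)"
   if "smooth_on S g" "y \<in> S" for g :: "'a \<Rightarrow> complex" and y u
   using frechet_derivative_at[OF has_derivative[OF smooth_on_has_derivative[OF that]]] by metis
  have "frechet_derivative (\<lambda>y. frechet_derivative (\<lambda>z. h (f z)) (at y) v) (at x) w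
    = frechet_derivative (\<lambda>y. h (frechet_derivative f (at y) v)) (at x) w"
   using frechet_derivative_cong_open[OF assms(1,2), of "\<lambda>y. frechet_derivative (\<lambda>z. h (f z)) (at y) v"
     "\<lambda>y. h (frechet_derivative f (at y) v)"] 1[OF assms(3)] by simp
  also have "\<dots> = h (frechet_derivative (\<lambda>y. frechet_derivative f (at y) v) (at x) w)"
   by (rule 1) (auto intro: smooth_on_frechet_derivative assms)
  finally show ?thesis .
 qed
 have "h (frechet_derivative (\<lambda>y. frechet_derivative f (at y) v) (at x) w)
   = h (frechet_derivative (\<lambda>y. frechet_derivative f (at y) w) (at x) v)"
  if "bounded_linear h" for h :: "complex \<Rightarrow> real"
  unfolding *[OF that, symmetric]
  using smooth_on_bounded_linear_compose[OF assms(1) that assms(3)] assms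
  by (intro frechet_derivative_symmetric_real) (auto simp: smooth_on_def)
 then show ?thesis using bounded_linear_Re bounded_linear_Im by (intro complex_eqI) blast+
qed

text \<open>The polynomial parameter makes this family closed under differentiation; the member with
  p = 1 is the standard smooth function that is positive exactly for t > 0.\<close>

definition flat :: "real poly \<Rightarrow> real \<Rightarrow> real" where
 "flat p t = (if t > 0 then poly p (1 / t) * exp (- 1 / t) else 0)"

lemma poly_exp_tendsto_0: "((\<lambda>s. poly p s * exp (- s)) \<longlongrightarrow> (0::real)) at_top"
proof -
 have "((\<lambda>s. \<Sum>i\<le>degree p. coeff p i * (s ^ i / exp s)) \<longlongrightarrow> (\<Sum>i\<le>degree p. coeff p i * 0)) at_top"
  by (intro tendsto_sum tendsto_mult tendsto_const tendsto_power_div_exp_0)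
 then show ?thesis
  by (simp add: poly_altdef sum_distrib_right exp_minus divide_inverse mult.assoc)
qed

text \<open>With s = 1/t one has ds/dt = - s^2, which is the factor \<open>[:0, 0, 1:]\<close>;
  differentiating e^(-s) contributes \<open>p\<close> and differentiating p(s) contributes
  \<open>- pderiv p\<close>.\<close>

lemma flat_has_derivative: "(flat p has_field_derivative flat ([:0, 0, 1:] * (p - pderiv p)) t) (at t)"
proof -
 consider "t > 0" | "t < 0" | "t = 0" by linarith
 then show ?thesis
 proof cases
  case 1
  have "((\<lambda>t. poly p (1 / t) * exp (- 1 / t)) has_field_derivative
    flat ([:0, 0, 1:] * (p - pderiv p)) t) (at t)"
   using 1 by (auto intro!: derivative_eq_intros simp: flat_def field_simps power2_eq_square)
  then show ?thesis
   by (rule has_field_derivative_transform_within_open[where S = "{0<..}"]) (use 1 in \<open>auto simp: flat_def\<close>)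
 next
  case 2
  have "((\<lambda>t. 0) has_field_derivative flat ([:0, 0, 1:] * (p - pderiv p)) t) (at t)"
   using 2 by (simp add: flat_def)
  then show ?thesis
   by (rule has_field_derivative_transform_within_open[where S = "{..<0}"]) (use 2 in \<open>auto simp: flat_def\<close>)
 next
  case 3
  \<comment> \<open>The difference quotient at 0 is s p(s) e^(-s) with s = 1/t;
    \<open>pCons 0 p\<close> is the polynomial s p(s).\<close>
  have "((\<lambda>t. poly (pCons 0 p) (inverse t) * exp (- inverse t)) \<longlongrightarrow> 0) (at_right 0)"
   by (rule filterlim_compose[OF poly_exp_tendsto_0 filterlim_inverse_at_top_right])
  then have r: "((\<lambda>t. flat p t / t) \<longlongrightarrow> 0) (at_right 0)"
   by (rule Lim_transform_eventually) (auto simp: flat_def eventually_at_filter field_simps)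
  have "((\<lambda>t. 0) \<longlongrightarrow> (0::real)) (at_left 0)" by simp
  then have l: "((\<lambda>t. flat p t / t) \<longlongrightarrow> 0) (at_left 0)"
   by (rule Lim_transform_eventually) (auto simp: flat_def eventually_at_filter)
  have "((\<lambda>t. flat p t / t) \<longlongrightarrow> 0) (at 0)"
   using l r by (simp add: filterlim_split_at)
  then show ?thesis using 3 by (simp add: has_field_derivative_iff flat_def)
 qed
qed

lemma smooth_bump:
 fixes x :: "'a::euclidean_space"
 assumes "open S" "x \<in> S"
 obtains \<phi> :: "'a \<Rightarrow> real" and K where "smooth_on UNIV \<phi>" "compact K" "K \<subseteq> S" "!!y. y \<notin> K ==> \<phi> y = 0"
  "\<phi> x > 0" "!!y. \<phi> y \<ge> 0"
proof -
 obtain r where r: "r > 0" "cball x r \<subseteq> S" using assms open_contains_cball by blast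
 \<comment> \<open>In coordinates this is visibly a polynomial, whereas the norm itself is not
   smooth at the centre.\<close>
 define t where "t y = r\<^sup>2 - (\<Sum>b\<in>Basis. ((y - x) \<bullet> b) * ((y - x) \<bullet> b))" for y
 have t: "t y = r\<^sup>2 - (norm (y - x))\<^sup>2" for y
  by (simp add: t_def power2_norm_eq_inner euclidean_inner[of "y - x" "y - x"])
 have sb: "smooth_on UNIV (\<lambda>y. (y - x) \<bullet> b)" for b
  using smooth_on_add[of UNIV "\<lambda>y. y \<bullet> b" "\<lambda>y. - (x \<bullet> b)"] smooth_on_bounded_linear[of UNIV "\<lambda>y. y \<bullet> b"]
  by (simp add: inner_diff_left bounded_linear_inner_left)
 have "smooth_on UNIV (\<lambda>y. r\<^sup>2 + - (\<Sum>b\<in>Basis. ((y - x) \<bullet> b) * ((y - x) \<bullet> b)))"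
  by (intro smooth_on_add smooth_on_const smooth_on_uminus smooth_on_sum smooth_on_mult sb open_UNIV)
 then have st: "smooth_on UNIV t" by (simp add: t_def[abs_def])
 show thesis
 proof
  show "smooth_on UNIV (\<lambda>y. flat 1 (t y))"
   by (rule smooth_on_field_compose[OF open_UNIV st, where F = "range flat"])
    (auto intro: flat_has_derivative)
  show "compact (cball x r)" "cball x r \<subseteq> S" using r by auto
  show "flat 1 (t y) = 0" if "y \<notin> cball x r" for y
  proof -
   have "r\<^sup>2 \<le> (norm (y - x))\<^sup>2"
    using that r by (intro power_mono) (auto simp: dist_norm norm_minus_commute)
   then show ?thesis by (simp add: flat_def t)
  qed
  show "flat 1 (t x) > 0" using r by (simp add: flat_def t)
  show "flat 1 (t y) \<ge> 0" for y by (simp add: flat_def)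
 qed
qed

section \<open>The Grassmann algebra\<close>

lemma neg_one_power_cancel [simp]: "(- 1) ^ n * ((- 1) ^ n * x) = (x :: complex)"
 by (simp add: mult.assoc[symmetric] power_add[symmetric])

lemma neg_one_power_eqI: "even (m + n) ==> (- 1) ^ m = ((- 1) ^ n :: complex)"
 by (auto simp: uminus_power_if)

lemma gcoeff_simps [simp]:
 fixes x y :: "'d::{finite,linorder} grass"
 shows "gcoeff (0 :: 'd grass) I J = 0"
  "gcoeff (x + y) I J = gcoeff x I J + gcoeff y I J"
  "gcoeff (x - y) I J = gcoeff x I J - gcoeff y I J"
  "gcoeff (- x) I J = - gcoeff x I J"
  "gcoeff (1 :: 'd grass) I J = (if I = {} \<and> J = {} then 1 else 0)"
  "gcoeff (gconst c) I J = (if I = {} \<and> J = {} then c else 0)"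
 by (simp_all add: zero_grass_def plus_grass_def minus_grass_def uminus_grass_def one_grass_def gconst_def)

lemma gcoeff_sum: "gcoeff (\<Sum>i\<in>S. f i :: 'd::{finite,linorder} grass) I J = (\<Sum>i\<in>S. gcoeff (f i) I J)"
 by (induction S rule: infinite_finite_induct) auto

lemma gcoeff_mult:
 "gcoeff (x * y :: 'd::{finite,linorder} grass) A B = (\<Sum>I\<in>Pow A. \<Sum>J\<in>Pow B.
   mono_sign I J (A - I) (B - J) * (gcoeff x I J * gcoeff y (A - I) (B - J)))"
 by (simp add: times_grass_def)

lemma gcoeff_body_mult [simp]:
 "gcoeff (x * y :: 'd::{finite,linorder} grass) {} {} = gcoeff x {} {} * gcoeff y {} {}"
 by (simp add: gcoeff_mult mono_sign_def)

lemma gcoeff_gconst_mult [simp]: "gcoeff (gconst c * x :: 'd::{finite,linorder} grass) A B = c * gcoeff x A B"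
proof -
 have "gcoeff (gconst c * x) A B = (\<Sum>I\<in>Pow A. \<Sum>J\<in>Pow B. if I = {} then if J = {} then c * gcoeff x A B else 0 else 0)"
  unfolding gcoeff_mult by (intro sum.cong refl) (auto simp: mono_sign_def)
 also have "\<dots> = (\<Sum>I\<in>Pow A. if I = {} then \<Sum>J\<in>Pow B. if J = {} then c * gcoeff x A B else 0 else 0)"
  by (intro sum.cong) auto
 finally show ?thesis by (simp add: sum.delta)
qed

lemma gconst_simps [simp]:
 "gconst 0 = (0 :: 'd::{finite,linorder} grass)" "gconst 1 = (1 :: 'd grass)"
 by (auto intro: grass_eqI)

lemma gconst_add: "gconst (a + b) = (gconst a + gconst b :: 'd::{finite,linorder} grass)"
 by (auto intro: grass_eqI)

lemma gconst_minus: "gconst (- a) = (- gconst a :: 'd::{finite,linorder} grass)"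
 by (auto intro: grass_eqI)

lemma gconst_mult: "gconst (a * b) = (gconst a * gconst b :: 'd::{finite,linorder} grass)"
 by (auto intro: grass_eqI)

lemma gconst_power: "gconst (a ^ n) = (gconst a ^ n :: 'd::{finite,linorder} grass)"
 by (induction n) (auto simp: gconst_mult)

lemma neg_one_power_gconst: "(- 1) ^ n * x = gconst ((- 1) ^ n) * (x :: 'd::{finite,linorder} grass)"
 by (simp add: gconst_power gconst_minus)

text \<open>The algebra automorphism multiplying each theta by (-1)^a and each theta-bar by (-1)^b.
  For a = b = 1 it is the parity involution, which encodes the Koszul signs for inhomogeneous
  elements. The mixed cases apply parity to one factor only of a product b a, see
  \<open>sg_shol\<close>.\<close>

definition gsg :: "nat \<Rightarrow> nat \<Rightarrow> 'd grass \<Rightarrow> 'd grass" where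
 "gsg a b x = Grass (\<lambda>I J. (- 1) ^ (a * card I + b * card J) * gcoeff x I J)"

lemma gcoeff_gsg [simp]: "gcoeff (gsg a b x) I J = (- 1) ^ (a * card I + b * card J) * gcoeff x I J"
 by (simp add: gsg_def)

lemma gsg_simps [simp]:
 fixes x y :: "'d::{finite,linorder} grass"
 shows "gsg a b 0 = (0 :: 'd grass)" "gsg a b 1 = (1 :: 'd grass)"
  "gsg a b (x + y) = gsg a b x + gsg a b y"
  "gsg a b (x - y) = gsg a b x - gsg a b y"
  "gsg a b (- x) = - gsg a b x"
  "gsg a b (gsg a b x) = x"
  "gsg a b (gconst c) = (gconst c :: 'd grass)"
 by (auto intro!: grass_eqI simp: algebra_simps)

lemma gsg_mult: "gsg a b (x * y) = gsg a b x * gsg a b (y :: 'd::{finite,linorder} grass)"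
proof (rule grass_eqI)
 fix A B :: "'d set"
 have c: "card A = card I + card (A - I)" if "I \<subseteq> A" for A I :: "'d set"
  using that by (simp add: card_Diff_subset card_mono finite_subset)
 show "gcoeff (gsg a b (x * y)) A B = gcoeff (gsg a b x * gsg a b y) A B"
  unfolding gcoeff_gsg gcoeff_mult sum_distrib_left
  by (intro sum.cong refl) (auto simp: c algebra_simps power_add)
qed

abbreviation gpar :: "'d grass \<Rightarrow> 'd grass" where "gpar \<equiv> gsg (Suc 0) (Suc 0)"

definition geven :: "'d::{finite,linorder} grass \<Rightarrow> 'd grass" where
 "geven x = gconst (1/2) * (x + gpar x)"

definition godd :: "'d::{finite,linorder} grass \<Rightarrow> 'd grass" where
 "godd x = gconst (1/2) * (x - gpar x)"

lemma geven_godd: "x = geven x + godd x"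
 by (rule grass_eqI) (simp add: geven_def godd_def algebra_simps)

lemma gsg_geven [simp]: "gpar (geven x) = geven x" "gpar (godd x) = - godd x"
 by (auto intro!: grass_eqI simp: geven_def godd_def algebra_simps)

text \<open>By disjointness each pair in I x K is an inversion for exactly one of the two
  orders.\<close>

lemma inversions_swap:
 fixes I K :: "'d::{finite,linorder} set"
 assumes "I \<inter> K = {}"
 shows "inversions I K + inversions K I = card I * card K"
proof -
 have "inversions K I = card {(i, k). i \<in> I \<and> k \<in> K \<and> i < k}"
  unfolding inversions_def by (rule bij_betw_same_card[of prod.swap]) (auto simp: bij_betw_def inj_on_def image_iff)
 then have "inversions I K + inversions K I
   = card ({(i, k). i \<in> I \<and> k \<in> K \<and> k < i} \<union> {(i, k). i \<in> I \<and> k \<in> K \<and> i < k})"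
  unfolding inversions_def by (subst card_Un_disjoint) auto
 also have "{(i, k). i \<in> I \<and> k \<in> K \<and> k < i} \<union> {(i, k). i \<in> I \<and> k \<in> K \<and> i < k} = I \<times> K"
  using assms by auto
 finally show ?thesis by (simp add: card_cartesian_product)
qed

text \<open>Supercommutativity at the level of monomials. \<open>inversions_swap\<close> is used for
  the theta and theta-bar parts separately; since only parities of exponents matter, what remains is
  propositional.\<close>

lemma mono_sign_swap:
 fixes I J K L :: "'d::{finite,linorder} set"
 assumes "I \<inter> K = {}" "J \<inter> L = {}"
 shows "mono_sign K L I J = (- 1) ^ ((card I + card J) * (card K + card L)) * mono_sign I J K L"
proof -
 have "even (inversions K I) \<longleftrightarrow> even (card I * card K + inversions I K)"
  "even (inversions L J) \<longleftrightarrow> even (card J * card L + inversions J L)"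
  using inversions_swap[OF assms(1), symmetric] inversions_swap[OF assms(2), symmetric] by auto
 then have "even (card L * card I + inversions K I + inversions L J
   + ((card I + card J) * (card K + card L) + (card J * card K + inversions I K + inversions J L)))"
  by (simp only: even_add even_mult_iff) argo
 then show ?thesis
  unfolding mono_sign_def power_add[symmetric] by (rule neg_one_power_eqI)
qed

lemma gcoeff_mult_swap:
 "gcoeff (y * x :: 'd::{finite,linorder} grass) A B = (\<Sum>I\<in>Pow A. \<Sum>J\<in>Pow B.
   (- 1) ^ ((card I + card J) * (card (A - I) + card (B - J)))
   * mono_sign I J (A - I) (B - J) * (gcoeff x I J * gcoeff y (A - I) (B - J)))"
proof -
 have "gcoeff (y * x) A B = (\<Sum>I\<in>Pow A. \<Sum>J\<in>Pow B.
   mono_sign (A - I) (B - J) I J * (gcoeff y (A - I) (B - J) * gcoeff x I J))"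
  unfolding gcoeff_mult
  by (intro sum.reindex_bij_witness[where i = "\<lambda>I. A - I" and j = "\<lambda>I. A - I"]
    sum.reindex_bij_witness[where i = "\<lambda>I. B - I" and j = "\<lambda>I. B - I"]) (auto simp: double_diff)
 also have "\<dots> = (\<Sum>I\<in>Pow A. \<Sum>J\<in>Pow B.
   (- 1) ^ ((card I + card J) * (card (A - I) + card (B - J)))
   * mono_sign I J (A - I) (B - J) * (gcoeff x I J * gcoeff y (A - I) (B - J)))"
  by (intro sum.cong refl, subst mono_sign_swap) auto
 finally show ?thesis .
qed

lemma geven_commute:
 fixes x y :: "'d::{finite,linorder} grass"
 assumes "gpar y = y"
 shows "y * x = x * y"
proof (rule grass_eqI)
 fix A B
 have *: "gcoeff y K L = 0" if "odd (card K + card L)" for K L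
  using arg_cong[OF assms, of "\<lambda>y. gcoeff y K L"] that by (simp add: equation_minus_iff)
 show "gcoeff (y * x) A B = gcoeff (x * y) A B"
  unfolding gcoeff_mult_swap[of y x] gcoeff_mult[of x y]
    using * by (intro sum.cong refl) (auto simp: uminus_power_if)
qed

text \<open>The sign (-1)^|x| of an odd element passing \<open>x\<close> becomes
  \<open>gpar x\<close>, so \<open>x\<close> may be inhomogeneous.\<close>

lemma godd_commute:
 fixes x y :: "'d::{finite,linorder} grass"
 assumes "gpar y = - y"
 shows "y * x = gpar x * y"
proof (rule grass_eqI)
 fix A B
 have *: "gcoeff y K L = 0" if "even (card K + card L)" for K L
  using arg_cong[OF assms, of "\<lambda>y. gcoeff y K L"] that by simp
 have "(- 1) ^ ((card I + card J) * (card K + card L)) * s * (a * gcoeff y K L)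
   = s * ((- 1) ^ (Suc 0 * card I + Suc 0 * card J) * a * gcoeff y K L)" for I J K L s a
  by (cases "even (card K + card L)"; cases "even (card I + card J)") (use *[of K L] in \<open>auto simp: uminus_power_if\<close>)
 note ** = this
 show "gcoeff (y * x) A B = gcoeff (gpar x * y) A B"
  unfolding gcoeff_mult_swap[of y x] gcoeff_mult[of "gpar x" y] gcoeff_gsg by (intro sum.cong refl) (subst **, simp)
qed

definition gtop :: "'d grass \<Rightarrow> complex" where "gtop x = gcoeff x UNIV UNIV"

lemma gtop_simps [simp]:
 fixes x y :: "'d::{finite,linorder} grass"
 shows "gtop (0 :: 'd grass) = 0" "gtop (x + y) = gtop x + gtop y" "gtop (x - y) = gtop x - gtop y" "gtop (- x) = - gtop x"
  "gtop (gconst c * x) = c * gtop x" "gtop (gpar x) = gtop x"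
 by (auto simp: gtop_def power_add[symmetric] mult_2[symmetric])

text \<open>The top monomial has even degree, so only components of equal parity of x and y
  contribute; there the sign (-1)^(|x||y|) equals (-1)^|x|, which is the effect of
  \<open>gpar x\<close>.\<close>

lemma gtop_swap: "gtop (x * y) = gtop (y * gpar (x :: 'd::{finite,linorder} grass))"
proof -
 have "x * y = x * geven y + x * godd y" by (subst geven_godd[of y]) (simp add: algebra_simps)
 also have "\<dots> = geven y * x + godd y * gpar x"
  using geven_commute[of "geven y" x] godd_commute[of "godd y" "gpar x"] by simp
 finally have 1: "gtop (x * y) = gtop (geven y * x) + gtop (godd y * gpar x)" by simp
 have "gtop (geven y * x) = gtop (gpar (geven y * x))" by simp
 also have "\<dots> = gtop (geven y * gpar x)" unfolding gsg_mult by simp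
 finally have "gtop (x * y) = gtop (geven y * gpar x + godd y * gpar x)" using 1 by simp
 also have "geven y * gpar x + godd y * gpar x = y * gpar x"
  by (subst (3) geven_godd[of y]) (simp add: algebra_simps)
 finally show ?thesis .
qed

section \<open>Graded Leibniz rules and anticommutation of the odd derivatives\<close>

lemma card_lt_Un:
 fixes I K :: "'d::{finite,linorder} set"
 assumes "I \<inter> K = {}"
 shows "card {i \<in> I \<union> K. i < \<alpha>} = card {i \<in> I. i < \<alpha>} + card {i \<in> K. i < \<alpha>}"
proof -
 have "{i \<in> I \<union> K. i < \<alpha>} = {i \<in> I. i < \<alpha>} \<union> {i \<in> K. i < \<alpha>}" by auto
 then show ?thesis using assms by (simp add: card_Un_disjoint disjoint_iff)
qed

lemma inversions_insert_left:
 fixes I K :: "'d::{finite,linorder} set"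
 assumes "\<alpha> \<notin> I"
 shows "inversions (insert \<alpha> I) K = inversions I K + card {k \<in> K. k < \<alpha>}"
proof -
 have "inversions {\<alpha>} K = card {k \<in> K. k < \<alpha>}"
  unfolding inversions_def by (rule bij_betw_same_card[of snd]) (auto simp: bij_betw_def inj_on_def image_iff)
 then show ?thesis using inversions_Un_left[of I "{\<alpha>}" K] assms by simp
qed

text \<open>The new inversions come from the elements of \<open>I\<close> above
  \<open>\<alpha>\<close>. They are counted as the complement of those below, and the additive form
  avoids subtraction of natural numbers.\<close>

lemma inversions_insert_right:
 fixes I K :: "'d::{finite,linorder} set"
 assumes "\<alpha> \<notin> K" "\<alpha> \<notin> I"
 shows "inversions I (insert \<alpha> K) + card {i \<in> I. i < \<alpha>} = inversions I K + card I"
proof -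
 have "inversions I {\<alpha>} = card {i \<in> I. \<alpha> < i}"
  unfolding inversions_def by (rule bij_betw_same_card[of fst]) (auto simp: bij_betw_def inj_on_def image_iff)
 moreover have "card {i \<in> I. \<alpha> < i} + card {i \<in> I. i < \<alpha>} = card ({i \<in> I. \<alpha> < i} \<union> {i \<in> I. i < \<alpha>})"
  by (subst card_Un_disjoint) auto
 moreover have "{i \<in> I. \<alpha> < i} \<union> {i \<in> I. i < \<alpha>} = I" using assms by (auto simp: not_less le_less)
 ultimately show ?thesis using inversions_Un_right[of K "{\<alpha>}" I] assms by simp
qed

lemma sum_Pow_insert:
 fixes F :: "'d::finite set \<Rightarrow> 'b::comm_monoid_add"
 assumes "\<alpha> \<notin> A"
 shows "(\<Sum>I\<in>Pow (insert \<alpha> A). F I) = (\<Sum>I\<in>Pow A. F (insert \<alpha> I)) + (\<Sum>I\<in>Pow A. F I)"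
proof -
 have "Pow (insert \<alpha> A) = insert \<alpha> ` Pow A \<union> Pow A" by (auto simp: Pow_insert)
 moreover have "insert \<alpha> ` Pow A \<inter> Pow A = {}" using assms by auto
 moreover have "inj_on (insert \<alpha>) (Pow A)" using assms by (auto simp: inj_on_def)
 ultimately show ?thesis by (simp add: sum.union_disjoint sum.reindex)
qed

text \<open>Coefficients of theta^A theta-bar^B are compared. If \<open>\<alpha>\<close> is not in
  A, the subsets of \<open>insert \<alpha> A\<close> containing \<open>\<alpha>\<close> yield the
  first term and the others the second. If it is, the left side vanishes and the two terms on the
  right cancel.\<close>

lemma gdtheta_mult:
 "gdtheta \<alpha> (x * y) = gdtheta \<alpha> x * y + gpar x * gdtheta \<alpha> (y :: 'd::{finite,linorder} grass)"
proof (rule grass_eqI)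
 fix A B :: "'d set"
 show "gcoeff (gdtheta \<alpha> (x * y)) A B = gcoeff (gdtheta \<alpha> x * y + gpar x * gdtheta \<alpha> y) A B"
 proof (cases "\<alpha> \<in> A")
  case True
  \<comment> \<open>The surviving index sets are I without \<open>\<alpha>\<close> in the first
    product and \<open>insert \<alpha> I\<close> in the second. Both then involve the same
    coefficients of x and y, with opposite signs.\<close>
  have "gcoeff (gdtheta \<alpha> x * y) A B + gcoeff (gpar x * gdtheta \<alpha> y) A B = 0"
  proof -
   obtain A' where A': "A = insert \<alpha> A'" "\<alpha> \<notin> A'" using True by (meson Set.set_insert)
   have 1: "gcoeff (gdtheta \<alpha> x * y) A B = (\<Sum>I\<in>Pow A'. \<Sum>J\<in>Pow B. mono_sign I J (insert \<alpha> (A' - I)) (B - J) *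
     ((- 1) ^ card {i \<in> I. i < \<alpha>} * gcoeff x (insert \<alpha> I) J * gcoeff y (insert \<alpha> (A' - I)) (B - J)))"
    using A' by (auto simp: gcoeff_mult A' sum_Pow_insert gdtheta_def insert_Diff_if intro!: sum.cong)
   have 2: "gcoeff (gpar x * gdtheta \<alpha> y) A B = (\<Sum>I\<in>Pow A'. \<Sum>J\<in>Pow B. mono_sign (insert \<alpha> I) J (A' - I) (B - J) *
     ((- 1) ^ (card (insert \<alpha> I) + card J) * gcoeff x (insert \<alpha> I) J *
     ((- 1) ^ card {i \<in> A' - I. i < \<alpha>} * gcoeff y (insert \<alpha> (A' - I)) (B - J))))"
   proof -
    have "(\<Sum>I\<in>Pow A'. \<Sum>J\<in>Pow B. mono_sign I J (insert \<alpha> A' - I) (B - J) *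
     (gcoeff (gpar x) I J * gcoeff (gdtheta \<alpha> y) (insert \<alpha> A' - I) (B - J))) = 0"
     using A' by (intro sum.neutral ballI) (auto simp: gdtheta_def insert_Diff_if)
    moreover have "insert \<alpha> A' - insert \<alpha> I = A' - I" if "I \<subseteq> A'" for I using that A' by auto
    ultimately show ?thesis using A'
     by (simp add: gcoeff_mult sum_Pow_insert) (intro sum.cong refl, auto simp: gdtheta_def insert_absorb)
   qed
   have "gcoeff (gdtheta \<alpha> x * y) A B + gcoeff (gpar x * gdtheta \<alpha> y) A B =
    (\<Sum>I\<in>Pow A'. \<Sum>J\<in>Pow B. 0)"
    unfolding 1 2 sum.distrib[symmetric]
   proof (intro sum.cong refl)
    fix I J assume IJ: "I \<in> Pow A'" "J \<in> Pow B"
    then have nI: "\<alpha> \<notin> I" "\<alpha> \<notin> A' - I" using A' by auto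
    have "(- 1) ^ card {i \<in> I. i < \<alpha>} * mono_sign I J (insert \<alpha> (A' - I)) (B - J)
     = (- 1) ^ Suc (card (insert \<alpha> I) + card J) * (- 1) ^ card {i \<in> A' - I. i < \<alpha>} * mono_sign (insert \<alpha> I) J (A' - I) (B - J)"
     using inversions_insert_right[OF nI(2,1)] nI
     unfolding mono_sign_def inversions_insert_left[OF nI(1)] power_add[symmetric]
     by (intro neg_one_power_eqI) (simp, presburger)
    then show "mono_sign I J (insert \<alpha> (A' - I)) (B - J) *
     ((- 1) ^ card {i \<in> I. i < \<alpha>} * gcoeff x (insert \<alpha> I) J * gcoeff y (insert \<alpha> (A' - I)) (B - J)) +
     mono_sign (insert \<alpha> I) J (A' - I) (B - J) *
     ((- 1) ^ (card (insert \<alpha> I) + card J) * gcoeff x (insert \<alpha> I) J *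
     ((- 1) ^ card {i \<in> A' - I. i < \<alpha>} * gcoeff y (insert \<alpha> (A' - I)) (B - J))) = 0"
     by (simp add: mult.assoc[symmetric]) (simp add: mult.commute mult.left_commute)
   qed
   then show ?thesis by simp
  qed
  then show ?thesis using True by (simp add: gdtheta_def)
 next
  case False
  have 1: "gcoeff (gdtheta \<alpha> x * y) A B = (\<Sum>I\<in>Pow A. \<Sum>J\<in>Pow B. mono_sign I J (A - I) (B - J) *
     ((- 1) ^ card {i \<in> I. i < \<alpha>} * gcoeff x (insert \<alpha> I) J * gcoeff y (A - I) (B - J)))"
   unfolding gcoeff_mult using False by (intro sum.cong refl) (auto simp: gdtheta_def)
  have 2: "gcoeff (gpar x * gdtheta \<alpha> y) A B = (\<Sum>I\<in>Pow A. \<Sum>J\<in>Pow B. mono_sign I J (A - I) (B - J) *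
     ((- 1) ^ (card I + card J) * gcoeff x I J * ((- 1) ^ card {i \<in> A - I. i < \<alpha>} * gcoeff y (insert \<alpha> (A - I)) (B - J))))"
   unfolding gcoeff_mult using False by (intro sum.cong refl) (auto simp: gdtheta_def)
  have "gcoeff (gdtheta \<alpha> (x * y)) A B = (-1) ^ card {i \<in> A. i < \<alpha>} * gcoeff (x * y) (insert \<alpha> A) B"
   using False by (simp add: gdtheta_def)
  also have "\<dots> = (\<Sum>I\<in>Pow A. \<Sum>J\<in>Pow B. (-1) ^ card {i \<in> A. i < \<alpha>} * (mono_sign (insert \<alpha> I) J (A - I) (B - J) *
     (gcoeff x (insert \<alpha> I) J * gcoeff y (A - I) (B - J)))) +
    (\<Sum>I\<in>Pow A. \<Sum>J\<in>Pow B. (-1) ^ card {i \<in> A. i < \<alpha>} * (mono_sign I J (insert \<alpha> (A - I)) (B - J) *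
     (gcoeff x I J * gcoeff y (insert \<alpha> (A - I)) (B - J))))"
  proof -
   have *: "insert \<alpha> A - insert \<alpha> I = A - I" "insert \<alpha> A - I = insert \<alpha> (A - I)" if "I \<in> Pow A" for I
    using that False by auto
   show ?thesis
    unfolding gcoeff_mult sum_Pow_insert[OF False] distrib_left sum_distrib_left
    by (intro arg_cong2[where f = "(+)"] sum.cong refl) (simp_all only: *)
  qed
  also have "\<dots> = gcoeff (gdtheta \<alpha> x * y) A B + gcoeff (gpar x * gdtheta \<alpha> y) A B"
   unfolding 1 2
  proof (intro arg_cong2[where f = "(+)"] sum.cong refl)
   fix I J assume IJ: "I \<in> Pow A" "J \<in> Pow B"
   then have nI: "\<alpha> \<notin> I" "\<alpha> \<notin> A - I" "I \<inter> (A - I) = {}" using False by auto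
   have c: "card {i \<in> A. i < \<alpha>} = card {i \<in> I. i < \<alpha>} + card {i \<in> A - I. i < \<alpha>}"
   proof -
    have "I \<union> (A - I) = A" using IJ by auto
    then show ?thesis using card_lt_Un[OF nI(3), of \<alpha>] by (simp only:)
   qed
   have "(-1) ^ card {i \<in> A. i < \<alpha>} * mono_sign (insert \<alpha> I) J (A - I) (B - J)
     = (-1) ^ card {i \<in> I. i < \<alpha>} * mono_sign I J (A - I) (B - J)"
    unfolding mono_sign_def inversions_insert_left[OF nI(1)] power_add[symmetric] c
    by (intro neg_one_power_eqI) (simp, argo)
   then show "(-1) ^ card {i \<in> A. i < \<alpha>} * (mono_sign (insert \<alpha> I) J (A - I) (B - J) *
     (gcoeff x (insert \<alpha> I) J * gcoeff y (A - I) (B - J))) =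
     mono_sign I J (A - I) (B - J) *
     ((- 1) ^ card {i \<in> I. i < \<alpha>} * gcoeff x (insert \<alpha> I) J * gcoeff y (A - I) (B - J))"
    by (simp add: mult.assoc[symmetric])
   have "(-1) ^ card {i \<in> A. i < \<alpha>} * mono_sign I J (insert \<alpha> (A - I)) (B - J)
     = (- 1) ^ (card I + card J) * (- 1) ^ card {i \<in> A - I. i < \<alpha>} * mono_sign I J (A - I) (B - J)"
    using inversions_insert_right[OF nI(2,1)] nI
    unfolding mono_sign_def power_add[symmetric] c
    by (intro neg_one_power_eqI) (simp, presburger)
   then show "(-1) ^ card {i \<in> A. i < \<alpha>} * (mono_sign I J (insert \<alpha> (A - I)) (B - J) *
     (gcoeff x I J * gcoeff y (insert \<alpha> (A - I)) (B - J))) =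
     mono_sign I J (A - I) (B - J) *
     ((- 1) ^ (card I + card J) * gcoeff x I J * ((- 1) ^ card {i \<in> A - I. i < \<alpha>} * gcoeff y (insert \<alpha> (A - I)) (B - J)))"
    by (simp add: mult.assoc[symmetric])
  qed
  finally show ?thesis by simp
 qed
qed

text \<open>The algebra automorphism exchanging theta and theta-bar of equal index; the sign
  restores the order of the monomial. It transports the calculus of \<open>gdtheta\<close> to
  \<open>gdthetabar\<close>.\<close>

definition gswap :: "'d grass \<Rightarrow> 'd grass" where
 "gswap x = Grass (\<lambda>I J. (- 1) ^ (card I * card J) * gcoeff x J I)"

lemma gcoeff_gswap [simp]: "gcoeff (gswap x) I J = (- 1) ^ (card I * card J) * gcoeff x J I"
 by (simp add: gswap_def)

lemma gswap_mult: "gswap (x * y) = gswap x * gswap (y :: 'd::{finite,linorder} grass)"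
proof (rule grass_eqI)
 fix A B :: "'d set"
 have c: "card A = card I + card (A - I)" if "I \<subseteq> A" for A I :: "'d set"
  using that by (simp add: card_Diff_subset card_mono finite_subset)
 have "gcoeff (gswap (x * y)) A B = (\<Sum>J\<in>Pow A. \<Sum>I\<in>Pow B. (- 1) ^ (card A * card B) *
   (mono_sign I J (B - I) (A - J) * (gcoeff x I J * gcoeff y (B - I) (A - J))))"
  by (simp add: gcoeff_mult sum_distrib_left) (rule sum.swap)
 also have "\<dots> = gcoeff (gswap x * gswap y) A B"
  unfolding gcoeff_mult
 proof (intro sum.cong refl)
  fix J I assume IJ: "J \<in> Pow A" "I \<in> Pow B"
  have "(- 1) ^ (card A * card B) * mono_sign I J (B - I) (A - J)
   = mono_sign J I (A - J) (B - I) * (- 1) ^ (card J * card I) * (- 1) ^ (card (A - J) * card (B - I))"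
   using IJ c[of J A] c[of I B] unfolding mono_sign_def power_add[symmetric]
   by (intro neg_one_power_eqI) (simp add: algebra_simps)
  then show "(- 1) ^ (card A * card B) * (mono_sign I J (B - I) (A - J) * (gcoeff x I J * gcoeff y (B - I) (A - J)))
    = mono_sign J I (A - J) (B - I) * (gcoeff (gswap x) J I * gcoeff (gswap y) (A - J) (B - I))"
   by (simp add: mult.assoc[symmetric])
 qed
 finally show "gcoeff (gswap (x * y)) A B = gcoeff (gswap x * gswap y) A B" .
qed

lemma gdthetabar_gswap: "gdthetabar \<beta> x = gswap (gdtheta \<beta> (gswap (x :: 'd::{finite,linorder} grass)))"
 by (rule grass_eqI) (simp add: gdthetabar_def gdtheta_def power_add algebra_simps)

lemma gswap_simps [simp]: "gswap (gswap x) = (x :: 'd::{finite,linorder} grass)"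
  "gswap (gpar x) = gpar (gswap x)" "gswap (x + y) = gswap x + gswap (y :: 'd::{finite,linorder} grass)"
 by (auto intro!: grass_eqI simp: algebra_simps)

lemma gdthetabar_mult:
 "gdthetabar \<beta> (x * y) = gdthetabar \<beta> x * y + gpar x * gdthetabar \<beta> (y :: 'd::{finite,linorder} grass)"
 by (simp only: gdthetabar_gswap gswap_mult gdtheta_mult gswap_simps)

lemma gd_linear [simp]:
 fixes x y :: "'d::{finite,linorder} grass"
 shows "gdtheta \<alpha> (x + y) = gdtheta \<alpha> x + gdtheta \<alpha> y" "gdthetabar \<alpha> (x + y) = gdthetabar \<alpha> x + gdthetabar \<alpha> y"
  "gdtheta \<alpha> (gconst c * x) = gconst c * gdtheta \<alpha> x" "gdthetabar \<alpha> (gconst c * x) = gconst c * gdthetabar \<alpha> x"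
  "gdtheta \<alpha> (gconst c) = (0::'d grass)" "gdthetabar \<alpha> (gconst c) = (0::'d grass)"
  "gdtheta \<alpha> (gtheta \<beta>) = (if \<alpha> = \<beta> then 1 else 0 :: 'd grass)" "gdthetabar \<alpha> (gthetabar \<beta>) = (if \<alpha> = \<beta> then 1 else 0 :: 'd grass)"
  "gdtheta \<alpha> (gthetabar \<beta>) = (0 :: 'd grass)" "gdthetabar \<alpha> (gtheta \<beta>) = (0 :: 'd grass)"
 by (auto intro!: grass_eqI simp: gdtheta_def gdthetabar_def gtheta_def gthetabar_def algebra_simps)

lemma gdtheta_gsg:
 fixes x :: "'d::{finite,linorder} grass"
 shows "gdtheta \<alpha> (gsg a b x) = (- 1) ^ a * gsg a b (gdtheta \<alpha> x)"
  "gdthetabar \<alpha> (gsg a b x) = (- 1) ^ b * gsg a b (gdthetabar \<alpha> x)"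
 by (auto intro!: grass_eqI simp: neg_one_power_gconst gdtheta_def gdthetabar_def algebra_simps power_add)

lemma card_lt_insert:
 fixes I :: "'d::{finite,linorder} set"
 assumes "\<alpha> \<notin> I"
 shows "card {i \<in> insert \<alpha> I. i < \<gamma>} = (if \<alpha> < \<gamma> then 1 else 0) + card {i \<in> I. i < \<gamma>}"
proof -
 have "{i \<in> {\<alpha>}. i < \<gamma>} = (if \<alpha> < \<gamma> then {\<alpha>} else {})" by auto
 then show ?thesis using card_lt_Un[of "{\<alpha>}" I \<gamma>] assms by simp
qed

lemma gdtheta_anticommute:
 fixes x :: "'d::{finite,linorder} grass"
 shows "gdtheta \<alpha> (gdtheta \<gamma> x) = - gdtheta \<gamma> (gdtheta \<alpha> x)"
proof (rule grass_eqI)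
 fix I J
 consider "\<alpha> = \<gamma>" | "\<alpha> < \<gamma>" | "\<gamma> < \<alpha>" by fastforce
 then show "gcoeff (gdtheta \<alpha> (gdtheta \<gamma> x)) I J = gcoeff (- gdtheta \<gamma> (gdtheta \<alpha> x)) I J"
  using card_lt_insert[of \<alpha> I \<gamma>] card_lt_insert[of \<gamma> I \<alpha>]
  by cases (auto simp: gdtheta_def insert_commute simp del: insert_iff)
qed

lemma gdthetabar_anticommute:
 fixes x :: "'d::{finite,linorder} grass"
 shows "gdthetabar \<alpha> (gdthetabar \<gamma> x) = - gdthetabar \<gamma> (gdthetabar \<alpha> x)"
proof -
 have "gswap (- x) = - gswap x" for x :: "'d grass" by (rule grass_eqI) simp
 then show ?thesis by (simp only: gdthetabar_gswap gswap_simps gdtheta_anticommute[of \<alpha> \<gamma>])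
qed

lemma gdtheta_gdthetabar:
 fixes x :: "'d::{finite,linorder} grass"
 shows "gdtheta \<alpha> (gdthetabar \<gamma> x) = - gdthetabar \<gamma> (gdtheta \<alpha> x)"
 by (rule grass_eqI) (auto simp: gdtheta_def gdthetabar_def)

lemma gsg_gtheta [simp]:
 "gsg a b (gtheta \<alpha>) = (- 1) ^ a * (gtheta \<alpha> :: 'd::{finite,linorder} grass)"
 "gsg a b (gthetabar \<alpha>) = (- 1) ^ b * (gthetabar \<alpha> :: 'd::{finite,linorder} grass)"
 by (auto intro!: grass_eqI simp: neg_one_power_gconst gtheta_def gthetabar_def)

text \<open>Taking a generator out on the left and putting it back there costs no sign. These
  projections onto the monomials containing a given generator build the sign operators in
  \<open>diff_op_sg\<close> and the degree operator in \<open>odd_euler\<close>.\<close>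

lemma gtheta_mult_gdtheta:
 fixes x :: "'d::{finite,linorder} grass"
 shows "gcoeff (gtheta \<alpha> * gdtheta \<alpha> x) A B = (if \<alpha> \<in> A then gcoeff x A B else 0)"
  and "gcoeff (gthetabar \<alpha> * gdthetabar \<alpha> x) A B = (if \<alpha> \<in> B then gcoeff x A B else 0)"
proof -
 have 1: "gcoeff (gtheta \<alpha> * gdtheta \<alpha> x) A B = (if \<alpha> \<in> A then gcoeff x A B else 0)" for x :: "'d grass" and A B
 proof -
  have "gcoeff (gtheta \<alpha> * gdtheta \<alpha> x) A B = (\<Sum>I\<in>Pow A. \<Sum>J\<in>Pow B. if I = {\<alpha>} then if J = {} then
    mono_sign {\<alpha>} {} (A - {\<alpha>}) B * gcoeff (gdtheta \<alpha> x) (A - {\<alpha>}) B else 0 else 0)"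
   unfolding gcoeff_mult by (intro sum.cong refl) (auto simp: gtheta_def)
  also have "\<dots> = (\<Sum>I\<in>Pow A. if I = {\<alpha>} then \<Sum>J\<in>Pow B. if J = {} then
    mono_sign {\<alpha>} {} (A - {\<alpha>}) B * gcoeff (gdtheta \<alpha> x) (A - {\<alpha>}) B else 0 else 0)"
   by (intro sum.cong) auto
  also have "\<dots> = (if \<alpha> \<in> A then mono_sign {\<alpha>} {} (A - {\<alpha>}) B * gcoeff (gdtheta \<alpha> x) (A - {\<alpha>}) B else 0)"
   by (simp add: sum.delta)
  also have "\<dots> = (if \<alpha> \<in> A then gcoeff x A B else 0)"
   using inversions_insert_left[of \<alpha> "{}" "A - {\<alpha>}"]
   by (auto simp: mono_sign_def gdtheta_def insert_absorb mult.assoc[symmetric] power_add[symmetric])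
  finally show ?thesis .
 qed
 then show "gcoeff (gtheta \<alpha> * gdtheta \<alpha> x) A B = (if \<alpha> \<in> A then gcoeff x A B else 0)" .
 have s: "gthetabar \<alpha> = gswap (gtheta \<alpha>)"
  by (rule grass_eqI) (auto simp: gtheta_def gthetabar_def)
 show "gcoeff (gthetabar \<alpha> * gdthetabar \<alpha> x) A B = (if \<alpha> \<in> B then gcoeff x A B else 0)"
  unfolding s gdthetabar_gswap gswap_mult[symmetric] gcoeff_gswap 1
  by (simp add: mult.commute)
qed

section \<open>Partial derivatives of superfunctions\<close>

lemma frechet_derivative_at': "(f has_derivative f') (at x) ==> frechet_derivative f (at x) = f'"
 using frechet_derivative_at by metis

text \<open>Both Wirtinger derivatives in one operator: s = - \<i> gives d/dz_k and s = \<i> gives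
  d/dz-bar_k, so that each rule is proved once.\<close>

definition wd :: "complex \<Rightarrow> 'm \<Rightarrow> (complex^'m \<Rightarrow> complex) \<Rightarrow> complex^'m \<Rightarrow> complex" where
 "wd s k f z = (frechet_derivative f (at z) (axis k 1) + s * frechet_derivative f (at z) (axis k \<i>)) / 2"

lemma wirt_wd: "wirt k = wd (- \<i>) k" "wirt_bar k = wd \<i> k"
 by (auto simp: fun_eq_iff wirt_def wirt_bar_def wd_def)

lemma wd_cong: "open V ==> z \<in> V ==> (!!y. y \<in> V ==> f y = g y) ==> wd s k f z = wd s k g z"
 unfolding wd_def by (simp add: frechet_derivative_cong_open[of V z f g])

lemma wd_const [simp]: "wd s k (\<lambda>z. c) z = 0"
 by (simp add: wd_def frechet_derivative_const)

lemma wd_add: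
 assumes "f differentiable (at z)" "g differentiable (at z)"
 shows "wd s k (\<lambda>z. f z + g z) z = wd s k f z + wd s k g z"
 using frechet_derivative_at'[OF has_derivative_add[OF assms[unfolded frechet_derivative_works]]]
 by (simp add: wd_def field_simps)

lemma wd_mult:
 assumes "f differentiable (at z)" "g differentiable (at z)"
 shows "wd s k (\<lambda>z. f z * g z) z = wd s k f z * g z + f z * wd s k g z"
 using frechet_derivative_at'[OF has_derivative_mult[OF assms[unfolded frechet_derivative_works]]]
 by (simp add: wd_def field_simps)

lemma wd_cmult: "f differentiable (at z) ==> wd s k (\<lambda>z. c * f z) z = c * wd s k f z"
 by (simp add: wd_mult)

lemma wd_sum:
 "(!!i. i \<in> I ==> f i differentiable (at z)) ==> wd s k (\<lambda>z. \<Sum>i\<in>I. f i z) z = (\<Sum>i\<in>I. wd s k (f i) z)"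
 by (induction I rule: infinite_finite_induct) (auto simp: wd_add)

lemma smooth_on_wd: "open U ==> smooth_on U f ==> smooth_on U (wd s k f)"
 unfolding wd_def[abs_def] divide_inverse
 by (intro smooth_on_add smooth_on_mult smooth_on_const smooth_on_frechet_derivative)

lemma wd_commute:
 assumes "open U" "z \<in> U" "smooth_on U f"
 shows "wd s k (wd t l f) z = wd t l (wd s k f) z"
proof -
 define D where "D v = (\<lambda>z. frechet_derivative f (at z) v)" for v
 have "smooth_on U (D v)" for v unfolding D_def by (rule smooth_on_frechet_derivative[OF assms(3)])
 then have d: "D v differentiable (at z)" for v
  using assms(2) smooth_on_differentiable by blast
 have *: "frechet_derivative (wd t l f) (at z) w
   = (frechet_derivative (D (axis l 1)) (at z) w + t * frechet_derivative (D (axis l \<i>)) (at z) w) / 2" for t l w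
 proof -
  have "(wd t l f has_derivative (\<lambda>w. (frechet_derivative (D (axis l 1)) (at z) w + t * frechet_derivative (D (axis l \<i>)) (at z) w) * (1/2))) (at z)"
   using d[of "axis l 1"] d[of "axis l \<i>"] unfolding wd_def[abs_def] frechet_derivative_works D_def[abs_def] divide_inverse
   by (auto intro!: derivative_eq_intros)
  then show ?thesis by (metis (no_types, lifting) frechet_derivative_at' mult.right_neutral times_divide_eq_right)
 qed
 have "frechet_derivative (D v) (at z) w = frechet_derivative (D w) (at z) v" for v w
  unfolding D_def by (rule frechet_derivative_symmetric[OF assms])
 then show ?thesis
  unfolding wd_def[of s k] wd_def[of t l "wd s k f"] * by (simp add: field_simps)
qed

text \<open>One index type for the four kinds of coordinates, so that statements about derivatives
  need no fourfold repetition; signs then depend on \<open>oddd\<close> only.\<close>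

datatype ('m, 'd) dir = DZ 'm | DZb 'm | DT 'd | DTb 'd

lemma finite_dir [simp]: "finite (S :: ('m::finite, 'd::finite) dir set)"
proof (rule finite_subset)
 show "S \<subseteq> range DZ \<union> range DZb \<union> range DT \<union> range DTb"
 proof
  fix i :: "('m, 'd) dir" show "i \<in> range DZ \<union> range DZb \<union> range DT \<union> range DTb"
   by (cases i) auto
 qed
qed auto

fun oddd :: "('m, 'd) dir \<Rightarrow> bool" where
 "oddd (DZ k) = False" | "oddd (DZb l) = False" | "oddd (DT \<alpha>) = True" | "oddd (DTb \<beta>) = True"

fun holo :: "('m, 'd) dir \<Rightarrow> bool" where
 "holo (DZ k) = True" | "holo (DZb l) = False" | "holo (DT \<alpha>) = True" | "holo (DTb \<beta>) = False"

fun pd :: "('m::finite, 'd::{finite,linorder}) dir \<Rightarrow> ('m, 'd) sfun \<Rightarrow> ('m, 'd) sfun" where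
 "pd (DZ k) = sf_dz k" | "pd (DZb l) = sf_dzbar l" | "pd (DT \<alpha>) = sf_dtheta \<alpha>" | "pd (DTb \<beta>) = sf_dthetabar \<beta>"

fun coord :: "('m::finite, 'd::{finite,linorder}) dir \<Rightarrow> ('m, 'd) sfun" where
 "coord (DZ k) = (\<lambda>z. gconst (z $ k))" | "coord (DZb l) = (\<lambda>z. gconst (cnj (z $ l)))"
| "coord (DT \<alpha>) = (\<lambda>z. gtheta \<alpha>)" | "coord (DTb \<beta>) = (\<lambda>z. gthetabar \<beta>)"

definition sconst :: "complex \<Rightarrow> ('m::finite, 'd::{finite,linorder}) sfun" where
 "sconst c = (\<lambda>z. gconst c)"

definition sg :: "nat \<Rightarrow> nat \<Rightarrow> ('m::finite, 'd::{finite,linorder}) sfun \<Rightarrow> ('m, 'd) sfun" where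
 "sg a b f = (\<lambda>z. gsg a b (f z))"

abbreviation spar :: "('m::finite, 'd::{finite,linorder}) sfun \<Rightarrow> ('m, 'd) sfun" where "spar \<equiv> sg (Suc 0) (Suc 0)"

text \<open>The twist of the left factor in the graded Leibniz rule for the direction
  \<open>i\<close>.\<close>

definition sgd :: "('m::finite, 'd::{finite,linorder}) dir \<Rightarrow> ('m, 'd) sfun \<Rightarrow> ('m, 'd) sfun" where
 "sgd i f = (if oddd i then spar f else f)"

text \<open>Multiplication by the Koszul sign (-1)^(|i||j|) of two directions.\<close>

definition ssgn :: "('m, 'd) dir \<Rightarrow> ('m, 'd) dir \<Rightarrow> 'b::ab_group_add \<Rightarrow> 'b" where
 "ssgn i j x = (if oddd i \<and> oddd j then - x else x)"

definition epd :: "complex \<Rightarrow> 'm \<Rightarrow> ('m::finite, 'd::{finite,linorder}) sfun \<Rightarrow> ('m, 'd) sfun" where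
 "epd s k f = (\<lambda>z. Grass (\<lambda>I J. wd s k (\<lambda>z. gcoeff (f z) I J) z))"

lemma gcoeff_epd [simp]: "gcoeff (epd s k f z) I J = wd s k (\<lambda>z. gcoeff (f z) I J) z"
 by (simp add: epd_def)

lemma pd_epd: "pd (DZ k) = epd (- \<i>) k" "pd (DZb k) = epd \<i> k"
 by (auto simp: epd_def sf_dz_def sf_dzbar_def wirt_wd sf_coeff_def fun_eq_iff)

lemma sf_smoothI: "(!!I J. smooth_on U (\<lambda>z. gcoeff (f z) I J)) ==> f \<in> sf_smooth U"
 by (simp add: sf_smooth_def sf_coeff_def)

lemma sf_smoothD: "f \<in> sf_smooth U ==> smooth_on U (\<lambda>z. gcoeff (f z) I J)"
 by (simp add: sf_smooth_def sf_coeff_def)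

lemma sf_smooth_differentiable: "f \<in> sf_smooth U ==> z \<in> U ==> (\<lambda>z. gcoeff (f z) I J) differentiable (at z)"
 using sf_smoothD smooth_on_differentiable by blast

lemma sf_smooth_cong:
 "open U ==> f \<in> sf_smooth U ==> (!!z. z \<in> U ==> f z = g z) ==> g \<in> sf_smooth U"
 by (rule sf_smoothI, rule smooth_on_cong[of U "\<lambda>z. gcoeff (f z) _ _"]) (auto dest: sf_smoothD)

lemma sf_smooth_sconst [simp]: "sconst c \<in> sf_smooth U"
 by (rule sf_smoothI) (simp add: sconst_def)

lemma sconst_simps: "sconst 0 = 0" "sconst 1 = 1"
 by (simp_all add: sconst_def fun_eq_iff)

lemma sf_smooth_0 [simp]: "0 \<in> sf_smooth U" "1 \<in> sf_smooth U"
 using sf_smooth_sconst[of 0] sf_smooth_sconst[of 1] by (simp_all add: sconst_simps)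

lemma sf_smooth_add [simp]: "open U ==> f \<in> sf_smooth U ==> g \<in> sf_smooth U ==> f + g \<in> sf_smooth U"
 by (rule sf_smoothI) (auto intro: smooth_on_add dest: sf_smoothD)

lemma sf_smooth_uminus [simp]: "open U ==> f \<in> sf_smooth U ==> - f \<in> sf_smooth U"
 by (rule sf_smoothI) (auto intro: smooth_on_uminus dest: sf_smoothD)

lemma sf_smooth_diff [simp]: "open U ==> f \<in> sf_smooth U ==> g \<in> sf_smooth U ==> f - g \<in> sf_smooth U"
 using sf_smooth_add[of U f "- g"] by simp

lemma sf_smooth_mult [simp]: "open U ==> f \<in> sf_smooth U ==> g \<in> sf_smooth U ==> f * g \<in> sf_smooth U"
 by (rule sf_smoothI) (auto simp: gcoeff_mult intro!: smooth_on_sum smooth_on_mult dest: sf_smoothD)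

lemma sf_smooth_sum: "open U ==> (!!i. i \<in> S ==> f i \<in> sf_smooth U) ==> (\<Sum>i\<in>S. f i) \<in> sf_smooth U"
 by (induction S rule: infinite_finite_induct) auto

lemma sum_fun_apply: "(\<Sum>i\<in>S. f i) z = (\<Sum>i\<in>S. f i z)"
 by (induction S rule: infinite_finite_induct) auto

lemma sf_smooth_sg [simp]: "open U ==> f \<in> sf_smooth U ==> sg a b f \<in> sf_smooth U"
 by (rule sf_smoothI) (auto simp: sg_def intro!: smooth_on_mult dest: sf_smoothD)

lemma sf_smooth_sgd [simp]: "open U ==> f \<in> sf_smooth U ==> sgd i f \<in> sf_smooth U"
 by (simp add: sgd_def)

lemma sf_smooth_ssgn [simp]: "open U ==> f \<in> sf_smooth U ==> ssgn i j f \<in> sf_smooth U"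
 by (simp add: ssgn_def)

lemma sf_smooth_epd: "open U ==> f \<in> sf_smooth U ==> epd s k f \<in> sf_smooth U"
 by (rule sf_smoothI) (auto intro: smooth_on_wd dest: sf_smoothD)

lemma sf_smooth_pd [simp]:
 assumes "open U" "f \<in> sf_smooth U"
 shows "pd i f \<in> sf_smooth U"
proof (cases i)
 case (DT \<alpha>)
 show ?thesis unfolding DT
 proof (rule sf_smoothI)
  fix I J show "smooth_on U (\<lambda>z. gcoeff (pd (DT \<alpha>) f z) I J)"
   using assms by (cases "\<alpha> \<in> I") (auto simp: sf_dtheta_def gdtheta_def intro!: smooth_on_mult dest: sf_smoothD)
 qed
next
 case (DTb \<alpha>)
 show ?thesis unfolding DTb
 proof (rule sf_smoothI)
  fix I J show "smooth_on U (\<lambda>z. gcoeff (pd (DTb \<alpha>) f z) I J)"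
   using assms by (cases "\<alpha> \<in> J") (auto simp: sf_dthetabar_def gdthetabar_def intro!: smooth_on_mult dest: sf_smoothD)
 qed
qed (use assms in \<open>auto simp: pd_epd sf_smooth_epd simp del: pd.simps\<close>)

lemma sf_smooth_coord [simp]: "open U ==> coord i \<in> sf_smooth U"
proof (cases i)
 case (DZ k)
 assume "open U"
 then have "smooth_on U (\<lambda>z. z $ k)" by (intro smooth_on_bounded_linear bounded_linear_vec_nth)
 then have "smooth_on U (\<lambda>z. gcoeff (coord (DZ k) z) I J)" for I J by (cases "I = {}"; cases "J = {}") simp_all
 then show ?thesis unfolding DZ by (rule sf_smoothI)
next
 case (DZb k)
 assume "open U"
 then have "smooth_on U (\<lambda>z. cnj (z $ k))"
  by (intro smooth_on_bounded_linear bounded_linear_compose[OF bounded_linear_cnj] bounded_linear_vec_nth)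
 then have "smooth_on U (\<lambda>z. gcoeff (coord (DZb k) z) I J)" for I J by (cases "I = {}"; cases "J = {}") simp_all
 then show ?thesis unfolding DZb by (rule sf_smoothI)
qed (auto intro!: sf_smoothI)

lemma pd_cong:
 assumes "open V" "z \<in> V" "!!y. y \<in> V ==> f y = g y"
 shows "pd i f z = pd i g z"
proof (cases i)
 case (DZ k)
 show ?thesis unfolding DZ pd_epd
  by (rule grass_eqI) (simp, rule wd_cong[OF assms(1,2)], simp add: assms(3))
next
 case (DZb k)
 show ?thesis unfolding DZb pd_epd
  by (rule grass_eqI) (simp, rule wd_cong[OF assms(1,2)], simp add: assms(3))
qed (use assms in \<open>simp_all add: sf_dtheta_def sf_dthetabar_def\<close>)

lemma pd_add:
 assumes "z \<in> U" "f \<in> sf_smooth U" "g \<in> sf_smooth U"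
 shows "pd i (f + g) z = pd i f z + pd i g z"
proof (cases i)
 case (DZ k)
 show ?thesis unfolding DZ pd_epd
  by (rule grass_eqI) (use assms in \<open>simp add: wd_add sf_smooth_differentiable\<close>)
next
 case (DZb k)
 show ?thesis unfolding DZb pd_epd
  by (rule grass_eqI) (use assms in \<open>simp add: wd_add sf_smooth_differentiable\<close>)
qed (simp_all add: sf_dtheta_def sf_dthetabar_def)

lemma epd_mult:
 assumes "z \<in> U" "f \<in> sf_smooth U" "g \<in> sf_smooth U"
 shows "epd s k (f * g) z = epd s k f z * g z + f z * epd s k g z"
proof (rule grass_eqI)
 fix A B
 note [simp] = sf_smooth_differentiable[OF assms(2,1)] sf_smooth_differentiable[OF assms(3,1)]
 show "gcoeff (epd s k (f * g) z) A B = gcoeff (epd s k f z * g z + f z * epd s k g z) A B"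
  by (simp add: gcoeff_mult wd_sum wd_cmult wd_mult sum.distrib[symmetric] distrib_left)
qed

lemma pd_mult:
 assumes "z \<in> U" "f \<in> sf_smooth U" "g \<in> sf_smooth U"
 shows "pd i (f * g) z = pd i f z * g z + sgd i f z * pd i g z"
proof (cases i)
 case (DZ k)
 show ?thesis unfolding DZ pd_epd using epd_mult[OF assms] by (simp add: sgd_def)
next
 case (DZb k)
 show ?thesis unfolding DZb pd_epd using epd_mult[OF assms] by (simp add: sgd_def)
qed (auto simp: sf_dtheta_def sf_dthetabar_def sgd_def sg_def gdtheta_mult gdthetabar_mult)

lemma pd_sconst [simp]: "pd i (sconst c) = 0" "pd i 0 = 0" "pd i 1 = 0"
proof -
 show *: "pd i (sconst c) = 0" for c :: complex
 proof (cases i)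
  case (DZ k)
  show ?thesis unfolding DZ pd_epd by (rule ext, rule grass_eqI) (simp add: sconst_def)
 next
  case (DZb k)
  show ?thesis unfolding DZb pd_epd by (rule ext, rule grass_eqI) (simp add: sconst_def)
 qed (auto simp: sf_dtheta_def sf_dthetabar_def sconst_def fun_eq_iff)
 show "pd i 0 = 0" "pd i 1 = 0" using *[of 0] *[of 1] by (simp_all add: sconst_simps)
qed

lemma pd_cmult: "z \<in> U ==> f \<in> sf_smooth U ==> pd i (sconst c * f) z = sconst c z * pd i f z"
 by (simp add: pd_mult) (simp add: sconst_def sgd_def sg_def)

lemma uminus_sconst: "- f = sconst (- 1) * (f :: ('m::finite, 'd::{finite,linorder}) sfun)"
 by (rule ext) (simp add: sconst_def gconst_minus)

lemma pd_uminus: "z \<in> U ==> f \<in> sf_smooth U ==> pd i (- f) z = - pd i f z"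
 unfolding uminus_sconst by (simp add: pd_cmult) (simp add: sconst_def gconst_minus)

lemma pd_diff: "open U ==> z \<in> U ==> f \<in> sf_smooth U ==> g \<in> sf_smooth U ==> pd i (f - g) z = pd i f z - pd i g z"
 using pd_add[of z U f "- g" i] by (simp add: pd_uminus)

lemma pd_sum:
 "open U ==> z \<in> U ==> (!!j. j \<in> S ==> f j \<in> sf_smooth U) ==> pd i (\<Sum>j\<in>S. f j) z = (\<Sum>j\<in>S. pd i (f j) z)"
proof (induction S rule: infinite_finite_induct)
 case (insert x F)
 then have "pd i (f x + sum f F) z = pd i (f x) z + pd i (sum f F) z"
  by (intro pd_add[of z U]) (auto intro: sf_smooth_sum)
 then show ?case using insert by (simp del: plus_fun_apply)
qed auto

lemma pd_sg:
 assumes "z \<in> U" "f \<in> sf_smooth U"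
 shows "pd i (sg a b f) z = (if oddd i then (if holo i then (- 1) ^ a else (- 1) ^ b) else 1) * sg a b (pd i f) z"
proof (cases i)
 case (DZ k)
 show ?thesis unfolding DZ pd_epd sg_def
  by (rule grass_eqI) (use assms in \<open>simp add: wd_cmult sf_smooth_differentiable\<close>)
next
 case (DZb k)
 show ?thesis unfolding DZb pd_epd sg_def
  by (rule grass_eqI) (use assms in \<open>simp add: wd_cmult sf_smooth_differentiable\<close>)
qed (auto simp: sf_dtheta_def sf_dthetabar_def sg_def gdtheta_gsg)

lemma pd_spar: "z \<in> U ==> f \<in> sf_smooth U ==> pd i (spar f) z = (if oddd i then - spar (pd i f) z else spar (pd i f) z)"
 by (simp add: pd_sg)

lemma wd_vec_nth:
 fixes z :: "complex^'m::finite"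
 shows "wd s j (\<lambda>z. vec_nth z k) z = (if j = k then (1 + s * \<i>) / 2 else 0)"
 "wd s j (\<lambda>z. cnj (vec_nth z k)) z = (if j = k then (1 - s * \<i>) / 2 else 0)"
proof -
 have "frechet_derivative (\<lambda>z::complex^'m. vec_nth z k) (at z) v = vec_nth v k" for v :: "complex^'m"
  using frechet_derivative_at'[OF bounded_linear_imp_has_derivative[OF bounded_linear_vec_nth[of k]], of z] by (rule fun_cong)
 then show "wd s j (\<lambda>z. vec_nth z k) z = (if j = k then (1 + s * \<i>) / 2 else 0)"
  by (auto simp: wd_def axis_def)
 have "frechet_derivative (\<lambda>z::complex^'m. cnj (vec_nth z k)) (at z) v = cnj (vec_nth v k)" for v :: "complex^'m"
  using frechet_derivative_at'[OF bounded_linear_imp_has_derivative[OF bounded_linear_compose[OF bounded_linear_cnj bounded_linear_vec_nth[of k]]], of z] by (rule fun_cong)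
 then show "wd s j (\<lambda>z. cnj (vec_nth z k)) z = (if j = k then (1 - s * \<i>) / 2 else 0)"
  by (auto simp: wd_def axis_def)
qed

lemma pd_coord:
 fixes i j :: "('m::finite, 'd::{finite,linorder}) dir"
 shows "pd i (coord j) z = (if i = j then 1 else 0)"
proof (cases "oddd i")
 case False
 then obtain s k where i: "i = (if s then DZ k else DZb k)"
  by (cases i) (use that[of True] that[of False] in auto)
 then have *: "pd i = epd (if s then - \<i> else \<i>) k" by (auto simp: pd_epd simp del: pd.simps)
 show ?thesis
  unfolding *
 proof (rule grass_eqI)
  fix I J show "gcoeff (epd (if s then - \<i> else \<i>) k (coord j) z) I J = gcoeff (if i = j then 1 else 0 :: 'd grass) I J"
   by (cases "I = {}"; cases "J = {}"; cases j) (simp_all add: i wd_vec_nth gtheta_def gthetabar_def)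
 qed
next
 case True
 then show ?thesis
  by (cases i; cases j) (auto simp: sf_dtheta_def sf_dthetabar_def fun_eq_iff)
qed

lemma pd_commute:
 fixes f :: "('a::finite, 'b::{finite,linorder}) sfun"
 assumes "open U" "z \<in> U" "f \<in> sf_smooth U"
 shows "pd i (pd j f) z = ssgn i j (pd j (pd i f)) z"
proof -
 have 1: "epd s k (epd t l f) z = epd t l (epd s k f) z" for s k t l
 proof (rule grass_eqI)
  fix I J show "gcoeff (epd s k (epd t l f) z) I J = gcoeff (epd t l (epd s k f) z) I J"
   using wd_commute[OF assms(1,2) sf_smoothD[OF assms(3), of I J], of s k t l] by (simp add: eta_contract_eq)
 qed
 note d = sf_smooth_differentiable[OF assms(3,2)]
 have 2: "epd s k (sf_dtheta \<alpha> f) z = sf_dtheta \<alpha> (epd s k f) z"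
    "epd s k (sf_dthetabar \<alpha> f) z = sf_dthetabar \<alpha> (epd s k f) z" for s k \<alpha>
  by (rule grass_eqI, auto simp: sf_dtheta_def sf_dthetabar_def gdtheta_def gdthetabar_def wd_cmult d)+
 have 3: "pd i (epd s k f) z = epd s k (pd i f) z" for s k i
 proof (cases i)
  case (DZ l) show ?thesis unfolding DZ pd_epd by (rule 1)
 next
  case (DZb l) show ?thesis unfolding DZb pd_epd by (rule 1)
 qed (simp_all only: pd.simps 2)
 have 4: "\<exists>s k. pd i = (epd s k :: ('a, 'b) sfun \<Rightarrow> _)" if "\<not> oddd i" for i :: "('a, 'b) dir"
  using that by (cases i) (auto simp only: pd_epd oddd.simps)
 consider "\<not> oddd i" | "\<not> oddd j" | "oddd i" "oddd j" by blast
 then show ?thesis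
 proof cases
  case 1
  then show ?thesis using 4[of i] 3[of j] by (auto simp: ssgn_def)
 next
  case 2
  then show ?thesis using 4[of j] 3[of i] by (auto simp: ssgn_def)
 next
  case 3
  then show ?thesis
   by (cases i; cases j)
    (simp_all add: ssgn_def sf_dtheta_def sf_dthetabar_def gdtheta_gdthetabar gdtheta_anticommute[symmetric] gdthetabar_anticommute[symmetric])
 qed
qed

section \<open>Differential operators and jets\<close>

lemma sconst_apply [simp]: "sconst c z = gconst c"
 by (simp add: sconst_def)

lemma gconst_commute: "x * gconst c = gconst c * (x :: 'd::{finite,linorder} grass)"
 by (rule geven_commute[symmetric]) simp

lemma diff_op_pd: "diff_op U (pd i)"
 by (cases i) (auto intro: diff_op.intros)

lemma diff_op_induct [consumes 1, case_names mult pd add comp]: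
 assumes "diff_op U D" "!!c. c \<in> sf_smooth U ==> P (\<lambda>f. c * f)" "!!i. P (pd i)"
  "!!A B. diff_op U A ==> P A ==> diff_op U B ==> P B ==> P (\<lambda>f. A f + B f)"
  "!!A B. diff_op U A ==> P A ==> diff_op U B ==> P B ==> P (\<lambda>f. A (B f))"
 shows "P D"
 using assms(1)
proof (induction rule: diff_op.induct)
 case (2 k) then show ?case using assms(3)[of "DZ k"] by simp
next
 case (3 k) then show ?case using assms(3)[of "DZb k"] by simp
next
 case (4 k) then show ?case using assms(3)[of "DT k"] by simp
next
 case (5 k) then show ?case using assms(3)[of "DTb k"] by simp
qed (rule assms; assumption)+

lemma diff_op_smooth: "open U ==> diff_op U D ==> f \<in> sf_smooth U ==> D f \<in> sf_smooth U"
 by (rotate_tac, induction arbitrary: f rule: diff_op_induct) auto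

lemma diff_op_cong:
 assumes "diff_op U A" "open V" "z \<in> V" "!!y. y \<in> V ==> f y = g y"
 shows "A f z = A g z"
 using assms
proof (induction arbitrary: f g z rule: diff_op_induct)
 case (pd i) then show ?case by (intro pd_cong[of V])
next
 case (add A B)
 show ?case using add.IH(1)[OF add.prems] add.IH(2)[OF add.prems] by simp
next
 case (comp A B)
 show ?case by (rule comp.IH(1)[OF comp.prems(1,2)], rule comp.IH(2)[OF comp.prems(1)]) (use comp.prems in auto)
qed simp

lemma diff_op_plus:
 assumes "open U" "diff_op U D" "f \<in> sf_smooth U" "g \<in> sf_smooth U" "z \<in> U"
 shows "D (f + g) z = D f z + D g z"
 using assms(2-5)
proof (induction arbitrary: f g z rule: diff_op_induct)
 case (mult c)
 then show ?case by (simp add: distrib_left)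
next
 case (pd i)
 then show ?case by (intro pd_add[of z U]) auto
next
 case (add A B)
 show ?case using add.IH(1)[OF add.prems] add.IH(2)[OF add.prems] by simp
next
 case (comp A B)
 have "A (B (f + g)) z = A (B f + B g) z"
  by (rule diff_op_cong[OF comp.hyps(1) assms(1)]) (simp_all add: comp.IH(2)[OF comp.prems(1,2)] comp.prems)
 also have "\<dots> = A (B f) z + A (B g) z"
  by (rule comp.IH(1)) (use comp.prems diff_op_smooth[OF assms(1) comp.hyps(2)] in auto)
 finally show ?case .
qed

lemma diff_op_cmult:
 assumes "open U" "diff_op U D" "f \<in> sf_smooth U" "z \<in> U"
 shows "D (sconst c * f) z = gconst c * D f z"
 using assms(2-4)
proof (induction arbitrary: f z rule: diff_op_induct)
 case (mult d)
 have "d z * gconst c * f z = gconst c * d z * f z" by (simp add: gconst_commute)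
 then show ?case by (simp add: sconst_apply mult.assoc)
next
 case (pd i)
 then have "pd i (sconst c * f) z = gconst c * pd i f z" using pd_cmult[of z U f i c] by simp
 then show ?case .
next
 case (comp A B)
 have "A (B (sconst c * f)) z = A (sconst c * B f) z"
  by (rule diff_op_cong[OF comp(1) assms(1)]) (simp_all add: comp.IH(2)[OF comp.prems(1)] comp.prems)
 also have "\<dots> = gconst c * A (B f) z"
  by (rule comp.IH(1)) (use comp.prems diff_op_smooth[OF assms(1) comp.hyps(2)] in auto)
 finally show ?case .
qed (auto simp: algebra_simps)

lemma diff_op_uminus_arg:
 "open U ==> diff_op U D ==> f \<in> sf_smooth U ==> z \<in> U ==> D (- f) z = - D f z"
 unfolding uminus_sconst by (simp add: diff_op_cmult gconst_minus)

lemma diff_op_minus_arg: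
 "open U ==> diff_op U D ==> f \<in> sf_smooth U ==> g \<in> sf_smooth U ==> z \<in> U ==> D (f - g) z = D f z - D g z"
 using diff_op_plus[of U D f "- g"] by (simp add: diff_op_uminus_arg)

lemma diff_op_0 [simp]: "open U ==> diff_op U D ==> z \<in> U ==> D 0 z = 0"
 using diff_op_plus[of U D 0 0 z] by simp

lemma diff_op_eq_0:
 assumes "diff_op U D" "open U" "open V" "V \<subseteq> U" "z \<in> V" "!!y. y \<in> V ==> f y = 0"
 shows "D f z = 0"
 using diff_op_cong[of U D V z f 0] assms by auto

lemma diff_op_sum_arg:
 "open U ==> diff_op U D ==> (!!i. i \<in> S ==> f i \<in> sf_smooth U) ==> z \<in> U ==> D (\<Sum>i\<in>S. f i) z = (\<Sum>i\<in>S. D (f i) z)"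
proof (induction S rule: infinite_finite_induct)
 case (insert x F)
 then have "D (f x + sum f F) z = D (f x) z + D (sum f F) z"
  by (intro diff_op_plus[of U]) (auto intro: sf_smooth_sum)
 then show ?case using insert by (simp del: plus_fun_apply)
qed auto

lemma diff_op_id: "diff_op U (\<lambda>f. f)"
 using diff_op.intros(1)[of 1 U] by simp

lemma diff_op_sconst: "diff_op U (\<lambda>f. sconst c * f)"
 by (rule diff_op.intros) simp

lemma diff_op_zero: "diff_op U (\<lambda>f. 0)"
 using diff_op_sconst[of U 0] by (simp add: sconst_simps)

lemma diff_op_uminus: "diff_op U D ==> diff_op U (\<lambda>f. - D f)"
 using diff_op.intros(7)[OF diff_op_sconst[of U "-1"], of D] by (simp add: uminus_sconst[symmetric])

lemma diff_op_minus: "diff_op U D ==> diff_op U E ==> diff_op U (\<lambda>f. D f - E f)"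
 using diff_op.intros(6)[of U D "\<lambda>f. - E f"] diff_op_uminus[of U E] by simp

lemma diff_op_sum: "(!!i. i \<in> S ==> diff_op U (D i)) ==> diff_op U (\<lambda>f. \<Sum>i\<in>S. D i f)"
 by (induction S rule: infinite_finite_induct) (auto intro: diff_op.intros(6) diff_op_zero)

text \<open>By \<open>gtheta_mult_gdtheta\<close>, the operator 1 - 2 theta d/dtheta changes the
  sign of exactly the monomials containing theta. Composing these over sets \<open>S\<close> of
  thetas and \<open>T\<close> of theta-bars gives \<open>R S T\<close>, hence every sign
  operator.\<close>

lemma diff_op_sg: "diff_op U (sg a b :: ('m::finite, 'd::{finite,linorder}) sfun \<Rightarrow> _)"
proof -
 define R where "R S T f = (\<lambda>z. Grass (\<lambda>I J. (- 1) ^ (card (I \<inter> S) + card (J \<inter> T)) * gcoeff (f z) I J))"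
  for S T :: "'d set" and f :: "('m, 'd) sfun"
 have coord: "coord i \<in> sf_smooth U" if "oddd i" for i :: "('m, 'd) dir"
  using that by (cases i) (auto intro!: sf_smoothI)
 have F: "diff_op U (\<lambda>f. f - sconst 2 * (coord i * pd i f))" if "oddd i" for i :: "('m, 'd) dir"
  using diff_op.intros(7)[OF diff_op.intros(1)[of "sconst 2 * coord i"] diff_op_pd[of U i]] coord[OF that] that
  by (cases i) (auto intro!: diff_op_minus diff_op_id diff_op.intros(7)[OF diff_op_sconst] diff_op.intros(7)[OF diff_op.intros(1) diff_op_pd] simp del: pd.simps)
 have RS: "R (insert \<alpha> S) T f = R S T (f - sconst 2 * (coord (DT \<alpha>) * pd (DT \<alpha>) f))" if "\<alpha> \<notin> S" for \<alpha> S T f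
  unfolding R_def
  by (rule ext, rule grass_eqI) (use that in \<open>simp add: sf_dtheta_def gtheta_mult_gdtheta(1) Int_insert_right\<close>)
 have RT: "R {} (insert \<alpha> S) f = R {} S (f - sconst 2 * (coord (DTb \<alpha>) * pd (DTb \<alpha>) f))" if "\<alpha> \<notin> S" for \<alpha> S f
  unfolding R_def
  by (rule ext, rule grass_eqI) (use that in \<open>simp add: sf_dthetabar_def gtheta_mult_gdtheta(2) Int_insert_right\<close>)
 have 1: "diff_op U (R {} T)" for T
 proof (induction T rule: infinite_finite_induct)
  case (insert x T)
  have "R {} (insert x T) = (\<lambda>f. R {} T (f - sconst 2 * (coord (DTb x) * pd (DTb x) f)))"
   using RT[OF insert(2)] by (rule ext)
  then show ?case by (simp only:) (rule diff_op.intros(7)[OF insert(3) F], simp)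
 qed (auto simp: R_def gcoeff_def[symmetric] diff_op_id grass.expand)
 have 2: "diff_op U (R S T)" for S T
 proof (induction S rule: infinite_finite_induct)
  case (insert x S)
  have "R (insert x S) T = (\<lambda>f. R S T (f - sconst 2 * (coord (DT x) * pd (DT x) f)))"
   using RS[OF insert(2)] by (rule ext)
  then show ?case by (simp only:) (rule diff_op.intros(7)[OF insert(3) F], simp)
 qed (auto intro: 1)
 \<comment> \<open>Only the parities of \<open>a\<close> and \<open>b\<close> matter: all generators
   of one kind are flipped, or none.\<close>
 have "R (if odd a then UNIV else {}) (if odd b then UNIV else {}) = sg a b"
  by (intro ext grass_eqI) (simp add: R_def sg_def power_add power_mult)
 then show ?thesis using 2 by metis
qed

lemma diff_op_sgd: "diff_op U (sgd i)"
 unfolding sgd_def[abs_def] using diff_op_sg[of U] diff_op_id[of U] by (cases "oddd i") auto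

text \<open>Vanishing to order \<open>n\<close> at \<open>x\<close>: the numerical parts at
  \<open>x\<close> of all iterated derivatives of order below \<open>n\<close>, odd ones included,
  are zero. It plays the role of the n-th power of the maximal ideal of the point.\<close>

primrec van :: "nat \<Rightarrow> complex^'m \<Rightarrow> ('m::finite, 'd::{finite,linorder}) sfun \<Rightarrow> bool" where
 "van 0 x f \<longleftrightarrow> True"
| "van (Suc n) x f \<longleftrightarrow> gcoeff (f x) {} {} = 0 \<and> (\<forall>i. van n x (pd i f))"

section \<open>Orders of vanishing, Euler's identity and the Nakayama induction\<close>

locale dom =
 fixes U :: "(complex^'m::finite) set"
 assumes oU [simp]: "open U"
begin

lemma van_cong: "x \<in> U ==> (!!y. y \<in> U ==> f y = g y) ==> van n x f = van n x g"
proof (induction n arbitrary: f g)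
 case (Suc n)
 have "van n x (pd i f) = van n x (pd i g)" for i
  by (rule Suc.IH[OF Suc.prems(1)], rule pd_cong[OF oU _ Suc.prems(2)])
 then show ?case using Suc.prems by simp
qed simp

lemma van_Suc_mono: "van (Suc n) x f ==> van n x f"
proof (induction n arbitrary: f)
 case (Suc n)
 have "van n x (pd i f)" for i
  by (rule Suc.IH) (use Suc.prems in simp)
 then show ?case using Suc.prems by simp
qed simp

lemma van_mono: "van n x f ==> m \<le> n ==> van m x f"
proof (induction n)
 case (Suc n)
 show ?case
 proof (cases "m = Suc n")
  case False
  then show ?thesis using Suc.IH[OF van_Suc_mono[OF Suc.prems(1)]] Suc.prems(2) by linarith
 qed (use Suc.prems in simp)
qed simp

lemma van_plus: "x \<in> U ==> f \<in> sf_smooth U ==> g \<in> sf_smooth U ==> van n x f ==> van n x g ==> van n x (f + g)"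
proof (induction n arbitrary: f g)
 case (Suc n)
 have "van n x (pd i f + pd i g)" for i
  by (rule Suc.IH) (use Suc.prems in auto)
 moreover have "pd i (f + g) y = (pd i f + pd i g) y" if "y \<in> U" for i y
  using pd_add[OF that Suc.prems(2,3)] by simp
 ultimately have "van n x (pd i (f + g))" for i
  using van_cong[OF Suc.prems(1), of "pd i (f + g)" "pd i f + pd i g" n] by blast
 moreover have "gcoeff ((f + g) x) {} {} = 0" using Suc.prems by simp
 ultimately show ?case unfolding van.simps by blast
qed simp

lemma van_0 [simp]: "x \<in> U ==> van n x 0"
 by (induction n) auto

lemma van_sum: "x \<in> U ==> (!!i. i \<in> S ==> f i \<in> sf_smooth U) ==> (!!i. i \<in> S ==> van n x (f i)) ==> van n x (\<Sum>i\<in>S. f i)"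
 by (induction S rule: infinite_finite_induct) (auto intro!: van_plus sf_smooth_sum)

lemma van_cmult: "x \<in> U ==> f \<in> sf_smooth U ==> van n x f ==> van n x (sconst c * f)"
proof (induction n arbitrary: f)
 case (Suc n)
 have "van n x (sconst c * pd i f)" for i
  by (rule Suc.IH) (use Suc.prems in auto)
 moreover have "pd i (sconst c * f) y = (sconst c * pd i f) y" if "y \<in> U" for i y
  using pd_cmult[OF that Suc.prems(2)] by simp
 ultimately have "van n x (pd i (sconst c * f))" for i
  using van_cong[OF Suc.prems(1), of "pd i (sconst c * f)" "sconst c * pd i f" n] by blast
 moreover have "gcoeff ((sconst c * f) x) {} {} = 0" using Suc.prems by simp
 ultimately show ?case unfolding van.simps by blast
qed simp

lemma van_uminus: "x \<in> U ==> f \<in> sf_smooth U ==> van n x f ==> van n x (- f)"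
 unfolding uminus_sconst by (rule van_cmult)

lemma van_minus: "x \<in> U ==> f \<in> sf_smooth U ==> g \<in> sf_smooth U ==> van n x f ==> van n x g ==> van n x (f - g)"
 using van_plus[of x f "- g" n] van_uminus[of x g n] by simp

lemma van_spar: "x \<in> U ==> f \<in> sf_smooth U ==> van n x f ==> van n x (spar f)"
proof (induction n arbitrary: f)
 case (Suc n)
 define h where "h i = (if oddd i then - spar (pd i f) else spar (pd i f))" for i
 have "van n x (spar (pd i f))" for i
  by (rule Suc.IH) (use Suc.prems in auto)
 then have "van n x (h i)" for i
  using Suc.prems by (auto simp: h_def intro!: van_uminus)
 moreover have "pd i (spar f) y = h i y" if "y \<in> U" for i y
  using pd_spar[OF that Suc.prems(2), of i] by (simp add: h_def)
 ultimately have "van n x (pd i (spar f))" for i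
  using van_cong[OF Suc.prems(1), of "pd i (spar f)" "h i" n] by blast
 moreover have "gcoeff (spar f x) {} {} = 0" using Suc.prems by (simp add: sg_def)
 ultimately show ?case unfolding van.simps by blast
qed simp

lemma van_sgd: "x \<in> U ==> f \<in> sf_smooth U ==> van n x f ==> van n x (sgd i f)"
 by (simp add: sgd_def van_spar)

text \<open>Induction on the total order: by the Leibniz rule each derivative lowers the order of
  one factor by one. A factor of order zero cannot be lowered, but then the other one carries the
  full order.\<close>

lemma van_mult:
 "x \<in> U ==> f \<in> sf_smooth U ==> g \<in> sf_smooth U ==> van n x f ==> van m x g ==> van (n + m) x (f * g)"
proof (induction "n + m" arbitrary: f g n m)
 case (Suc k)
 have 1: "van k x (pd i f * g)" for i
 proof (cases n)
  case 0
  then have "van (Suc k) x g" using Suc.prems Suc.hyps(2) by simp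
  then have "van k x g" by (rule van_Suc_mono)
  then show ?thesis using Suc.hyps(1)[of 0 k "pd i f" g] Suc.prems by simp
 next
  case (Suc n')
  then show ?thesis using Suc.hyps(1)[of n' m "pd i f" g] Suc.prems Suc.hyps(2) by simp
 qed
 have 2: "van k x (sgd i f * pd i g)" for i
 proof (cases m)
  case 0
  then have "van (Suc k) x f" using Suc.prems Suc.hyps(2) by simp
  then have "van k x (sgd i f)" using Suc.prems van_Suc_mono van_sgd by blast
  then show ?thesis using Suc.hyps(1)[of k 0 "sgd i f" "pd i g"] Suc.prems by simp
 next
  case (Suc m')
  then show ?thesis using Suc.hyps(1)[of n m' "sgd i f" "pd i g"] Suc.prems Suc.hyps(2) by (simp add: van_sgd)
 qed
 have "van k x (pd i (f * g))" for i
 proof -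
  have "van k x (pd i f * g + sgd i f * pd i g)"
   using Suc.prems 1 2 by (intro van_plus) auto
  moreover have "pd i (f * g) y = (pd i f * g + sgd i f * pd i g) y" if "y \<in> U" for y
   using pd_mult[OF that Suc.prems(2,3)] by simp
  ultimately show ?thesis
   using van_cong[OF Suc.prems(1), of "pd i (f * g)" "pd i f * g + sgd i f * pd i g" k] by blast
 qed
 moreover have "gcoeff ((f * g) x) {} {} = 0"
  using Suc.prems Suc.hyps(2) by (cases n; cases m) auto
 ultimately show ?case unfolding Suc.hyps(2)[symmetric] van.simps by blast
qed simp

text \<open>\<open>N\<close> bounds the order of the operator. It is uniform in the point, the
  function and \<open>n\<close>, as the inductions over orders of vanishing require.\<close>

lemma van_diff_op:
 fixes D :: "('m, 'd::{finite,linorder}) sfun \<Rightarrow> ('m, 'd) sfun"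
 assumes "diff_op U D"
 shows "\<exists>N. \<forall>n x f. x \<in> U --> f \<in> sf_smooth U --> van (n + N) x f --> van n x (D f)"
 using assms
proof (induction rule: diff_op_induct)
 case (mult c)
 have "van n x (c * f)" if "x \<in> U" "f \<in> sf_smooth U" "van (n + 0) x f" for n x f
  using van_mult[OF that(1) mult that(2), of 0 n] that(3) by simp
 then show ?case by blast
next
 case (pd i)
 have "van n x (pd i f)" if "van (n + 1) x f" for n x f
  using that by simp
 then show ?case by blast
next
 case (add A B)
 then obtain M N where MN: "\<forall>n x f. x \<in> U --> f \<in> sf_smooth U --> van (n + M) x f --> van n x (A f)"
  "\<forall>n x f. x \<in> U --> f \<in> sf_smooth U --> van (n + N) x f --> van n x (B f)" by blast
 show ?case
 proof (intro exI[of _ "M + N"] allI impI)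
  fix n x and f :: "('m, 'd) sfun" assume *: "x \<in> U" "f \<in> sf_smooth U" "van (n + (M + N)) x f"
  then show "van n x (A f + B f)"
   using MN van_mono[of "n + (M + N)" x f "n + M"] van_mono[of "n + (M + N)" x f "n + N"] add(1,2)
   by (intro van_plus) (auto intro: diff_op_smooth)
 qed
next
 case (comp A B)
 then obtain M N where MN: "\<forall>n x f. x \<in> U --> f \<in> sf_smooth U --> van (n + M) x f --> van n x (A f)"
  "\<forall>n x f. x \<in> U --> f \<in> sf_smooth U --> van (n + N) x f --> van n x (B f)" by blast
 have "van n x (A (B f))" if "x \<in> U" "f \<in> sf_smooth U" "van (n + (M + N)) x f" for n x f
  using that MN diff_op_smooth[OF oU comp(2) that(2)] by (simp add: add.assoc[symmetric])
 then show ?case by blast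
qed

text \<open>Up to sign, a coefficient is the numerical part of an iterated odd derivative of order
  |I| + |J|. So vanishing to every order kills the whole value at \<open>x\<close>, not only its
  numerical part.\<close>

lemma van_gcoeff: "van n x f ==> card I + card J < n ==> gcoeff (f x) I J = 0"
proof (induction n arbitrary: f I J)
 case (Suc n)
 consider \<alpha> where "\<alpha> \<in> I" | \<beta> where "\<beta> \<in> J" | "I = {}" "J = {}" by blast
 then show ?case
 proof cases
  case 1
  then obtain I' where I: "I = insert \<alpha> I'" "\<alpha> \<notin> I'" by (meson Set.set_insert)
  have "gcoeff (pd (DT \<alpha>) f x) I' J = 0"
   using Suc.prems I by (intro Suc.IH) (auto simp del: pd.simps)
  then show ?thesis using I by (simp add: sf_dtheta_def gdtheta_def)
 next
  case 2
  then obtain I' where I: "J = insert \<beta> I'" "\<beta> \<notin> I'" by (meson Set.set_insert)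
  have "gcoeff (pd (DTb \<beta>) f x) I I' = 0"
   using Suc.prems I by (intro Suc.IH) (auto simp del: pd.simps)
  then show ?thesis using I by (simp add: sf_dthetabar_def gdthetabar_def)
 next
  case 3
  then show ?thesis using Suc.prems by simp
 qed
qed simp

lemma van_all_imp_0: "(!!n. van n x f) ==> f x = 0"
proof (rule grass_eqI)
 fix I J assume "!!n. van n x f"
 then show "gcoeff (f x) I J = gcoeff 0 I J"
  using van_gcoeff[of "Suc (card I + card J)" x f I J] by simp
qed

definition lcoord :: "complex^'m \<Rightarrow> ('m, 'd::{finite,linorder}) dir \<Rightarrow> ('m, 'd) sfun" where
 "lcoord x i = coord i - sconst (gcoeff (coord i x) {} {})"

lemma lcoord_smooth [simp]: "lcoord x i \<in> sf_smooth U"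
 by (simp add: lcoord_def)

lemma lcoord_body [simp]: "gcoeff (lcoord x i x) {} {} = 0"
 by (simp add: lcoord_def sconst_apply)

lemma pd_lcoord: "z \<in> U ==> pd i (lcoord x j) z = (if i = j then 1 else 0)"
 by (simp add: lcoord_def pd_diff[OF oU] pd_coord)

lemma spar_lcoord: "spar (lcoord x i) = (if oddd i then - lcoord x i else lcoord x i)"
 by (cases i) (auto simp: sg_def lcoord_def sconst_apply fun_eq_iff gtheta_def gthetabar_def intro!: grass_eqI)

lemma van_lcoord [simp]: "x \<in> U ==> van (Suc 0) x (lcoord x i)"
 by simp

lemma sgd_lcoord: "sgd j (lcoord x i) = ssgn j i (lcoord x i)"
 by (simp add: sgd_def ssgn_def spar_lcoord)

lemma lcoord_mult: "lcoord x i * f = sgd i f * lcoord x i"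
proof (rule ext)
 fix z
 have "gpar (lcoord x i z) = (if oddd i then - lcoord x i z else lcoord x i z)"
  using fun_cong[OF spar_lcoord[of x i], of z] by (simp add: sg_def)
 then show "(lcoord x i * f) z = (sgd i f * lcoord x i) z"
  using geven_commute[of "lcoord x i z" "f z"] godd_commute[of "lcoord x i z" "f z"]
  by (auto simp: sgd_def sg_def)
qed

text \<open>The Euler operator E satisfies d_j E = (E + 1) d_j, so differentiating E F - n F gives
  the same expression for d_j F with n lowered by one. The Koszul signs of odd directions cancel
  between coordinate and derivative.\<close>

lemma van_euler:
 fixes F :: "('m, 'd::{finite,linorder}) sfun"
 assumes "x \<in> U"
 shows "F \<in> sf_smooth U ==> van n x F ==> van (Suc n) x ((\<Sum>i\<in>UNIV. lcoord x i * pd i F) - sconst (of_nat n) * F)"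
proof (induction n arbitrary: F)
 case 0
 then show ?case by (simp add: sum_fun_apply gcoeff_sum sconst_apply)
next
 case (Suc n)
 let ?E = "\<lambda>F. (\<Sum>i\<in>UNIV. lcoord x i * pd i F) :: ('m, 'd) sfun"
 have Es: "?E F \<in> sf_smooth U" if "F \<in> sf_smooth U" for F using that by (intro sf_smooth_sum) auto
 have "van (Suc n) x (pd j (?E F - sconst (of_nat (Suc n)) * F))" for j
 proof -
  have "pd j (?E F - sconst (of_nat (Suc n)) * F) z = (?E (pd j F) - sconst (of_nat n) * pd j F) z" if z: "z \<in> U" for z
  proof -
   have "pd j (?E F) z = (\<Sum>i\<in>UNIV. pd j (lcoord x i * pd i F) z)"
    using Suc.prems z by (intro pd_sum[of U]) auto
   also have "\<dots> = (\<Sum>i\<in>UNIV. (if i = j then pd j F z else 0) + lcoord x i z * pd i (pd j F) z)"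
   proof (intro sum.cong refl)
    fix i :: "('m, 'd) dir"
    have 1: "pd j (lcoord x i * pd i F) z = (if j = i then 1 else 0) * pd i F z + ssgn j i (lcoord x i) z * pd j (pd i F) z"
     using Suc.prems z by (simp add: pd_mult[of z U] pd_lcoord sgd_lcoord)
    have 2: "ssgn j i (lcoord x i) z * pd j (pd i F) z = lcoord x i z * pd i (pd j F) z"
     using pd_commute[OF oU z Suc.prems(1), of j i] by (simp add: ssgn_def)
    show "pd j (lcoord x i * pd i F) z = (if i = j then pd j F z else 0) + lcoord x i z * pd i (pd j F) z"
     unfolding 1 2 by auto
   qed
   also have "\<dots> = pd j F z + ?E (pd j F) z" by (simp add: sum.distrib sum_fun_apply)
   finally show ?thesis using Suc.prems z Es
    by (simp add: pd_diff[OF oU] pd_cmult[of z U]) (simp add: sconst_apply gconst_add algebra_simps)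
  qed
  moreover have "van (Suc n) x (?E (pd j F) - sconst (of_nat n) * pd j F)"
   by (rule Suc.IH) (use Suc.prems in auto)
  ultimately show ?thesis using van_cong[OF assms] by blast
 qed
 moreover have "gcoeff ((?E F - sconst (of_nat (Suc n)) * F) x) {} {} = 0"
  using Suc.prems by (simp add: sum_fun_apply gcoeff_sum)
 ultimately show ?case unfolding van.simps(2)[of "Suc n"] by blast
qed

text \<open>Substitute for Taylor's formula: modulo order n + 1, a function of order n > 0 is 1/n
  times the sum of the x_i d_i F, and each of these may be replaced by any \<open>G i\<close> of the
  same class.\<close>

lemma van_euler_remainder:
 fixes F :: "('m, 'd::{finite,linorder}) sfun"
 assumes "x \<in> U" "F \<in> sf_smooth U" "van n x F" "n > 0" "!!i. G i \<in> sf_smooth U"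
  and "!!i. van (Suc n) x (lcoord x i * pd i F - G i)"
 shows "van (Suc n) x (F - (\<Sum>i\<in>UNIV. sconst (1 / of_nat n) * G i))"
proof -
 have s: "(\<Sum>i\<in>UNIV. lcoord x i * pd i F) \<in> sf_smooth U" "(\<Sum>i\<in>UNIV. lcoord x i * pd i F - G i) \<in> sf_smooth U"
  using assms by (auto intro!: sf_smooth_sum)
 have "F - (\<Sum>i\<in>UNIV. sconst (1 / of_nat n) * G i)
   = sconst (1 / of_nat n) * (\<Sum>i\<in>UNIV. lcoord x i * pd i F - G i)
    - sconst (1 / of_nat n) * ((\<Sum>i\<in>UNIV. lcoord x i * pd i F) - sconst (of_nat n) * F)"
 proof (rule ext, rule grass_eqI)
  fix z I J
  show "gcoeff ((F - (\<Sum>i\<in>UNIV. sconst (1 / of_nat n) * G i)) z) I J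
   = gcoeff ((sconst (1 / of_nat n) * (\<Sum>i\<in>UNIV. lcoord x i * pd i F - G i)
    - sconst (1 / of_nat n) * ((\<Sum>i\<in>UNIV. lcoord x i * pd i F) - sconst (of_nat n) * F)) z) I J"
   using assms(4) by (simp add: sum_fun_apply gcoeff_sum sconst_apply sum_subtractf sum_divide_distrib right_diff_distrib)
 qed
 moreover have "van (Suc n) x (sconst (1 / of_nat n) * (\<Sum>i\<in>UNIV. lcoord x i * pd i F - G i)
    - sconst (1 / of_nat n) * ((\<Sum>i\<in>UNIV. lcoord x i * pd i F) - sconst (of_nat n) * F))"
 proof -
  have 1: "van (Suc n) x (\<Sum>i\<in>UNIV. lcoord x i * pd i F - G i)"
   by (rule van_sum[OF assms(1) _ assms(6)]) (use assms(2,5) in auto)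
  have 2: "van (Suc n) x ((\<Sum>i\<in>UNIV. lcoord x i * pd i F) - sconst (of_nat n) * F)"
   by (rule van_euler[OF assms(1-3)])
  show ?thesis
   by (rule van_minus[OF assms(1) _ _ van_cmult[OF assms(1) _ 1] van_cmult[OF assms(1) _ 2]]) (use s assms(2) in auto)
 qed
 ultimately show ?thesis by (simp only:)
qed

declare van.simps(2) [simp del]

text \<open>A Nakayama argument: \<open>g j\<close> generate the maximal ideal at \<open>x\<close> modulo its square, and \<open>T\<close> maps
 multiples of them to functions vanishing to higher order.\<close>

lemma diff_op_nakayama:
 fixes T :: "('m, 'd::{finite,linorder}) sfun \<Rightarrow> ('m, 'd) sfun"
 assumes T: "diff_op U T" and x: "x \<in> U" and g: "!!j. g j \<in> sf_smooth U"
  and T1: "!!z. z \<in> U ==> T 1 z = 0"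
  and gen: "!!i. van 2 x (lcoord x i - (\<Sum>j\<in>UNIV. sconst (A i j) * g j))"
  and step: "!!j F M. F \<in> sf_smooth U ==> (!!G. G \<in> sf_smooth U ==> van M x (T G)) ==> van (Suc M) x (T (g j * F))"
  and F: "F \<in> sf_smooth U"
 shows "T F x = 0"
proof -
 note [simp] = g diff_op_smooth[OF oU T]
 obtain N where N: "!!n x f. x \<in> U ==> f \<in> sf_smooth U ==> van (n + N) x f ==> van n x (T f)"
  using van_diff_op[OF T] by blast
 \<comment> \<open>The order of T F at \<open>x\<close> is raised step by step for all F at once,
   because \<open>step\<close> assumes the previous bound for every function.\<close>
 have "\<forall>F\<in>sf_smooth U. van M x (T F)" for M
 proof (induction M)
  case (Suc M)
  \<comment> \<open>Descending induction on the order of F: at order M + 1 + N the claim is the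
    order bound for \<open>T\<close>, and at order 0 it covers every F.\<close>
  have "\<forall>F\<in>sf_smooth U. van (Suc M + N - k) x F --> van (Suc M) x (T F)" for k
  proof (induction k)
   case 0
   then show ?case using N[OF x, of _ "Suc M"] by simp
  next
   case (Suc k)
   show ?case
   proof (intro ballI impI)
    fix F :: "('m, 'd) sfun" assume Fs: "F \<in> sf_smooth U" and v: "van (Suc M + N - Suc k) x F"
    consider "Suc k > Suc M + N" | "Suc k = Suc M + N" | "Suc k < Suc M + N" by linarith
    then show "van (Suc M) x (T F)"
    proof cases
     case 1
     then show ?thesis using Suc.IH v Fs by auto
    next
     case 2
     \<comment> \<open>F differs from the constant \<open>c\<close> by a function of order one, and
       by \<open>T1\<close> the operator annihilates constants.\<close>
     define c where "c = gcoeff (F x) {} {}"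
     have k: "Suc M + N - k = Suc 0" using 2 by simp
     have a: "van (Suc M) x (T (F - sconst c * 1))"
     proof -
      have "van (Suc 0) x (F - sconst c * 1)" by (simp add: van.simps(2) c_def)
      moreover have "F - sconst c * 1 \<in> sf_smooth U" using Fs by simp
      ultimately show ?thesis using Suc.IH unfolding k by blast
     qed
     have "T F z = T (F - sconst c * 1) z" if "z \<in> U" for z
      using diff_op_minus_arg[OF oU T Fs _ that, of "sconst c * 1"] diff_op_cmult[OF oU T _ that, of 1 c] T1[OF that] by simp
     then show ?thesis using a van_cong[OF x, of "T F" "T (F - sconst c * 1)"] by blast
    next
     case 3
     define n where "n = Suc M + N - Suc k"
     have n: "n > 0" "Suc M + N - k = Suc n" "van n x F" using 3 v by (auto simp: n_def)
     \<comment> \<open>In x_i d_i F the coordinate is replaced by its expression in the generators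
       \<open>g j\<close>. By \<open>gen\<close> the error has order 2 + (n - 1), so it falls under
       the induction hypothesis.\<close>
     define G where "G i = (\<Sum>j\<in>UNIV. sconst (A i j) * (g j * pd i F))" for i
     have Gs: "G i \<in> sf_smooth U" for i using Fs unfolding G_def by (intro sf_smooth_sum) auto
     define H where "H = (\<Sum>i\<in>UNIV. sconst (1 / of_nat n) * G i)"
     have Hs: "H \<in> sf_smooth U" unfolding H_def using Gs by (intro sf_smooth_sum) auto
     have "van (Suc n) x (F - H)" unfolding H_def
     proof (rule van_euler_remainder[OF x Fs n(3,1) Gs])
      fix i
      have "lcoord x i * pd i F - G i = (lcoord x i - (\<Sum>j\<in>UNIV. sconst (A i j) * g j)) * pd i F"
       by (simp add: G_def left_diff_distrib sum_distrib_right mult.assoc)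
      moreover have "van (2 + (n - 1)) x ((lcoord x i - (\<Sum>j\<in>UNIV. sconst (A i j) * g j)) * pd i F)"
      proof (rule van_mult[OF x _ _ gen])
       have "van (Suc (n - 1)) x F" using n by simp
       then show "van (n - 1) x (pd i F)" by (simp add: van.simps(2))
      qed (use Fs in \<open>auto intro!: sf_smooth_diff sf_smooth_sum\<close>)
      ultimately show "van (Suc n) x (lcoord x i * pd i F - G i)" using n(1) by simp
     qed
     then have 1: "van (Suc M) x (T (F - H))" using Suc.IH sf_smooth_diff[OF oU Fs Hs] unfolding n(2) by blast
     have "van (Suc M) x (\<Sum>i\<in>UNIV. sconst (1 / of_nat n) * (\<Sum>j\<in>UNIV. sconst (A i j) * T (g j * pd i F)))"
     proof -
      have "van (Suc M) x (T (g j * pd i F))" for i j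
       using Fs \<open>\<forall>F\<in>sf_smooth U. van M x (T F)\<close> by (intro step) auto
      then show ?thesis
       using Fs by (intro van_sum van_cmult sf_smooth_sum x sf_smooth_mult oU) auto
     qed
     moreover have "(\<Sum>i\<in>UNIV. sconst (1 / of_nat n) * (\<Sum>j\<in>UNIV. sconst (A i j) * T (g j * pd i F))) z = T H z" if z: "z \<in> U" for z
     proof -
      have 3: "T (G i) z = (\<Sum>j\<in>UNIV. gconst (A i j) * T (g j * pd i F) z)" for i
       unfolding G_def using Fs z by (subst diff_op_sum_arg[OF oU T]) (auto simp: diff_op_cmult[OF oU T])
      have "T H z = (\<Sum>i\<in>UNIV. T (sconst (1 / of_nat n) * G i) z)"
       unfolding H_def using Gs z by (intro diff_op_sum_arg[OF oU T]) auto
      also have "\<dots> = (\<Sum>i\<in>UNIV. gconst (1 / of_nat n) * T (G i) z)"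
       using Gs z by (intro sum.cong refl diff_op_cmult[OF oU T])
      finally show ?thesis unfolding 3 by (simp add: sum_fun_apply)
     qed
     ultimately have 2: "van (Suc M) x (T H)" using van_cong[OF x] by blast
     have "T F z = (T (F - H) + T H) z" if "z \<in> U" for z
      using diff_op_minus_arg[OF oU T Fs Hs that] by simp
     moreover have "van (Suc M) x (T (F - H) + T H)" using Fs Hs by (intro van_plus[OF x _ _ 1 2]) auto
     ultimately show ?thesis using van_cong[OF x, of "T F" "T (F - H) + T H"] by blast
    qed
   qed
  qed
  from this[of "Suc M + N"] show ?case by simp
 qed simp
 then show ?thesis using van_all_imp_0 F by blast
qed

text \<open>The Cauchy-Riemann equations in all even and odd directions, which pass easily to
  products and derivatives; \<open>shol_sf_hol\<close> gives the agreement with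
  \<open>sf_hol\<close>. Smoothness is required on U, holomorphy on \<open>V\<close> only, as in the
  definition of separation of variables.\<close>

definition shol :: "(complex^'m) set \<Rightarrow> ('m, 'd::{finite,linorder}) sfun \<Rightarrow> bool" where
 "shol V a \<longleftrightarrow> a \<in> sf_smooth U \<and> (\<forall>i. \<not> holo i --> (\<forall>z\<in>V. pd i a z = 0))"

definition santi :: "(complex^'m) set \<Rightarrow> ('m, 'd::{finite,linorder}) sfun \<Rightarrow> bool" where
 "santi V a \<longleftrightarrow> a \<in> sf_smooth U \<and> (\<forall>i. holo i --> (\<forall>z\<in>V. pd i a z = 0))"

lemma shol_mult: "V \<subseteq> U ==> shol V a ==> shol V b ==> shol V (a * b)"
 unfolding shol_def by (auto simp: pd_mult[of _ U] subset_iff)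

lemma santi_mult: "V \<subseteq> U ==> santi V a ==> santi V b ==> santi V (a * b)"
 unfolding santi_def by (auto simp: pd_mult[of _ U] subset_iff)

lemma shol_sg: "V \<subseteq> U ==> shol V f ==> shol V (sg a b f)"
 unfolding shol_def by (auto simp: pd_sg[of _ U] subset_iff) (auto simp: sg_def)

lemma santi_sg: "V \<subseteq> U ==> santi V f ==> santi V (sg a b f)"
 unfolding santi_def by (auto simp: pd_sg[of _ U] subset_iff) (auto simp: sg_def)

lemma shol_sgd: "V \<subseteq> U ==> shol V f ==> shol V (sgd i f)"
 by (simp add: sgd_def shol_sg)

lemma santi_sgd: "V \<subseteq> U ==> santi V f ==> santi V (sgd i f)"
 by (simp add: sgd_def santi_sg)

lemma shol_pd:
 fixes f :: "('m, 'b::{finite,linorder}) sfun"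
 assumes "open V" "V \<subseteq> U" "shol V f"
 shows "shol V (pd j f)"
 unfolding shol_def
proof (intro conjI allI impI ballI)
 fix i :: "('m, 'b) dir" and z assume *: "\<not> holo i" "z \<in> V"
 have "pd j (pd i f) z = pd j 0 z"
  by (rule pd_cong[OF assms(1) *(2)]) (use assms * in \<open>auto simp: shol_def\<close>)
 then show "pd i (pd j f) z = 0"
  using pd_commute[of U z f i j] assms * by (auto simp: shol_def ssgn_def)
qed (use assms in \<open>auto simp: shol_def\<close>)

lemma santi_pd:
 fixes f :: "('m, 'b::{finite,linorder}) sfun"
 assumes "open V" "V \<subseteq> U" "santi V f"
 shows "santi V (pd j f)"
 unfolding santi_def
proof (intro conjI allI impI ballI)
 fix i :: "('m, 'b) dir" and z assume *: "holo i" "z \<in> V"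
 have "pd j (pd i f) z = pd j 0 z"
  by (rule pd_cong[OF assms(1) *(2)]) (use assms * in \<open>auto simp: santi_def\<close>)
 then show "pd i (pd j f) z = 0"
  using pd_commute[of U z f i j] assms * by (auto simp: santi_def ssgn_def)
qed (use assms in \<open>auto simp: santi_def\<close>)

lemma shol_sconst [simp]: "shol V (sconst c)" "santi V (sconst c)" "shol V 1" "santi V 1" "shol V 0" "santi V 0"
 by (auto simp: shol_def santi_def)

lemma shol_lcoord: "V \<subseteq> U ==> holo i ==> shol V (lcoord x i)" "V \<subseteq> U ==> \<not> holo i ==> santi V (lcoord x i)"
 by (auto simp: shol_def santi_def pd_lcoord)

section \<open>Sums of products b a and their jets\<close>

inductive poly_ba :: "('m, 'd::{finite,linorder}) sfun \<Rightarrow> bool" where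
 "santi U b ==> shol U a ==> poly_ba (b * a)"
| "poly_ba p ==> poly_ba q ==> poly_ba (p + q)"

lemma poly_ba_smooth: "poly_ba p ==> p \<in> sf_smooth U"
proof (induction rule: poly_ba.induct)
 case (1 b a)
 then show ?case by (intro sf_smooth_mult oU) (auto simp: santi_def shol_def)
next
 case (2 p q)
 then show ?case by (intro sf_smooth_add oU)
qed

lemma poly_ba_cmult: "poly_ba p ==> poly_ba (sconst c * p)"
proof (induction rule: poly_ba.induct)
 case (1 b a)
 then have "poly_ba ((sconst c * b) * a)" by (intro poly_ba.intros(1) santi_mult) auto
 then show ?case by (simp only: mult.assoc)
next
 case (2 p q)
 then have "poly_ba (sconst c * p + sconst c * q)" by (intro poly_ba.intros(2))
 then show ?case by (simp only: distrib_left)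
qed

lemma poly_ba_0: "poly_ba 0"
 using poly_ba.intros(1)[of 0 0] by simp

lemma poly_ba_sconst: "poly_ba (sconst c)"
 using poly_ba.intros(1)[of "sconst c" 1] by simp

lemma poly_ba_sum: "(!!i. i \<in> S ==> poly_ba (f i)) ==> poly_ba (\<Sum>i\<in>S. f i)"
 by (induction S rule: infinite_finite_induct) (auto intro: poly_ba_0 poly_ba.intros)

text \<open>An antiholomorphic coordinate joins \<open>b\<close> directly; a holomorphic one must
  first pass \<open>b\<close> to reach \<open>a\<close>, which twists \<open>b\<close> by
  \<open>sgd i\<close>.\<close>

lemma poly_ba_lcoord: "poly_ba p ==> poly_ba (lcoord x i * p)"
proof (induction rule: poly_ba.induct)
 case (1 b a)
 show ?case
 proof (cases "holo i")
  case False
  then have "poly_ba ((lcoord x i * b) * a)" using 1 by (intro poly_ba.intros(1) santi_mult shol_lcoord) auto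
  then show ?thesis by (simp only: mult.assoc)
 next
  case True
  have "lcoord x i * (b * a) = sgd i b * (lcoord x i * a)"
   by (simp only: mult.assoc[symmetric] lcoord_mult[of x i b])
  moreover have "poly_ba (sgd i b * (lcoord x i * a))"
   using 1 True by (intro poly_ba.intros(1) santi_sgd shol_mult shol_lcoord) auto
  ultimately show ?thesis by (simp only:)
 qed
next
 case (2 p q)
 then have "poly_ba (lcoord x i * p + lcoord x i * q)" by (intro poly_ba.intros(2))
 then show ?case by (simp only: distrib_left)
qed

text \<open>The induction integrates jets: if d_i h is approximated by q_i to order n, then h,
  already of order n, is approximated to order n + 1 by 1/n times the sum of the x_i q_i.\<close>

lemma poly_approx:
 fixes F :: "('m, 'd::{finite,linorder}) sfun"
 assumes x: "x \<in> U"
 shows "F \<in> sf_smooth U ==> \<exists>p. poly_ba p \<and> van n x (F - p)"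
proof (induction n arbitrary: F)
 case 0
 then show ?case using poly_ba_0 by auto
next
 case (Suc n)
 show ?case
 \<comment> \<open>Treated apart because the Euler step divides by \<open>n\<close>.\<close>
 proof (cases "n = 0")
  case True
  then have "van (Suc n) x (F - sconst (gcoeff (F x) {} {}))" by (simp add: van.simps(2))
  then show ?thesis using poly_ba_sconst by blast
 next
  case False
  obtain p where p: "poly_ba p" "van n x (F - p)" using Suc by blast
  define h where "h = F - p"
  have hs: "h \<in> sf_smooth U" using Suc.prems poly_ba_smooth[OF p(1)] by (simp add: h_def)
  have "\<forall>i. \<exists>q. poly_ba q \<and> van n x (pd i h - q)" using Suc.IH sf_smooth_pd[OF oU hs] by blast
  then obtain q where q: "!!i. poly_ba (q i)" "!!i. van n x (pd i h - q i)" by metis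
  note qs [simp] = poly_ba_smooth[OF q(1)]
  have "van (Suc n) x (h - (\<Sum>i\<in>UNIV. sconst (1 / of_nat n) * (lcoord x i * q i)))"
  proof (rule van_euler_remainder[OF x hs])
   show "van n x h" "0 < n" using p False by (auto simp: h_def)
   fix i
   have "van (Suc 0 + n) x (lcoord x i * (pd i h - q i))"
    by (rule van_mult[OF x _ _ van_lcoord[OF x] q(2)]) (use hs in auto)
   then show "van (Suc n) x (lcoord x i * pd i h - lcoord x i * q i)" unfolding right_diff_distrib by (simp only: plus_nat.simps)
  qed simp
  then have "van (Suc n) x (F - (p + (\<Sum>i\<in>UNIV. sconst (1 / of_nat n) * (lcoord x i * q i))))"
   unfolding h_def diff_diff_eq .
  moreover have "poly_ba (p + (\<Sum>i\<in>UNIV. sconst (1 / of_nat n) * (lcoord x i * q i)))"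
   using p(1) q(1) by (intro poly_ba.intros(2) poly_ba_sum poly_ba_cmult poly_ba_lcoord)
  ultimately show ?thesis by blast
 qed
qed

text \<open>The coefficient (I, J) of D F at \<open>x\<close> is determined by a jet of F of order
  |I| + |J| + 1 plus the order of D, and by \<open>poly_approx\<close> a sum of products b a has the
  same jet.\<close>

lemma diff_op_zero_on_poly:
 fixes D :: "('m, 'd::{finite,linorder}) sfun \<Rightarrow> ('m, 'd) sfun"
 assumes D: "diff_op U D" and x: "x \<in> U" and F: "F \<in> sf_smooth U"
  and ba: "!!b a. santi U b ==> shol U a ==> D (b * a) x = 0"
 shows "D F x = 0"
proof (rule grass_eqI)
 fix I J :: "'d set"
 obtain N where N: "!!n x f. x \<in> U ==> f \<in> sf_smooth U ==> van (n + N) x f ==> van n x (D f)"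
  using van_diff_op[OF D] by blast
 obtain p where p: "poly_ba p" "van (Suc (card I + card J) + N) x (F - p)"
  using poly_approx[OF x F] by blast
 note ps = poly_ba_smooth[OF p(1)]
 have "D p x = 0" using p(1)
 proof (induction rule: poly_ba.induct)
  case (1 b a)
  then show ?case by (rule ba)
 next
  case (2 p q)
  have "D (p + q) x = D p x + D q x"
   by (rule diff_op_plus[OF oU D _ _ x]) (use 2 poly_ba_smooth in auto)
  then show ?case using 2 by (simp only: add_0_right)
 qed
 moreover have "gcoeff (D (F - p) x) I J = 0"
  by (rule van_gcoeff[OF N[OF x _ p(2)]]) (use F ps in auto)
 ultimately show "gcoeff (D F x) I J = gcoeff 0 I J"
  using diff_op_minus_arg[OF oU D F ps x] by simp
qed

end

section \<open>Formal differential operators\<close>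

lemma eq_on_refl [simp]: "eq_on V f f" by (simp add: eq_on_def)
lemma eq_on_sym: "eq_on V f g ==> eq_on V g f" by (simp add: eq_on_def)
lemma eq_on_trans [trans]: "eq_on V f g ==> eq_on V g h ==> eq_on V f h" by (simp add: eq_on_def)
lemma eq_on_subset: "eq_on U f g ==> V \<subseteq> U ==> eq_on V f g" by (auto simp: eq_on_def)
lemma eq_onI: "(!!n z. z \<in> V ==> (f $$ n) z = (g $$ n) z) ==> eq_on V f g" by (simp add: eq_on_def)
lemma eq_onD: "eq_on V f g ==> z \<in> V ==> (f $$ n) z = (g $$ n) z" by (simp add: eq_on_def)
lemma eq_on_add: "eq_on V f f' ==> eq_on V g g' ==> eq_on V (f + g) (f' + g')" by (simp add: eq_on_def)
lemma eq_on_diff: "eq_on V f f' ==> eq_on V g g' ==> eq_on V (f - g) (f' - g')" by (simp add: eq_on_def)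
lemma eq_on_uminus: "eq_on V f f' ==> eq_on V (- f) (- f')" by (simp add: eq_on_def)

text \<open>The bounds \<open>r\<close> and \<open>s\<close> concern the values at \<open>z\<close>
  only. \<open>fls_subdegree\<close> is not the right bound for functions that matter on U only,
  since it depends on their values elsewhere.\<close>

lemma fls_mult_nth_at:
 fixes f g :: "('m::finite, 'd::{finite,linorder}) formal"
 assumes "!!j. j < s ==> (g $$ j) z = 0" "!!j. j < r ==> (f $$ j) z = 0"
 shows "((f * g) $$ n) z = (\<Sum>j = s..n - r. (f $$ (n - j)) z * (g $$ j) z)"
proof -
 define a where "a = min s (fls_subdegree g)"
 define b where "b = min r (fls_subdegree f)"
 have "((f * g) $$ n) z = (\<Sum>j = fls_subdegree g..n - fls_subdegree f. (f $$ (n - j)) z * (g $$ j) z)"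
 proof -
  have "((f * g) $$ n) z = (\<Sum>i = fls_subdegree f..n - fls_subdegree g. (f $$ i) z * (g $$ (n - i)) z)"
   by (simp add: fls_times_nth(2) sum_fun_apply)
  also have "\<dots> = (\<Sum>j = fls_subdegree g..n - fls_subdegree f. (f $$ (n - j)) z * (g $$ j) z)"
   by (rule sum.reindex_bij_witness[where i = "\<lambda>j. n - j" and j = "\<lambda>r. n - r"]) auto
  finally show ?thesis .
 qed
 also have "\<dots> = (\<Sum>j = a..n - b. (f $$ (n - j)) z * (g $$ j) z)"
 proof (rule sum.mono_neutral_left)
  show "\<forall>i\<in>{a..n - b} - {fls_subdegree g..n - fls_subdegree f}. (f $$ (n - i)) z * (g $$ i) z = 0"
  proof
   fix i assume "i \<in> {a..n - b} - {fls_subdegree g..n - fls_subdegree f}"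
   then have "i < fls_subdegree g \<or> n - i < fls_subdegree f" by auto
   then show "(f $$ (n - i)) z * (g $$ i) z = 0" by auto
  qed
 qed (auto simp: a_def b_def)
 also have "\<dots> = (\<Sum>j = s..n - r. (f $$ (n - j)) z * (g $$ j) z)"
 proof (rule sum.mono_neutral_right)
  show "\<forall>i\<in>{a..n - b} - {s..n - r}. (f $$ (n - i)) z * (g $$ i) z = 0"
  proof
   fix i assume "i \<in> {a..n - b} - {s..n - r}"
   then have "i < s \<or> n - i < r" by auto
   then show "(f $$ (n - i)) z * (g $$ i) z = 0" using assms by auto
  qed
 qed (auto simp: a_def b_def)
 finally show ?thesis .
qed

lemma eq_on_mult: "eq_on V f f' ==> eq_on V g g' ==> eq_on V (f * g) (f' * g')"
proof (rule eq_onI)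
 fix n z assume *: "eq_on V f f'" "eq_on V g g'" "z \<in> V"
 define s where "s = min (fls_subdegree g) (fls_subdegree g')"
 define r where "r = min (fls_subdegree f) (fls_subdegree f')"
 have "((f * g) $$ n) z = (\<Sum>j = s..n - r. (f $$ (n - j)) z * (g $$ j) z)"
  by (rule fls_mult_nth_at) (auto simp: s_def r_def)
 also have "\<dots> = (\<Sum>j = s..n - r. (f' $$ (n - j)) z * (g' $$ j) z)"
  using * by (simp add: eq_on_def)
 also have "\<dots> = ((f' * g') $$ n) z"
  by (rule fls_mult_nth_at[symmetric]) (auto simp: s_def r_def)
 finally show "((f * g) $$ n) z = ((f' * g') $$ n) z" .
qed

text \<open>The even part \<open>c0\<close> commutes with everything and the odd part
  \<open>c1\<close> commutes up to \<open>spar\<close>, itself a differential operator.\<close>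

lemma diff_op_rmult:
 assumes "c \<in> sf_smooth U" "open U"
 shows "diff_op U (\<lambda>f. f * c)"
proof -
 define c0 where "c0 = sconst (1/2) * (c + spar c)"
 define c1 where "c1 = sconst (1/2) * (c - spar c)"
 have *: "f * c = c0 * f + c1 * spar f" for f
 proof (rule ext)
  fix z
  have 0: "c0 z = geven (c z)" "c1 z = godd (c z)" by (simp_all add: c0_def c1_def geven_def godd_def sg_def)
  have "f z * c z = f z * geven (c z) + f z * godd (c z)"
   by (subst geven_godd[of "c z"]) (simp add: distrib_left)
  also have "f z * geven (c z) = geven (c z) * f z" by (rule geven_commute[symmetric]) simp
  also have "f z * godd (c z) = godd (c z) * gpar (f z)"
   using godd_commute[of "godd (c z)" "gpar (f z)"] by simp
  finally show "(f * c) z = (c0 * f + c1 * spar f) z" by (simp add: 0 sg_def)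
 qed
 have s: "c0 \<in> sf_smooth U" "c1 \<in> sf_smooth U" using assms by (auto simp: c0_def c1_def)
 have "diff_op U (\<lambda>f. c0 * f + c1 * spar f)"
  by (intro diff_op.intros(6) diff_op.intros(1)[OF s(1)] diff_op.intros(7)[OF diff_op.intros(1)[OF s(2)] diff_op_sg])
 then show ?thesis by (simp only: *)
qed

text \<open>The coefficients of the inverse of a formal operator 1 + nu D_1 + nu^2 D_2 + ..., by the
  recursion E_0 = id, E_n = - (D_n E_0 + ... + D_1 E_(n-1)).\<close>

fun inv_seq :: "(int \<Rightarrow> ('m::finite, 'd::{finite,linorder}) sfun \<Rightarrow> ('m, 'd) sfun) \<Rightarrow> nat \<Rightarrow> ('m, 'd) sfun \<Rightarrow> ('m, 'd) sfun" where
 "inv_seq D n = (\<lambda>f. (if n = 0 then f else - (\<Sum>k<n. D (int (n - k)) (inv_seq D k f))))"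

declare inv_seq.simps [simp del]

lemma sum_swap_triangle:
 fixes F :: "int \<Rightarrow> int \<Rightarrow> 'b::comm_monoid_add"
 shows "(\<Sum>j = s + q..n. \<Sum>i = s..j - q. F i j) = (\<Sum>i = s..n - q. \<Sum>k = q..n - i. F i (k + i))"
proof -
 have "(\<Sum>j = s + q..n. \<Sum>i = s..j - q. F i j) = (\<Sum>(j, i)\<in>(SIGMA j:{s + q..n}. {s..j - q}). F i j)"
  by (subst sum.Sigma) auto
 also have "\<dots> = (\<Sum>(i, k)\<in>(SIGMA i:{s..n - q}. {q..n - i}). F i (k + i))"
  by (rule sum.reindex_bij_witness[where i = "\<lambda>(i, k). (k + i, i)" and j = "\<lambda>(j, i). (i, j - i)"]) auto
 also have "\<dots> = (\<Sum>i = s..n - q. \<Sum>k = q..n - i. F i (k + i))"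
  by (subst sum.Sigma) auto
 finally show ?thesis .
qed

section \<open>Calculus of formal differential operators\<close>

context dom
begin

abbreviation FF :: "('m, 'd::{finite,linorder}) formal set" where "FF \<equiv> formal_funs U"

text \<open>Equivalent to \<open>formal_expansion\<close> by \<open>fdo_with_iff_expansion\<close>,
  but the sum may start at any \<open>s\<close> below which f vanishes on U. This frees computations
  from \<open>fls_subdegree\<close> and lets different arguments share one summation range.\<close>

definition fdo_with :: "int \<Rightarrow> (int \<Rightarrow> ('m, 'd::{finite,linorder}) sfun \<Rightarrow> ('m, 'd) sfun) \<Rightarrow> (('m, 'd) formal \<Rightarrow> ('m, 'd) formal) \<Rightarrow> bool" where
 "fdo_with r0 D A \<longleftrightarrow> (\<forall>r. diff_op U (D r)) \<and> (\<forall>f\<in>FF. \<forall>s. (\<forall>j<s. \<forall>z\<in>U. (f $$ j) z = 0) -->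
   (\<forall>n. \<forall>z\<in>U. (A f $$ n) z = (\<Sum>j = s..n - r0. D (n - j) (f $$ j) z)))"

definition fdo :: "(('m, 'd::{finite,linorder}) formal \<Rightarrow> ('m, 'd) formal) \<Rightarrow> bool" where
 "fdo A \<longleftrightarrow> (\<exists>r0 D. fdo_with r0 D A)"

lemma FF_nth [simp]: "f \<in> FF ==> f $$ n \<in> sf_smooth U"
 by (simp add: formal_funs_def)

lemma fdo_withD: "fdo_with r0 D A ==> f \<in> FF ==> (!!j z. j < s ==> z \<in> U ==> (f $$ j) z = 0) ==> z \<in> U ==>
 (A f $$ n) z = (\<Sum>j = s..n - r0. D (n - j) (f $$ j) z)"
 by (simp add: fdo_with_def)

lemma fdo_with_diff_op: "fdo_with r0 D A ==> diff_op U (D r)"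
 by (simp add: fdo_with_def)

lemma fdo_with_iff_expansion:
 fixes A :: "('m, 'd::{finite,linorder}) formal \<Rightarrow> ('m, 'd) formal"
 shows "fdo_with r0 D A \<longleftrightarrow> (\<forall>r. diff_op U (D r)) \<and> formal_expansion U r0 D A"
proof -
 have re: "(\<Sum>r = r0..n - s. D r (f $$ (n - r)) z) = (\<Sum>j = s..n - r0. D (n - j) (f $$ j) z)" for n s and f :: "('m, 'd) formal" and z
  by (rule sum.reindex_bij_witness[where i = "\<lambda>j. n - j" and j = "\<lambda>r. n - r"]) auto
 show ?thesis
 proof
  assume *: "fdo_with r0 D A"
  have "(A f $$ n) z = (\<Sum>r = r0..n - fls_subdegree f. D r (f $$ (n - r)) z)" if "f \<in> FF" "z \<in> U" for f n z
   unfolding re by (rule fdo_withD[OF * that(1) _ that(2)]) simp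
  then show "(\<forall>r. diff_op U (D r)) \<and> formal_expansion U r0 D A"
   using * by (auto simp: formal_expansion_def fdo_with_def)
 next
  assume *: "(\<forall>r. diff_op U (D r)) \<and> formal_expansion U r0 D A"
  show "fdo_with r0 D A"
   unfolding fdo_with_def
  proof (intro conjI ballI allI impI)
   fix f :: "('m, 'd) formal" and s n z assume f: "f \<in> FF" and s: "\<forall>j<s. \<forall>z\<in>U. (f $$ j) z = 0" and z: "z \<in> U"
   have z0: "D r (f $$ j) z = 0" if "j < s \<or> j < fls_subdegree f" for r j
    using diff_op_eq_0[of U "D r" U z "f $$ j"] * s z that by auto
   have "(A f $$ n) z = (\<Sum>j = fls_subdegree f..n - r0. D (n - j) (f $$ j) z)"
    using * f z unfolding formal_expansion_def re by blast
   also have "\<dots> = (\<Sum>j = min s (fls_subdegree f)..n - r0. D (n - j) (f $$ j) z)"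
    by (rule sum.mono_neutral_left) (auto intro!: z0)
   also have "\<dots> = (\<Sum>j = s..n - r0. D (n - j) (f $$ j) z)"
    by (rule sum.mono_neutral_right) (auto intro!: z0)
   finally show "(A f $$ n) z = (\<Sum>j = s..n - r0. D (n - j) (f $$ j) z)" .
  qed (use * in auto)
 qed
qed

lemma fdo_iff: "fdo A \<longleftrightarrow> formal_diff_op U A"
 unfolding fdo_def formal_diff_op_def fdo_with_iff_expansion by auto

lemma fdo_with_closed:
 assumes "fdo_with r0 D A" "f \<in> FF"
 shows "A f \<in> FF"
 unfolding formal_funs_def
proof (rule CollectI, rule allI)
 fix n
 have s: "(\<Sum>j = fls_subdegree f..n - r0. D (n - j) (f $$ j)) \<in> sf_smooth U"
  using assms by (intro sf_smooth_sum diff_op_smooth[OF oU fdo_with_diff_op[OF assms(1)]]) auto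
 show "A f $$ n \<in> sf_smooth U"
  by (rule sf_smooth_cong[OF oU s])
   (unfold sum_fun_apply, rule fdo_withD[OF assms, symmetric], auto)
qed

lemma fdo_closed: "fdo A ==> f \<in> FF ==> A f \<in> FF"
 unfolding fdo_def using fdo_with_closed by blast

lemma fdo_cong:
 assumes "fdo A" "f \<in> FF" "g \<in> FF" "open V" "V \<subseteq> U" "eq_on V f g"
 shows "eq_on V (A f) (A g)"
proof (rule eq_onI)
 fix n z assume z: "z \<in> V"
 obtain r0 D where D: "fdo_with r0 D A" using assms(1) unfolding fdo_def by blast
 define s where "s = min (fls_subdegree f) (fls_subdegree g)"
 have zU: "z \<in> U" using z assms(5) by auto
 have "(A f $$ n) z = (\<Sum>j = s..n - r0. D (n - j) (f $$ j) z)"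
  by (rule fdo_withD[OF D assms(2) _ zU]) (simp add: s_def)
 also have "\<dots> = (\<Sum>j = s..n - r0. D (n - j) (g $$ j) z)"
  by (intro sum.cong refl diff_op_cong[OF fdo_with_diff_op[OF D] assms(4) z] eq_onD[OF assms(6)])
 also have "\<dots> = (A g $$ n) z"
  by (rule fdo_withD[OF D assms(3) _ zU, symmetric]) (simp add: s_def)
 finally show "(A f $$ n) z = (A g $$ n) z" .
qed

lemma fdo_cong_U: "fdo A ==> f \<in> FF ==> g \<in> FF ==> eq_on U f g ==> eq_on U (A f) (A g)"
 using fdo_cong[of A f g U] by simp

lemma fdo_with_eq:
 assumes "fdo_with r0 D A" "!!f. f \<in> FF ==> eq_on U (B f) (A f)"
 shows "fdo_with r0 D B"
 using assms unfolding fdo_with_def by (simp add: eq_on_def)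

lemma fdo_eq: "fdo A ==> (!!f. f \<in> FF ==> eq_on U (B f) (A f)) ==> fdo B"
 unfolding fdo_def using fdo_with_eq by blast

lemma FF_add [simp]: "f \<in> FF ==> g \<in> FF ==> f + g \<in> FF"
 unfolding formal_funs_def mem_Collect_eq fls_plus_nth by (intro allI sf_smooth_add oU; blast)

lemma FF_uminus [simp]: "f \<in> FF ==> - f \<in> FF"
 unfolding formal_funs_def mem_Collect_eq fls_uminus_nth by (intro allI sf_smooth_uminus oU; blast)

lemma FF_diff [simp]: "f \<in> FF ==> g \<in> FF ==> f - g \<in> FF"
 unfolding diff_conv_add_uminus[of f g] by (intro FF_add FF_uminus)

lemma FF_const [simp]:
 assumes "f \<in> sf_smooth U"
 shows "cst f \<in> FF"
 unfolding formal_funs_def mem_Collect_eq fls_const_nth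
proof
 fix n show "(if n = 0 then f else 0) \<in> sf_smooth U"
  using assms by (cases "n = 0") (simp_all only: if_True if_False sf_smooth_0 simp_thms)
qed

lemma FF_0 [simp]: "0 \<in> FF" "1 \<in> FF"
 using FF_const[of 0] FF_const[of 1] by simp_all

lemma fdo_with_add:
 assumes "fdo_with r0 D A" "fdo_with r0 E B"
 shows "fdo_with r0 (\<lambda>r f. D r f + E r f) (\<lambda>f. A f + B f)"
 using assms unfolding fdo_with_def by (auto simp: sum.distrib intro: diff_op.intros(6))

text \<open>The operators \<open>D r\<close> with r < r0 never enter the expansion and may be
  arbitrary; they must be reset to zero before the range is enlarged.\<close>

lemma fdo_with_lower:
 fixes A :: "('m, 'b::{finite,linorder}) formal \<Rightarrow> ('m, 'b) formal"
 assumes D: "fdo_with r0 D A" and "r1 \<le> r0"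
 shows "fdo_with r1 (\<lambda>r. if r < r0 then (\<lambda>f. 0) else D r) A"
 unfolding fdo_with_def
proof (intro conjI ballI allI impI)
 fix f :: "('m, 'b) formal" and s n z assume f: "f \<in> FF" and s: "\<forall>j<s. \<forall>z\<in>U. (f $$ j) z = 0" and z: "z \<in> U"
 have "(A f $$ n) z = (\<Sum>j = s..n - r0. D (n - j) (f $$ j) z)"
  by (rule fdo_withD[OF D f _ z]) (use s in auto)
 also have "\<dots> = (\<Sum>j = s..n - r1. (if n - j < r0 then (\<lambda>f. 0) else D (n - j)) (f $$ j) z)"
  using assms(2) by (intro sum.mono_neutral_cong_left) auto
 finally show "(A f $$ n) z = (\<Sum>j = s..n - r1. (if n - j < r0 then (\<lambda>f. 0) else D (n - j)) (f $$ j) z)" .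
qed (use fdo_with_diff_op[OF D] diff_op_zero in auto)

lemma fdo_add:
 assumes "fdo A" "fdo B"
 shows "fdo (\<lambda>f. A f + B f)"
proof -
 obtain r D q E where "fdo_with r D A" "fdo_with q E B" using assms unfolding fdo_def by blast
 then have "fdo_with (min r q) (\<lambda>k. if k < r then (\<lambda>f. 0) else D k) A" "fdo_with (min r q) (\<lambda>k. if k < q then (\<lambda>f. 0) else E k) B"
  by (auto intro: fdo_with_lower)
 from fdo_with_add[OF this] show ?thesis unfolding fdo_def by blast
qed

lemma fdo_uminus:
 assumes "fdo A"
 shows "fdo (\<lambda>f. - A f)"
proof -
 obtain r D where "fdo_with r D A" using assms unfolding fdo_def by blast
 then have "fdo_with r (\<lambda>k f. - D k f) (\<lambda>f. - A f)"
  unfolding fdo_with_def by (auto simp: sum_negf intro: diff_op_uminus)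
 then show ?thesis unfolding fdo_def by blast
qed

lemma fdo_diff: "fdo A ==> fdo B ==> fdo (\<lambda>f. A f - B f)"
 using fdo_add[of A "\<lambda>f. - B f"] fdo_uminus[of B] by simp

lemma fdo_with_comp:
 fixes A :: "('m, 'b::{finite,linorder}) formal \<Rightarrow> ('m, 'b) formal"
 assumes A: "fdo_with r D A" and B: "fdo_with q E B"
 shows "fdo_with (r + q) (\<lambda>t f. \<Sum>k = q..t - r. D (t - k) (E k f)) (\<lambda>f. A (B f))"
 unfolding fdo_with_def
proof (intro conjI ballI allI impI)
 show "diff_op U (\<lambda>f. \<Sum>k = q..t - r. D (t - k) (E k f))" for t
  by (intro diff_op_sum diff_op.intros(7)[OF fdo_with_diff_op[OF A] fdo_with_diff_op[OF B]])
 fix f :: "('m, 'b) formal" and s n z assume f: "f \<in> FF" and s: "\<forall>j<s. \<forall>z\<in>U. (f $$ j) z = 0" and z: "z \<in> U"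
 have Bf: "(B f $$ j) z = (\<Sum>i = s..j - q. E (j - i) (f $$ i) z)" if "z \<in> U" for j z
  by (rule fdo_withD[OF B f _ that]) (use s in auto)
 have Es: "E k (f $$ i) \<in> sf_smooth U" for k i
  by (rule diff_op_smooth[OF oU fdo_with_diff_op[OF B]]) (use f in simp)
 have "(A (B f) $$ n) z = (\<Sum>j = s + q..n - r. D (n - j) (B f $$ j) z)"
  by (rule fdo_withD[OF A fdo_with_closed[OF B f] _ z]) (simp add: Bf)
 also have "\<dots> = (\<Sum>j = s + q..n - r. \<Sum>i = s..j - q. D (n - j) (E (j - i) (f $$ i)) z)"
 proof (intro sum.cong refl)
  fix j
  have "D (n - j) (B f $$ j) z = D (n - j) (\<Sum>i = s..j - q. E (j - i) (f $$ i)) z"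
   by (rule diff_op_cong[OF fdo_with_diff_op[OF A] oU z]) (simp add: Bf sum_fun_apply)
  then show "D (n - j) (B f $$ j) z = (\<Sum>i = s..j - q. D (n - j) (E (j - i) (f $$ i)) z)"
   by (simp only: diff_op_sum_arg[OF oU fdo_with_diff_op[OF A] Es z])
 qed
 also have "\<dots> = (\<Sum>i = s..n - r - q. \<Sum>k = q..n - r - i. D (n - (k + i)) (E ((k + i) - i) (f $$ i)) z)"
  by (rule sum_swap_triangle)
 also have "\<dots> = (\<Sum>j = s..n - (r + q). (\<Sum>k = q..n - j - r. D (n - j - k) (E k (f $$ j))) z)"
  by (simp add: sum_fun_apply algebra_simps)
 finally show "(A (B f) $$ n) z = (\<Sum>j = s..n - (r + q). (\<Sum>k = q..n - j - r. D (n - j - k) (E k (f $$ j))) z)" .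
qed

lemma fdo_comp: "fdo A ==> fdo B ==> fdo (\<lambda>f. A (B f))"
 unfolding fdo_def using fdo_with_comp by blast

text \<open>This recovers the coefficient operators from the values on functions constant in nu,
  which reduces identities of formal operators to single differential operators.\<close>

lemma fdo_with_const:
 assumes D: "fdo_with r D A" and f: "f \<in> sf_smooth U" and z: "z \<in> U"
 shows "(A (cst f) $$ n) z = (if n < r then 0 else D n f z)"
proof -
 have "(A (cst f) $$ n) z = (\<Sum>j = 0..n - r. D (n - j) (cst f $$ j) z)"
  by (rule fdo_withD[OF D _ _ z]) (use f in auto)
 also have "\<dots> = (\<Sum>j = 0..n - r. if j = 0 then D n f z else 0)"
  by (intro sum.cong refl) (simp add: diff_op_0[OF oU fdo_with_diff_op[OF D] z])
 finally show ?thesis by (auto simp: sum.delta)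
qed

text \<open>On products b a each coefficient operator is read off by \<open>fdo_with_const\<close>;
  then \<open>diff_op_zero_on_poly\<close> applies to it at every point of \<open>V\<close>. The
  factors may be taken holomorphic and antiholomorphic on all of U even if \<open>V\<close> is
  smaller.\<close>

lemma fdo_zero_on_poly:
 fixes A :: "('m, 'd::{finite,linorder}) formal \<Rightarrow> ('m, 'd) formal"
 assumes A: "fdo A" and V: "V \<subseteq> U" "open V" and f: "f \<in> FF"
  and ba: "!!b a. santi U b ==> shol U a ==> eq_on V (A (cst (b * a))) 0"
 shows "eq_on V (A f) 0"
proof (rule eq_onI)
 fix n z assume z: "z \<in> V"
 then have zU: "z \<in> U" using V by auto
 obtain r D where D: "fdo_with r D A" using A unfolding fdo_def by blast
 have "D k g z = 0" if "\<not> k < r" and g: "g \<in> sf_smooth U" for k g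
 proof (rule diff_op_zero_on_poly[OF fdo_with_diff_op[OF D] zU g])
  fix a b :: "('m, 'd) sfun" assume *: "santi U b" "shol U a"
  then have "b * a \<in> sf_smooth U" by (intro sf_smooth_mult oU) (auto simp: santi_def shol_def)
  from fdo_with_const[OF D this zU, of k] that(1) eq_onD[OF ba[OF *] z, of k]
  show "D k (b * a) z = 0" by simp
 qed
 then have "(\<Sum>j = fls_subdegree f..n - r. D (n - j) (f $$ j) z) = 0"
  using f by (intro sum.neutral ballI) auto
 moreover have "(A f $$ n) z = (\<Sum>j = fls_subdegree f..n - r. D (n - j) (f $$ j) z)"
  by (rule fdo_withD[OF D f _ zU]) simp
 ultimately show "(A f $$ n) z = (0 $$ n) z" by simp
qed

lemma fdo_eq_on_poly:
 fixes A B :: "('m, 'd::{finite,linorder}) formal \<Rightarrow> ('m, 'd) formal"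
 assumes "fdo A" "fdo B" "V \<subseteq> U" "open V" "f \<in> FF"
  and "!!b a. santi U b ==> shol U a ==> eq_on V (A (cst (b * a))) (B (cst (b * a)))"
 shows "eq_on V (A f) (B f)"
proof -
 have "eq_on V (A f - B f) 0"
  by (rule fdo_zero_on_poly[OF fdo_diff[OF assms(1,2)] assms(3-5)]) (use assms(6) in \<open>simp add: eq_on_def\<close>)
 then show ?thesis by (simp add: eq_on_def)
qed

lemma fdo_additive:
 assumes "fdo A" "f \<in> FF" "g \<in> FF"
 shows "eq_on U (A (f + g)) (A f + A g)"
proof (rule eq_onI)
 fix n z assume z: "z \<in> U"
 obtain r D where D: "fdo_with r D A" using assms(1) unfolding fdo_def by blast
 define s where "s = min (fls_subdegree f) (fls_subdegree g)"
 have "(A (f + g) $$ n) z = (\<Sum>j = s..n - r. D (n - j) ((f + g) $$ j) z)"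
  by (rule fdo_withD[OF D _ _ z]) (use assms in \<open>auto simp: s_def\<close>)
 also have "\<dots> = (\<Sum>j = s..n - r. D (n - j) (f $$ j) z + D (n - j) (g $$ j) z)"
  unfolding fls_plus_nth
  by (intro sum.cong refl diff_op_plus[OF oU fdo_with_diff_op[OF D] _ _ z]) (use assms in auto)
 also have "\<dots> = (A f $$ n) z + (A g $$ n) z"
 proof -
  have "(A f $$ n) z = (\<Sum>j = s..n - r. D (n - j) (f $$ j) z)" by (rule fdo_withD[OF D assms(2) _ z]) (simp add: s_def)
  moreover have "(A g $$ n) z = (\<Sum>j = s..n - r. D (n - j) (g $$ j) z)" by (rule fdo_withD[OF D assms(3) _ z]) (simp add: s_def)
  ultimately show ?thesis by (simp add: sum.distrib)
 qed
 finally show "(A (f + g) $$ n) z = ((A f + A g) $$ n) z" by simp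
qed

lemma fdo_uminus_arg:
 assumes "fdo A" "f \<in> FF"
 shows "eq_on U (A (- f)) (- A f)"
proof -
 have 1: "eq_on U (A (0 + 0)) (A 0 + A 0)" by (rule fdo_additive[OF assms(1)]) auto
 have "eq_on U (A (f + - f)) (A f + A (- f))" by (rule fdo_additive[OF assms(1)]) (use assms in auto)
 then show ?thesis using 1 by (simp add: eq_on_def add_eq_0_iff2)
qed

lemma fdo_minus_arg:
 assumes "fdo A" "f \<in> FF" "g \<in> FF"
 shows "eq_on U (A (f - g)) (A f - A g)"
 using fdo_additive[OF assms(1,2) FF_uminus[OF assms(3)]] fdo_uminus_arg[OF assms(1,3)] by (simp add: eq_on_def)

lemma fdo_coeffwise:
 fixes A :: "('m, 'b::{finite,linorder}) formal \<Rightarrow> ('m, 'b) formal"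
 assumes D: "diff_op U D" and A: "!!f n z. f \<in> FF ==> z \<in> U ==> (A f $$ n) z = D (f $$ n) z"
 shows "fdo A"
proof -
 have "fdo_with 0 (\<lambda>r. if r = 0 then D else (\<lambda>f. 0)) A"
  unfolding fdo_with_def
 proof (intro conjI ballI allI impI)
  fix f :: "('m, 'b) formal" and s n z assume f: "f \<in> FF" and s: "\<forall>j<s. \<forall>z\<in>U. (f $$ j) z = 0" and z: "z \<in> U"
  have "(\<Sum>j = s..n - 0. (if n - j = 0 then D else (\<lambda>f. 0)) (f $$ j) z) = (\<Sum>j = s..n. if j = n then D (f $$ n) z else 0)"
   by (intro sum.cong) auto
  also have "\<dots> = D (f $$ n) z"
   using diff_op_eq_0[OF D oU oU _ z, of "f $$ n"] s by (auto simp: sum.delta)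
  finally show "(A f $$ n) z = (\<Sum>j = s..n - 0. (if n - j = 0 then D else (\<lambda>f. 0)) (f $$ j) z)"
   using A[OF f z] by simp
 qed (use D diff_op_zero in auto)
 then show ?thesis unfolding fdo_def by blast
qed

lemma fdo_lmult:
 fixes w :: "('m, 'b::{finite,linorder}) formal"
 assumes w: "w \<in> FF"
 shows "fdo (\<lambda>f. w * f)"
proof -
 have "fdo_with (fls_subdegree w) (\<lambda>r f. w $$ r * f) (\<lambda>f. w * f)"
  unfolding fdo_with_def
 proof (intro conjI ballI allI impI)
  fix f :: "('m, 'b) formal" and s n z assume f: "f \<in> FF" and s: "\<forall>j<s. \<forall>z\<in>U. (f $$ j) z = 0" and z: "z \<in> U"
  have "((w * f) $$ n) z = (\<Sum>j = s..n - fls_subdegree w. (w $$ (n - j)) z * (f $$ j) z)"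
   by (rule fls_mult_nth_at) (use s z in auto)
  then show "((w * f) $$ n) z = (\<Sum>j = s..n - fls_subdegree w. (w $$ (n - j) * f $$ j) z)" by simp
 qed (use w in \<open>auto intro!: diff_op.intros(1)\<close>)
 then show ?thesis unfolding fdo_def by blast
qed

lemma fdo_rmult:
 fixes w :: "('m, 'b::{finite,linorder}) formal"
 assumes w: "w \<in> FF"
 shows "fdo (\<lambda>f. f * w)"
proof -
 have "fdo_with (fls_subdegree w) (\<lambda>r f. f * w $$ r) (\<lambda>f. f * w)"
  unfolding fdo_with_def
 proof (intro conjI ballI allI impI)
  fix f :: "('m, 'b) formal" and s n z assume f: "f \<in> FF" and s: "\<forall>j<s. \<forall>z\<in>U. (f $$ j) z = 0" and z: "z \<in> U"
  have "((f * w) $$ n) z = (\<Sum>j = fls_subdegree w..n - s. (f $$ (n - j)) z * (w $$ j) z)"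
   by (rule fls_mult_nth_at) (use s z in auto)
  also have "\<dots> = (\<Sum>j = s..n - fls_subdegree w. (f $$ j) z * (w $$ (n - j)) z)"
   by (rule sum.reindex_bij_witness[where i = "\<lambda>j. n - j" and j = "\<lambda>r. n - r"]) auto
  finally show "((f * w) $$ n) z = (\<Sum>j = s..n - fls_subdegree w. (f $$ j * w $$ (n - j)) z)" by simp
 qed (use w in \<open>auto intro!: diff_op_rmult\<close>)
 then show ?thesis unfolding fdo_def by blast
qed

lemma FF_mult [simp]: "f \<in> FF ==> g \<in> FF ==> f * g \<in> FF"
 using fdo_closed[OF fdo_lmult] by blast

definition op_of :: "(int \<Rightarrow> ('m, 'd::{finite,linorder}) sfun \<Rightarrow> ('m, 'd) sfun) \<Rightarrow> ('m, 'd) formal \<Rightarrow> ('m, 'd) formal" where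
 "op_of D f = Abs_fls (\<lambda>n. \<Sum>j = fls_subdegree f..n. D (n - j) (f $$ j))"

lemma fdo_with_op_of:
 fixes D :: "int \<Rightarrow> ('m, 'b::{finite,linorder}) sfun \<Rightarrow> ('m, 'b) sfun"
 assumes "!!r. diff_op U (D r)"
 shows "fdo_with 0 D (op_of D)"
 unfolding fdo_with_iff_expansion formal_expansion_def
proof (intro conjI ballI allI)
 fix f :: "('m, 'b) formal" and n z assume "z \<in> U"
 have "op_of D f $$ n = (\<Sum>j = fls_subdegree f..n. D (n - j) (f $$ j))"
  unfolding op_of_def by (rule nth_Abs_fls_lower_bound[of "fls_subdegree f"]) simp
 also have "\<dots> = (\<Sum>r = 0..n - fls_subdegree f. D r (f $$ (n - r)))"
  by (rule sum.reindex_bij_witness[where i = "\<lambda>j. n - j" and j = "\<lambda>r. n - r"]) auto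
 finally show "(op_of D f $$ n) z = (\<Sum>r = 0..n - fls_subdegree f. D r (f $$ (n - r)) z)"
  by (simp add: sum_fun_apply)
qed (use assms in auto)

lemma diff_op_inv_seq:
 assumes "!!r. diff_op U (D r)"
 shows "diff_op U (inv_seq D n)"
proof (induction n rule: less_induct)
 case (less n)
 show ?case
 proof (cases "n = 0")
  case True
  then have "inv_seq D n = (\<lambda>f. f)" by (simp add: inv_seq.simps)
  then show ?thesis using diff_op_id by simp
 next
  case False
  then have "inv_seq D n = (\<lambda>f. - (\<Sum>k<n. D (int (n - k)) (inv_seq D k f)))" by (subst inv_seq.simps) simp
  then show ?thesis
   by (simp only:) (intro diff_op_uminus diff_op_sum diff_op.intros(7)[OF assms] less, simp)
 qed
qed

section \<open>Operators starting with the identity, and their inverses\<close>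

context
 fixes B :: "('m, 'd::{finite,linorder}) formal \<Rightarrow> ('m, 'd) formal" and D
 assumes B: "fdo_with 0 D B" and D0: "D 0 = id"
begin

lemma unipotent_nth:
 assumes "f \<in> FF" "open V" "V \<subseteq> U" "!!j z. j < n ==> z \<in> V ==> (f $$ j) z = 0" "z \<in> V"
 shows "(B f $$ n) z = (f $$ n) z"
proof -
 have zU: "z \<in> U" using assms by auto
 have "(B f $$ n) z = (\<Sum>j = min n (fls_subdegree f)..n - 0. D (n - j) (f $$ j) z)"
  by (rule fdo_withD[OF B assms(1) _ zU]) auto
 also have "\<dots> = (\<Sum>j = min n (fls_subdegree f)..n. if j = n then (f $$ n) z else 0)"
 proof (intro sum.cong)
  fix j assume j: "j \<in> {min n (fls_subdegree f)..n}"
  show "D (n - j) (f $$ j) z = (if j = n then (f $$ n) z else 0)"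
   using j diff_op_eq_0[OF fdo_with_diff_op[OF B] oU assms(2,3,5), of "f $$ j"] assms(4) by (auto simp: D0)
 qed auto
 also have "\<dots> = (f $$ n) z" by simp
 finally show ?thesis .
qed

text \<open>By \<open>unipotent_nth\<close> the lowest nonzero coefficient of a difference would
  survive under \<open>B\<close>. The induction runs upwards from the subdegree and uses values on
  \<open>V\<close> only.\<close>

lemma unipotent_inj:
 assumes "f \<in> FF" "g \<in> FF" "open V" "V \<subseteq> U" "eq_on V (B f) (B g)"
 shows "eq_on V f g"
proof -
 define h where "h = f - g"
 have h: "h \<in> FF" using assms by (simp add: h_def)
 have Bh: "(B h $$ n) z = 0" if "z \<in> V" for n z
  using eq_onD[OF fdo_minus_arg[of B f g] , of z n] eq_onD[OF assms(5) that, of n] assms that B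
  unfolding h_def fdo_def by auto
 have "\<forall>z\<in>V. (h $$ (fls_subdegree h + int n)) z = 0" for n
 proof (induction n rule: less_induct)
  case (less n)
  have "(h $$ j) z = 0" if "j < fls_subdegree h + int n" "z \<in> V" for j z
  proof (cases "j < fls_subdegree h")
   case False
   then have "j = fls_subdegree h + int (nat (j - fls_subdegree h))" by simp
   moreover have "nat (j - fls_subdegree h) < n" using that False by linarith
   ultimately show ?thesis using less that by metis
  qed simp
  from unipotent_nth[OF h assms(3,4) this] show ?case using Bh by auto
 qed
 then have "(h $$ n) z = 0" if "z \<in> V" for n z
  using that fls_eq0_below_subdegree[of n h] by (cases "n < fls_subdegree h") (auto dest!: spec[of _ "nat (n - fls_subdegree h)"], metis diff_add_cancel int_nat_eq linorder_not_less add.commute diff_ge_0_iff_ge)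
 then show ?thesis by (simp add: h_def eq_on_def)
qed

text \<open>The recursion of \<open>inv_seq\<close> is made so that the coefficient operators of the
  composite are id, 0, 0, and so on. A right inverse is enough, since \<open>unipotent_inj\<close>
  gives injectivity.\<close>

lemma unipotent_inverse:
 shows "\<exists>J E. fdo_with 0 E J \<and> (\<forall>f\<in>FF. eq_on U (B (J f)) f)"
proof -
 define E where "E r = (if r < 0 then (\<lambda>f. 0) else inv_seq D (nat r))" for r
 have Ed: "diff_op U (E r)" for r
  unfolding E_def using diff_op_inv_seq[OF fdo_with_diff_op[OF B]] diff_op_zero by (cases "r < 0") (simp_all only: if_True if_False)
 have J: "fdo_with 0 E (op_of E)" by (rule fdo_with_op_of[OF Ed])
 have C: "fdo_with (0 + 0) (\<lambda>t f. \<Sum>k = 0..t - 0. D (t - k) (E k f)) (\<lambda>f. B (op_of E f))"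
  by (rule fdo_with_comp[OF B J])
 have G: "(\<Sum>k = 0..t - 0. D (t - k) (E k f)) = (if t = 0 then f else 0)" if "t \<ge> 0" for t f
 proof (cases "t = 0")
  case True
  then show ?thesis by (simp add: D0 E_def inv_seq.simps)
 next
  case False
  define n where "n = nat t"
  have t: "t = int n" "n > 0" using that False by (auto simp: n_def)
  have "(\<Sum>k = 0..t - 0. D (t - k) (E k f)) = (\<Sum>k\<le>n. D (int (n - k)) (inv_seq D k f))"
   by (rule sum.reindex_bij_witness[where i = int and j = nat]) (auto simp: t E_def of_nat_diff)
  also have "\<dots> = inv_seq D n f + (\<Sum>k<n. D (int (n - k)) (inv_seq D k f))"
   by (simp add: lessThan_Suc_atMost[symmetric] D0 add.commute)
  also have "\<dots> = 0" using t by (subst inv_seq.simps) simp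
  finally show ?thesis using False by simp
 qed
 have "eq_on U (B (op_of E f)) f" if f: "f \<in> FF" for f
 proof (rule eq_onI)
  fix n z assume z: "z \<in> U"
  define s where "s = min n (fls_subdegree f)"
  have "(B (op_of E f) $$ n) z = (\<Sum>j = s..n - (0 + 0). (\<Sum>k = 0..n - j - 0. D (n - j - k) (E k (f $$ j))) z)"
   by (rule fdo_withD[OF C f _ z]) (simp add: s_def)
  also have "\<dots> = (\<Sum>j = s..n. if j = n then (f $$ n) z else 0)"
  proof (rule sum.cong)
   fix j assume "j \<in> {s..n}"
   then show "(\<Sum>k = 0..n - j - 0. D (n - j - k) (E k (f $$ j))) z = (if j = n then (f $$ n) z else 0)"
    using G[of "n - j" "f $$ j"] by (auto simp only: atLeastAtMost_iff diff_ge_0_iff_ge zero_fun_apply split: if_splits)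
  qed simp
  finally show "(B (op_of E f) $$ n) z = (f $$ n) z" by (simp add: s_def)
 qed
 then show ?thesis using J by blast
qed

text \<open>\<open>op_inv\<close> is a choice; surjectivity guarantees that there is something to
  choose.\<close>

lemma op_inv_props:
 assumes "f \<in> FF"
 shows "op_inv U B f \<in> FF" "eq_on U (B (op_inv U B f)) f"
proof -
 obtain J E where J: "fdo_with 0 E J" "\<forall>f\<in>FF. eq_on U (B (J f)) f" using unipotent_inverse by blast
 have "\<exists>g. g \<in> FF \<and> eq_on U (B g) f" using J assms fdo_with_closed by blast
 from someI_ex[OF this] show "op_inv U B f \<in> FF" "eq_on U (B (op_inv U B f)) f"
  unfolding op_inv_def by auto
qed

lemma op_inv_unique:
 assumes "g \<in> FF" "f \<in> FF" "open V" "V \<subseteq> U" "eq_on V (B g) f"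
 shows "eq_on V (op_inv U B f) g"
 by (rule unipotent_inj[OF op_inv_props(1)[OF assms(2)] assms(1,3,4)])
  (use eq_on_subset[OF op_inv_props(2)[OF assms(2)] assms(4)] eq_on_sym[OF assms(5)] eq_on_trans in blast)

lemma op_inv_fdo_with: "\<exists>E. fdo_with 0 E (op_inv U B)"
proof -
 obtain J E where J: "fdo_with 0 E J" "\<forall>f\<in>FF. eq_on U (B (J f)) f" using unipotent_inverse by blast
 have "fdo_with 0 E (op_inv U B)"
  by (rule fdo_with_eq[OF J(1)], rule op_inv_unique) (use J fdo_with_closed in auto)
 then show ?thesis by blast
qed

end

text \<open>\<open>t\<close> is any lower bound for the nu-order of the values of A on smooth
  functions and may be sharper than the bound of a given expansion. In \<open>lead_const\<close> it
  is the order below which A is already known to vanish.\<close>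

lemma fdo_expand_const:
 assumes A: "fdo A" and f: "f \<in> FF" and z: "z \<in> U" and s: "!!j z. j < s ==> z \<in> U ==> (f $$ j) z = 0"
  and t: "!!g r z. g \<in> sf_smooth U ==> z \<in> U ==> r < t ==> (A (cst g) $$ r) z = 0"
 shows "(A f $$ n) z = (\<Sum>j = s..n - t. (A (cst (f $$ j)) $$ (n - j)) z)"
proof -
 obtain r D where D: "fdo_with r D A" using A unfolding fdo_def by blast
 define q where "q = min r t"
 have c: "(A (cst (f $$ j)) $$ (n - j)) z = (if n - j < r then 0 else D (n - j) (f $$ j) z)" for j
  using fdo_with_const[OF D _ z, of "f $$ j" "n - j"] f by simp
 have "(A f $$ n) z = (\<Sum>j = s..n - r. D (n - j) (f $$ j) z)"
  by (rule fdo_withD[OF D f s z])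
 also have "\<dots> = (\<Sum>j = s..n - q. (A (cst (f $$ j)) $$ (n - j)) z)"
  unfolding c by (intro sum.mono_neutral_cong_left) (auto simp: q_def)
 also have "\<dots> = (\<Sum>j = s..n - t. (A (cst (f $$ j)) $$ (n - j)) z)"
  using f by (intro sum.mono_neutral_right) (auto simp: q_def intro!: t[OF _ z])
 finally show ?thesis .
qed

lemma fdo_eq_on_const:
 assumes A: "fdo A" and B: "fdo B" and "!!g. g \<in> sf_smooth U ==> eq_on U (A (cst g)) (B (cst g))" and f: "f \<in> FF"
 shows "eq_on U (A f) (B f)"
 by (rule fdo_eq_on_poly[OF A B order_refl oU f], rule assms(3)) (auto intro!: sf_smooth_mult simp: santi_def shol_def)

text \<open>Expanding first in \<open>g\<close> and then in \<open>f\<close> needs only that each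
  argument separately enters through a formal differential operator. It yields the
  \<open>star_expansion\<close> of the dual product and reduces integral identities to functions
  constant in nu.\<close>

lemma product_expand:
 assumes L: "!!f. f \<in> FF ==> fdo (P f)" and R: "!!g. g \<in> FF ==> fdo (\<lambda>f. P f g)"
  and neg: "!!f g r z. f \<in> sf_smooth U ==> g \<in> sf_smooth U ==> z \<in> U ==> r < 0 ==> (P (cst f) (cst g) $$ r) z = 0"
 assumes f: "f \<in> FF" and g: "g \<in> FF" and z: "z \<in> U"
 shows "(P f g $$ n) z = (\<Sum>(i, j) | fls_subdegree f \<le> i \<and> fls_subdegree g \<le> j \<and> i + j \<le> n.
     (P (cst (f $$ i)) (cst (g $$ j)) $$ (n - i - j)) z)"
proof -
 define s where "s = fls_subdegree f"
 define t where "t = fls_subdegree g"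
 have 1: "(P f (cst h) $$ m) z = (\<Sum>i = s..m - 0. (P (cst (f $$ i)) (cst h) $$ (m - i)) z)"
  if "h \<in> sf_smooth U" "z \<in> U" for h m z
  by (rule fdo_expand_const[OF R f that(2)]) (use that neg in \<open>auto simp: s_def\<close>)
 have "(P f g $$ n) z = (\<Sum>j = t..n - s. (P f (cst (g $$ j)) $$ (n - j)) z)"
  by (rule fdo_expand_const[OF L[OF f] g z]) (auto simp: t_def 1)
 also have "\<dots> = (\<Sum>j = t..n - s. \<Sum>i = s..n - j. (P (cst (f $$ i)) (cst (g $$ j)) $$ (n - j - i)) z)"
  using g z by (intro sum.cong refl) (simp add: 1)
 also have "\<dots> = (\<Sum>(j, i)\<in>(SIGMA j:{t..n - s}. {s..n - j}). (P (cst (f $$ i)) (cst (g $$ j)) $$ (n - j - i)) z)"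
  by (subst sum.Sigma) auto
 also have "\<dots> = (\<Sum>(i, j) | s \<le> i \<and> t \<le> j \<and> i + j \<le> n. (P (cst (f $$ i)) (cst (g $$ j)) $$ (n - i - j)) z)"
  by (rule sum.reindex_bij_witness[where i = prod.swap and j = prod.swap]) (auto simp: algebra_simps)
 finally show ?thesis by (simp add: s_def t_def)
qed

end

section \<open>The Berezin integral\<close>

lemma continuous_on_extend_zero:
 fixes h :: "'a::euclidean_space \<Rightarrow> 'b::real_normed_vector"
 assumes "open U" "compact K" "K \<subseteq> U" "continuous_on U h" "!!z. z \<in> U - K ==> h z = 0"
 shows "continuous_on UNIV (\<lambda>z. if z \<in> U then h z else 0)"
proof -
 have "continuous_on U (\<lambda>z. if z \<in> U then h z else 0)"
  using assms(4) by (rule continuous_on_eq) simp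
 moreover have "continuous_on (- K) (\<lambda>z. if z \<in> U then h z else 0)"
  by (rule continuous_on_eq[where f = "\<lambda>z. 0"]) (use assms(5) in auto)
 moreover have "open (- K)" using assms(2) by (simp add: compact_imp_closed open_Compl)
 ultimately have "continuous_on (U \<union> - K) (\<lambda>z. if z \<in> U then h z else 0)"
  using assms(1) by (intro continuous_on_open_Un) auto
 moreover have "U \<union> - K = UNIV" using assms(3) by auto
 ultimately show ?thesis by simp
qed

text \<open>By translation invariance the difference quotients \<open>q n\<close> with step 1/(n+1)
  integrate to zero. They converge pointwise to the derivative, dominated by \<open>M\<close> on the
  ball \<open>L\<close>.\<close>

lemma integral_directional_derivative_eq_0:
 fixes h :: "'a::euclidean_space \<Rightarrow> complex"
 assumes h': "!!x. (h has_derivative h' x) (at x)" and K: "compact K"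
  and z: "!!x. x \<notin> K ==> h x = 0" "!!x. x \<notin> K ==> h' x v = 0" and c: "continuous_on UNIV (\<lambda>x. h' x v)"
 shows "(LINT x|lborel. h' x v) = 0"
proof -
 have hc: "continuous_on UNIV h"
  using h' by (auto intro!: continuous_at_imp_continuous_on has_derivative_continuous)
 have "bounded ((\<lambda>x. h' x v) ` K)"
  by (rule compact_imp_bounded[OF compact_continuous_image[OF _ K]]) (rule continuous_on_subset[OF c], simp)
 then obtain M where M: "M > 0" "!!x. x \<in> K ==> norm (h' x v) \<le> M" by (auto simp: bounded_pos)
 have M': "norm (h' x v) \<le> M" for x using M z(2)[of x] by (cases "x \<in> K") auto
 obtain R where R: "R > 0" "K \<subseteq> cball 0 R"
  using compact_imp_bounded[OF K] by (metis bounded_pos mem_cball_0 subsetI)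
 \<comment> \<open>Contains \<open>K\<close> and its translates by - s v for s between 0 and 1,
   hence the sets where the difference quotients may be nonzero.\<close>
 define L where "L = cball (0::'a) (R + norm v)"
 define q where "q n x = (h (x + (1 / real (Suc n)) *\<^sub>R v) - h x) * of_nat (Suc n)" for n x
 have bound: "norm (q n x) \<le> indicator L x * M" for n x
 proof (cases "x \<in> L")
  case True
  define t where "t = 1 / real (Suc n)"
  have t: "t > 0" by (simp add: t_def)
  have "norm (h (x + t *\<^sub>R v) - h (x + 0 *\<^sub>R v)) \<le> M * norm (t - 0)"
  proof (rule differentiable_bound[where S = UNIV and f' = "\<lambda>s u. h' (x + s *\<^sub>R v) (u *\<^sub>R v)"])
   fix s
   show "((\<lambda>s. h (x + s *\<^sub>R v)) has_derivative (\<lambda>u. h' (x + s *\<^sub>R v) (u *\<^sub>R v))) (at s within UNIV)"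
    by (rule has_derivative_compose[where g = h, OF _ h']) (auto intro!: derivative_eq_intros)
   have lin: "linear (h' (x + s *\<^sub>R v))" using h' has_derivative_bounded_linear bounded_linear.linear by blast
   show "onorm (\<lambda>u. h' (x + s *\<^sub>R v) (u *\<^sub>R v)) \<le> M"
   proof (rule onorm_bound)
    show "norm (h' (x + s *\<^sub>R v) (u *\<^sub>R v)) \<le> M * norm u" for u
     using mult_left_mono[OF M'[of "x + s *\<^sub>R v"] abs_ge_zero[of u]] by (simp add: linear_scale[OF lin] mult.commute)
   qed (use M in simp)
  qed auto
  then have "norm (h (x + t *\<^sub>R v) - h x) * real (Suc n) \<le> M * t * real (Suc n)"
   using t by (intro mult_right_mono) auto
  then show ?thesis using True unfolding q_def norm_mult norm_of_nat t_def by simp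
 next
  case False
  have "x \<notin> K"
  proof
   assume "x \<in> K"
   then have "norm x \<le> R" using R by auto
   then show False using False norm_ge_zero[of v] by (simp add: L_def del: norm_ge_zero)
  qed
  moreover have "x + (1 / real (Suc n)) *\<^sub>R v \<notin> K"
  proof
   assume "x + (1 / real (Suc n)) *\<^sub>R v \<in> K"
   then have "norm (x + (1 / real (Suc n)) *\<^sub>R v) \<le> R" using R by auto
   moreover have "norm x \<le> norm (x + (1 / real (Suc n)) *\<^sub>R v) + norm ((1 / real (Suc n)) *\<^sub>R v)"
    using norm_triangle_ineq4[of "x + (1 / real (Suc n)) *\<^sub>R v" "(1 / real (Suc n)) *\<^sub>R v"] by simp
   moreover have "norm ((1 / real (Suc n)) *\<^sub>R v) \<le> norm v"
    by (simp add: divide_le_eq mult_le_cancel_left1)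
   ultimately show False using False by (simp add: L_def)
  qed
  ultimately show ?thesis using False z(1) by (simp add: q_def)
 qed
 have hi: "integrable lborel h"
 proof -
  have "integrable lborel (\<lambda>x. indicator K x *\<^sub>R h x)"
   by (rule borel_integrable_compact[OF K continuous_on_subset[OF hc]]) simp
  moreover have "(\<lambda>x. indicator K x *\<^sub>R h x) = h" using z(1) by (auto simp: fun_eq_iff indicator_def)
  ultimately show ?thesis by simp
 qed
 have shift: "integrable lborel (\<lambda>x. h (x + w))" "(LINT x|lborel. h (x + w)) = (LINT x|lborel. h x)" for w
 proof -
  have hm: "h \<in> borel_measurable borel" using hc by (rule borel_measurable_continuous_onI)
  have d: "distr lborel borel ((+) w) = lborel" by (rule lborel_distr_plus)
  have "integrable (distr lborel borel ((+) w)) h" unfolding d by (rule hi)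
  then show "integrable lborel (\<lambda>x. h (x + w))"
   using integrable_distr_eq[of "(+) w" lborel borel h] hm by (simp add: add.commute)
  have "(LINT x|distr lborel borel ((+) w). h x) = (LINT x|lborel. h (w + x))"
   by (rule integral_distr) (use hm in auto)
  then show "(LINT x|lborel. h (x + w)) = (LINT x|lborel. h x)" unfolding d by (simp add: add.commute)
 qed
 have q0: "(LINT x|lborel. q n x) = 0" for n
  unfolding q_def using shift hi by simp
 have "(\<lambda>n. LINT x|lborel. q n x) \<longlonglongrightarrow> (LINT x|lborel. h' x v)"
 proof (rule integral_dominated_convergence[where w = "\<lambda>x. indicator L x * M"])
  show "(\<lambda>x. h' x v) \<in> borel_measurable lborel" using c by (simp add: borel_measurable_continuous_onI)
  have "continuous_on UNIV (q n)" for n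
   unfolding q_def by (intro continuous_intros continuous_on_compose2[OF hc]) auto
  then show "!!n. q n \<in> borel_measurable lborel" by (simp add: borel_measurable_continuous_onI)
  have "integrable lborel (\<lambda>x. indicator L x *\<^sub>R M)"
   by (rule borel_integrable_compact) (auto simp: L_def)
  then show "integrable lborel (\<lambda>x. indicator L x * M)" by simp
  show "AE x in lborel. (\<lambda>n. q n x) \<longlonglongrightarrow> h' x v"
  proof (rule AE_I2)
   fix x
   have lin: "linear (h' x)" using h' has_derivative_bounded_linear bounded_linear.linear by blast
   have "((\<lambda>s. h (x + s *\<^sub>R v)) has_derivative (\<lambda>u. h' (x + 0 *\<^sub>R v) (u *\<^sub>R v))) (at 0)"
    by (rule has_derivative_compose[where g = h, OF _ h']) (auto intro!: derivative_eq_intros)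
   then have "((\<lambda>s. norm ((h (x + s *\<^sub>R v) - h x) - (s - 0) *\<^sub>R h' x v) / norm (s - 0)) \<longlongrightarrow> 0) (at 0)"
    unfolding has_derivative_iff_norm by (simp add: linear_scale[OF lin])
   then have "((\<lambda>s. norm ((h (x + s *\<^sub>R v) - h x) /\<^sub>R s - h' x v)) \<longlongrightarrow> 0) (at 0)"
   proof (rule Lim_transform_eventually, unfold eventually_at_filter, intro always_eventually allI impI)
    fix s :: real assume s: "s \<noteq> 0"
    define a where "a = h (x + s *\<^sub>R v) - h x"
    have "a /\<^sub>R s - h' x v = (a - s *\<^sub>R h' x v) /\<^sub>R s" using s by (simp add: scaleR_diff_right)
    then have "norm (a /\<^sub>R s - h' x v) = norm (a - s *\<^sub>R h' x v) / norm s"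
     by (simp only: norm_scaleR) (simp add: divide_inverse mult.commute)
    then show "norm (h (x + s *\<^sub>R v) - h x - (s - 0) *\<^sub>R h' x v) / norm (s - 0) = norm ((h (x + s *\<^sub>R v) - h x) /\<^sub>R s - h' x v)"
     by (simp add: a_def)
   qed
   then have 1: "((\<lambda>s. (h (x + s *\<^sub>R v) - h x) /\<^sub>R s) \<longlongrightarrow> h' x v) (at 0)"
    by (rule LIM_zero_cancel[OF tendsto_norm_zero_cancel])
   have 2: "filterlim (\<lambda>n. 1 / real (Suc n)) (at 0) sequentially"
    using LIMSEQ_Suc[OF lim_1_over_n] by (auto simp: filterlim_at)
   show "(\<lambda>n. q n x) \<longlonglongrightarrow> h' x v"
    using filterlim_compose[OF 1 2] by (simp add: q_def scaleR_conv_of_real mult.commute)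
  qed
 qed (use bound in auto)
 then show ?thesis using q0 LIMSEQ_unique by (simp add: tendsto_const_iff)
qed

text \<open>Outer operators are a constructor of their own, so no Leibniz expansion of D (P h * Q g)
  is ever needed; under the integral they are moved onto the density, see
  \<open>bidiff_transpose\<close>.\<close>

inductive bidiff :: "(complex^'m) set \<Rightarrow> (('m::finite, 'd::{finite,linorder}) sfun \<Rightarrow> ('m, 'd) sfun \<Rightarrow> ('m, 'd) sfun) \<Rightarrow> bool"
 for U where
 prod: "diff_op U P ==> diff_op U Q ==> bidiff U (\<lambda>h g. P h * Q g)"
| add: "bidiff U A ==> bidiff U B ==> bidiff U (\<lambda>h g. A h g + B h g)"
| op: "diff_op U D ==> bidiff U B ==> bidiff U (\<lambda>h g. D (B h g))"

lemma bidiff_comp: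
 assumes "bidiff U B" "diff_op U P" "diff_op U Q"
 shows "bidiff U (\<lambda>h g. B (P h) (Q g))"
 using assms(1)
proof induction
 case (prod P' Q')
 show ?case using bidiff.prod[OF diff_op.intros(7)[OF prod(1) assms(2)] diff_op.intros(7)[OF prod(2) assms(3)]] .
next
 case (add A B)
 then show ?case using bidiff.add by blast
next
 case (op D B)
 then show ?case using bidiff.op[OF op(1) op(3)] by blast
qed

lemma bidiff_cong:
 assumes "bidiff U B" "open V" "z \<in> V" "!!y. y \<in> V ==> h y = h' y" "!!y. y \<in> V ==> g y = g' y"
 shows "B h g z = B h' g' z"
 using assms(1,3)
proof (induction arbitrary: z)
 case (prod P Q)
 show ?case using diff_op_cong[OF prod(1) assms(2) prod(3), of h h'] diff_op_cong[OF prod(2) assms(2) prod(3), of g g'] assms(4,5)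
  by (simp only: times_fun_apply)
next
 case (add A B)
 show ?case using add.IH(1)[OF add.prems] add.IH(2)[OF add.prems] by (simp only: plus_fun_apply)
next
 case (op D B)
 show ?case by (rule diff_op_cong[OF op(1) assms(2) op.prems]) (rule op.IH)
qed

lemma bidiff_zero: "bidiff U (\<lambda>h g. 0)"
 using bidiff.prod[OF diff_op_zero diff_op_zero, of U] by simp

lemma bidiff_sum: "(!!i. i \<in> S ==> bidiff U (B i)) ==> bidiff U (\<lambda>h g. \<Sum>i\<in>S. B i h g)"
proof (induction S rule: infinite_finite_induct)
 case (insert x F)
 then have "bidiff U (\<lambda>h g. B x h g + (\<Sum>i\<in>F. B i h g))" by (intro bidiff.add) auto
 then show ?case unfolding sum.insert[OF insert(1,2)] .
qed (simp_all add: bidiff_zero)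

section \<open>Integration by parts and transposed operators\<close>

context dom
begin

definition csup :: "('m, 'd::{finite,linorder}) sfun \<Rightarrow> bool" where
 "csup f \<longleftrightarrow> (\<exists>K. compact K \<and> K \<subseteq> U \<and> (\<forall>z\<in>U - K. f z = 0))"

definition bint :: "('m, 'd::{finite,linorder}) sfun \<Rightarrow> complex" where
 "bint f = (LINT z:U|lborel. gtop (f z))"

lemma berezin_integral_bint: "berezin_integral U h n = bint (h $$ n)"
 by (simp add: berezin_integral_def bint_def gtop_def sf_coeff_def)

text \<open>Phrased through local vanishing, so that it covers differential operators and pointwise
  products alike.\<close>

lemma csup_mono: "csup f ==> (!!z V. open V ==> V \<subseteq> U ==> z \<in> V ==> (!!y. y \<in> V ==> f y = 0) ==> g z = 0) ==> csup g"
 unfolding csup_def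
proof (elim exE conjE, intro exI conjI ballI)
 fix K z assume K: "compact K" "K \<subseteq> U" "\<forall>z\<in>U - K. f z = 0" and z: "z \<in> U - K"
  and *: "!!z V. open V ==> V \<subseteq> U ==> z \<in> V ==> (!!y. y \<in> V ==> f y = 0) ==> g z = 0"
 have "open (U - K)" using K(1) by (intro open_Diff oU compact_imp_closed)
 then show "g z = 0" using * K z by blast
qed

lemma csup_diff_op: "diff_op U D ==> csup f ==> csup (D f)"
 by (erule csup_mono) (rule diff_op_eq_0[OF _ oU])

lemma csup_lmult: "csup f ==> csup (g * f)"
 by (erule csup_mono) simp

lemma csup_rmult: "csup f ==> csup (f * g)"
 by (erule csup_mono) simp

lemma csup_0: "csup 0"
 unfolding csup_def by (intro exI[of _ "{}"]) auto

lemma csup_cong: "csup f ==> (!!z. z \<in> U ==> f z = g z) ==> csup g"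
 unfolding csup_def by (metis DiffD1)

lemma csup_add: "csup f ==> csup g ==> csup (f + g)"
 unfolding csup_def
proof (elim exE conjE)
 fix K L assume "compact K" "K \<subseteq> U" "\<forall>z\<in>U - K. f z = 0" "compact L" "L \<subseteq> U" "\<forall>z\<in>U - L. g z = 0"
 then show "\<exists>K. compact K \<and> K \<subseteq> U \<and> (\<forall>z\<in>U - K. (f + g) z = 0)"
  by (intro exI[of _ "K \<union> L"]) (auto intro: compact_Un)
qed

lemma csup_bidiff:
 assumes "bidiff U B" "csup h \<or> csup g"
 shows "csup (B h g)"
 using assms(1)
proof induction
 case (prod P Q)
 show ?case using assms(2)
 proof
  assume "csup h" then show ?thesis by (rule csup_rmult[OF csup_diff_op[OF prod(1)]])
 next
  assume "csup g" then show ?thesis by (rule csup_lmult[OF csup_diff_op[OF prod(2)]])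
 qed
next
 case (add A B) then show ?case by (intro csup_add)
next
 case (op D B) show ?case by (rule csup_diff_op[OF op(1) op.IH])
qed

lemma sf_smooth_bidiff:
 assumes "bidiff U B" "h \<in> sf_smooth U" "g \<in> sf_smooth U"
 shows "B h g \<in> sf_smooth U"
 using assms(1)
proof induction
 case (prod P Q)
 show ?case by (intro sf_smooth_mult oU diff_op_smooth[OF oU prod(1)] diff_op_smooth[OF oU prod(2)] assms)
next
 case (add A B) then show ?case by (intro sf_smooth_add oU)
next
 case (op D B) then show ?case by (intro diff_op_smooth[OF oU op(1)])
qed

lemma bidiff_left:
 assumes "bidiff U B" "g \<in> sf_smooth U"
 shows "diff_op U (\<lambda>h. B h g)"
 using assms(1)
proof induction
 case (prod P Q)
 show ?case
  by (rule diff_op.intros(7)[OF diff_op_rmult[OF diff_op_smooth[OF oU prod(2) assms(2)] oU] prod(1)])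
next
 case (add A B) show ?case by (rule diff_op.intros(6)[OF add.IH])
next
 case (op D B) show ?case by (rule diff_op.intros(7)[OF op(1) op.IH])
qed

lemma bint_cong: "(!!z. z \<in> U ==> gtop (f z) = gtop (g z)) ==> bint f = bint g"
 unfolding bint_def by (intro set_lebesgue_integral_cong) auto

lemma set_integrable_csup:
 assumes "f \<in> sf_smooth U" "csup f"
 shows "set_integrable lborel U (\<lambda>z. gtop (f z))"
proof -
 obtain K where K: "compact K" "K \<subseteq> U" "\<forall>z\<in>U - K. f z = 0" using assms(2) by (auto simp: csup_def)
 have "continuous_on U (\<lambda>z. gtop (f z))"
  using smooth_on_continuous_on[OF sf_smoothD[OF assms(1)]] by (simp add: gtop_def)
 then have "integrable lborel (\<lambda>z. indicator K z *\<^sub>R gtop (f z))"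
  by (intro borel_integrable_compact K continuous_on_subset[OF _ K(2)])
 moreover have "(\<lambda>z. indicator K z *\<^sub>R gtop (f z)) = (\<lambda>z. indicator U z *\<^sub>R gtop (f z))"
 proof (rule ext)
  fix z show "indicator K z *\<^sub>R gtop (f z) = indicator U z *\<^sub>R gtop (f z)"
   using K by (cases "z \<in> K"; cases "z \<in> U") auto
 qed
 ultimately show ?thesis by (simp add: set_integrable_def)
qed

lemma bint_add: "f \<in> sf_smooth U ==> csup f ==> g \<in> sf_smooth U ==> csup g ==> bint (f + g) = bint f + bint g"
 unfolding bint_def by (simp add: set_integrable_csup)

lemma bint_cmult: "bint (sconst c * f) = c * bint f"
 unfolding bint_def by simp

lemma bint_uminus: "bint (- f) = - bint f"
 unfolding uminus_sconst[of f] bint_cmult by simp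

lemma bint_sum:
 "(!!i. i \<in> S ==> f i \<in> sf_smooth U) ==> (!!i. i \<in> S ==> csup (f i)) ==> bint (\<Sum>i\<in>S. f i) = (\<Sum>i\<in>S. bint (f i))
  \<and> csup (\<Sum>i\<in>S. f i)"
proof (induction S rule: infinite_finite_induct)
 case (insert x F)
 then have "bint (f x + (\<Sum>i\<in>F. f i)) = bint (f x) + bint (\<Sum>i\<in>F. f i)" "csup (f x + (\<Sum>i\<in>F. f i))"
  by (intro bint_add sf_smooth_sum csup_add; simp)+
 then show ?case using insert by (simp del: plus_fun_apply)
qed (simp_all add: bint_def csup_0)

text \<open>In an even direction the top coefficient, extended by zero, is a compactly supported
  function and its directional derivatives integrate to zero. In an odd direction a derivative has
  no top coefficient at all.\<close>

lemma bint_pd: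
 assumes f: "f \<in> sf_smooth U" "csup f"
 shows "bint (pd i f) = 0"
proof -
 obtain K where K: "compact K" "K \<subseteq> U" "\<forall>z\<in>U - K. f z = 0" using f(2) by (auto simp: csup_def)
 define h where "h z = gtop (f z)" for z
 have hs: "smooth_on U h" using sf_smoothD[OF f(1), of UNIV UNIV] by (simp add: h_def[abs_def] gtop_def)
 have h0: "h z = 0" if "z \<in> U - K" for z using K that by (simp add: h_def)
 have oUK: "open (U - K)" using K(1) by (intro open_Diff oU compact_imp_closed)
 have d0: "frechet_derivative h (at z) v = 0" if "z \<in> U - K" for z v
  using frechet_derivative_cong_open[OF oUK that, of h "\<lambda>z. 0"] h0 by (simp add: frechet_derivative_const)
 have D: "(LINT z:U|lborel. frechet_derivative h (at z) v) = 0" and DI: "set_integrable lborel U (\<lambda>z. frechet_derivative h (at z) v)" for v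
 proof -
  \<comment> \<open>Extension by zero to the whole space; differentiable at points off U because the
    complement of \<open>K\<close> is an open set on which \<open>H\<close> vanishes.\<close>
  define H where "H z = (if z \<in> U then h z else 0)" for z
  define H' where "H' z v = (if z \<in> U then frechet_derivative h (at z) v else 0)" for z v
  have "(H has_derivative H' z) (at z)" for z
  proof (cases "z \<in> U")
   case True
   then have "(h has_derivative H' z) (at z)" using smooth_on_has_derivative[OF hs True] by (simp add: H'_def[abs_def])
   then show ?thesis by (rule has_derivative_transform_within_open[OF _ oU True]) (simp add: H_def)
  next
   case False
   then have "z \<in> - K" using K by auto
   have "H' z = (\<lambda>v. 0)" using False by (simp add: H'_def fun_eq_iff)
   then have "((\<lambda>z. 0) has_derivative H' z) (at z)" by simp
   then show ?thesis
    by (rule has_derivative_transform_within_open[OF _ _ \<open>z \<in> - K\<close>]) (use K h0 in \<open>auto simp: H_def compact_imp_closed\<close>)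
  qed
  moreover have c: "continuous_on UNIV (\<lambda>z. H' z v)"
   unfolding H'_def
   by (rule continuous_on_extend_zero[OF oU K(1,2)])
    (use d0 in \<open>auto intro: smooth_on_continuous_on smooth_on_frechet_derivative[OF hs]\<close>)
  moreover have z: "H x = 0" "H' x v = 0" if "x \<notin> K" for x using that h0 d0 by (auto simp: H_def H'_def)
  ultimately have "(LINT x|lborel. H' x v) = 0" by (intro integral_directional_derivative_eq_0[where h = H and h' = H' and v = v, OF _ K(1)])
  moreover have e: "(\<lambda>z. indicator U z *\<^sub>R frechet_derivative h (at z) v) = (\<lambda>z. H' z v)" by (auto simp: H'_def fun_eq_iff)
  ultimately show "(LINT z:U|lborel. frechet_derivative h (at z) v) = 0" by (simp add: set_lebesgue_integral_def)
  have "integrable lborel (\<lambda>z. indicator K z *\<^sub>R H' z v)"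
   by (rule borel_integrable_compact[OF K(1) continuous_on_subset[OF c]]) simp
  moreover have "(\<lambda>z. indicator K z *\<^sub>R H' z v) = (\<lambda>z. H' z v)" using z by (auto simp: fun_eq_iff indicator_def)
  ultimately show "set_integrable lborel U (\<lambda>z. frechet_derivative h (at z) v)" by (simp add: set_integrable_def e)
 qed
 have "bint (epd s k f) = 0" for s k
 proof -
  have "bint (epd s k f) = (LINT z:U|lborel. (frechet_derivative h (at z) (axis k 1) + s * frechet_derivative h (at z) (axis k \<i>)) / 2)"
   by (simp add: bint_def gtop_def wd_def h_def[abs_def])
  also have "\<dots> = ((LINT z:U|lborel. frechet_derivative h (at z) (axis k 1)) + s * (LINT z:U|lborel. frechet_derivative h (at z) (axis k \<i>))) / 2"
   using DI by simp
  finally show ?thesis using D by simp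
 qed
 then have "bint (pd (DZ k) f) = 0" "bint (pd (DZb k) f) = 0" for k by (simp_all only: pd_epd)
 moreover have "bint (pd (DT k) f) = 0" "bint (pd (DTb k) f) = 0" for k
  by (simp_all add: bint_def gtop_def sf_dtheta_def sf_dthetabar_def gdtheta_def gdthetabar_def)
 ultimately show ?thesis by (cases i) (simp_all only:)
qed

lemma bint_swap: "bint (f * g) = bint (g * spar f)"
 by (rule bint_cong) (simp add: gtop_swap[of "f _"] sg_def)

lemma bint_spar: "bint (spar f * g) = bint (f * spar g)"
proof (rule bint_cong)
 fix z
 have "gtop (gpar (f z) * g z) = gtop (gpar (gpar (f z) * g z))" by (simp only: gtop_simps)
 also have "\<dots> = gtop (f z * gpar (g z))" by (simp add: gsg_mult)
 finally show "gtop ((spar f * g) z) = gtop ((f * spar g) z)" by (simp add: sg_def)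
qed

lemma bint_sgd: "bint (sgd i f * g) = bint (f * sgd i g)"
 by (simp add: sgd_def bint_spar)

lemma bint_parts:
 assumes "f \<in> sf_smooth U" "g \<in> sf_smooth U" "csup f \<or> csup g"
 shows "bint (pd i f * g) = - bint (sgd i f * pd i g)"
proof -
 have c: "csup (f * g)" using assms(3) csup_lmult csup_rmult by blast
 have c1: "csup (pd i f * g)" using assms(3) csup_lmult[of g "pd i f"] csup_rmult[of "pd i f" g] csup_diff_op[OF diff_op_pd] by blast
 have c2: "csup (sgd i f * pd i g)" using assms(3) csup_lmult[of "pd i g" "sgd i f"] csup_rmult[of "sgd i f" "pd i g"] csup_diff_op[OF diff_op_pd] csup_diff_op[OF diff_op_sgd] by blast
 have "bint (pd i (f * g)) = bint (pd i f * g + sgd i f * pd i g)"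
  by (rule bint_cong) (simp add: pd_mult[OF _ assms(1,2)])
 also have "\<dots> = bint (pd i f * g) + bint (sgd i f * pd i g)"
  using assms by (intro bint_add c1 c2) auto
 finally show ?thesis using bint_pd[OF _ c, of i] assms by (simp add: eq_neg_iff_add_eq_0)
qed

text \<open>Built along the generators of the algebra: a multiplication by \<open>c\<close> moves to
  the far right with the twist \<open>spar c\<close>, a derivative becomes \<open>- sgd i\<close> of
  the derivative, and compositions reverse.\<close>

lemma diff_op_transpose:
 fixes D :: "('m, 'b::{finite,linorder}) sfun \<Rightarrow> ('m, 'b) sfun"
 assumes "diff_op U D"
 shows "\<exists>E. diff_op U E \<and> (\<forall>g\<in>sf_smooth U. \<forall>h\<in>sf_smooth U. csup g \<or> csup h --> bint (D g * h) = bint (g * E h))"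
 using assms
proof (induction rule: diff_op_induct)
 case (mult c)
 have *: "bint (c * g * h) = bint (g * (h * spar c))" for g h
  using bint_swap[of c "g * h"] by (simp only: mult.assoc)
 moreover have "diff_op U (\<lambda>h. h * spar c)" using mult by (intro diff_op_rmult oU sf_smooth_sg)
 ultimately show ?case by (intro exI[of _ "\<lambda>h. h * spar c"] conjI ballI impI)
next
 case (pd i)
 have "bint (pd i g * h) = bint (g * - sgd i (pd i h))" if "g \<in> sf_smooth U" "h \<in> sf_smooth U" "csup g \<or> csup h" for g h
  using bint_parts[OF that, of i] bint_uminus[of "g * sgd i (pd i h)"] by (simp only: bint_sgd mult_minus_right)
 moreover have "diff_op U (\<lambda>h. - sgd i (pd i h))" by (rule diff_op_uminus[OF diff_op.intros(7)[OF diff_op_sgd diff_op_pd]])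
 ultimately show ?case by blast
next
 case (add A B)
 then obtain E F where EF: "diff_op U E" "!!g h. g \<in> sf_smooth U ==> h \<in> sf_smooth U ==> csup g \<or> csup h ==> bint (A g * h) = bint (g * E h)"
  "diff_op U F" "!!g h. g \<in> sf_smooth U ==> h \<in> sf_smooth U ==> csup g \<or> csup h ==> bint (B g * h) = bint (g * F h)" by blast
 have "bint ((A g + B g) * h) = bint (g * (E h + F h))" if "g \<in> sf_smooth U" "h \<in> sf_smooth U" "csup g \<or> csup h" for g h
 proof -
  have c: "csup (A' g * h)" "csup (g * A' h)" "A' g * h \<in> sf_smooth U" "g * A' h \<in> sf_smooth U" if "diff_op U A'" for A'
  proof -
   show "csup (A' g * h)" using \<open>csup g \<or> csup h\<close> csup_diff_op[OF that, of g] csup_lmult[of h "A' g"] csup_rmult[of "A' g" h] by auto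
   show "csup (g * A' h)" using \<open>csup g \<or> csup h\<close> csup_diff_op[OF that, of h] csup_lmult[of "A' h" g] csup_rmult[of g "A' h"] by auto
   show "A' g * h \<in> sf_smooth U" "g * A' h \<in> sf_smooth U"
    using diff_op_smooth[OF oU that] \<open>g \<in> sf_smooth U\<close> \<open>h \<in> sf_smooth U\<close> by auto
  qed
  have "bint ((A g + B g) * h) = bint (A g * h) + bint (B g * h)"
   unfolding distrib_right by (rule bint_add[OF c(3)[OF add(1)] c(1)[OF add(1)] c(3)[OF add(2)] c(1)[OF add(2)]])
  also have "\<dots> = bint (g * E h) + bint (g * F h)" by (simp only: EF(2)[OF that] EF(4)[OF that])
  also have "\<dots> = bint (g * (E h + F h))"
   unfolding distrib_left by (rule bint_add[OF c(4)[OF EF(1)] c(2)[OF EF(1)] c(4)[OF EF(3)] c(2)[OF EF(3)], symmetric])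
  finally show ?thesis .
 qed
 then show ?case by (intro exI[of _ "\<lambda>h. E h + F h"] conjI ballI impI diff_op.intros(6)[OF EF(1,3)])
next
 case (comp A B)
 then obtain E F where EF: "diff_op U E" "!!g h. g \<in> sf_smooth U ==> h \<in> sf_smooth U ==> csup g \<or> csup h ==> bint (A g * h) = bint (g * E h)"
  "diff_op U F" "!!g h. g \<in> sf_smooth U ==> h \<in> sf_smooth U ==> csup g \<or> csup h ==> bint (B g * h) = bint (g * F h)" by blast
 show ?case
 proof (intro exI[of _ "\<lambda>h. F (E h)"] conjI ballI impI)
  show "diff_op U (\<lambda>h. F (E h))" by (rule diff_op.intros(7)[OF EF(3,1)])
  fix g h :: "('m, 'b) sfun" assume that: "g \<in> sf_smooth U" "h \<in> sf_smooth U" "csup g \<or> csup h"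
  have "bint (A (B g) * h) = bint (B g * E h)"
   by (rule EF(2)) (use that diff_op_smooth[OF oU comp(2)] csup_diff_op[OF comp(2)] in auto)
  also have "bint (B g * E h) = bint (g * F (E h))"
   by (rule EF(4)) (use that diff_op_smooth[OF oU EF(1)] csup_diff_op[OF EF(1)] in auto)
  finally show "bint (A (B g) * h) = bint (g * F (E h))" .
 qed
qed

text \<open>For P h * Q g the factor P h is moved cyclically to the density, Q is transposed, and
  cyclicity brings g back to the right. \<open>K\<close> depends on the density, which varies in the
  induction because outer operators are transposed onto it.\<close>

lemma bidiff_transpose:
 assumes "bidiff U B" "\<rho> \<in> sf_smooth U"
 shows "\<exists>K. diff_op U K \<and> (\<forall>h\<in>sf_smooth U. \<forall>g\<in>sf_smooth U. csup h \<or> csup g --> bint (B h g * \<rho>) = bint (K h * g))"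
 using assms
proof (induction arbitrary: \<rho> rule: bidiff.induct)
 case (prod P Q)
 obtain E where E: "diff_op U E" "!!g h. g \<in> sf_smooth U ==> h \<in> sf_smooth U ==> csup g \<or> csup h ==> bint (Q g * h) = bint (g * E h)"
  using diff_op_transpose[OF prod(2)] by blast
 have PD: "diff_op U (\<lambda>h. \<rho> * spar (P h))"
  by (rule diff_op.intros(7)[OF diff_op.intros(1)[OF prod(3)] diff_op.intros(7)[OF diff_op_sg prod(1)]])
 have KD: "diff_op U (\<lambda>h. spar (E (\<rho> * spar (P h))))"
  by (rule diff_op.intros(7)[OF diff_op_sg diff_op.intros(7)[OF E(1) PD]])
 moreover have "bint (P h * Q g * \<rho>) = bint (spar (E (\<rho> * spar (P h))) * g)" if "h \<in> sf_smooth U" "g \<in> sf_smooth U" "csup h \<or> csup g" for h g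
 proof -
  have "bint (P h * Q g * \<rho>) = bint (Q g * (\<rho> * spar (P h)))"
   using bint_swap[of "P h" "Q g * \<rho>"] by (simp only: mult.assoc)
  also have "\<dots> = bint (g * E (\<rho> * spar (P h)))"
   using that diff_op_smooth[OF oU PD] csup_diff_op[OF PD] by (intro E(2)) auto
  also have "\<dots> = bint (E (\<rho> * spar (P h)) * spar g)" by (rule bint_swap)
  also have "\<dots> = bint (spar (E (\<rho> * spar (P h))) * g)" by (rule bint_spar[symmetric])
  finally show ?thesis .
 qed
 ultimately show ?case by blast
next
 case (add A B)
 obtain E where E: "diff_op U E" "!!g h. h \<in> sf_smooth U ==> g \<in> sf_smooth U ==> csup h \<or> csup g ==> bint (A h g * \<rho>) = bint (E h * g)"
  using add.IH(1)[OF add.prems] by blast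
 obtain F where F: "diff_op U F" "!!g h. h \<in> sf_smooth U ==> g \<in> sf_smooth U ==> csup h \<or> csup g ==> bint (B h g * \<rho>) = bint (F h * g)"
  using add.IH(2)[OF add.prems] by blast
 have "bint ((A h g + B h g) * \<rho>) = bint ((E h + F h) * g)" if that: "h \<in> sf_smooth U" "g \<in> sf_smooth U" "csup h \<or> csup g" for h g
 proof -
  have c: "csup (A' h g * \<rho>)" "A' h g * \<rho> \<in> sf_smooth U" if "bidiff U A'" for A'
   using csup_rmult[OF csup_bidiff[OF that \<open>csup h \<or> csup g\<close>]] sf_smooth_bidiff[OF that] \<open>h \<in> sf_smooth U\<close> \<open>g \<in> sf_smooth U\<close> add.prems by auto
  have d: "csup (A' h * g)" "A' h * g \<in> sf_smooth U" if "diff_op U A'" for A'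
  proof -
   show "csup (A' h * g)" using \<open>csup h \<or> csup g\<close> csup_diff_op[OF that, of h] csup_lmult csup_rmult by blast
   show "A' h * g \<in> sf_smooth U" using diff_op_smooth[OF oU that] \<open>h \<in> sf_smooth U\<close> \<open>g \<in> sf_smooth U\<close> by (intro sf_smooth_mult oU) auto
  qed
  have "bint ((A h g + B h g) * \<rho>) = bint (A h g * \<rho>) + bint (B h g * \<rho>)"
   unfolding distrib_right using add(1,2) by (intro bint_add c)
  also have "\<dots> = bint (E h * g) + bint (F h * g)" using E F that by simp
  also have "\<dots> = bint ((E h + F h) * g)"
   unfolding distrib_right using E(1) F(1) by (intro bint_add[symmetric] d)
  finally show ?thesis .
 qed
 then show ?case by (intro exI[of _ "\<lambda>h. E h + F h"] conjI ballI impI diff_op.intros(6)[OF E(1) F(1)])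
next
 case (op D B)
 obtain E where E: "diff_op U E" "!!g h. g \<in> sf_smooth U ==> h \<in> sf_smooth U ==> csup g \<or> csup h ==> bint (D g * h) = bint (g * E h)"
  using diff_op_transpose[OF op(1)] by blast
 obtain K where K: "diff_op U K" "!!h g. h \<in> sf_smooth U ==> g \<in> sf_smooth U ==> csup h \<or> csup g ==> bint (B h g * E \<rho>) = bint (K h * g)"
  using op.IH[OF diff_op_smooth[OF oU E(1) op.prems]] by blast
 have "bint (D (B h g) * \<rho>) = bint (K h * g)" if "h \<in> sf_smooth U" "g \<in> sf_smooth U" "csup h \<or> csup g" for h g
  using E(2)[of "B h g" \<rho>] K(2)[OF that] sf_smooth_bidiff[OF op(2)] csup_bidiff[OF op(2)] that op.prems by auto
 then show ?case using K(1) by blast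
qed

section \<open>Operators applied to a holomorphic multiple, as bidifferential operators in b
  a\<close>

lemma shol_gcoeff: "shol V a ==> z \<in> V ==> J \<noteq> {} ==> gcoeff (a z) I J = 0"
proof -
 assume *: "shol V a" "z \<in> V" "J \<noteq> {}"
 then obtain \<beta> J' where J: "J = insert \<beta> J'" "\<beta> \<notin> J'" by (meson Set.set_insert ex_in_conv)
 have "pd (DTb \<beta>) a z = 0" using * by (auto simp: shol_def simp del: pd.simps)
 from arg_cong[OF this, of "\<lambda>x. gcoeff x I J'"] show ?thesis using J by (simp add: sf_dthetabar_def gdthetabar_def)
qed

lemma santi_gcoeff: "santi V a ==> z \<in> V ==> I \<noteq> {} ==> gcoeff (a z) I J = 0"
proof -
 assume *: "santi V a" "z \<in> V" "I \<noteq> {}"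
 then obtain \<beta> J' where J: "I = insert \<beta> J'" "\<beta> \<notin> J'" by (meson Set.set_insert ex_in_conv)
 have "pd (DT \<beta>) a z = 0" using * by (auto simp: santi_def simp del: pd.simps)
 from arg_cong[OF this, of "\<lambda>x. gcoeff x J' J"] show ?thesis using J by (simp add: sf_dtheta_def gdtheta_def)
qed

text \<open>A holomorphic \<open>a\<close> contains only thetas and an antiholomorphic
  \<open>b\<close> only theta-bars, so each mixed sign automorphism acts as parity on one factor and
  trivially on the other.\<close>

lemma sg_shol:
 assumes "shol V a" "santi V b" "z \<in> V"
 shows "sg (Suc 0) 0 (b * a) z = b z * spar a z" "sg 0 (Suc 0) (b * a) z = spar b z * a z"
proof -
 have a: "gsg (Suc 0) 0 (a z) = gpar (a z)" "gsg 0 (Suc 0) (a z) = a z"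
  by (rule grass_eqI, case_tac "J = {}", use shol_gcoeff[OF assms(1,3)] in auto)+
 have b: "gsg (Suc 0) 0 (b z) = b z" "gsg 0 (Suc 0) (b z) = gpar (b z)"
  by (rule grass_eqI, case_tac "I = {}", use santi_gcoeff[OF assms(2,3)] in auto)+
 show "sg (Suc 0) 0 (b * a) z = b z * spar a z" "sg 0 (Suc 0) (b * a) z = spar b z * a z"
  by (simp_all add: sg_def gsg_mult a b)
qed

text \<open>The requirement is that b E(a g) depend on the pair a, b only through the product h = b
  a, by an operator bidifferential in h and g.\<close>

definition leibniz :: "(('m, 'd::{finite,linorder}) sfun \<Rightarrow> ('m, 'd) sfun) \<Rightarrow> bool" where
 "leibniz E \<longleftrightarrow> (\<exists>Bd. bidiff U Bd \<and> (\<forall>b a g. santi U b --> shol U a --> g \<in> sf_smooth U -->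
   (\<forall>z\<in>U. b z * E (a * g) z = Bd (b * a) g z)))"

text \<open>\<open>E\<close> acts first on a g and turns it into a sum of terms a' g', to which the
  hypothesis on the outer \<open>E'\<close> applies. This is why \<open>E'\<close> is generalised in
  the induction over \<open>E\<close>.\<close>

lemma leibniz_comp:
 fixes E :: "('m, 'd::{finite,linorder}) sfun \<Rightarrow> ('m, 'd) sfun"
 assumes "diff_op U E" "diff_op U E'" "leibniz E'"
 shows "leibniz (\<lambda>f. E' (E f))"
 using assms
proof (induction arbitrary: E' rule: diff_op_induct)
 case (mult c)
 obtain Bd where Bd: "bidiff U Bd" "!!b a g z. santi U b ==> shol U a ==> g \<in> sf_smooth U ==> z \<in> U ==> b z * E' (a * g) z = Bd (b * a) g z"
  using mult.prems by (auto simp: leibniz_def)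
 define c0 where "c0 = sconst (1/2) * (c + spar c)"
 define c1 where "c1 = sconst (1/2) * (c - spar c)"
 have cs: "c0 \<in> sf_smooth U" "c1 \<in> sf_smooth U" using mult(1) by (auto simp: c0_def c1_def)
 have c: "c * (a * g) = a * (c0 * g) + spar a * (c1 * g)" for a g
 proof (rule ext)
  fix z
  have 0: "c0 z = geven (c z)" "c1 z = godd (c z)" by (simp_all add: c0_def c1_def geven_def godd_def sg_def)
  have "c z * (a z * g z) = (geven (c z) * a z) * g z + (godd (c z) * a z) * g z"
   by (subst geven_godd[of "c z"]) (simp add: distrib_right mult.assoc)
  also have "\<dots> = a z * (geven (c z) * g z) + gpar (a z) * (godd (c z) * g z)"
   using geven_commute[of "geven (c z)" "a z"] godd_commute[of "godd (c z)" "a z"] by (simp add: mult.assoc)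
  finally show "(c * (a * g)) z = (a * (c0 * g) + spar a * (c1 * g)) z" by (simp add: 0 sg_def)
 qed
 have "bidiff U (\<lambda>h g. Bd h (c0 * g) + Bd (sg (Suc 0) 0 h) (c1 * g))"
  by (rule bidiff.add[OF bidiff_comp[OF Bd(1) diff_op_id diff_op.intros(1)[OF cs(1)]] bidiff_comp[OF Bd(1) diff_op_sg diff_op.intros(1)[OF cs(2)]]])
 moreover have "b z * E' (c * (a * g)) z = (Bd (b * a) (c0 * g) + Bd (sg (Suc 0) 0 (b * a)) (c1 * g)) z"
  if *: "santi U b" "shol U a" "g \<in> sf_smooth U" and z: "z \<in> U" for b a g z
 proof -
  have as: "a \<in> sf_smooth U" using * by (simp add: shol_def)
  have "E' (c * (a * g)) z = E' (a * (c0 * g)) z + E' (spar a * (c1 * g)) z"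
   unfolding c by (rule diff_op_plus[OF oU mult.prems(1) _ _ z]) (use as * cs in auto)
  moreover have "b z * E' (a * (c0 * g)) z = Bd (b * a) (c0 * g) z" using * cs z by (intro Bd(2) sf_smooth_mult oU)
  moreover have "b z * E' (spar a * (c1 * g)) z = Bd (b * spar a) (c1 * g) z" using * cs z by (intro Bd(2) shol_sg sf_smooth_mult oU order_refl)
  moreover have "Bd (b * spar a) (c1 * g) z = Bd (sg (Suc 0) 0 (b * a)) (c1 * g) z"
   by (rule bidiff_cong[OF Bd(1) oU z]) (simp_all add: sg_shol(1)[OF *(2,1)])
  ultimately show ?thesis by (simp only: distrib_left plus_fun_apply)
 qed
 ultimately show ?case unfolding leibniz_def
  by (intro exI[of _ "\<lambda>h g. Bd h (c0 * g) + Bd (sg (Suc 0) 0 h) (c1 * g)"]) blast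
next
 case (pd i)
 obtain Bd where Bd: "bidiff U Bd" "!!b a g z. santi U b ==> shol U a ==> g \<in> sf_smooth U ==> z \<in> U ==> b z * E' (a * g) z = Bd (b * a) g z"
  using pd.prems by (auto simp: leibniz_def)
 \<comment> \<open>The operators \<open>t1\<close> and \<open>t2\<close> insert the twist
   \<open>sgd i\<close> on the factor \<open>a\<close>, respectively \<open>b\<close>, while acting
   on the product b a alone.\<close>
 define t1 :: "('m, 'd) sfun \<Rightarrow> ('m, 'd) sfun" where "t1 = (if oddd i then sg (Suc 0) 0 else (\<lambda>f. f))"
 define t2 :: "('m, 'd) sfun \<Rightarrow> ('m, 'd) sfun" where "t2 = (if oddd i then sg 0 (Suc 0) else (\<lambda>f. f))"
 have td: "diff_op U t1" "diff_op U t2" by (auto simp: t1_def t2_def diff_op_sg diff_op_id)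
 have t: "t1 (b * a) z = b z * sgd i a z" "t2 (b * a) z = sgd i b z * a z" if "santi U b" "shol U a" "z \<in> U" for b a z
  using sg_shol[OF that(2,1,3)] by (auto simp: t1_def t2_def sgd_def)
 have split: "b z * E' (pd i (a * g)) z = b z * E' (pd i a * g) z + b z * E' (sgd i a * pd i g) z"
  if *: "shol U a" "g \<in> sf_smooth U" "z \<in> U" for a b g z
 proof -
  have as: "a \<in> sf_smooth U" using * by (simp add: shol_def)
  have "E' (pd i (a * g)) z = E' (pd i a * g + sgd i a * pd i g) z"
   by (rule diff_op_cong[OF pd.prems(1) oU *(3)]) (simp add: pd_mult[OF _ as *(2)])
  also have "\<dots> = E' (pd i a * g) z + E' (sgd i a * pd i g) z"
   by (rule diff_op_plus[OF oU pd.prems(1) _ _ *(3)]) (use as * in auto)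
  finally show ?thesis by (simp only: distrib_left)
 qed
 have second: "b z * E' (sgd i a * pd i g) z = Bd (t1 (b * a)) (pd i g) z"
  if *: "santi U b" "shol U a" "g \<in> sf_smooth U" "z \<in> U" for a b g z
 proof -
  have "b z * E' (sgd i a * pd i g) z = Bd (b * sgd i a) (pd i g) z" using * by (intro Bd(2) shol_sgd sf_smooth_pd oU order_refl)
  also have "\<dots> = Bd (t1 (b * a)) (pd i g) z"
   by (rule bidiff_cong[OF Bd(1) oU *(4)]) (simp_all add: t(1)[OF *(1,2)])
  finally show ?thesis .
 qed
 show ?case
 proof (cases "holo i")
  case True
  \<comment> \<open>As d_i b = 0, differentiating \<open>a\<close> alone amounts to differentiating
    b a; the sign from passing \<open>b\<close> is compensated beforehand by \<open>t2\<close>. For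
    antiholomorphic \<open>i\<close> this term is zero since d_i a = 0.\<close>
  have first: "b z * E' (pd i a * g) z = Bd (pd i (t2 (b * a))) g z"
   if *: "santi U b" "shol U a" "g \<in> sf_smooth U" "z \<in> U" for a b g z
  proof -
   have "b z * E' (pd i a * g) z = Bd (b * pd i a) g z" using * by (intro Bd(2) shol_pd oU order_refl)
   also have "\<dots> = Bd (pd i (t2 (b * a))) g z"
   proof (rule bidiff_cong[OF Bd(1) oU *(4)])
    fix y assume y: "y \<in> U"
    have sb: "santi U (sgd i b)" using * by (intro santi_sgd) auto
    have "pd i (t2 (b * a)) y = pd i (sgd i b * a) y"
     by (rule pd_cong[OF oU y]) (simp add: t(2)[OF *(1,2)])
    also have "\<dots> = pd i (sgd i b) y * a y + sgd i (sgd i b) y * pd i a y"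
     by (rule pd_mult[OF y]) (use sb * in \<open>auto simp: santi_def shol_def\<close>)
    also have "\<dots> = b y * pd i a y" using sb True y by (simp add: santi_def) (simp add: sgd_def sg_def)
    finally show "(b * pd i a) y = pd i (t2 (b * a)) y" by simp
   qed simp
   finally show ?thesis .
  qed
  have "bidiff U (\<lambda>h g. Bd (pd i (t2 h)) g + Bd (t1 h) (pd i g))"
   by (rule bidiff.add[OF bidiff_comp[OF Bd(1) diff_op.intros(7)[OF diff_op_pd td(2)] diff_op_id] bidiff_comp[OF Bd(1) td(1) diff_op_pd]])
  moreover have "b z * E' (pd i (a * g)) z = (Bd (pd i (t2 (b * a))) g + Bd (t1 (b * a)) (pd i g)) z"
   if "santi U b" "shol U a" "g \<in> sf_smooth U" "z \<in> U" for a b g z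
   using split[OF that(2-4), of b] first[OF that] second[OF that] by (simp only: plus_fun_apply)
  ultimately show ?thesis unfolding leibniz_def by (intro exI[of _ "\<lambda>h g. Bd (pd i (t2 h)) g + Bd (t1 h) (pd i g)"]) blast
 next
  case False
  have first: "b z * E' (pd i a * g) z = 0"
   if *: "santi U b" "shol U a" "g \<in> sf_smooth U" "z \<in> U" for a b g z
  proof -
   have "E' (pd i a * g) z = 0"
    by (rule diff_op_eq_0[OF pd.prems(1) oU oU _ *(4)]) (use False * in \<open>auto simp: shol_def\<close>)
   then show ?thesis by simp
  qed
  have "bidiff U (\<lambda>h g. Bd (t1 h) (pd i g))"
   by (rule bidiff_comp[OF Bd(1) td(1) diff_op_pd])
  moreover have "b z * E' (pd i (a * g)) z = Bd (t1 (b * a)) (pd i g) z"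
   if "santi U b" "shol U a" "g \<in> sf_smooth U" "z \<in> U" for a b g z
   using split[OF that(2-4), of b] first[OF that] second[OF that] by simp
  ultimately show ?thesis unfolding leibniz_def by (intro exI[of _ "\<lambda>h g. Bd (t1 h) (pd i g)"]) blast
 qed
next
 case (add A B)
 obtain F where F: "bidiff U F" "!!b a g z. santi U b ==> shol U a ==> g \<in> sf_smooth U ==> z \<in> U ==> b z * E' (A (a * g)) z = F (b * a) g z"
  using add.IH(1)[OF add.prems] by (auto simp: leibniz_def)
 obtain G where G: "bidiff U G" "!!b a g z. santi U b ==> shol U a ==> g \<in> sf_smooth U ==> z \<in> U ==> b z * E' (B (a * g)) z = G (b * a) g z"
  using add.IH(2)[OF add.prems] by (auto simp: leibniz_def)
 have "b z * E' (A (a * g) + B (a * g)) z = (F (b * a) g + G (b * a) g) z"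
  if *: "santi U b" "shol U a" "g \<in> sf_smooth U" "z \<in> U" for a b g z
 proof -
  have s: "a * g \<in> sf_smooth U" using * by (auto simp: shol_def)
  have "E' (A (a * g) + B (a * g)) z = E' (A (a * g)) z + E' (B (a * g)) z"
   by (rule diff_op_plus[OF oU add.prems(1) diff_op_smooth[OF oU add(1) s] diff_op_smooth[OF oU add(2) s] *(4)])
  then show ?thesis using F(2)[OF *] G(2)[OF *] by (simp only: distrib_left plus_fun_apply)
 qed
 then show ?case unfolding leibniz_def using bidiff.add[OF F(1) G(1)]
  by (intro exI[of _ "\<lambda>h g. F h g + G h g"]) blast
next
 case (comp A B)
 have "leibniz (\<lambda>f. E' (A f))" by (rule comp.IH(1)[OF comp.prems])
 then show ?case using comp.IH(2)[of "\<lambda>f. E' (A f)"] diff_op.intros(7)[OF comp.prems(1) comp(1)] by blast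
qed

lemma diff_op_leibniz:
 fixes E :: "('m, 'd::{finite,linorder}) sfun \<Rightarrow> ('m, 'd) sfun"
 assumes "diff_op U E"
 shows "\<exists>Bd. bidiff U Bd \<and> (\<forall>b a g. santi U b --> shol U a --> g \<in> sf_smooth U -->
   (\<forall>z\<in>U. (b * E (a * g)) z = Bd (b * a) g z))"
proof -
 have "leibniz (\<lambda>f :: ('m, 'd) sfun. f)"
  unfolding leibniz_def
  by (rule exI[of _ "\<lambda>h g. h * g"], rule conjI[OF bidiff.prod[OF diff_op_id diff_op_id]]) (simp add: mult.assoc)
 from leibniz_comp[OF assms diff_op_id this] show ?thesis unfolding leibniz_def by (simp only: times_fun_apply)
qed

text \<open>For each coefficient f_IJ the test function is the bump times its conjugate, placed at
  the complementary monomial. Up to a constant sign the integrand is then the bump times the squared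
  modulus of f_IJ.\<close>

lemma bint_separates:
 fixes f :: "('m, 'd::{finite,linorder}) sfun"
 assumes f: "f \<in> sf_smooth U" and 0: "!!g. g \<in> sf_smooth U ==> csup g ==> bint (f * g) = 0" and x: "x \<in> U"
 shows "f x = 0"
proof (rule grass_eqI)
 fix I J :: "'d set"
 obtain \<phi> :: "complex^'m \<Rightarrow> real" and K where \<phi>: "smooth_on UNIV \<phi>" "compact K" "K \<subseteq> U" "!!y. y \<notin> K ==> \<phi> y = 0"
  "\<phi> x > 0" "!!y. \<phi> y \<ge> 0" using smooth_bump[OF oU x] by metis
 define F where "F z = gcoeff (f z) I J" for z
 \<comment> \<open>At the complementary monomial, only f_IJ contributes to the top coefficient of
   the product.\<close>
 define g where "g z = Grass (\<lambda>A B. if A = - I \<and> B = - J then of_real (\<phi> z) * cnj (F z) else 0)" for z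
 have Fs: "smooth_on U F" using sf_smoothD[OF f] by (simp add: F_def[abs_def])
 have \<phi>s: "smooth_on U (\<lambda>z. of_real (\<phi> z) :: complex)"
  by (rule smooth_on_bounded_linear_compose[OF oU bounded_linear_of_real smooth_on_subset[OF \<phi>(1)]]) simp
 have "smooth_on U (\<lambda>z. of_real (\<phi> z) * cnj (F z))"
  by (intro smooth_on_mult oU \<phi>s smooth_on_bounded_linear_compose[OF oU bounded_linear_cnj Fs])
 then have gs: "g \<in> sf_smooth U"
 proof (intro sf_smoothI)
  fix A B assume *: "smooth_on U (\<lambda>z. of_real (\<phi> z) * cnj (F z))"
  show "smooth_on U (\<lambda>z. gcoeff (g z) A B)"
  proof (cases "A = - I \<and> B = - J")
   case True
   then have "gcoeff (g z) A B = of_real (\<phi> z) * cnj (F z)" for z by (simp add: g_def)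
   then show ?thesis using * by simp
  next
   case False
   then have "gcoeff (g z) A B = 0" for z by (auto simp: g_def)
   then show ?thesis by simp
  qed
 qed
 have "g z = 0" if "z \<notin> K" for z
  by (rule grass_eqI) (simp add: g_def \<phi>(4)[OF that])
 then have gc: "csup g" unfolding csup_def using \<phi> by blast
 define \<psi> where "\<psi> z = (if z \<in> U then \<phi> z * (norm (F z))\<^sup>2 else 0)" for z
 have top: "gtop (f z * g z) = mono_sign I J (- I) (- J) * of_real (\<phi> z * (norm (F z))\<^sup>2)" for z
 proof -
  have "gtop (f z * g z) = (\<Sum>A\<in>UNIV. \<Sum>B\<in>UNIV. if A = I then if B = J then mono_sign I J (- I) (- J) * (F z * (of_real (\<phi> z) * cnj (F z))) else 0 else 0)"
   unfolding gtop_def gcoeff_mult by (simp add: Pow_UNIV) (intro sum.cong refl, auto simp: g_def F_def Compl_eq_Diff_UNIV[symmetric])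
  also have "\<dots> = (\<Sum>A\<in>UNIV. if A = I then \<Sum>B\<in>UNIV. if B = J then mono_sign I J (- I) (- J) * (F z * (of_real (\<phi> z) * cnj (F z))) else 0 else 0)"
   by (intro sum.cong) auto
  also have "\<dots> = mono_sign I J (- I) (- J) * (F z * (of_real (\<phi> z) * cnj (F z)))" by simp
  also have "F z * (of_real (\<phi> z) * cnj (F z)) = of_real (\<phi> z * (norm (F z))\<^sup>2)"
   using complex_norm_square[of "F z"] by (simp add: ac_simps)
  finally show ?thesis .
 qed
 have "continuous_on UNIV \<psi>"
  unfolding \<psi>_def
  by (rule continuous_on_extend_zero[OF oU \<phi>(2,3)])
   (use \<phi>(4) in \<open>auto intro!: continuous_intros smooth_on_continuous_on[OF Fs] continuous_on_subset[OF smooth_on_continuous_on[OF \<phi>(1)]]\<close>)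
 moreover have "(\<lambda>z. indicator K z *\<^sub>R \<psi> z) = \<psi>" using \<phi>(4) by (auto simp: \<psi>_def fun_eq_iff indicator_def)
 ultimately have int: "integrable lborel \<psi>"
  using borel_integrable_compact[OF \<phi>(2), of \<psi>] continuous_on_subset by (metis subset_UNIV)
 have "0 = bint (f * g)" using 0 gs gc by simp
 also have "\<dots> = (LINT z|lborel. mono_sign I J (- I) (- J) * of_real (\<psi> z))"
  unfolding bint_def set_lebesgue_integral_def times_fun_apply top
  by (rule Bochner_Integration.integral_cong) (auto simp: \<psi>_def indicator_def)
 also have "\<dots> = mono_sign I J (- I) (- J) * of_real (LINT z|lborel. \<psi> z)"
  by simp
 finally have "(LINT z|lborel. \<psi> z) = 0" by (simp add: mono_sign_def)
 then have "AE z in lborel. \<psi> z = 0"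
 proof -
  have "AE z in lborel. 0 \<le> \<psi> z" using \<phi>(6) by (intro AE_I2) (simp add: \<psi>_def)
  from integral_nonneg_eq_0_iff_AE[OF int this] \<open>(LINT z|lborel. \<psi> z) = 0\<close> show ?thesis by blast
 qed
 then have AE: "AE z\<in>UNIV in lebesgue. z \<in> {z. \<psi> z = 0}"     using AE_completion[of "\<lambda>z. \<psi> z = 0" lborel] by simp
 have cl: "closed {z. \<psi> z = 0}"
  by (rule closed_Collect_eq[OF \<open>continuous_on UNIV \<psi>\<close> continuous_on_const])
 have "x \<in> {z. \<psi> z = 0}"
  by (rule mem_closed_if_AE_lebesgue_open[OF open_UNIV cl AE UNIV_I])
 then show "gcoeff (f x) I J = gcoeff 0 I J" using x \<phi>(5) by (simp add: \<psi>_def F_def)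
qed

end

section \<open>Closed one-forms\<close>

text \<open>Defined from the form and not from a primitive, so that integrals along edges lying in
  different balls, each with its own local primitive, can be compared.\<close>

definition seg_int :: "('a::euclidean_space \<Rightarrow> 'a \<Rightarrow> complex) \<Rightarrow> 'a \<Rightarrow> 'a \<Rightarrow> complex" where
 "seg_int w a b = integral {0..1} (\<lambda>t. w (a + t *\<^sub>R (b - a)) (b - a))"

lemma seg_int_primitive:
 fixes w :: "'a::euclidean_space \<Rightarrow> 'a \<Rightarrow> complex"
 assumes "convex B" "a \<in> B" "b \<in> B" "!!x. x \<in> B ==> (P has_derivative w x) (at x)"
 shows "seg_int w a b = P b - P a"
proof -
 have inB: "a + t *\<^sub>R (b - a) \<in> B" if "t \<in> {0..1}" for t
 proof -
  have "(1 - t) *\<^sub>R a + t *\<^sub>R b \<in> B" using assms(1-3) that by (intro convexD) auto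
  then show ?thesis by (simp add: algebra_simps)
 qed
 have "((\<lambda>t. w (a + t *\<^sub>R (b - a)) (b - a)) has_integral (P (a + 1 *\<^sub>R (b - a)) - P (a + 0 *\<^sub>R (b - a)))) {0..1}"
 proof (rule fundamental_theorem_of_calculus)
  fix t :: real assume t: "t \<in> {0..1}"
  have lin: "linear (w (a + t *\<^sub>R (b - a)))"
   using assms(4)[OF inB[OF t]] has_derivative_bounded_linear bounded_linear.linear by blast
  have "((\<lambda>t. P (a + t *\<^sub>R (b - a))) has_derivative (\<lambda>u. w (a + t *\<^sub>R (b - a)) (u *\<^sub>R (b - a)))) (at t)"
   by (rule has_derivative_compose[where g = P and f = "\<lambda>t. a + t *\<^sub>R (b - a)", OF _ assms(4)[OF inB[OF t]]]) (auto intro!: derivative_eq_intros)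
  then show "((\<lambda>t. P (a + t *\<^sub>R (b - a))) has_vector_derivative w (a + t *\<^sub>R (b - a)) (b - a)) (at t within {0..1})"
   by (simp add: has_vector_derivative_def linear_scale[OF lin] has_derivative_at_withinI)
 qed simp
 then show ?thesis unfolding seg_int_def by (simp add: integral_unique)
qed

text \<open>The primitive is the integral of w along the radius from \<open>a\<close>. By the
  symmetry \<open>sym\<close>, the derivative of the integrand in x is the t-derivative of t times w
  at the point \<open>\<gamma> x t\<close>, so the fundamental theorem returns w at the end of the
  radius.\<close>

lemma closed_form_primitive_on_ball:
 fixes w :: "'a::euclidean_space \<Rightarrow> 'a \<Rightarrow> complex"
 assumes "ball a r \<subseteq> S"
  and lin: "!!x. x \<in> S ==> linear (w x)"
  and w': "!!x v. x \<in> S ==> ((\<lambda>x. w x v) has_derivative w' x v) (at x)"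
  and cont: "!!u v. continuous_on S (\<lambda>x. w' x v u)"
  and sym: "!!x u v. x \<in> S ==> w' x v u = w' x u v"
 shows "\<exists>P. \<forall>x\<in>ball a r. (P has_derivative w x) (at x)"
proof -
 define B where "B = ball a r"
 have BS: "B \<subseteq> S" using assms(1) by (simp add: B_def)
 define \<gamma> where "\<gamma> x t = a + t *\<^sub>R (x - a)" for x t
 have \<gamma>B: "\<gamma> x t \<in> B" if "x \<in> B" "t \<in> {0..1}" for x t
 proof -
  have "norm (t *\<^sub>R (x - a)) \<le> norm (x - a)" using that by (auto simp: mult_left_le_one_le)
  then show ?thesis using that by (simp add: B_def \<gamma>_def dist_norm norm_minus_commute)
 qed
 note \<gamma>S = subsetD[OF BS \<gamma>B]
 have wsum: "w x v = (\<Sum>b\<in>Basis. (v \<bullet> b) *\<^sub>R w x b)" if "x \<in> S" for x v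
  using linear_sum[OF lin[OF that], of "\<lambda>b. (v \<bullet> b) *\<^sub>R b" Basis] by (simp add: euclidean_representation linear_scale[OF lin[OF that]])
 have w'sum: "w' x v u = (\<Sum>b\<in>Basis. (v \<bullet> b) *\<^sub>R w' x b u)" if x: "x \<in> S" for x v u
 proof -
  have l: "linear (w' x u)" using w'[OF x] has_derivative_bounded_linear bounded_linear.linear by blast
  show ?thesis
   using linear_sum[OF l, of "\<lambda>b. (v \<bullet> b) *\<^sub>R b" Basis] sym[OF x]
   by (simp add: euclidean_representation linear_scale[OF l])
 qed
 have wc: "continuous_on S (\<lambda>x. w x b)" for b
  using w' by (auto intro!: continuous_at_imp_continuous_on has_derivative_continuous)
 define f where "f x t = w (\<gamma> x t) (x - a)" for x t
 \<comment> \<open>The product rule in x: the position \<open>\<gamma> x t\<close> moves at speed t,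
   and the direction x - a moves as well.\<close>
 define f' where "f' x t u = t *\<^sub>R w' (\<gamma> x t) (x - a) u + w (\<gamma> x t) u" for x t u
 have fd: "((\<lambda>x. f x t) has_derivative f' x t) (at x)" if xt: "x \<in> B" "t \<in> {0..1}" for x t
 proof -
  have "((\<lambda>x. \<Sum>b\<in>Basis. ((x - a) \<bullet> b) *\<^sub>R w (\<gamma> x t) b) has_derivative
    (\<lambda>u. \<Sum>b\<in>Basis. ((x - a) \<bullet> b) *\<^sub>R (w' (\<gamma> x t) b (t *\<^sub>R u)) + (u \<bullet> b) *\<^sub>R w (\<gamma> x t) b)) (at x)"
  proof (intro has_derivative_sum has_derivative_scaleR)
   fix b :: 'a
   show "((\<lambda>x. (x - a) \<bullet> b) has_derivative (\<lambda>u. u \<bullet> b)) (at x)"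
    by (auto intro!: derivative_eq_intros)
   show "((\<lambda>x. w (\<gamma> x t) b) has_derivative (\<lambda>u. w' (\<gamma> x t) b (t *\<^sub>R u))) (at x)"
    by (rule has_derivative_compose[where g = "\<lambda>y. w y b" and f = "\<lambda>x. \<gamma> x t", OF _ w'[OF \<gamma>S[OF xt]]]) (auto simp: \<gamma>_def intro!: derivative_eq_intros)
  qed
  moreover have "(\<Sum>b\<in>Basis. ((x - a) \<bullet> b) *\<^sub>R (w' (\<gamma> x t) b (t *\<^sub>R u)) + (u \<bullet> b) *\<^sub>R w (\<gamma> x t) b) = f' x t u" for u
  proof -
   have l: "linear (w' (\<gamma> x t) v)" for v using w'[OF \<gamma>S[OF xt]] has_derivative_bounded_linear bounded_linear.linear by blast
   show ?thesis
    unfolding f'_def wsum[OF \<gamma>S[OF xt], of u] w'sum[OF \<gamma>S[OF xt], of "x - a" u]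
    by (simp add: sum.distrib linear_scale[OF l] scaleR_sum_right mult.commute)
  qed
  ultimately have "((\<lambda>x. \<Sum>b\<in>Basis. ((x - a) \<bullet> b) *\<^sub>R w (\<gamma> x t) b) has_derivative f' x t) (at x)" by simp
  moreover have "open B" by (simp add: B_def)
  ultimately show ?thesis
   by (rule has_derivative_transform_within_open[OF _ _ xt(1)]) (simp add: f_def wsum[OF \<gamma>S[OF _ xt(2)], of _ "_ - a"])
 qed
 have bl: "bounded_linear (f' x t)" if "x \<in> B" "t \<in> {0..1}" for x t
  using fd[OF that] by (rule has_derivative_bounded_linear)
 have f'c: "continuous_on (B \<times> {0..1}) (\<lambda>(x, t). f' x t u)" for u
 proof -
  have g: "continuous_on (B \<times> {0..1}) (\<lambda>p. \<gamma> (fst p) (snd p))"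
   unfolding \<gamma>_def by (intro continuous_intros)
  have im: "(\<lambda>p. \<gamma> (fst p) (snd p)) ` (B \<times> {0..1}) \<subseteq> S" using \<gamma>S by auto
  have "continuous_on (B \<times> {0..1}) (\<lambda>p. snd p *\<^sub>R (\<Sum>b\<in>Basis. ((fst p - a) \<bullet> b) *\<^sub>R w' (\<gamma> (fst p) (snd p)) b u) + w (\<gamma> (fst p) (snd p)) u)"
   by (intro continuous_intros continuous_on_compose2[OF cont g im] continuous_on_compose2[OF wc g im])
  then show ?thesis
   by (rule continuous_on_eq) (auto simp: f'_def split_beta w'sum[OF \<gamma>S])
 qed
 have main: "((\<lambda>x. integral (cbox 0 1) (f x)) has_derivative w x) (at x)" if x: "x \<in> B" for x
 proof -
  \<comment> \<open>Differentiation under the integral is available for derivatives of the type of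
    bounded linear functions, hence the passage through \<open>Blinfun\<close>.\<close>
  define fx where "fx x t = Blinfun (f' x t)" for x t
  have app: "blinfun_apply (fx x t) = f' x t" if "x \<in> B" "t \<in> {0..1}" for x t
   using bl[OF that] by (simp add: fx_def bounded_linear_Blinfun_apply)
  have fxc: "continuous_on (B \<times> cbox 0 1) (\<lambda>(x, t). fx x t)"
   unfolding cbox_interval
  proof (rule continuous_on_blinfun_componentwise)
   fix i :: 'a
   show "continuous_on (B \<times> {0..1}) (\<lambda>p. blinfun_apply (case p of (x, t) \<Rightarrow> fx x t) i)"
    by (rule continuous_on_eq[OF f'c[of i]]) (auto simp: app)
  qed
  have "((\<lambda>x. integral (cbox 0 1) (f x)) has_derivative blinfun_apply (integral (cbox 0 1) (fx x))) (at x within B)"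
  proof (rule leibniz_rule[OF _ _ fxc x])
   show "((\<lambda>x. f x t) has_derivative blinfun_apply (fx x t)) (at x within B)" if "x \<in> B" "t \<in> cbox 0 1" for x t
    using fd[of x t] app[of x t] that by (simp add: has_derivative_at_withinI)
   show "f x integrable_on cbox 0 1" if "x \<in> B" for x
   proof (rule integrable_continuous)
    have "continuous_on {0..1} (\<lambda>t. w (\<gamma> x t) (x - a))"
     by (rule continuous_on_compose2[OF wc[of "x - a"]]) (use \<gamma>S[OF that] in \<open>auto simp: \<gamma>_def intro!: continuous_intros\<close>)
    then show "continuous_on (cbox 0 1) (f x)" by (simp add: f_def[abs_def] cbox_interval)
   qed
  qed (simp add: B_def)
  then have 1: "((\<lambda>x. integral (cbox 0 1) (f x)) has_derivative blinfun_apply (integral (cbox 0 1) (fx x))) (at x)"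
   using x at_within_open[of x B] by (simp add: B_def)
  have "blinfun_apply (integral (cbox 0 1) (fx x)) u = w x u" for u
  proof -
   have "fx x integrable_on cbox 0 1"
    by (rule integrable_continuous, rule continuous_on_compose2[OF fxc, of _ "\<lambda>t. (x, t)", simplified])
     (use x in \<open>auto intro!: continuous_intros\<close>)
   then have "blinfun_apply (integral (cbox 0 1) (fx x)) u = integral (cbox 0 1) (\<lambda>t. blinfun_apply (fx x t) u)"
    by (rule blinfun_apply_integral)
   also have "\<dots> = integral {0..1} (\<lambda>t. f' x t u)"
    unfolding cbox_interval by (rule integral_cong) (simp add: app[OF x])
   also have "((\<lambda>t. f' x t u) has_integral (1 *\<^sub>R w (\<gamma> x 1) u - 0 *\<^sub>R w (\<gamma> x 0) u)) {0..1}"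
   proof (rule fundamental_theorem_of_calculus)
    fix t :: real assume t: "t \<in> {0..1}"
    have l: "linear (w' (\<gamma> x t) u)" using w'[OF \<gamma>S[OF x t]] has_derivative_bounded_linear bounded_linear.linear by blast
    have "((\<lambda>t. w (\<gamma> x t) u) has_derivative (\<lambda>s. w' (\<gamma> x t) u (s *\<^sub>R (x - a)))) (at t)"
     by (rule has_derivative_compose[where g = "\<lambda>y. w y u" and f = "\<lambda>t. \<gamma> x t", OF _ w'[OF \<gamma>S[OF x t]]]) (auto simp: \<gamma>_def intro!: derivative_eq_intros)
    then have "((\<lambda>t. w (\<gamma> x t) u) has_vector_derivative w' (\<gamma> x t) u (x - a)) (at t)"
     by (simp add: has_vector_derivative_def linear_scale[OF l])
    then have "((\<lambda>t. t *\<^sub>R w (\<gamma> x t) u) has_vector_derivative (t *\<^sub>R w' (\<gamma> x t) u (x - a) + 1 *\<^sub>R w (\<gamma> x t) u)) (at t)"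
     by (intro has_vector_derivative_scaleR DERIV_ident)
    then show "((\<lambda>t. t *\<^sub>R w (\<gamma> x t) u) has_vector_derivative f' x t u) (at t within {0..1})"
     by (simp add: f'_def sym[OF \<gamma>S[OF x t], of "x - a" u] has_vector_derivative_at_within)
   qed simp
   then have "integral {0..1} (\<lambda>t. f' x t u) = w x u" by (simp add: integral_unique \<gamma>_def)
   finally show ?thesis .
  qed
  then have "blinfun_apply (integral (cbox 0 1) (fx x)) = w x" by (rule ext)
  then show ?thesis using 1 by simp
 qed
 then show ?thesis unfolding B_def by blast
qed

text \<open>The primitive at \<open>x\<close> is minus the integral along the path traced by \<open>x\<close> under the contraction,
 computed on fine polygons.\<close>

lemma closed_form_primitive:
 fixes w :: "'a::euclidean_space \<Rightarrow> 'a \<Rightarrow> complex"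
 assumes S: "open S" "contractible S"
  and lin: "!!x. x \<in> S ==> linear (w x)"
  and w': "!!x v. x \<in> S ==> ((\<lambda>x. w x v) has_derivative w' x v) (at x)"
  and cont: "!!u v. continuous_on S (\<lambda>x. w' x v u)"
  and sym: "!!x u v. x \<in> S ==> w' x v u = w' x u v"
 shows "\<exists>F. \<forall>x\<in>S. (F has_derivative w x) (at x)"
proof -
 obtain c where "homotopic_with_canon (\<lambda>x. True) S S id (\<lambda>x. c)"
  using S(2) unfolding contractible_def by blast
 then obtain h :: "real \<times> 'a \<Rightarrow> 'a" where h: "continuous_on ({0..1} \<times> S) h" "h ` ({0..1} \<times> S) \<subseteq> S"
  "!!x. x \<in> S ==> h (0, x) = x" "!!x. x \<in> S ==> h (1, x) = c"
  unfolding homotopic_with_def by (auto simp: image_subset_iff_funcset[symmetric])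
 \<comment> \<open>The paths traced by the homotopy are only continuous, so the form is integrated
   along the inscribed polygon with n edges; for large n the value turns out to be independent of
   n.\<close>
 define G where "G n x = (\<Sum>i<n. seg_int w (h (real i / real n, x)) (h (real (Suc i) / real n, x)))" for n :: nat and x
 have prim: "\<exists>P. \<forall>x\<in>ball a r. (P has_derivative w x) (at x)" if "ball a r \<subseteq> S" for a r
  by (rule closed_form_primitive_on_ball[OF that lin w' cont sym])
 \<comment> \<open>Uniform continuity makes the polygons so fine near \<open>x\<close> that
   corresponding edges of the polygons of \<open>x\<close> and \<open>y\<close> lie in a common ball
   inside \<open>S\<close>, where the form has a primitive.\<close>
 have local: "\<exists>e>0. \<exists>N>0. ball x e \<subseteq> S \<and> (\<forall>n\<ge>N. \<forall>y\<in>ball x e. G n y = G n x - seg_int w x y) \<and> (\<forall>n\<ge>N. \<forall>k>0. G (n * k) x = G n x)"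
  if x: "x \<in> S" for x
 proof -
  obtain r where r: "r > 0" "cball x r \<subseteq> S" using S(1) x open_contains_cball by blast
  define K where "K = {0..1::real} \<times> cball x r"
  have K: "compact K" unfolding K_def by (intro compact_Times) auto
  have Kc: "continuous_on K h" using h(1) r by (intro continuous_on_subset[OF h(1)]) (auto simp: K_def)
  have hK: "compact (h ` K)" by (rule compact_continuous_image[OF Kc K])
  have hKS: "h ` K \<subseteq> S" using h(2) r by (auto simp: K_def)
  obtain \<delta> where \<delta>: "\<delta> > 0" "(\<Union>y\<in>h ` K. ball y \<delta>) \<subseteq> S"
   using compact_subset_open_imp_ball_epsilon_subset[OF hK S(1) hKS] by blast
  have "uniformly_continuous_on K h" by (rule compact_uniformly_continuous[OF Kc K])
  then obtain \<eta> where \<eta>: "\<eta> > 0" "!!p q. p \<in> K ==> q \<in> K ==> dist q p < \<eta> ==> dist (h q) (h p) < \<delta>"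
   using \<delta>(1) unfolding uniformly_continuous_on_def by metis
  define e where "e = min r (\<eta> / 2)"
  obtain N where N: "N > 0" "1 / real N < \<eta> / 2"
   using \<eta>(1) by (metis half_gt_zero nat_approx_posE zero_less_Suc)
  have e: "e > 0" "ball x e \<subseteq> S" using r \<eta> by (auto simp: e_def)
  have near: "h (s, y) \<in> ball (h (t, x)) \<delta>" if "t \<in> {0..1}" "s \<in> {0..1}" "\<bar>s - t\<bar> \<le> 1 / real n" "n \<ge> N" "y \<in> ball x e" for s t y and n :: nat
  proof -
   have "1 / real n \<le> 1 / real N" using that(4) N(1) by (simp add: frac_le)
   then have "\<bar>s - t\<bar> < \<eta> / 2" using that(3) N(2) by linarith
   moreover have "dist y x < \<eta> / 2" using that(5) by (simp add: e_def dist_commute)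
   ultimately have "dist (s, y) (t, x) < \<eta>"
    using sqrt_sum_squares_le_sum_abs[of "dist s t" "dist y x"] by (simp add: dist_Pair_Pair dist_real_def)
   then show ?thesis using \<eta>(2)[of "(t, x)" "(s, y)"] that r by (auto simp: K_def e_def dist_commute)
  qed
  have bS: "ball (h (t, x)) \<delta> \<subseteq> S" if "t \<in> {0..1}" for t
  proof -
   have "h (t, x) \<in> h ` K" using that r by (intro imageI) (simp add: K_def)
   then show ?thesis using \<delta>(2) by blast
  qed
  have t01: "real i / real n \<in> {0..1}" if "i \<le> n" for i n :: nat
   using that by (cases "n = 0") (auto simp: divide_le_eq)
  have step: "\<bar>real (Suc i) / real n - real i / real n\<bar> \<le> 1 / real n" for i n :: nat
   by (simp add: diff_divide_distrib[symmetric])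
  have 1: "G n y = G n x - seg_int w x y" if n: "n \<ge> N" and y: "y \<in> ball x e" for n y
  proof -
   \<comment> \<open>The integrals along the rungs joining corresponding vertices of the two
     polygons. In each quadrilateral the integrals close up, so the difference of the polygons
     telescopes to \<open>D n - D 0\<close>; the last rung is degenerate because both paths end at
     \<open>c\<close>, and the first joins \<open>x\<close> to \<open>y\<close>.\<close>
   define D where "D i = seg_int w (h (real i / real n, x)) (h (real i / real n, y))" for i :: nat
   have xe: "x \<in> ball x e" using e by simp
   have "seg_int w (h (real i / real n, y)) (h (real (Suc i) / real n, y)) - seg_int w (h (real i / real n, x)) (h (real (Suc i) / real n, x)) = D (Suc i) - D i"
    if i: "i < n" for i
   proof -
    let ?t = "real i / real n" and ?s = "real (Suc i) / real n"
    have t: "?t \<in> {0..1}" "?s \<in> {0..1}" using t01[of i n] t01[of "Suc i" n] i by auto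
    obtain P where P: "!!x'. x' \<in> ball (h (?t, x)) \<delta> ==> (P has_derivative w x') (at x')"
     using prim[OF bS[OF t(1)]] by blast
    have 0: "\<bar>?t - ?t\<bar> \<le> 1 / real n" by simp
    note m = near[OF t(1) t(1) 0 n xe] near[OF t(1) t(1) 0 n y] near[OF t step n xe] near[OF t step n y]
    note S = seg_int_primitive[OF convex_ball _ _ P]
    show ?thesis
     using S[OF m(1,3)] S[OF m(2,4)] S[OF m(1,2)] S[OF m(3,4)] by (simp add: D_def)
   qed
   then have *: "G n y - G n x = (\<Sum>i<n. D (Suc i) - D i)"
    unfolding G_def sum_subtractf[symmetric] by (intro sum.cong) auto
   have "D n = 0" "D 0 = seg_int w x y"
   proof -
    have "y \<in> S" "n > 0" using y e n N(1) by auto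
    moreover have "h (1, x) \<in> S" using h(2) x by (auto simp: image_subset_iff)
    then have "linear (w c)" using h(4)[OF x] lin[of c] by simp
    ultimately show "D n = 0" using x \<open>linear (w c)\<close> by (simp add: D_def h(4) seg_int_def linear_0)
    show "D 0 = seg_int w x y" using \<open>y \<in> S\<close> x by (simp add: D_def h(3))
   qed
   then show ?thesis using * sum_lessThan_telescope[of D n] by (simp add: algebra_simps)
  qed
  \<comment> \<open>Each block of \<open>k\<close> short edges stays in the ball containing the long
    edge, so both integrals are the same difference of values of a primitive.\<close>
  have 2: "G (n * k) x = G n x" if n: "n \<ge> N" and k: "k > 0" for n k
  proof -
   have n0: "n > 0" using n N by simp
   define g where "g j = seg_int w (h (real j / real (n * k), x)) (h (real (Suc j) / real (n * k), x))" for j :: nat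
   have "G (n * k) x = (\<Sum>i<n. sum g {i * k..<i * k + k})"
    unfolding G_def g_def[symmetric] by (rule sum.nat_group[symmetric])
   also have "\<dots> = G n x"
    unfolding G_def
   proof (intro sum.cong refl)
    fix i assume "i \<in> {..<n}"
    then have i: "i < n" by simp
    let ?t = "real i / real n"
    have t: "?t \<in> {0..1}" using t01[of i n] i by auto
    obtain P where P: "!!x'. x' \<in> ball (h (?t, x)) \<delta> ==> (P has_derivative w x') (at x')"
     using prim[OF bS[OF t]] by blast
    have xe: "x \<in> ball x e" using e by simp
    note S = seg_int_primitive[OF convex_ball _ _ P]
    have m: "h (real j / real (n * k), x) \<in> ball (h (?t, x)) \<delta>" if "i * k \<le> j" "j \<le> i * k + k" for j
    proof -
     have nk: "real (n * k) > 0" using n0 k by simp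
     have jn: "j \<le> n * k"
     proof -
      have "i * k + k \<le> n * k" using i by (metis Suc_leI add.commute mult_Suc mult_le_mono1)
      then show ?thesis using that by simp
     qed
     have "?t = real (i * k) / real (n * k)" using k by simp
     then have "\<bar>real j / real (n * k) - ?t\<bar> = \<bar>real j - real (i * k)\<bar> / real (n * k)"
      using nk by (simp only: diff_divide_distrib[symmetric] abs_divide)
     also have "\<dots> \<le> real k / real (n * k)"
     proof (rule divide_right_mono)
      have "real (i * k) \<le> real j" "real j \<le> real (i * k) + real k"
       by (simp_all only: of_nat_le_iff of_nat_add[symmetric] that)
      then show "\<bar>real j - real (i * k)\<bar> \<le> real k" by linarith
     qed (use nk in simp)
     also have "\<dots> = 1 / real n" using k by simp
     finally show ?thesis using near[OF t t01[OF jn] _ n xe] by simp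
    qed
    have "sum g {i * k..<i * k + k} = (\<Sum>j = i * k..<i * k + k. P (h (real (Suc j) / real (n * k), x)) - P (h (real j / real (n * k), x)))"
    proof (rule sum.cong)
     fix j assume "j \<in> {i * k..<i * k + k}"
     then have j: "i * k \<le> j" "j \<le> i * k + k" "i * k \<le> Suc j" "Suc j \<le> i * k + k" by auto
     show "g j = P (h (real (Suc j) / real (n * k), x)) - P (h (real j / real (n * k), x))"
      unfolding g_def by (rule S[OF m[OF j(1,2)] m[OF j(3,4)]])
    qed simp
    also have "\<dots> = P (h (real (i * k + k) / real (n * k), x)) - P (h (real (i * k) / real (n * k), x))"
     by (rule sum_Suc_diff') simp
    also have "\<dots> = seg_int w (h (real (i * k) / real (n * k), x)) (h (real (i * k + k) / real (n * k), x))"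
    proof -
     have m0: "h (real (i * k) / real (n * k), x) \<in> ball (h (?t, x)) \<delta>" by (rule m) simp_all
     have m1: "h (real (i * k + k) / real (n * k), x) \<in> ball (h (?t, x)) \<delta>" by (rule m) simp_all
     show ?thesis using S[OF m0 m1] by simp
    qed
    also have "real (i * k) / real (n * k) = ?t" using k by simp
    also have "real (i * k + k) / real (n * k) = real (Suc i) / real n"
    proof -
     have "real (i * k + k) = real (Suc i) * real k" by (simp add: algebra_simps)
     then show ?thesis using k by (simp only: of_nat_mult) simp
    qed
    finally show "sum g {i * k..<i * k + k} = seg_int w (h (?t, x)) (h (real (Suc i) / real n, x))" .
   qed
   finally show ?thesis .
  qed
  show ?thesis using e N(1) 1 2 by blast
 qed
 define Q where "Q x e N \<longleftrightarrow> e > 0 \<and> N > 0 \<and> ball x e \<subseteq> S \<and>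
   (\<forall>n\<ge>N. \<forall>y\<in>ball x e. G n y = G n x - seg_int w x y) \<and> (\<forall>n\<ge>N. \<forall>k>0. G (n * k) x = G n x)" for x e and N :: nat
 have "\<forall>x\<in>S. \<exists>e N. Q x e N" using local unfolding Q_def by blast
 then obtain E N where "!!x. x \<in> S ==> Q x (E x) (N x)" by metis
 then have EN: "E x > 0" "N x > (0::nat)" "ball x (E x) \<subseteq> S"
   "!!n y. n \<ge> N x ==> y \<in> ball x (E x) ==> G n y = G n x - seg_int w x y" "!!n k. n \<ge> N x ==> k > 0 ==> G (n * k) x = G n x" if "x \<in> S" for x
  using that unfolding Q_def by blast+
 define F where "F x = - G (N x) x" for x
 \<comment> \<open>Two admissible numbers of edges are compared through their product, a common
   refinement.\<close>
 have GF: "G n x = - F x" if "x \<in> S" "n \<ge> N x" for n x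
 proof -
  have "n > 0" using EN(2)[OF that(1)] that(2) by linarith
  then have "G (N x * n) x = G (N x) x" by (intro EN(5)[OF that(1)] order_refl)
  moreover have "G (n * N x) x = G n x" by (intro EN(5)[OF that(1)] that(2) EN(2)[OF that(1)])
  ultimately show ?thesis by (simp add: F_def mult.commute)
 qed
 have "(F has_derivative w x) (at x)" if x: "x \<in> S" for x
 proof -
  note b = EN(3)[OF x] EN(1)[OF x]
  obtain P where P: "!!x'. x' \<in> ball x (E x) ==> (P has_derivative w x') (at x')"
   using prim[OF b(1)] by blast
  have "F y = F x + (P y - P x)" if y: "y \<in> ball x (E x)" for y
  proof -
   define n where "n = max (N x) (N y)"
   have "G n y = G n x - seg_int w x y" by (rule EN(4)[OF x _ y]) (simp add: n_def)
   moreover have "y \<in> S" using y b by auto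
   moreover have "seg_int w x y = P y - P x"
    by (rule seg_int_primitive[OF convex_ball _ y P]) (use b in auto)
   ultimately have "- F y = - F x - (P y - P x)" using GF[OF x, of n] GF[of y n] by (simp add: n_def)
   from arg_cong[OF this, of uminus] show ?thesis by simp
  qed
  note eq = this
  have xb: "x \<in> ball x (E x)" using b by simp
  have "((\<lambda>y. F x + (P y - P x)) has_derivative (\<lambda>v. 0 + (w x v - 0))) (at x)"
   by (rule has_derivative_add[OF has_derivative_const has_derivative_diff[OF P[OF xb] has_derivative_const]])
  then have "((\<lambda>y. F x + (P y - P x)) has_derivative w x) (at x)" by simp
  then show ?thesis
   by (rule has_derivative_transform_within_open[OF _ open_ball xb]) (rule eq[symmetric])
 qed
 then show ?thesis by blast
qed

section \<open>The exponential of a formal function\<close>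

text \<open>The ring of formal superfunctions is not commutative, so only the two summands are
  assumed to commute.\<close>

lemma commuting_binomial:
 fixes x y :: "'a::ring_1"
 assumes "x * y = y * x"
 shows "(x + y) ^ n = (\<Sum>k\<le>n. of_nat (n choose k) * (x ^ (n - k) * y ^ k))"
proof (induction n)
 case (Suc n)
 have yx: "y * x ^ k = x ^ k * y" for k
  using power_commuting_commutes[OF assms, of k] by simp
 define c where "c m k = (of_nat (m choose k) :: 'a)" for m k
 have cc: "z * c m k = c m k * z" for z m k by (simp add: c_def mult_of_nat_commute)
 have t1: "x * (c n k * (x ^ (n - k) * y ^ k)) = c n k * (x ^ (Suc n - k) * y ^ k)" if "k \<le> n" for k
 proof -
  have "x * (c n k * (x ^ (n - k) * y ^ k)) = c n k * ((x * x ^ (n - k)) * y ^ k)"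
   by (simp only: mult.assoc[symmetric] cc)
  then show ?thesis using that by (simp add: Suc_diff_le)
 qed
 have t2: "y * (c n k * (x ^ (n - k) * y ^ k)) = c n k * (x ^ (n - k) * y ^ Suc k)" for k
 proof -
  have "y * (c n k * (x ^ (n - k) * y ^ k)) = c n k * ((y * x ^ (n - k)) * y ^ k)"
   by (simp only: mult.assoc[symmetric] cc)
  then show ?thesis by (simp add: yx mult.assoc)
 qed
 have "(x + y) ^ Suc n = (\<Sum>k\<le>n. x * (c n k * (x ^ (n - k) * y ^ k))) + (\<Sum>k\<le>n. y * (c n k * (x ^ (n - k) * y ^ k)))"
  unfolding power_Suc Suc.IH distrib_right sum_distrib_left sum.distrib c_def ..
 also have "(\<Sum>k\<le>n. x * (c n k * (x ^ (n - k) * y ^ k))) = (\<Sum>k\<le>n. c n k * (x ^ (Suc n - k) * y ^ k))"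
  by (intro sum.cong refl t1) simp
 also have "(\<Sum>k\<le>n. y * (c n k * (x ^ (n - k) * y ^ k))) = (\<Sum>k\<le>n. c n k * (x ^ (n - k) * y ^ Suc k))"
  by (intro sum.cong refl t2)
 also have "(\<Sum>k\<le>n. c n k * (x ^ (Suc n - k) * y ^ k)) = x ^ Suc n + (\<Sum>k<n. c n (Suc k) * (x ^ (n - k) * y ^ Suc k))"
  by (subst lessThan_Suc_atMost[symmetric], subst sum.lessThan_Suc_shift) (simp add: c_def)
 also have "(\<Sum>k\<le>n. c n k * (x ^ (n - k) * y ^ Suc k)) = (\<Sum>k<n. c n k * (x ^ (n - k) * y ^ Suc k)) + y ^ Suc n"
  by (simp add: lessThan_Suc_atMost[symmetric] c_def)
 also have "x ^ Suc n + (\<Sum>k<n. c n (Suc k) * (x ^ (n - k) * y ^ Suc k)) + ((\<Sum>k<n. c n k * (x ^ (n - k) * y ^ Suc k)) + y ^ Suc n)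
   = x ^ Suc n + (\<Sum>k<n. c (Suc n) (Suc k) * (x ^ (n - k) * y ^ Suc k)) + y ^ Suc n"
  by (simp add: c_def sum.distrib distrib_right algebra_simps)
 also have "\<dots> = (\<Sum>k\<le>Suc n. c (Suc n) k * (x ^ (Suc n - k) * y ^ k))"
  by (subst lessThan_Suc_atMost[symmetric], subst sum.lessThan_Suc_shift) (simp add: c_def binomial_eq_0)
 finally show ?case by (simp add: c_def)
qed simp

lemma fls_sum_nth: "(\<Sum>i\<in>S. f i :: ('m::finite, 'd::{finite,linorder}) formal) $$ n = (\<Sum>i\<in>S. f i $$ n)"
proof (induction S rule: infinite_finite_induct)
 case (insert x F)
 show ?case unfolding sum.insert[OF insert(1,2)] fls_plus_nth insert(3) ..
qed (simp_all only: sum.infinite sum.empty fls_zero_nth not_False_eq_True)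

text \<open>Order in nu plus degree in the odd coordinates is at least \<open>k\<close>.\<close>

definition filt :: "nat \<Rightarrow> ('m::finite, 'd::{finite,linorder}) formal \<Rightarrow> bool" where
 "filt k f \<longleftrightarrow> (\<forall>n z I J. n + int (card I) + int (card J) < int k \<or> n < 0 --> gcoeff ((f $$ n) z) I J = 0)"

lemma filt_mult:
 fixes f g :: "('m::finite, 'd::{finite,linorder}) formal"
 assumes "filt k f" "filt l g"
 shows "filt (k + l) (f * g)"
 unfolding filt_def
proof (intro allI impI)
 fix n z and A B :: "'d set" assume *: "n + int (card A) + int (card B) < int (k + l) \<or> n < 0"
 have f0: "(f $$ j) z = 0" "(g $$ j) z = 0" if "j < 0" for j
  by (rule grass_eqI, use assms that in \<open>simp add: filt_def\<close>)+
 have "((f * g) $$ n) z = (\<Sum>j = 0..n - 0. (f $$ (n - j)) z * (g $$ j) z)"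
  by (rule fls_mult_nth_at) (use f0 in auto)
 moreover have "gcoeff ((f $$ (n - j)) z * (g $$ j) z) A B = 0" if "j \<in> {0..n - 0}" for j
  unfolding gcoeff_mult
 proof (intro sum.neutral ballI)
  fix I J assume IJ: "I \<in> Pow A" "J \<in> Pow B"
  have c: "card A = card I + card (A - I)" "card B = card J + card (B - J)"
   using IJ by (simp_all add: card_Diff_subset card_mono finite_subset)
  have "n - j + int (card I) + int (card J) < int k \<or> j + int (card (A - I)) + int (card (B - J)) < int l"
   using * that c by auto
  then have d: "gcoeff ((f $$ (n - j)) z) I J = 0 \<or> gcoeff ((g $$ j) z) (A - I) (B - J) = 0"
  proof (elim disjE)
   assume "n - j + int (card I) + int (card J) < int k"
   then show ?thesis using assms(1)[unfolded filt_def, rule_format, of "n - j" I J z] by simp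
  next
   assume "j + int (card (A - I)) + int (card (B - J)) < int l"
   then show ?thesis using assms(2)[unfolded filt_def, rule_format, of j "A - I" "B - J" z] by simp
  qed
  show "mono_sign I J (A - I) (B - J) * (gcoeff ((f $$ (n - j)) z) I J * gcoeff ((g $$ j) z) (A - I) (B - J)) = 0"
   using d by (elim disjE) simp_all
 qed
 ultimately show "gcoeff (((f * g) $$ n) z) A B = 0" by (simp add: gcoeff_sum)
qed

lemma filt_power: "filt 1 f ==> filt j (f ^ j)"
proof (induction j)
 case 0
 show ?case by (auto simp: filt_def)
next
 case (Suc j)
 then show ?case using filt_mult[of 1 f j "f ^ j"] by simp
qed

definition fpd :: "('m::finite, 'd::{finite,linorder}) dir \<Rightarrow> ('m, 'd) formal \<Rightarrow> ('m, 'd) formal" where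
 "fpd i = fls_map (pd i)"

lemma fpd_nth [simp]: "fpd i f $$ n = pd i (f $$ n)"
 unfolding fpd_def by (rule fls_map_nth) simp

lemma f_d_fpd: "f_dz k = fpd (DZ k)" "f_dzbar l = fpd (DZb l)" "f_dtheta \<alpha> = fpd (DT \<alpha>)" "f_dthetabar \<beta> = fpd (DTb \<beta>)"
 by (simp_all add: f_dz_def f_dzbar_def f_dtheta_def f_dthetabar_def fpd_def)

definition fpar :: "('m::finite, 'd::{finite,linorder}) formal \<Rightarrow> ('m, 'd) formal" where
 "fpar = fls_map spar"

lemma spar_0 [simp]: "spar 0 = 0" by (simp add: sg_def fun_eq_iff)

lemma fpar_nth [simp]: "fpar f $$ n = spar (f $$ n)"
 unfolding fpar_def by (rule fls_map_nth) simp

definition fsgd :: "('m::finite, 'd::{finite,linorder}) dir \<Rightarrow> ('m, 'd) formal \<Rightarrow> ('m, 'd) formal" where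
 "fsgd i f = (if oddd i then fpar f else f)"

lemma fsgd_nth [simp]: "fsgd i f $$ n = sgd i (f $$ n)"
 by (simp add: fsgd_def sgd_def)

lemma eq_on_power: "eq_on V f g ==> eq_on V (f ^ k) (g ^ k)"
 by (induction k) (auto intro: eq_on_mult)

section \<open>Derivatives, parity and the exponential of formal functions\<close>

context dom
begin

lemma fdo_fpd: "fdo (fpd i)"
 by (rule fdo_coeffwise[OF diff_op_pd[of U i]]) simp

lemma fdo_fpar: "fdo fpar"
 by (rule fdo_coeffwise[OF diff_op_sg[of U "Suc 0" "Suc 0"]]) simp

lemma fdo_fsgd: "fdo (fsgd i)"
 by (rule fdo_coeffwise[OF diff_op_sgd[of U i]]) simp

lemma FF_fpd [simp]: "f \<in> FF ==> fpd i f \<in> FF" by (rule fdo_closed[OF fdo_fpd])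
lemma FF_fpar [simp]: "f \<in> FF ==> fpar f \<in> FF" by (rule fdo_closed[OF fdo_fpar])
lemma FF_fsgd [simp]: "f \<in> FF ==> fsgd i f \<in> FF" by (rule fdo_closed[OF fdo_fsgd])

lemma FF_power [simp]: "f \<in> FF ==> f ^ k \<in> FF"
 by (induction k) auto

lemma fpd_mult:
 fixes f g :: "('m, 'b::{finite,linorder}) formal"
 assumes "f \<in> FF" "g \<in> FF"
 shows "eq_on U (fpd i (f * g)) (fpd i f * g + fsgd i f * fpd i g)"
proof (rule eq_onI)
 fix n z assume z: "z \<in> U"
 define s where "s = fls_subdegree g"
 define r where "r = fls_subdegree f"
 have fg: "((f' * g') $$ n) z = (\<Sum>j = s..n - r. (f' $$ (n - j)) z * (g' $$ j) z)"
  if "!!j. j < r ==> f' $$ j = 0" "!!j. j < s ==> g' $$ j = 0" for f' g' :: "('m, 'b) formal" and z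
  by (rule fls_mult_nth_at) (use that in auto)
 have e: "(f * g) $$ n = (\<Sum>j = s..n - r. f $$ (n - j) * g $$ j)"
  unfolding fun_eq_iff sum_fun_apply times_fun_apply by (intro allI fg) (simp_all add: r_def s_def)
 have "pd i ((f * g) $$ n) z = (\<Sum>j = s..n - r. pd i (f $$ (n - j) * g $$ j) z)"
  unfolding e using assms by (intro pd_sum[OF oU z] sf_smooth_mult oU) auto
 also have "\<dots> = (\<Sum>j = s..n - r. pd i (f $$ (n - j)) z * (g $$ j) z + sgd i (f $$ (n - j)) z * pd i (g $$ j) z)"
  using assms by (intro sum.cong refl pd_mult[OF z]) auto
 also have "\<dots> = ((fpd i f * g) $$ n) z + ((fsgd i f * fpd i g) $$ n) z"
  by (subst (1 2) fg) (auto simp: r_def s_def sum.distrib sgd_def)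
 finally show "(fpd i (f * g) $$ n) z = ((fpd i f * g + fsgd i f * fpd i g) $$ n) z" by simp
qed

lemma fpar_mult:
 fixes f g :: "('m, 'b::{finite,linorder}) formal"
 shows "eq_on V (fpar (f * g)) (fpar f * fpar g)"
proof (rule eq_onI)
 fix n z
 define s where "s = fls_subdegree g"
 define r where "r = fls_subdegree f"
 have fg: "((f' * g') $$ n) z = (\<Sum>j = s..n - r. (f' $$ (n - j)) z * (g' $$ j) z)"
  if "!!j. j < r ==> f' $$ j = 0" "!!j. j < s ==> g' $$ j = 0" for f' g' :: "('m, 'b) formal"
  by (rule fls_mult_nth_at) (use that in auto)
 have gs: "gpar (\<Sum>j\<in>S. h j) = (\<Sum>j\<in>S. gpar (h j))" for S and h :: "int \<Rightarrow> 'b grass"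
  by (induction S rule: infinite_finite_induct) auto
 have e: "((f * g) $$ n) z = (\<Sum>j = s..n - r. (f $$ (n - j)) z * (g $$ j) z)"
  by (rule fg) (simp_all add: r_def s_def)
 have "(fpar (f * g) $$ n) z = gpar (\<Sum>j = s..n - r. (f $$ (n - j)) z * (g $$ j) z)"
  by (simp only: fpar_nth sg_def e)
 also have "\<dots> = ((fpar f * fpar g) $$ n) z"
  by (subst fg) (auto simp: r_def s_def gs gsg_mult sg_def)
 finally show "(fpar (f * g) $$ n) z = ((fpar f * fpar g) $$ n) z" .
qed

lemma fls_mult_commute_even:
 fixes f g :: "('m, 'b::{finite,linorder}) formal"
 assumes "eq_on V (fpar f) f"
 shows "eq_on V (f * g) (g * f)"
proof (rule eq_onI)
 fix n z assume z: "z \<in> V"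
 have e: "(f $$ j) z * (g $$ k) z = (g $$ k) z * (f $$ j) z" for j k
  by (rule geven_commute) (use eq_onD[OF assms z, of j] in \<open>simp add: sg_def\<close>)
 have "((f * g) $$ n) z = (\<Sum>j = fls_subdegree g..n - fls_subdegree f. (f $$ (n - j)) z * (g $$ j) z)"
  by (rule fls_mult_nth_at) auto
 also have "\<dots> = (\<Sum>j = fls_subdegree f..n - fls_subdegree g. (g $$ (n - j)) z * (f $$ j) z)"
  by (rule sum.reindex_bij_witness[where i = "\<lambda>j. n - j" and j = "\<lambda>r. n - r"]) (auto simp: e)
 also have "\<dots> = ((g * f) $$ n) z"
  by (rule fls_mult_nth_at[symmetric]) auto
 finally show "((f * g) $$ n) z = ((g * f) $$ n) z" .
qed

lemma fls_mult_commute_odd: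
 fixes f g :: "('m, 'b::{finite,linorder}) formal"
 assumes "eq_on V (fpar f) (- f)"
 shows "eq_on V (f * g) (fpar g * f)"
proof (rule eq_onI)
 fix n z assume z: "z \<in> V"
 have e: "(f $$ j) z * (g $$ k) z = gpar ((g $$ k) z) * (f $$ j) z" for j k
  by (rule godd_commute) (use eq_onD[OF assms z, of j] in \<open>simp add: sg_def\<close>)
 have "((f * g) $$ n) z = (\<Sum>j = fls_subdegree g..n - fls_subdegree f. (f $$ (n - j)) z * (g $$ j) z)"
  by (rule fls_mult_nth_at) auto
 also have "\<dots> = (\<Sum>j = fls_subdegree f..n - fls_subdegree g. (fpar g $$ (n - j)) z * (f $$ j) z)"
  by (rule sum.reindex_bij_witness[where i = "\<lambda>j. n - j" and j = "\<lambda>r. n - r"]) (auto simp: e sg_def)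
 also have "\<dots> = ((fpar g * f) $$ n) z"
  by (rule fls_mult_nth_at[symmetric]) (auto simp: sg_def)
 finally show "((f * g) $$ n) z = ((fpar g * f) $$ n) z" .
qed

context
 fixes Z :: "('m, 'd::{finite,linorder}) formal"
 assumes ZF: "Z \<in> FF" and Zneg: "!!n z. n < 0 ==> z \<in> U ==> (Z $$ n) z = 0" and Zeven: "eq_on U (fpar Z) Z"
begin

text \<open>\<open>Z\<close> splits on \<open>U\<close> into its numerical part \<open>eb\<close> and the topologically nilpotent \<open>en\<close>.\<close>

definition eb :: "complex^'m \<Rightarrow> complex" where "eb z = gcoeff ((Z $$ 0) z) {} {}"

definition en :: "('m, 'd) formal" where
 "en = Abs_fls (\<lambda>n. if n < 0 then 0 else if n = 0 then (\<lambda>z. gnil ((Z $$ 0) z)) else Z $$ n)"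

lemma en_nth: "en $$ n = (if n < 0 then 0 else if n = 0 then (\<lambda>z. gnil ((Z $$ 0) z)) else Z $$ n)"
 unfolding en_def by (rule nth_Abs_fls_lower_bound[of 0]) simp

lemma Z_split: "eq_on U Z (cst (\<lambda>z. gconst (eb z)) + en)"
proof (rule eq_onI)
 fix n z assume z: "z \<in> U"
 show "(Z $$ n) z = ((cst (\<lambda>z. gconst (eb z)) + en) $$ n) z"
  by (rule grass_eqI) (use Zneg[of n z] z in \<open>auto simp: en_nth eb_def gnil_def\<close>)
qed

lemma filt_en: "filt 1 en"
 unfolding filt_def
proof (intro allI impI)
 fix n z and I J :: "'d set" assume *: "n + int (card I) + int (card J) < int 1 \<or> n < 0"
 have "n < 0 \<or> n = 0 \<and> card I = 0 \<and> card J = 0" using * by linarith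
 then consider "n < 0" | "n = 0" "I = {}" "J = {}" by auto
 then show "gcoeff ((en $$ n) z) I J = 0" by cases (auto simp: en_nth gnil_def)
qed

text \<open>A nonzero coefficient of \<open>en ^ j\<close> at nu^n needs j <= n + |I| + |J|, and |I|
  + |J| is at most twice the number of odd generators of one kind.\<close>

definition edeg :: "int \<Rightarrow> nat" where "edeg n = nat n + 2 * card (UNIV :: 'd set)"

lemma en_power_0:
 assumes "j > edeg n"
 shows "((en ^ j) $$ n) z = 0"
proof (rule grass_eqI)
 fix I J :: "'d set"
 have "card I \<le> card (UNIV :: 'd set)" "card J \<le> card (UNIV :: 'd set)" by (auto intro: card_mono)
 then have "n + int (card I) + int (card J) < int j \<or> n < 0" using assms by (auto simp: edeg_def)
 then show "gcoeff (((en ^ j) $$ n) z) I J = gcoeff 0 I J"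
  using filt_power[OF filt_en, of j] unfolding filt_def by auto
qed

lemma eb_smooth: "smooth_on U eb"
 using sf_smoothD[OF FF_nth[OF ZF, of 0], of "{}" "{}"] by (simp add: eb_def[abs_def])

lemma en_FF: "en \<in> FF"
proof -
 have n0: "(\<lambda>z. gnil ((Z $$ 0) z)) \<in> sf_smooth U"
 proof (rule sf_smoothI)
  fix I J show "smooth_on U (\<lambda>z. gcoeff (gnil ((Z $$ 0) z)) I J)"
   using sf_smoothD[OF FF_nth[OF ZF, of 0], of I J] by (cases "I = {}"; cases "J = {}") (simp_all add: gnil_def)
 qed
 have "en $$ n \<in> sf_smooth U" for n
 proof -
  show ?thesis
  proof (cases "n < 0")
   case True
   show ?thesis unfolding en_nth if_P[OF True] by (rule sf_smooth_0)
  next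
   case False
   note n = if_not_P[OF False]
   show ?thesis
   proof (cases "n = 0")
    case True
    show ?thesis unfolding en_nth n if_P[OF True] by (rule n0)
   next
    case False
    show ?thesis unfolding en_nth n if_not_P[OF False] by (rule FF_nth[OF ZF])
   qed
  qed
 qed
 then show ?thesis unfolding formal_funs_def by (intro CollectI allI)
qed

text \<open>Partial sums of the exponential series of the nilpotent part; by
  \<open>epart_stable\<close> the coefficient at nu^n no longer changes from m =
  \<open>edeg n\<close> on.\<close>

definition epart :: "nat \<Rightarrow> ('m, 'd) formal" where
 "epart m = (\<Sum>j\<le>m. cst (sconst (1 / fact j)) * en ^ j)"

lemma epart_nth_at: "(epart m $$ n) z = (\<Sum>j\<le>m. gconst (1 / fact j) * ((en ^ j) $$ n) z)"
 by (simp add: epart_def fls_sum_nth sum_fun_apply)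

lemma epart_stable: "m \<ge> edeg n ==> (epart m $$ n) z = (epart (edeg n) $$ n) z"
 unfolding epart_nth_at by (rule sum.mono_neutral_right) (auto simp: en_power_0)

lemma fls_const_gconst_power: "cst (\<lambda>z. gconst (c z)) ^ k = cst (\<lambda>z. gconst (c z ^ k) :: 'd grass)"
proof (induction k)
 case 0
 have "(\<lambda>z. gconst (1 :: complex) :: 'd grass) = 1" by (simp add: fun_eq_iff)
 then show ?case by simp
next
 case (Suc k)
 have "(\<lambda>z. gconst (c z)) * (\<lambda>z. gconst (c z ^ k)) = (\<lambda>z. gconst (c z ^ Suc k) :: 'd grass)"
  by (simp add: fun_eq_iff gconst_mult)
 then show ?case using Suc.IH by simp
qed

text \<open>The numerical part commutes with \<open>en\<close>, so the series is a Cauchy product.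
  In each coefficient the factor from \<open>en\<close> is a finite sum, and only the scalar
  exponential series has to converge.\<close>

lemma formal_exp_nth:
 assumes z: "z \<in> U" and n: "n \<ge> 0"
 shows "(formal_exp Z $$ n) z = gconst (exp (eb z)) * (epart (edeg n) $$ n) z"
proof (rule grass_eqI)
 fix I J :: "'d set"
 define x where "x = cst (\<lambda>z. gconst (eb z) :: 'd grass)"
 have comm: "x * en = en * x"
  unfolding x_def by (rule fls_eqI) (simp add: fun_eq_iff gconst_commute)
 define b where "b j = gcoeff (((en ^ j) $$ n) z) I J / fact j" for j
 define a where "a i = eb z ^ i / fact i" for i :: nat
 have b0: "b j = 0" if "j > edeg n" for j using en_power_0[OF that] by (simp add: b_def)
 have "gcoeff (((Z ^ k) $$ n) z) I J / fact k = (\<Sum>j\<le>k. a (k - j) * b j)" for k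
 proof -
  have "((Z ^ k) $$ n) z = (((x + en) ^ k) $$ n) z"
   using eq_onD[OF eq_on_power[OF Z_split, of k] z, of n] by (simp add: x_def)
  also have "(x + en) ^ k = (\<Sum>j\<le>k. of_nat (k choose j) * (x ^ (k - j) * en ^ j))"
   by (rule commuting_binomial[OF comm])
  also have "(\<dots> $$ n) z = (\<Sum>j\<le>k. gconst (of_nat (k choose j)) * (gconst (eb z ^ (k - j)) * ((en ^ j) $$ n) z))"
  proof -
   have nat: "of_nat m = (cst (sconst (of_nat m)) :: ('m, 'd) formal)" for m
    by (induction m) (auto simp: sconst_def gconst_add fls_eq_iff fun_eq_iff)
   show ?thesis
    unfolding x_def fls_const_gconst_power nat by (simp add: fls_sum_nth sum_fun_apply)
  qed
  finally have "gcoeff (((Z ^ k) $$ n) z) I J / fact k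
    = (\<Sum>j\<le>k. of_nat (k choose j) * (eb z ^ (k - j) * gcoeff (((en ^ j) $$ n) z) I J)) / fact k"
   by (simp add: gcoeff_sum)
  also have "\<dots> = (\<Sum>j\<le>k. a (k - j) * b j)"
   unfolding sum_divide_distrib
   by (intro sum.cong refl) (simp add: a_def b_def binomial_fact)
  finally show ?thesis .
 qed
 then have "(\<Sum>k. gcoeff (((Z ^ k) $$ n) z) I J / fact k) = (\<Sum>k. \<Sum>j\<le>k. a (k - j) * b j)" by simp
 also have "\<dots> = (\<Sum>k. \<Sum>j\<le>k. a j * b (k - j))"
 proof -
  have "(\<Sum>j\<le>k. a (k - j) * b j) = (\<Sum>j\<le>k. a j * b (k - j))" for k
   by (rule sum.reindex_bij_witness[where i = "\<lambda>j. k - j" and j = "\<lambda>j. k - j"]) auto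
  then show ?thesis by simp
 qed
 also have "\<dots> = (\<Sum>k. a k) * (\<Sum>k. b k)"
 proof (rule Cauchy_product[symmetric])
  have "summable (\<lambda>i. norm (eb z ^ i /\<^sub>R fact i))" by (rule summable_norm_exp)
  then show "summable (\<lambda>i. norm (a i))"
   by (simp add: a_def divide_inverse norm_mult norm_inverse mult.commute)
  show "summable (\<lambda>i. norm (b i))"
   by (rule summable_finite[of "{..edeg n}"]) (use b0 in auto)
 qed
 also have "(\<Sum>k. a k) = exp (eb z)"
  by (simp add: exp_def a_def scaleR_conv_of_real divide_inverse mult.commute)
 also have "(\<Sum>k. b k) = (\<Sum>j\<le>edeg n. b j)"
  by (rule suminf_finite) (use b0 in auto)
 finally have "(\<Sum>k. gcoeff (((Z ^ k) $$ n) z) I J / fact k) = exp (eb z) * (\<Sum>j\<le>edeg n. b j)" .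
 moreover have "gcoeff ((formal_exp Z $$ n) z) I J = (\<Sum>k. gcoeff (((Z ^ k) $$ n) z) I J / fact k)"
  using n by (simp add: formal_exp_def)
 ultimately show "gcoeff ((formal_exp Z $$ n) z) I J = gcoeff (gconst (exp (eb z)) * (epart (edeg n) $$ n) z) I J"
  by (simp add: epart_nth_at gcoeff_sum b_def)
qed

lemma formal_exp_nth_neg: "n < 0 ==> formal_exp Z $$ n = 0"
 by (simp add: formal_exp_def)

definition eexp :: "('m, 'd) sfun" where "eexp z = gconst (exp (eb z))"

lemma epart_FF: "epart m \<in> FF"
proof -
 have "(\<Sum>j\<in>S. cst (sconst (1 / fact j)) * en ^ j) \<in> FF" for S :: "nat set"
 proof (induction S rule: infinite_finite_induct)
  case (insert j S)
  show ?case unfolding sum.insert[OF insert(1,2)]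
   by (rule FF_add[OF FF_mult[OF FF_const[OF sf_smooth_sconst] FF_power[OF en_FF]] insert(3)])
 qed simp_all
 then show ?thesis by (simp add: epart_def)
qed

lemma gconst_smooth: "smooth_on U c ==> (\<lambda>z. gconst (c z) :: 'd grass) \<in> sf_smooth U"
proof (rule sf_smoothI)
 fix I J assume "smooth_on U c"
 then show "smooth_on U (\<lambda>z. gcoeff (gconst (c z) :: 'd grass) I J)" by (cases "I = {}"; cases "J = {}") simp_all
qed

lemma eexp_smooth: "eexp \<in> sf_smooth U"
 using gconst_smooth[OF smooth_on_exp[OF oU eb_smooth]] by (simp add: eexp_def[abs_def])

lemma formal_exp_at:
 assumes "z \<in> U" "m \<ge> edeg n"
 shows "(formal_exp Z $$ n) z = ((cst eexp * epart m) $$ n) z"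
proof (cases "n < 0")
 case True
 have "((en ^ j) $$ n) z = 0" for j
  by (rule grass_eqI) (use filt_power[OF filt_en, of j] True in \<open>auto simp: filt_def\<close>)
 then show ?thesis using True by (simp add: formal_exp_nth_neg epart_nth_at)
next
 case False
 then show ?thesis using formal_exp_nth[OF assms(1), of n] epart_stable[OF assms(2)] by (simp add: eexp_def)
qed

lemma formal_exp_FF: "formal_exp Z \<in> FF"
 unfolding formal_funs_def
proof (rule CollectI, rule allI)
 fix n
 have "cst eexp * epart (edeg n) \<in> FF" using eexp_smooth epart_FF by simp
 then show "formal_exp Z $$ n \<in> sf_smooth U"
  using formal_exp_at[OF _ order_refl, of _ n] by (intro sf_smooth_cong[OF oU FF_nth]) auto
qed

lemma pd_gconst:
 assumes "smooth_on U c" "z \<in> U"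
 shows "pd i (\<lambda>z. gconst (exp (c z))) z = pd i (\<lambda>z. gconst (c z)) z * gconst (exp (c z) :: complex)"
proof -
 have wd: "wd s k (\<lambda>z. exp (c z)) z = wd s k c z * exp (c z)" for s k
 proof -
  have "((\<lambda>z. exp (c z)) has_derivative (\<lambda>v. exp (c z) * frechet_derivative c (at z) v)) (at z)"
   using smooth_on_has_derivative[OF assms] DERIV_exp[of "c z"]
   by (auto intro: has_derivative_compose simp: has_field_derivative_def)
  from frechet_derivative_at'[OF this] show ?thesis by (simp add: wd_def algebra_simps)
 qed
 have "epd s k (\<lambda>z. gconst (exp (c z))) z = epd s k (\<lambda>z. gconst (c z)) z * gconst (exp (c z))" for s k
 proof (rule grass_eqI)
  fix I J
  show "gcoeff (epd s k (\<lambda>z. gconst (exp (c z))) z) I J = gcoeff (epd s k (\<lambda>z. gconst (c z)) z * gconst (exp (c z))) I J"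
   unfolding gconst_commute by (cases "I = {}"; cases "J = {}") (simp_all add: wd)
 qed
 then have "pd (DZ k) (\<lambda>z. gconst (exp (c z))) z = pd (DZ k) (\<lambda>z. gconst (c z)) z * gconst (exp (c z))"
  "pd (DZb k) (\<lambda>z. gconst (exp (c z))) z = pd (DZb k) (\<lambda>z. gconst (c z)) z * gconst (exp (c z))" for k
  by (simp_all only: pd_epd)
 then show ?thesis
  by (cases i) (simp_all only:, simp_all add: sf_dtheta_def sf_dthetabar_def)
qed

lemma fpar_en: "eq_on U (fpar en) en"
proof (rule eq_onI)
 fix n z assume z: "z \<in> U"
 have "gpar ((Z $$ n) z) = (Z $$ n) z" using eq_onD[OF Zeven z, of n] by (simp add: sg_def)
 moreover have "gpar (gnil ((Z $$ 0) z)) = gnil (gpar ((Z $$ 0) z))" by (rule grass_eqI) (simp add: gnil_def)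
 ultimately show "(fpar en $$ n) z = (en $$ n) z" by (auto simp: en_nth sg_def)
qed

lemma fpd_en_power: "eq_on U (fpd i (en ^ Suc j)) (of_nat (Suc j) * (fpd i en * en ^ j))"
proof (induction j)
 case (Suc j)
 have c: "eq_on U (en * g) (g * en)" for g by (rule fls_mult_commute_even[OF fpar_en])
 have "eq_on U (fpd i (en * en ^ Suc j)) (fpd i en * en ^ Suc j + fsgd i en * fpd i (en ^ Suc j))"
  by (rule fpd_mult) (use en_FF in auto)
 also have "eq_on U \<dots> (fpd i en * en ^ Suc j + en * (of_nat (Suc j) * (fpd i en * en ^ j)))"
 proof (intro eq_on_add eq_on_mult eq_on_refl Suc.IH)
  show "eq_on U (fsgd i en) en" using fpar_en by (simp add: fsgd_def)
 qed
 also have "en * (of_nat (Suc j) * (fpd i en * en ^ j)) = of_nat (Suc j) * (en * (fpd i en * en ^ j))"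
 proof -
  have "en * of_nat (Suc j) = of_nat (Suc j) * en" by (rule mult_of_nat_commute[symmetric])
  then show ?thesis by (simp only: mult.assoc[symmetric])
 qed
 also have "eq_on U (fpd i en * en ^ Suc j + of_nat (Suc j) * (en * (fpd i en * en ^ j)))
   (fpd i en * en ^ Suc j + of_nat (Suc j) * ((fpd i en * en ^ j) * en))"
  by (intro eq_on_add eq_on_mult eq_on_refl c)
 also have "fpd i en * en ^ Suc j + of_nat (Suc j) * ((fpd i en * en ^ j) * en) = of_nat (Suc (Suc j)) * (fpd i en * en ^ Suc j)"
  by (simp add: mult.assoc power_commutes distrib_right)
 finally show ?case by simp
qed simp

text \<open>Differentiation lowers the power of \<open>en\<close> by one, so the partial sum loses a
  term. This is harmless once \<open>m\<close> is beyond \<open>edeg\<close>.\<close>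

lemma fpd_epart: "eq_on U (fpd i (epart (Suc m))) (fpd i en * epart m)"
proof (rule eq_onI)
 fix n z assume z: "z \<in> U"
 have pc: "pd i (sconst c * f) z = gconst c * pd i f z" if "f \<in> sf_smooth U" for c f
  using pd_cmult[OF z that] by simp
 have "fpd i (epart (Suc m)) $$ n = pd i (\<Sum>j\<le>Suc m. sconst (1 / fact j) * (en ^ j) $$ n)"
  by (simp add: epart_def fls_sum_nth)
 then have "(fpd i (epart (Suc m)) $$ n) z = (\<Sum>j\<le>Suc m. gconst (1 / fact j) * pd i ((en ^ j) $$ n) z)"
  using en_FF by (simp only:) (subst pd_sum[OF oU z], auto simp: pc)
 also have "\<dots> = (\<Sum>j\<le>m. gconst (1 / fact (Suc j)) * pd i ((en ^ Suc j) $$ n) z)"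
 proof -
  have "pd i ((en ^ 0) $$ n) z = 0" by (cases "n = 0") auto
  then show ?thesis by (subst lessThan_Suc_atMost[symmetric], subst sum.lessThan_Suc_shift) (simp add: lessThan_Suc_atMost del: power_Suc)
 qed
 also have "\<dots> = (\<Sum>j\<le>m. gconst (1 / fact j) * ((fpd i en * en ^ j) $$ n) z)"
 proof (intro sum.cong refl)
  fix j
  have nat: "of_nat k = (cst (sconst (of_nat k)) :: ('m, 'd) formal)" for k
   by (induction k) (auto simp: sconst_def gconst_add fls_eq_iff fun_eq_iff)
  have "pd i ((en ^ Suc j) $$ n) z = gconst (of_nat (Suc j)) * ((fpd i en * en ^ j) $$ n) z"
   using eq_onD[OF fpd_en_power[of i j] z, of n] unfolding nat fpd_nth fls_mult_const_nth by simp
  then have "gconst (1 / fact (Suc j)) * pd i ((en ^ Suc j) $$ n) z = gconst (1 / fact (Suc j) * of_nat (Suc j)) * ((fpd i en * en ^ j) $$ n) z"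
   by (simp only: gconst_mult mult.assoc)
  moreover have "1 / fact (Suc j) * of_nat (Suc j) = (1 / fact j :: complex)"
   unfolding fact_Suc of_nat_mult using of_nat_neq_0[of j, where 'a = complex] by (simp del: of_nat_Suc)
  ultimately show "gconst (1 / fact (Suc j)) * pd i ((en ^ Suc j) $$ n) z = gconst (1 / fact j) * ((fpd i en * en ^ j) $$ n) z"
   by (simp only:)
 qed
 also have "\<dots> = ((fpd i en * epart m) $$ n) z"
 proof -
  have cc: "fpd i en * (cst (sconst c) * en ^ j) = cst (sconst c) * (fpd i en * en ^ j)" for c j
  proof -
   have "fpd i en * cst (sconst c) = cst (sconst c) * fpd i en"
    by (rule fls_eqI) (simp add: fun_eq_iff gconst_commute)
   then show ?thesis by (simp only: mult.assoc[symmetric])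
  qed
  show ?thesis by (simp add: epart_def sum_distrib_left cc fls_sum_nth sum_fun_apply)
 qed
 finally show "(fpd i (epart (Suc m)) $$ n) z = ((fpd i en * epart m) $$ n) z" .
qed

text \<open>For each single coefficient the exponential may be replaced by e^(eb) times a long
  enough partial sum, which is differentiated by the product rule. All factors involved are even, so
  no signs arise.\<close>

lemma fpd_formal_exp: "eq_on U (fpd i (formal_exp Z)) (fpd i Z * formal_exp Z)"
proof (rule eq_onI)
 fix n z assume z: "z \<in> U"
 define m where "m = edeg n"
 define c where "c = cst (\<lambda>z. gconst (eb z) :: 'd grass)"
 have cs: "c \<in> FF" unfolding c_def by (rule FF_const[OF gconst_smooth[OF eb_smooth]])
 have ee: "eq_on U (fpar (cst eexp)) (cst eexp)"
  by (rule eq_onI) (auto simp: sg_def eexp_def)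
 have "(fpd i (formal_exp Z) $$ n) z = (fpd i (cst eexp * epart (Suc m)) $$ n) z"
  unfolding fpd_nth by (rule pd_cong[OF oU z], rule formal_exp_at) (auto simp: m_def)
 also have "eq_on U (fpd i (cst eexp * epart (Suc m))) (fpd i c * (cst eexp * epart (Suc m)) + fpd i en * (cst eexp * epart m))"
 proof -
  have "eq_on U (fpd i (cst eexp * epart (Suc m))) (fpd i (cst eexp) * epart (Suc m) + fsgd i (cst eexp) * fpd i (epart (Suc m)))"
   by (rule fpd_mult) (use eexp_smooth epart_FF in auto)
  also have "eq_on U \<dots> (fpd i c * cst eexp * epart (Suc m) + cst eexp * (fpd i en * epart m))"
  proof (intro eq_on_add eq_on_mult eq_on_refl fpd_epart)
   show "eq_on U (fpd i (cst eexp)) (fpd i c * cst eexp)"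
   proof (rule eq_onI)
    fix k y assume y: "y \<in> U"
    show "(fpd i (cst eexp) $$ k) y = ((fpd i c * cst eexp) $$ k) y"
     using pd_gconst[OF eb_smooth y, of i] by (cases "k = 0") (simp_all add: c_def eexp_def[abs_def])
   qed
   show "eq_on U (fsgd i (cst eexp)) (cst eexp)" using ee by (simp add: fsgd_def)
  qed
  also have "eq_on U (fpd i c * cst eexp * epart (Suc m) + cst eexp * (fpd i en * epart m))
    (fpd i c * cst eexp * epart (Suc m) + (fpd i en * cst eexp) * epart m)"
   unfolding mult.assoc[of "cst eexp", symmetric]
   by (intro eq_on_add eq_on_mult eq_on_refl fls_mult_commute_even[OF ee])
  finally show ?thesis by (simp only: mult.assoc)
 qed
 from eq_onD[OF this z] have "(fpd i (cst eexp * epart (Suc m)) $$ n) z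
  = ((fpd i c * (cst eexp * epart (Suc m))) $$ n) z + ((fpd i en * (cst eexp * epart m)) $$ n) z" by simp
 also have "\<dots> = ((fpd i c * formal_exp Z) $$ n) z + ((fpd i en * formal_exp Z) $$ n) z"
 proof -
  \<comment> \<open>Since \<open>w\<close> has no poles, the coefficient at nu^n of the product
    involves the exponential only up to order n, where it agrees with the partial sum.\<close>
  have A: "((w * (cst eexp * epart M)) $$ n) z = ((w * formal_exp Z) $$ n) z"
   if w: "!!j. j < 0 ==> w $$ j = 0" and M: "M \<ge> m" for w :: "('m, 'd) formal" and M
  proof -
   have e: "(formal_exp Z $$ j) z = ((cst eexp * epart M) $$ j) z" if "j \<le> n" for j
    by (rule formal_exp_at[OF z]) (use that M in \<open>auto simp: m_def edeg_def\<close>)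
   define s where "s = min 0 (fls_subdegree (cst eexp * epart M))"
   have g0: "(cst eexp * epart M) $$ j = 0" if "j < s" for j
    using that unfolding s_def by (intro fls_eq0_below_subdegree) simp
   have "((w * (cst eexp * epart M)) $$ n) z = (\<Sum>j = s..n - 0. (w $$ (n - j)) z * ((cst eexp * epart M) $$ j) z)"
    by (rule fls_mult_nth_at) (simp_all only: g0 w zero_fun_apply)
   also have "\<dots> = (\<Sum>j = s..n - 0. (w $$ (n - j)) z * (formal_exp Z $$ j) z)"
    by (intro sum.cong refl) (use e in auto)
   also have "\<dots> = ((w * formal_exp Z) $$ n) z"
    by (rule fls_mult_nth_at[symmetric]) (use w in \<open>auto simp: s_def formal_exp_nth_neg\<close>)
   finally show ?thesis .
  qed
  show ?thesis by (subst A, simp add: c_def, simp, subst A) (auto simp: en_nth)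
 qed
 also have "\<dots> = ((fpd i Z * formal_exp Z) $$ n) z"
 proof -
  have "eq_on U (fpd i Z) (fpd i c + fpd i en)"
   using fdo_cong_U[OF fdo_fpd ZF _ Z_split] fdo_additive[OF fdo_fpd cs en_FF, of i] cs en_FF
   unfolding c_def by (blast intro: eq_on_trans FF_add)
  from eq_onD[OF eq_on_mult[OF this eq_on_refl] z] show ?thesis by (simp add: distrib_right)
 qed
 finally show "(fpd i (formal_exp Z) $$ n) z = ((fpd i Z * formal_exp Z) $$ n) z"
  using \<open>(fpd i (formal_exp Z) $$ n) z = (fpd i (cst eexp * epart (Suc m)) $$ n) z\<close> by simp
qed

end

end

section \<open>The super Poincare lemma\<close>

lemma frechet_derivative_wd:
 fixes f :: "complex^'m::finite \<Rightarrow> complex"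
 assumes "f differentiable (at x)"
 shows "frechet_derivative f (at x) u = (\<Sum>k\<in>UNIV. wd (- \<i>) k f x * vec_nth u k + wd \<i> k f x * cnj (vec_nth u k))"
proof -
 define L where "L = frechet_derivative f (at x)"
 have lin: "linear L"
  unfolding L_def by (rule linear_frechet_derivative[OF assms])
 have "u = (\<Sum>k\<in>UNIV. Re (vec_nth u k) *\<^sub>R axis k 1 + Im (vec_nth u k) *\<^sub>R axis k \<i>)" (is "u = ?r")
 proof (rule vec_eq_iff[THEN iffD2], rule allI)
  fix j
  have "vec_nth ?r j = (\<Sum>k\<in>UNIV. if k = j then Re (vec_nth u k) *\<^sub>R 1 + Im (vec_nth u k) *\<^sub>R \<i> else 0)"
   unfolding sum_component by (rule sum.cong) (auto simp: axis_def)
  also have "\<dots> = vec_nth u j" by (simp add: complex_eq_iff)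
  finally show "vec_nth u j = vec_nth ?r j" by (rule sym)
 qed
 then have "L u = L (\<Sum>k\<in>UNIV. Re (vec_nth u k) *\<^sub>R axis k 1 + Im (vec_nth u k) *\<^sub>R axis k \<i>)" by (rule arg_cong)
 also have "\<dots> = (\<Sum>k\<in>UNIV. Re (vec_nth u k) *\<^sub>R L (axis k 1) + Im (vec_nth u k) *\<^sub>R L (axis k \<i>))"
  by (simp only: linear_sum[OF lin] linear_add[OF lin] linear_cmul[OF lin])
 also have "\<dots> = (\<Sum>k\<in>UNIV. wd (- \<i>) k f x * vec_nth u k + wd \<i> k f x * cnj (vec_nth u k))"
 proof (rule sum.cong[OF refl])
  fix k
  obtain r s where u: "vec_nth u k = Complex r s" by (cases "vec_nth u k")
  obtain a b where ab: "L (axis k 1) = a" "L (axis k \<i>) = b" by simp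
  show "Re (vec_nth u k) *\<^sub>R L (axis k 1) + Im (vec_nth u k) *\<^sub>R L (axis k \<i>)
    = wd (- \<i>) k f x * vec_nth u k + wd \<i> k f x * cnj (vec_nth u k)"
   unfolding wd_def L_def[symmetric] ab u
   by (simp add: complex_eq_iff field_simps)
 qed
 finally show ?thesis by (simp add: L_def)
qed

text \<open>By \<open>frechet_derivative_wd\<close> the numbers \<open>wd \<i> k f z\<close> are the
  coefficients of the conjugate-linear part of the derivative, which vanishes exactly when the
  derivative is complex linear.\<close>

lemma hol_on_wd:
 fixes f :: "complex^'m::finite \<Rightarrow> complex"
 assumes "open V" "!!z. z \<in> V ==> f differentiable (at z)"
 shows "hol_on V f \<longleftrightarrow> (\<forall>z\<in>V. \<forall>k. wd \<i> k f z = 0)"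
proof
 assume h: "hol_on V f"
 show "\<forall>z\<in>V. \<forall>k. wd \<i> k f z = 0"
 proof (intro ballI allI)
  fix z k assume "z \<in> V"
  then obtain D where D: "(f has_derivative D) (at z)" "!!c v. D (c *s v) = c * D v" using h by (auto simp: hol_on_def)
  have "axis k \<i> = \<i> *s (axis k 1 :: complex^'m)" by (simp add: vec_eq_iff axis_def)
  then have "D (axis k \<i>) = \<i> * D (axis k 1)" using D(2) by simp
  then show "wd \<i> k f z = 0"
   unfolding wd_def frechet_derivative_at'[OF D(1)] by simp
 qed
next
 assume h: "\<forall>z\<in>V. \<forall>k. wd \<i> k f z = 0"
 show "hol_on V f"
  unfolding hol_on_def
 proof (intro ballI exI conjI allI)
  fix z assume z: "z \<in> V"
  show "(f has_derivative frechet_derivative f (at z)) (at z)" using assms(2)[OF z] by (simp add: frechet_derivative_works)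
  show "frechet_derivative f (at z) (c *s v) = c * frechet_derivative f (at z) v" for c v
   unfolding frechet_derivative_wd[OF assms(2)[OF z]] using h z by (simp add: sum_distrib_left algebra_simps)
 qed
qed

lemma wd_cnj:
 fixes f :: "complex^'m::finite \<Rightarrow> complex"
 assumes "f differentiable (at z)"
 shows "wd s k (\<lambda>z. cnj (f z)) z = cnj (wd (cnj s) k f z)"
proof -
 have "((\<lambda>z. cnj (f z)) has_derivative (\<lambda>v. cnj (frechet_derivative f (at z) v))) (at z)"
  using bounded_linear.has_derivative[OF bounded_linear_cnj frechet_derivative_works[THEN iffD1, OF assms]] .
 from frechet_derivative_at'[OF this] show ?thesis by (simp add: wd_def)
qed

lemma antihol_on_wd:
 fixes f :: "complex^'m::finite \<Rightarrow> complex"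
 assumes "open V" "!!z. z \<in> V ==> f differentiable (at z)"
 shows "antihol_on V f \<longleftrightarrow> (\<forall>z\<in>V. \<forall>k. wd (- \<i>) k f z = 0)"
proof -
 have d: "(\<lambda>z. cnj (f z)) differentiable (at z)" if "z \<in> V" for z
  using bounded_linear.has_derivative[OF bounded_linear_cnj frechet_derivative_works[THEN iffD1, OF assms(2)[OF that]]]
  unfolding differentiable_def by blast
 have "hol_on V (\<lambda>z. cnj (f z)) \<longleftrightarrow> (\<forall>z\<in>V. \<forall>k. wd \<i> k (\<lambda>z. cnj (f z)) z = 0)"
  by (rule hol_on_wd[OF assms(1) d])
 then show ?thesis
  by (simp add: antihol_on_def wd_cnj[OF assms(2)])
qed

context dom
begin

text \<open>The odd antiholomorphic derivatives vanish exactly if all coefficients with nonempty J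
  do; what then remains are the Cauchy-Riemann equations for J = {}.\<close>

lemma shol_sf_hol:
 fixes a :: "('m, 'b::{finite,linorder}) sfun"
 assumes "open V" "V \<subseteq> U" "a \<in> sf_smooth U"
 shows "shol V a \<longleftrightarrow> sf_hol V a"
proof -
 have d: "sf_coeff a I J differentiable (at z)" if "z \<in> V" for I J z
  using sf_smooth_differentiable[OF assms(3)] that assms(2) by (auto simp: sf_coeff_def)
 have g: "gcoeff (pd (DZb k) a z) I J = wd \<i> k (sf_coeff a I J) z" for k z I J
  by (simp only: pd_epd gcoeff_epd sf_coeff_def)
 show ?thesis
 proof
  assume s: "shol V a"
  have "wd \<i> k (sf_coeff a I {}) z = 0" if "z \<in> V" for k I z
  proof -
   have "pd (DZb k) a z = 0" using s[unfolded shol_def, THEN conjunct2, rule_format, of "DZb k" z] that by simp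
   then show ?thesis unfolding g[symmetric] by (simp only: gcoeff_simps)
  qed
  moreover have "sf_coeff a I J z = 0" if "J \<noteq> {}" "z \<in> V" for I J z
   using shol_gcoeff[OF s that(2,1)] by (simp add: sf_coeff_def)
  ultimately show "sf_hol V a" unfolding sf_hol_def using hol_on_wd[OF assms(1) d] by auto
 next
  assume s: "sf_hol V a"
  have n: "sf_coeff a I J z = 0" if "J \<noteq> {}" "z \<in> V" for I J z using s that unfolding sf_hol_def by blast
  have h: "wd \<i> k (sf_coeff a I {}) z = 0" if "z \<in> V" for k I z
   using s that hol_on_wd[OF assms(1) d] unfolding sf_hol_def by blast
  show "shol V a"
   unfolding shol_def
  proof (intro conjI allI impI ballI assms)
   fix i :: "('m, 'b) dir" and z assume i: "\<not> holo i" and z: "z \<in> V"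
   show "pd i a z = 0"
   proof (rule grass_eqI)
    fix I J :: "'b set"
    show "gcoeff (pd i a z) I J = gcoeff 0 I J"
    proof (cases i)
     case (DZb k)
     have "wd \<i> k (sf_coeff a I J) z = 0"
     proof (cases "J = {}")
      case False
      then show ?thesis using wd_cong[OF assms(1) z, of "sf_coeff a I J" "\<lambda>z. 0" \<i> k] n by auto
     qed (use h z in simp)
     then show ?thesis unfolding DZb g by simp
    next
     case (DTb \<beta>)
     then show ?thesis using n[of "insert \<beta> J" z I] z by (simp add: sf_dthetabar_def gdthetabar_def sf_coeff_def)
    qed (use i in auto)
   qed
  qed
 qed
qed

lemma santi_sf_antihol:
 fixes a :: "('m, 'b::{finite,linorder}) sfun"
 assumes "open V" "V \<subseteq> U" "a \<in> sf_smooth U"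
 shows "santi V a \<longleftrightarrow> sf_antihol V a"
proof -
 have d: "sf_coeff a I J differentiable (at z)" if "z \<in> V" for I J z
  using sf_smooth_differentiable[OF assms(3)] that assms(2) by (auto simp: sf_coeff_def)
 have g: "gcoeff (pd (DZ k) a z) I J = wd (- \<i>) k (sf_coeff a I J) z" for k z I J
  by (simp only: pd_epd gcoeff_epd sf_coeff_def)
 show ?thesis
 proof
  assume s: "santi V a"
  have "wd (- \<i>) k (sf_coeff a {} J) z = 0" if "z \<in> V" for k J z
  proof -
   have "pd (DZ k) a z = 0" using s[unfolded santi_def, THEN conjunct2, rule_format, of "DZ k" z] that by simp
   then show ?thesis unfolding g[symmetric] by (simp only: gcoeff_simps)
  qed
  moreover have "sf_coeff a I J z = 0" if "I \<noteq> {}" "z \<in> V" for I J z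
   using santi_gcoeff[OF s that(2,1)] by (simp add: sf_coeff_def)
  ultimately show "sf_antihol V a" unfolding sf_antihol_def using antihol_on_wd[OF assms(1) d] by auto
 next
  assume s: "sf_antihol V a"
  have n: "sf_coeff a I J z = 0" if "I \<noteq> {}" "z \<in> V" for I J z using s that unfolding sf_antihol_def by blast
  have h: "wd (- \<i>) k (sf_coeff a {} J) z = 0" if "z \<in> V" for k J z
   using s that antihol_on_wd[OF assms(1) d] unfolding sf_antihol_def by blast
  show "santi V a"
   unfolding santi_def
  proof (intro conjI allI impI ballI assms)
   fix i :: "('m, 'b) dir" and z assume i: "holo i" and z: "z \<in> V"
   show "pd i a z = 0"
   proof (rule grass_eqI)
    fix I J :: "'b set"
    show "gcoeff (pd i a z) I J = gcoeff 0 I J"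
    proof (cases i)
     case (DZ k)
     have "wd (- \<i>) k (sf_coeff a I J) z = 0"
     proof (cases "I = {}")
      case False
      then show ?thesis using wd_cong[OF assms(1) z, of "sf_coeff a I J" "\<lambda>z. 0" "- \<i>" k] n by auto
     qed (use h z in simp)
     then show ?thesis unfolding DZ g by simp
    next
     case (DT \<beta>)
     then show ?thesis using n[of "insert \<beta> I" z J] z by (simp add: sf_dtheta_def gdtheta_def sf_coeff_def)
    qed (use i in auto)
   qed
  qed
 qed
qed

text \<open>The one-form \<open>\<Sum>\<^sub>l A\<^sub>l dz\<^sub>l + B\<^sub>l d\<bar>z\<^sub>l\<close>.\<close>

lemma wirtinger_primitive:
 fixes A B :: "'m \<Rightarrow> complex^'m \<Rightarrow> complex"
 assumes "contractible U" and A: "!!l. smooth_on U (A l)" and B: "!!l. smooth_on U (B l)"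
  and AA: "!!k l z. z \<in> U ==> wd (- \<i>) k (A l) z = wd (- \<i>) l (A k) z"
  and BB: "!!k l z. z \<in> U ==> wd \<i> k (B l) z = wd \<i> l (B k) z"
  and AB: "!!k l z. z \<in> U ==> wd \<i> k (A l) z = wd (- \<i>) l (B k) z"
 shows "\<exists>F. smooth_on U F \<and> (\<forall>l. \<forall>z\<in>U. wd (- \<i>) l F z = A l z \<and> wd \<i> l F z = B l z)"
proof -
 define w where "w x v = (\<Sum>l\<in>UNIV. A l x * vec_nth v l + B l x * cnj (vec_nth v l))" for x v
 define w' where "w' x v u = (\<Sum>l\<in>UNIV. frechet_derivative (A l) (at x) u * vec_nth v l
  + frechet_derivative (B l) (at x) u * cnj (vec_nth v l))" for x v u
 have lin: "linear (w x)" for x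
  unfolding w_def by (rule linearI) (simp_all add: sum.distrib[symmetric] scaleR_sum_right algebra_simps)
 have w': "((\<lambda>x. w x v) has_derivative w' x v) (at x)" if "x \<in> U" for x v
  unfolding w_def w'_def[abs_def]
  by (intro has_derivative_sum has_derivative_add has_derivative_mult_left smooth_on_has_derivative[OF A that] smooth_on_has_derivative[OF B that])
 have smw: "smooth_on U (\<lambda>x. w x v)" for v
  unfolding w_def by (intro smooth_on_sum smooth_on_add smooth_on_mult smooth_on_const A B oU)
 have cont: "continuous_on U (\<lambda>x. w' x v u)" for u v
  unfolding w'_def
  by (intro continuous_intros smooth_on_continuous_on smooth_on_frechet_derivative A B)
 have sym: "w' x v u = w' x u v" if x: "x \<in> U" for x u v
 proof -
  have dA: "A l differentiable (at x)" "B l differentiable (at x)" for l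
   using smooth_on_differentiable[OF A x] smooth_on_differentiable[OF B x] by auto
  have e: "w' x v u = (\<Sum>l\<in>UNIV. \<Sum>k\<in>UNIV.
    wd (- \<i>) k (A l) x * vec_nth u k * vec_nth v l + wd \<i> k (A l) x * cnj (vec_nth u k) * vec_nth v l
    + wd (- \<i>) k (B l) x * vec_nth u k * cnj (vec_nth v l) + wd \<i> k (B l) x * cnj (vec_nth u k) * cnj (vec_nth v l))" for v u
   unfolding w'_def frechet_derivative_wd[OF dA(1)] frechet_derivative_wd[OF dA(2)]
   by (simp add: sum_distrib_right sum_distrib_left sum.distrib algebra_simps)
  show ?thesis
   unfolding e[of v u] e[of u v]
  proof (subst sum.swap, intro sum.cong refl)
   fix k l
   show "wd (- \<i>) k (A l) x * vec_nth u k * vec_nth v l + wd \<i> k (A l) x * cnj (vec_nth u k) * vec_nth v l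
     + wd (- \<i>) k (B l) x * vec_nth u k * cnj (vec_nth v l) + wd \<i> k (B l) x * cnj (vec_nth u k) * cnj (vec_nth v l)
    = wd (- \<i>) l (A k) x * vec_nth v l * vec_nth u k + wd \<i> l (A k) x * cnj (vec_nth v l) * vec_nth u k
     + wd (- \<i>) l (B k) x * vec_nth v l * cnj (vec_nth u k) + wd \<i> l (B k) x * cnj (vec_nth v l) * cnj (vec_nth u k)"
    using AA[OF x, of k l] AB[OF x, of k l] AB[OF x, of l k] BB[OF x, of k l] by (simp add: algebra_simps)
  qed
 qed
 obtain F where F: "!!x. x \<in> U ==> (F has_derivative w x) (at x)"
  using closed_form_primitive[OF oU assms(1) lin w' cont sym] by blast
 have Fs: "smooth_on U F" by (rule smooth_onI'[OF oU F smw])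
 have W: "wd s l F z = (A l z * (1 + s * \<i>) + B l z * (1 - s * \<i>)) / 2" if "z \<in> U" for s l z
 proof -
  have ax: "w z (axis l c) = A l z * c + B l z * cnj c" for c
  proof -
   have "w z (axis l c) = (\<Sum>k\<in>UNIV. if k = l then A l z * c + B l z * cnj c else 0)"
    unfolding w_def by (intro sum.cong refl) (auto simp: axis_def)
   then show ?thesis by simp
  qed
  show ?thesis unfolding wd_def frechet_derivative_at'[OF F[OF that]] ax by (simp add: algebra_simps)
 qed
 have "wd (- \<i>) l F z = A l z" "wd \<i> l F z = B l z" if "z \<in> U" for l z
  using W[OF that, of "- \<i>" l] W[OF that, of \<i> l] by simp_all
 then show ?thesis using Fs by blast
qed

lemma sum_odd_dir: "(\<Sum>i | oddd i. f i) = (\<Sum>\<alpha>\<in>UNIV. f (DT \<alpha>)) + (\<Sum>\<beta>\<in>UNIV. f (DTb \<beta>))"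
 for f :: "('n::finite, 'd::finite) dir \<Rightarrow> 'c::comm_monoid_add"
proof -
 have "{i :: ('n, 'd) dir. oddd i} = range DT \<union> range DTb"
 proof (rule set_eqI)
  fix i :: "('n, 'd) dir" show "i \<in> {i. oddd i} \<longleftrightarrow> i \<in> range DT \<union> range DTb" by (cases i) auto
 qed
 moreover have "(\<Sum>i\<in>range DT \<union> range DTb. f i) = (\<Sum>i\<in>range DT. f i) + (\<Sum>i\<in>range DTb. f i)"
  by (rule sum.union_disjoint) auto
 moreover have "(\<Sum>i\<in>range DT. f i) = (\<Sum>\<alpha>\<in>UNIV. f (DT \<alpha>))" "(\<Sum>i\<in>range DTb. f i) = (\<Sum>\<beta>\<in>UNIV. f (DTb \<beta>))"
  by (subst sum.reindex, simp_all add: inj_on_def)+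
 ultimately show ?thesis by simp
qed

text \<open>Summing the projections of \<open>gtheta_mult_gdtheta\<close> over all odd generators
  counts the generators in a monomial.\<close>

lemma odd_euler:
 fixes f :: "('m, 'd::{finite,linorder}) sfun"
 shows "gcoeff (\<Sum>i | oddd (i :: ('m, 'd) dir). coord i z * pd i f z) I J = of_nat (card I + card J) * gcoeff (f z) I J"
proof -
 have "gcoeff (\<Sum>i | oddd (i :: ('m, 'd) dir). coord i z * pd i f z) I J
   = (\<Sum>\<alpha>\<in>UNIV. if \<alpha> \<in> I then gcoeff (f z) I J else 0) + (\<Sum>\<beta>\<in>UNIV. if \<beta> \<in> J then gcoeff (f z) I J else 0)"
  unfolding gcoeff_sum sum_odd_dir by (simp add: sf_dtheta_def sf_dthetabar_def gtheta_mult_gdtheta gcoeff_sum)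
 also have "\<dots> = of_nat (card I + card J) * gcoeff (f z) I J"
  by (simp add: sum.If_cases distrib_right)
 finally show ?thesis .
qed

text \<open>Components of positive odd degree have an algebraic primitive: contract the form with
  the odd coordinates and divide by the degree. Only the numerical part of a primitive comes from
  the topology of U, by \<open>wirtinger_primitive\<close>.\<close>

lemma super_poincare:
 fixes y :: "('m, 'd::{finite,linorder}) dir \<Rightarrow> ('m, 'd) sfun"
 assumes con: "contractible U" and y: "!!i. y i \<in> sf_smooth U"
  and closed: "!!i j z. z \<in> U ==> pd i (y j) z = ssgn i j (pd j (y i) z)"
 shows "\<exists>G\<in>sf_smooth U. \<forall>i. \<forall>z\<in>U. pd i G z = y i z"
proof -
 have wdy: "wd s k (\<lambda>z. gcoeff (y j z) {} {}) z = gcoeff (epd s k (y j) z) {} {}" for s k j z by simp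
 have smb: "smooth_on U (\<lambda>z. gcoeff (y j z) I J)" for j I J by (rule sf_smoothD[OF y])
 have "\<exists>F. smooth_on U F \<and> (\<forall>l. \<forall>z\<in>U. wd (- \<i>) l F z = gcoeff (y (DZ l) z) {} {} \<and> wd \<i> l F z = gcoeff (y (DZb l) z) {} {})"
 proof (rule wirtinger_primitive[OF con])
  show "smooth_on U (\<lambda>z. gcoeff (y (DZ l) z) {} {})" "smooth_on U (\<lambda>z. gcoeff (y (DZb l) z) {} {})" for l
   by (rule smb)+
  fix k l :: 'm and z assume z: "z \<in> U"
  show "wd (- \<i>) k (\<lambda>z. gcoeff (y (DZ l) z) {} {}) z = wd (- \<i>) l (\<lambda>z. gcoeff (y (DZ k) z) {} {}) z"
   using closed[OF z, of "DZ k" "DZ l"] unfolding wdy pd_epd ssgn_def by simp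
  show "wd \<i> k (\<lambda>z. gcoeff (y (DZb l) z) {} {}) z = wd \<i> l (\<lambda>z. gcoeff (y (DZb k) z) {} {}) z"
   using closed[OF z, of "DZb k" "DZb l"] unfolding wdy pd_epd ssgn_def by simp
  show "wd \<i> k (\<lambda>z. gcoeff (y (DZ l) z) {} {}) z = wd (- \<i>) l (\<lambda>z. gcoeff (y (DZb k) z) {} {}) z"
   using closed[OF z, of "DZb k" "DZ l"] unfolding wdy pd_epd ssgn_def by simp
 qed
 then obtain F where F: "smooth_on U F" "!!l z. z \<in> U ==> wd (- \<i>) l F z = gcoeff (y (DZ l) z) {} {}"
  "!!l z. z \<in> U ==> wd \<i> l F z = gcoeff (y (DZb l) z) {} {}" by blast
 define T where "T = (\<Sum>i | oddd (i :: ('m, 'd) dir). coord i * y i)"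
 have Ts: "T \<in> sf_smooth U" unfolding T_def by (intro sf_smooth_sum oU) (simp add: y)
 \<comment> \<open>A homotopy formula: differentiating the coordinate gives the summand for odd
   \<open>j\<close>, and \<open>closed\<close> turns the remaining sum into the degree operator
   applied to \<open>y j\<close>.\<close>
 have pT: "gcoeff (pd j T z) I J = of_nat ((if oddd j then 1 else 0) + card I + card J) * gcoeff (y j z) I J"
  if z: "z \<in> U" for j z I J
 proof -
  have "pd j T z = (\<Sum>i | oddd (i :: ('m, 'd) dir). pd j (coord i * y i) z)"
   unfolding T_def by (rule pd_sum[OF oU z]) (simp add: y)
  also have "\<dots> = (\<Sum>i | oddd (i :: ('m, 'd) dir). (if j = i then y j z else 0) + coord i z * pd i (y j) z)"
  proof (rule sum.cong[OF refl])
   fix i :: "('m, 'd) dir" assume "i \<in> {i. oddd i}"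
   then have i: "oddd i" by simp
   have s: "sgd j (coord i) z = ssgn j i (coord i z)"
    using i by (cases i) (auto simp: sgd_def ssgn_def sg_def)
   have "pd j (coord i * y i) z = pd j (coord i) z * y i z + sgd j (coord i) z * pd j (y i) z"
    by (rule pd_mult[OF z]) (simp_all add: y)
   then show "pd j (coord i * y i) z = (if j = i then y j z else 0) + coord i z * pd i (y j) z"
    unfolding pd_coord s closed[OF z, of j i] by (simp add: ssgn_def)
  qed
  also have "\<dots> = (if oddd j then y j z else 0) + (\<Sum>i | oddd (i :: ('m, 'd) dir). coord i z * pd i (y j) z)"
   by (simp add: sum.distrib)
  finally show ?thesis by (simp add: odd_euler distrib_right)
 qed
 \<comment> \<open>The degree is nonzero off the numerical part. An odd derivative lowers it by one,
   which matches the additional 1 in \<open>pT\<close> for odd directions.\<close>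
 define G where "G z = Grass (\<lambda>I J. if I = {} \<and> J = {} then F z else gcoeff (T z) I J / of_nat (card I + card J))" for z
 have gG: "gcoeff (G z) I J = (if I = {} \<and> J = {} then F z else (1 / of_nat (card I + card J)) * gcoeff (T z) I J)" for z I J
  by (simp add: G_def)
 have c0: "card I + card J \<noteq> 0" if "\<not> (I = {} \<and> J = {})" for I J :: "'d set" using that by auto
 have Gs: "G \<in> sf_smooth U"
 proof (rule sf_smoothI)
  fix I J
  show "smooth_on U (\<lambda>z. gcoeff (G z) I J)"
  proof (cases "I = {} \<and> J = {}")
   case True
   show ?thesis unfolding gG if_P[OF True] by (rule F(1))
  next
   case False
   show ?thesis unfolding gG if_not_P[OF False]
    by (rule smooth_on_mult[OF oU smooth_on_const sf_smoothD[OF Ts, of I J]])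
  qed
 qed
 have "pd j G z = y j z" if z: "z \<in> U" for j z
 proof (rule grass_eqI)
  fix I J :: "'d set"
  have c1: "(1 + (of_nat (card I) + of_nat (card J)) :: complex) \<noteq> 0"
   using of_nat_neq_0[of "card I + card J", where 'a = complex] by simp
  have even: "gcoeff (epd s k G z) I J = gcoeff (y j z) I J"
   if j: "!!f. pd j f = epd s k f" "\<not> oddd j" and Fz: "wd s k F z = gcoeff (y j z) {} {}" for s k
  proof (cases "I = {} \<and> J = {}")
   case True
   then show ?thesis using Fz by (simp add: gG)
  next
   case False
   have e1: "wd s k (\<lambda>z. (1 / of_nat (card I + card J)) * gcoeff (T z) I J) z = (1 / of_nat (card I + card J)) * wd s k (\<lambda>z. gcoeff (T z) I J) z"
    by (rule wd_cmult[OF sf_smooth_differentiable[OF Ts z]])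
   have e2: "wd s k (\<lambda>z. gcoeff (T z) I J) z = of_nat (card I + card J) * gcoeff (y j z) I J"
    using pT[OF z, of j I J] j by simp
   have "(of_nat (card I + card J) :: complex) \<noteq> 0" using c0[OF False] by (simp only: of_nat_eq_0_iff not_False_eq_True)
   then show ?thesis unfolding gcoeff_epd gG if_not_P[OF False] e1 e2 by (simp del: of_nat_add)
  qed
  show "gcoeff (pd j G z) I J = gcoeff (y j z) I J"
  proof (cases j)
   case (DZ k)
   show ?thesis using even[of "- \<i>" k] F(2)[OF z] unfolding DZ pd_epd by simp
  next
   case (DZb k)
   show ?thesis using even[of \<i> k] F(3)[OF z] unfolding DZb pd_epd by simp
  next
   case (DT \<alpha>)
   show ?thesis
    using pT[OF z, of j I J] c1 unfolding DT
    by (cases "\<alpha> \<in> I") (auto simp: sf_dtheta_def gdtheta_def gG divide_simps)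
  next
   case (DTb \<alpha>)
   show ?thesis
    using pT[OF z, of j I J] c1 unfolding DTb
    by (cases "\<alpha> \<in> J") (auto simp: sf_dthetabar_def gdthetabar_def gG divide_simps)
  qed
 qed
 then show ?thesis using Gs by blast
qed

text \<open>A primitive is averaged with its image under parity, which is again a primitive because
  \<open>y i\<close> has the parity of the direction \<open>i\<close>.\<close>

lemma super_poincare_even:
 fixes y :: "('m, 'd::{finite,linorder}) dir \<Rightarrow> ('m, 'd) sfun"
 assumes con: "contractible U" and y: "!!i. y i \<in> sf_smooth U"
  and closed: "!!i j z. z \<in> U ==> pd i (y j) z = ssgn i j (pd j (y i) z)"
  and par: "!!i z. z \<in> U ==> gpar (y i z) = (if oddd i then - y i z else y i z)"
 shows "\<exists>G\<in>sf_smooth U. (\<forall>z\<in>U. gpar (G z) = G z) \<and> (\<forall>i. \<forall>z\<in>U. pd i G z = y i z)"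
proof -
 obtain G where G: "G \<in> sf_smooth U" and d: "!!i z. z \<in> U ==> pd i G z = y i z"
  using super_poincare[OF con y closed] by blast
 define H where "H = sconst (1/2) * (G + spar G)"
 have Hs: "H \<in> sf_smooth U" unfolding H_def by (simp add: G)
 have half: "gconst (1/2) * (x + x) = (x :: 'd grass)" for x by (rule grass_eqI) simp
 have "gpar (H z) = H z" for z by (simp add: H_def sg_def gsg_mult add.commute)
 moreover have "pd i H z = y i z" if z: "z \<in> U" for i z
 proof -
  have p: "gpar (pd i G z) = (if oddd i then - pd i G z else pd i G z)" using par[OF z] d[OF z] by simp
  have "pd i H z = gconst (1/2) * (pd i G z + pd i (spar G) z)"
   unfolding H_def using pd_cmult[OF z, of "G + spar G" i "1/2"] pd_add[OF z G, of "spar G" i] G by simp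
  also have "pd i (spar G) z = pd i G z"
   unfolding pd_spar[OF z G] using p by (simp add: sg_def)
  finally show ?thesis using d[OF z] half by simp
 qed
 ultimately show ?thesis using Hs by blast
qed

end

section \<open>The dual star product\<close>

lemma grass_eq_iff: "x = y \<longleftrightarrow> (\<forall>I J. gcoeff x I J = gcoeff y I J)"
 by (auto intro: grass_eqI)

lemma gcoeff_gpart: "gcoeff (gpart p x) I J = (if even (card I + card J) = even p then gcoeff x I J else 0)"
 by (auto simp: gpart_def mod_2_eq_odd)

lemma gpart_sums:
 fixes x :: "'d::{finite,linorder} grass"
 shows "gpart 0 x + gpart (Suc 0) x = x" "gpart 0 x - gpart (Suc 0) x = gpar x"
  "gpar (gpart p x) = (if even p then gpart p x else - gpart p x)"
 by (auto simp: grass_eq_iff gcoeff_gpart minus_one_power_iff)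

lemma gpart_fixed_iff:
 fixes x :: "'d::{finite,linorder} grass"
 shows "gpart p x = x \<longleftrightarrow> gpar x = (if even p then x else - x)"
proof -
 have c: "c = - c \<longleftrightarrow> c = 0" "- c = c \<longleftrightarrow> c = 0" for c :: complex by (auto simp: complex_eq_iff)
 show ?thesis
  unfolding grass_eq_iff by (intro all_cong1) (auto simp: gcoeff_gpart minus_one_power_iff c)
qed

lemma gpart_of_fixed:
 fixes x :: "'d::{finite,linorder} grass"
 assumes "gpar x = (if q then - x else x)"
 shows "gpart 0 x = (if q then 0 else x)" "gpart (Suc 0) x = (if q then x else 0)"
 using gpart_sums(1)[of x] gpart_fixed_iff[of 0 x] gpart_fixed_iff[of "Suc 0" x] assms by (cases q; force)+

lemma f_part_nth [simp]: "(f_part p f $$ n) z = gpart p ((f $$ n) z)"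
proof -
 have "f_part p f $$ n = (\<lambda>z. gpart p ((f $$ n) z))"
  unfolding f_part_def by (rule fls_map_nth) (rule sf_op_zero(5))
 then show ?thesis by simp
qed

lemma f_part_sums: "f_part 0 f + f_part (Suc 0) f = f" "f_part 0 f + - f_part (Suc 0) f = fpar f"
 by (rule fls_eqI, rule ext, simp add: gpart_sums sg_def)+

lemma fpar_fpar [simp]: "fpar (fpar f) = f"
 by (rule fls_eqI, rule ext) (simp add: sg_def)

lemma fsgd_fsgd [simp]: "fsgd i (fsgd i f) = f"
 by (simp add: fsgd_def)

lemma fls_const_fops:
 "fpd i (cst f) = cst (pd i f)" "fpar (cst f) = cst (spar f)" "fsgd i (cst f) = cst (sgd i f)"
 by (rule fls_eqI, simp add: sgd_def)+

lemma cst_mult: "cst b * cst a = cst (b * a :: ('m::finite, 'd::{finite,linorder}) sfun)"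
 by simp

lemma ssgn_nth: "(ssgn i j f $$ n) z = ssgn i j ((f $$ n) z)"
 by (simp add: ssgn_def)

lemma invertible_uminus:
 fixes A :: "complex^'n::finite^'n"
 assumes "invertible A"
 shows "invertible (- A)"
proof -
 obtain B where "A ** B = mat 1" "B ** A = mat 1" using assms by (auto simp: invertible_def)
 moreover have "(- A) ** (- B) = A ** B" "(- B) ** (- A) = B ** A"
  by (simp_all add: matrix_matrix_mult_def vec_eq_iff)
 ultimately show ?thesis unfolding invertible_def by metis
qed

context dom
begin

text \<open>Homogeneity as an eigenvalue equation for \<open>fpar\<close>, \<open>True\<close>
  standing for odd; this is easier to carry through operators than the projection
  \<open>f_part\<close>.\<close>

definition par :: "bool \<Rightarrow> ('m, 'd::{finite,linorder}) formal \<Rightarrow> bool" where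
 "par q f \<longleftrightarrow> eq_on U (fpar f) (if q then - f else f)"

lemma parD: "par q f ==> z \<in> U ==> gpar ((f $$ n) z) = (if q then - (f $$ n) z else (f $$ n) z)"
 unfolding par_def by (drule eq_onD[of _ _ _ z n]) (auto simp: sg_def)

lemma parI: "(!!n z. z \<in> U ==> gpar ((f $$ n) z) = (if q then - (f $$ n) z else (f $$ n) z)) ==> par q f"
 unfolding par_def by (rule eq_onI) (auto simp: sg_def)

lemma homogeneous_on_par:
 fixes f :: "('m, 'b::{finite,linorder}) formal"
 shows "homogeneous_on U p f \<longleftrightarrow> par (odd p) f"
proof -
 have "homogeneous_on U p f \<longleftrightarrow> (\<forall>n. \<forall>z\<in>U. gpar ((f $$ n) z) = (if even p then (f $$ n) z else - (f $$ n) z))"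
  unfolding homogeneous_on_def eq_on_def f_part_nth gpart_fixed_iff ..
 also have "\<dots> \<longleftrightarrow> par (odd p) f"
  using parD[of "odd p" f] parI[of f "odd p"] by (cases "even p") auto
 finally show ?thesis .
qed

lemma FF_f_part [simp]: "f \<in> FF ==> f_part p f \<in> FF"
proof -
 assume f: "f \<in> FF"
 have "f_part p f $$ n \<in> sf_smooth U" for n
 proof (rule sf_smoothI)
  fix I J
  have "smooth_on U (\<lambda>z. if c then gcoeff ((f $$ n) z) I J else 0)" for c
   by (cases c) (simp_all only: if_True if_False sf_smoothD[OF FF_nth[OF f]] smooth_on_const)
  then show "smooth_on U (\<lambda>z. gcoeff ((f_part p f $$ n) z) I J)"
   unfolding f_part_nth gcoeff_gpart .
 qed
 then show ?thesis unfolding formal_funs_def by (intro CollectI allI)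
qed

lemma par_f_part: "par (odd p) (f_part p f)"
 by (rule parI) (simp add: gpart_sums(3))

lemma f_part_par:
 fixes f :: "('m, 'b::{finite,linorder}) formal"
 assumes "par q f"
 shows "eq_on U (f_part 0 f) (if q then 0 else f)" "eq_on U (f_part (Suc 0) f) (if q then f else 0)"
 by (rule eq_onI, use gpart_of_fixed[OF parD[OF assms]] in simp)+

lemma fdo_0:
 fixes A :: "('m, 'b::{finite,linorder}) formal \<Rightarrow> ('m, 'b) formal"
 assumes "fdo A"
 shows "eq_on U (A 0) 0"
proof (rule eq_onI)
 fix n z assume "z \<in> U"
 from eq_onD[OF fdo_additive[OF assms FF_0(1) FF_0(1)] this, of n] show "(A 0 $$ n) z = (0 $$ n) z" by simp
qed

text \<open>By \<open>fdo_eq_on_const\<close> it suffices to look at functions constant in nu, where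
  both sides are the same convolution sum.\<close>

lemma fdo_f_scalar:
 fixes A :: "('m, 'b::{finite,linorder}) formal \<Rightarrow> ('m, 'b) formal"
 assumes A: "fdo A" and f: "f \<in> FF"
 shows "eq_on U (A (f_scalar c * f)) (f_scalar c * A f)"
proof -
 have sn: "f_scalar c $$ n = sconst (c $$ n)" for n
  unfolding f_scalar_def sconst_def by (rule fls_map_nth) (simp add: fun_eq_iff)
 have sF: "(f_scalar c :: ('m, 'b) formal) \<in> FF"
  unfolding formal_funs_def by (intro CollectI allI) (simp add: sn)
 obtain r0 D where D: "fdo_with r0 D A" using A by (auto simp: fdo_def)
 show ?thesis
 proof (rule fdo_eq_on_const[where A = "\<lambda>f. A (f_scalar c * f)" and B = "\<lambda>f. f_scalar c * A f"])
  show "fdo (\<lambda>f. A (f_scalar c * f))" by (rule fdo_comp[OF A fdo_lmult[OF sF]])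
  show "fdo (\<lambda>f. f_scalar c * A f)" by (rule fdo_comp[OF fdo_lmult[OF sF] A])
  fix g :: "('m, 'b) sfun" assume g: "g \<in> sf_smooth U"
  show "eq_on U (A (f_scalar c * cst g)) (f_scalar c * A (cst g))"
  proof (rule eq_onI)
   fix n z assume z: "z \<in> U"
   define s where "s = fls_subdegree c"
   have nth: "(f_scalar c * cst g) $$ j = sconst (c $$ j) * g" for j by (simp add: sn)
   have "(A (f_scalar c * cst g) $$ n) z = (\<Sum>j = s..n - r0. D (n - j) ((f_scalar c * cst g) $$ j) z)"
   proof (rule fdo_withD[OF D _ _ z])
    show "f_scalar c * cst g \<in> FF" by (rule FF_mult[OF sF FF_const[OF g]])
    show "((f_scalar c * cst g) $$ j) x = 0" if "j < s" for j x
     unfolding nth using that by (simp add: s_def)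
   qed
   also have "\<dots> = (\<Sum>j = s..n - r0. gconst (c $$ j) * D (n - j) g z)"
    unfolding nth by (intro sum.cong refl diff_op_cmult[OF oU fdo_with_diff_op[OF D] g z])
   also have "\<dots> = (\<Sum>j = r0..n - s. gconst (c $$ (n - j)) * D j g z)"
    by (rule sum.reindex_bij_witness[where i = "\<lambda>j. n - j" and j = "\<lambda>j. n - j"]) auto
   also have "\<dots> = (\<Sum>j = r0..n - s. (f_scalar c $$ (n - j)) z * (A (cst g) $$ j) z)"
    by (intro sum.cong refl) (simp add: sn fdo_with_const[OF D g z])
   also have "\<dots> = ((f_scalar c * A (cst g)) $$ n) z"
    by (rule fls_mult_nth_at[symmetric]) (simp_all add: sn s_def fdo_with_const[OF D g z])
   finally show "(A (f_scalar c * cst g) $$ n) z = ((f_scalar c * A (cst g)) $$ n) z" .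
  qed
 qed (rule f)
qed

text \<open>Only \<open>w\<close> needs to be split into parts: the sign for an odd component of
  \<open>w\<close> is absorbed in \<open>fpar f\<close>.\<close>

lemma right_mult_eq:
 fixes P :: "('m, 'b::{finite,linorder}) prod"
 assumes add: "!!f g h. f \<in> FF ==> g \<in> FF ==> h \<in> FF ==> eq_on U (P (f + g) h) (P f h + P g h)"
  and w: "w \<in> FF" and f: "f \<in> FF"
 shows "eq_on U (right_mult P w f) (P f (f_part 0 w) + P (fpar f) (f_part (Suc 0) w))"
proof (rule eq_onI)
 fix n z assume z: "z \<in> U"
 define a b where "a = f_part 0 f" and "b = f_part (Suc 0) f"
 have ab: "a \<in> FF" "b \<in> FF" using f by (simp_all add: a_def b_def)
 have A: "(P (g + g') h $$ n) z = (P g h $$ n) z + (P g' h $$ n) z" if "g \<in> FF" "g' \<in> FF" "h \<in> FF" for g g' h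
  using eq_onD[OF add[OF that] z, of n] by simp
 have P0: "(P 0 h $$ n) z = 0" if "h \<in> FF" for h
  using A[OF FF_0(1) FF_0(1) that] by simp
 have Pm: "(P (- g) h $$ n) z = - (P g h $$ n) z" if "g \<in> FF" "h \<in> FF" for g h
  using A[OF that(1) FF_uminus[OF that(1)] that(2)] P0[OF that(2)] by (simp add: eq_neg_iff_add_eq_0 add.commute)
 have "(P f (f_part 0 w) $$ n) z = (P a (f_part 0 w) $$ n) z + (P b (f_part 0 w) $$ n) z"
  using A[OF ab, of "f_part 0 w"] w unfolding a_def b_def f_part_sums by simp
 moreover have "(P (fpar f) (f_part (Suc 0) w) $$ n) z = (P a (f_part (Suc 0) w) $$ n) z - (P b (f_part (Suc 0) w) $$ n) z"
  using A[OF ab(1) FF_uminus[OF ab(2)], of "f_part (Suc 0) w"] Pm[OF ab(2), of "f_part (Suc 0) w"] w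
  unfolding a_def b_def f_part_sums by simp
 ultimately show "(right_mult P w f $$ n) z = ((P f (f_part 0 w) + P (fpar f) (f_part (Suc 0) w)) $$ n) z"
  by (simp add: right_mult_def a_def b_def)
qed

lemma right_mult_par:
 fixes P :: "('m, 'b::{finite,linorder}) prod"
 assumes add: "!!f g h. f \<in> FF ==> g \<in> FF ==> h \<in> FF ==> eq_on U (P (f + g) h) (P f h + P g h)"
  and R: "!!f. f \<in> FF ==> fdo (P f)" and w: "w \<in> FF" "par q w" and f: "f \<in> FF"
 shows "eq_on U (right_mult P w f) (P (if q then fpar f else f) w)"
proof -
 have z: "eq_on U (P g (f_part p w)) 0" if "eq_on U (f_part p w) 0" "g \<in> FF" for p g
  by (rule eq_on_trans[OF fdo_cong_U[OF R[OF that(2)] _ _ that(1)] fdo_0[OF R[OF that(2)]]]) (use w in simp_all)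
 have e: "eq_on U (P g (f_part p w)) (P g w)" if "eq_on U (f_part p w) w" "g \<in> FF" for p g
  by (rule fdo_cong_U[OF R[OF that(2)] _ _ that(1)]) (use w in simp_all)
 note re = right_mult_eq[where P = P, OF add w(1) f]
 show ?thesis
 proof (cases q)
  case True
  have "eq_on U (P f (f_part 0 w) + P (fpar f) (f_part (Suc 0) w)) (0 + P (fpar f) w)"
   by (rule eq_on_add[OF z e]) (use f_part_par[OF w(2)] True f in simp_all)
  from eq_on_trans[OF re this] show ?thesis using True by simp
 next
  case False
  have "eq_on U (P f (f_part 0 w) + P (fpar f) (f_part (Suc 0) w)) (P f w + 0)"
   by (rule eq_on_add[OF e z]) (use f_part_par[OF w(2)] False f in simp_all)
  from eq_on_trans[OF re this] show ?thesis using False by simp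
 qed
qed

lemma fdo_right_mult:
 fixes P :: "('m, 'b::{finite,linorder}) prod"
 assumes L: "!!g. g \<in> FF ==> fdo (\<lambda>f. P f g)" and w: "w \<in> FF"
 shows "fdo (right_mult P w)"
proof (rule fdo_eq[OF fdo_add[OF L fdo_comp[OF L fdo_fpar]]])
 show "f_part 0 w \<in> FF" "f_part (Suc 0) w \<in> FF" using w by simp_all
 fix f :: "('m, 'b) formal" assume f: "f \<in> FF"
 show "eq_on U (right_mult P w f) (P f (f_part 0 w) + P (fpar f) (f_part (Suc 0) w))"
  by (rule right_mult_eq[OF _ w f], rule fdo_additive[OF L])
qed

lemma par_comm:
 fixes f g :: "('m, 'b::{finite,linorder}) formal" and i :: "('m, 'b) dir"
 assumes "par (oddd i) f"
 shows "eq_on U (f * g) (fsgd i g * f)"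
 using assms fls_mult_commute_even[of U f g] fls_mult_commute_odd[of U f g] by (cases "oddd i") (auto simp: par_def fsgd_def)

lemma par_fsgd:
 fixes f :: "('m, 'b::{finite,linorder}) formal" and i j :: "('m, 'b) dir"
 assumes "par (oddd i) f"
 shows "eq_on U (fsgd j f) (ssgn i j f)"
 using assms by (auto simp: par_def fsgd_def ssgn_def)

lemma par_fpd:
 fixes f :: "('m, 'b::{finite,linorder}) formal"
 assumes "par False f" "f \<in> FF"
 shows "par (oddd i) (fpd i f)"
proof (rule parI)
 fix n z assume z: "z \<in> U"
 have s: "f $$ n \<in> sf_smooth U" using assms by simp
 have "pd i (spar (f $$ n)) z = pd i (f $$ n) z"
  by (rule pd_cong[OF oU z]) (use parD[OF assms(1)] in \<open>simp add: sg_def\<close>)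
 then show "gpar ((fpd i f $$ n) z) = (if oddd i then - (fpd i f $$ n) z else (fpd i f $$ n) z)"
  unfolding pd_spar[OF z s] fpd_nth by (auto simp: sg_def split: if_splits) (metis minus_minus)
qed

lemma fpd_closed:
 fixes f :: "('m, 'b::{finite,linorder}) formal"
 assumes "f \<in> FF"
 shows "eq_on U (fpd i (fpd j f)) (ssgn i j (fpd j (fpd i f)))"
proof (rule eq_onI)
 fix n z assume "z \<in> U"
 from pd_commute[OF oU this FF_nth[OF assms], of i j n]
 show "(fpd i (fpd j f) $$ n) z = (ssgn i j (fpd j (fpd i f)) $$ n) z"
  unfolding ssgn_nth fpd_nth by (auto simp: ssgn_def)
qed

lemma shol_mono: "shol U a ==> V \<subseteq> U ==> shol V a" "santi U b ==> V \<subseteq> U ==> santi V b"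
 by (auto simp: shol_def santi_def)

lemma shol_smooth: "shol V a ==> a \<in> sf_smooth U" "santi V a ==> a \<in> sf_smooth U"
 by (simp_all add: shol_def santi_def)

lemma eq_on_ssgn: "eq_on V f g ==> eq_on V (ssgn i j f) (ssgn i j g)"
 by (simp add: ssgn_def eq_on_uminus)

end

section \<open>The star product, the Berezin transform and the dual product\<close>

locale bstar = dom U for U :: "(complex^'m::finite) set" +
 fixes star :: "('m, 'd::{finite,linorder}) prod" and X :: "('m, 'd) formal"
  and Ber :: "('m, 'd) formal \<Rightarrow> ('m, 'd) formal"
 assumes pot: "nondegenerate_potential U X" and det: "determines_anti_wick U X star"
  and ber: "berezin_transform U star Ber"
begin

lemma sp: "star_product U star" and aw: "anti_wick U star"
 using det by (simp_all add: determines_anti_wick_def)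

lemma star_FF [simp]: "f \<in> FF ==> g \<in> FF ==> star f g \<in> FF"
 using sp unfolding star_product_def by blast

lemma star_addl: "f \<in> FF ==> g \<in> FF ==> h \<in> FF ==> eq_on U (star (f + g) h) (star f h + star g h)"
 and star_addr: "f \<in> FF ==> g \<in> FF ==> h \<in> FF ==> eq_on U (star f (g + h)) (star f g + star f h)"
 and star_assoc: "f \<in> FF ==> g \<in> FF ==> h \<in> FF ==> eq_on U (star (star f g) h) (star f (star g h))"
 and star_one: "f \<in> FF ==> eq_on U (star 1 f) f" "f \<in> FF ==> eq_on U (star f 1) f"
 using sp unfolding star_product_def by blast+

lemma star_fdo: "f \<in> FF ==> fdo (star f)" and rm_fdo: "f \<in> FF ==> fdo (right_mult star f)"
 using sp unfolding star_product_def fdo_iff by blast+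

lemma star_rm:
 assumes "w \<in> FF" "par q w" "f \<in> FF"
 shows "eq_on U (right_mult star w f) (star (if q then fpar f else f) w)"
 by (rule right_mult_par[OF star_addl star_fdo assms])

text \<open>The definition of a star product provides the graded right multiplications; ungraded
  right multiplication by \<open>g\<close> is recovered from the even and odd parts of
  \<open>g\<close>.\<close>

lemma star_fdo_r:
 assumes g: "g \<in> FF"
 shows "fdo (\<lambda>f. star f g)"
proof (rule fdo_eq[OF fdo_add[OF rm_fdo fdo_comp[OF rm_fdo fdo_fpar]]])
 show w: "f_part 0 g \<in> FF" "f_part (Suc 0) g \<in> FF" using g by simp_all
 fix f :: "('m, 'd) formal" assume f: "f \<in> FF"
 have e: "eq_on U (right_mult star (f_part 0 g) f) (star f (f_part 0 g))"
  using star_rm[OF w(1) par_f_part[of 0 g] f] by simp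
 have o: "eq_on U (right_mult star (f_part (Suc 0) g) (fpar f)) (star f (f_part (Suc 0) g))"
  using star_rm[OF w(2) par_f_part[of "Suc 0" g] FF_fpar[OF f]] by simp
 have "eq_on U (star f g) (star f (f_part 0 g) + star f (f_part (Suc 0) g))"
  using star_addr[OF f w] unfolding f_part_sums .
 from eq_on_trans[OF this eq_on_sym[OF eq_on_add[OF e o]]]
 show "eq_on U (star f g) (right_mult star (f_part 0 g) f + right_mult star (f_part (Suc 0) g) (fpar f))" .
qed

lemma star_cong:
 assumes "open V" "V \<subseteq> U" "f \<in> FF" "f' \<in> FF" "g \<in> FF" "g' \<in> FF" "eq_on V f f'" "eq_on V g g'"
 shows "eq_on V (star f g) (star f' g')"
 by (rule eq_on_trans[OF fdo_cong[OF star_fdo[OF assms(3)] assms(5,6,1,2,8)] fdo_cong[OF star_fdo_r[OF assms(6)] assms(3,4,1,2,7)]])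

lemmas star_cong_U = star_cong[OF oU subset_refl]

lemma star_par_homogeneous:
 assumes "par p f" "par q g" "f \<in> FF" "g \<in> FF"
 shows "par (p \<noteq> q) (star f g)"
proof -
 have "par (odd (of_bool p + of_bool q :: nat)) (star f g)"
 proof -
  have "homogeneous_on U (of_bool p) f" "homogeneous_on U (of_bool q) g"
   using assms by (cases p; cases q; simp add: homogeneous_on_par)+
  then have "homogeneous_on U (of_bool p + of_bool q) (star f g)"
   using sp assms(3,4) unfolding star_product_def by blast
  then show ?thesis by (simp only: homogeneous_on_par)
 qed
 then show ?thesis by (cases p; cases q) simp_all
qed

lemma fpar_star:
 assumes f: "f \<in> FF" and g: "g \<in> FF"
 shows "eq_on U (fpar (star f g)) (star (fpar f) (fpar g))"
proof (rule eq_onI)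
 fix n z assume z: "z \<in> U"
 define a b c d where "a = f_part 0 f" and "b = f_part (Suc 0) f" and "c = f_part 0 g" and "d = f_part (Suc 0) g"
 have F: "a \<in> FF" "b \<in> FF" "c \<in> FF" "d \<in> FF" using f g by (simp_all add: a_def b_def c_def d_def)
 have p: "par False a" "par True b" "par False c" "par True d"
  using par_f_part[of 0 f] par_f_part[of "Suc 0" f] par_f_part[of 0 g] par_f_part[of "Suc 0" g] by (simp_all add: a_def b_def c_def d_def)
 have L: "(star (u + v) h $$ n) z = (star u h $$ n) z + (star v h $$ n) z" if "u \<in> FF" "v \<in> FF" "h \<in> FF" for u v h
  using eq_onD[OF star_addl[OF that] z, of n] by simp
 have R: "(star u (v + h) $$ n) z = (star u v $$ n) z + (star u h $$ n) z" if "u \<in> FF" "v \<in> FF" "h \<in> FF" for u v h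
  using eq_onD[OF star_addr[OF that] z, of n] by simp
 have Lm: "(star (- u) h $$ n) z = - (star u h $$ n) z" if "u \<in> FF" "h \<in> FF" for u h
  using eq_onD[OF fdo_uminus_arg[OF star_fdo_r[OF that(2)] that(1)] z, of n] by simp
 have Rm: "(star u (- h) $$ n) z = - (star u h $$ n) z" if "u \<in> FF" "h \<in> FF" for u h
  using eq_onD[OF fdo_uminus_arg[OF star_fdo[OF that(1)] that(2)] z, of n] by simp
 have G: "gpar ((star u v $$ n) z) = (if p \<noteq> q then - (star u v $$ n) z else (star u v $$ n) z)"
  if "par p u" "par q v" "u \<in> FF" "v \<in> FF" for p q u v
  by (rule parD[OF star_par_homogeneous[OF that] z])
 have fe: "f = a + b" "g = c + d" "fpar f = a + - b" "fpar g = c + - d"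
  unfolding a_def b_def c_def d_def f_part_sums by (rule refl)+
 have "(star (a + b) (c + d) $$ n) z = (star a c $$ n) z + (star a d $$ n) z + ((star b c $$ n) z + (star b d $$ n) z)"
  using F by (simp add: L R)
 moreover have "(star (a + - b) (c + - d) $$ n) z = (star a c $$ n) z - (star a d $$ n) z - ((star b c $$ n) z - (star b d $$ n) z)"
 proof -
  have "(star (a + - b) (c + - d) $$ n) z = (star a (c + - d) $$ n) z + (star (- b) (c + - d) $$ n) z"
   by (rule L) (use F in simp_all)
  moreover have "(star a (c + - d) $$ n) z = (star a c $$ n) z + (star a (- d) $$ n) z"
   by (rule R) (use F in simp_all)
  moreover have "(star (- b) (c + - d) $$ n) z = (star (- b) c $$ n) z + (star (- b) (- d) $$ n) z"
   by (rule R) (use F in simp_all)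
  ultimately show ?thesis using F by (simp only: Lm Rm FF_uminus) (simp add: Lm Rm)
 qed
 ultimately show "(fpar (star f g) $$ n) z = (star (fpar f) (fpar g) $$ n) z"
  unfolding fe(3,4) unfolding fe(1,2) using p F by (simp add: sg_def G)
qed

lemma star_hol: "open V ==> V \<subseteq> U ==> shol V a ==> f \<in> FF ==> eq_on V (star (cst a) f) (cst a * f)"
 using aw shol_sf_hol[of V a] shol_smooth(1)[of V a] unfolding anti_wick_def by blast

lemma star_anti: "open V ==> V \<subseteq> U ==> santi V b ==> f \<in> FF ==> eq_on V (star f (cst b)) (f * cst b)"
 using aw santi_sf_antihol[of V b] shol_smooth(2)[of V b] unfolding anti_wick_def by blast

lemmas star_hol_U = star_hol[OF oU subset_refl] and star_anti_U = star_anti[OF oU subset_refl]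

definition DB where "DB = (SOME D. fdo_with 0 D Ber \<and> D 0 = id)"

lemma DB: "fdo_with 0 DB Ber" "DB 0 = id"
proof -
 have "\<exists>D. fdo_with 0 D Ber \<and> D 0 = id"
  using ber unfolding berezin_transform_def fdo_with_iff_expansion by blast
 from someI_ex[OF this] show "fdo_with 0 DB Ber" "DB 0 = id" by (simp_all add: DB_def)
qed

lemma Ber_fdo: "fdo Ber" using DB(1) by (auto simp: fdo_def)

lemma Ber_FF [simp]: "f \<in> FF ==> Ber f \<in> FF" by (rule fdo_closed[OF Ber_fdo])

lemma Ber_ba:
 assumes "open V" "V \<subseteq> U" "santi V b" "shol V a"
 shows "eq_on V (Ber (cst (b * a))) (star (cst b) (cst a))"
proof -
 have "eq_on V (Ber (cst b * cst a)) (star (cst b) (cst a))"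
  using ber assms shol_sf_hol[OF assms(1,2) shol_smooth(1)[OF assms(4)]] santi_sf_antihol[OF assms(1,2) shol_smooth(2)[OF assms(3)]]
   shol_smooth(1)[OF assms(4)] shol_smooth(2)[OF assms(3)] unfolding berezin_transform_def by blast
 then show ?thesis unfolding cst_mult .
qed

abbreviation J :: "('m, 'd) formal \<Rightarrow> ('m, 'd) formal" where "J \<equiv> op_inv U Ber"

lemma J_FF [simp]: "f \<in> FF ==> J f \<in> FF"
 and Ber_J: "f \<in> FF ==> eq_on U (Ber (J f)) f"
 using op_inv_props[OF DB] by blast+

lemma J_fdo_with: "\<exists>E. fdo_with 0 E J" by (rule op_inv_fdo_with[OF DB])

lemma J_fdo: "fdo J" using J_fdo_with by (auto simp: fdo_def)

lemmas J_unique = op_inv_unique[OF DB]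

text \<open>Since \<open>Ber\<close> starts with the identity, it does not change the lowest
  coefficient on U, and so neither does its inverse. This transfers the pole of \<open>w i\<close>
  to \<open>y i\<close>.\<close>

lemma J_low:
 assumes f: "f \<in> FF" and 0: "!!j z. j < n ==> z \<in> U ==> (f $$ j) z = 0" and z: "z \<in> U"
 shows "j < n ==> (J f $$ j) z = 0" "(J f $$ n) z = (f $$ n) z"
proof -
 obtain E where E: "fdo_with 0 E J" using J_fdo_with by blast
 have l: "(J f $$ j) z = 0" if "j < n" "z \<in> U" for j z
  using fdo_withD[OF E f 0 that(2), where n = j and s = n] that by simp
 show "j < n ==> (J f $$ j) z = 0" using l z by blast
 have "(Ber (J f) $$ n) z = (J f $$ n) z"
  by (rule unipotent_nth[OF DB J_FF[OF f] oU subset_refl l z])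
 then show "(J f $$ n) z = (f $$ n) z" using eq_onD[OF Ber_J[OF f] z, of n] by simp
qed

lemma Ber_one: "shol V a ==> open V ==> V \<subseteq> U ==> eq_on V (Ber (cst a)) (cst a)"
 "santi V b ==> open V ==> V \<subseteq> U ==> eq_on V (Ber (cst b)) (cst b)"
proof -
 assume V: "open V" "V \<subseteq> U"
 show "eq_on V (Ber (cst a)) (cst a)" if a: "shol V a"
 proof -
  have "eq_on V (Ber (cst (1 * a))) (star (cst 1) (cst a))" by (rule Ber_ba[OF V shol_sconst(4) a])
  moreover have "eq_on V (star 1 (cst a)) (cst a)"
   using eq_on_subset[OF star_one(1)[OF FF_const[OF shol_smooth(1)[OF a]]] V(2)] .
  ultimately show ?thesis unfolding mult_1 fls_const_1 by (rule eq_on_trans)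
 qed
 show "eq_on V (Ber (cst b)) (cst b)" if b: "santi V b"
 proof -
  have "eq_on V (Ber (cst (b * 1))) (star (cst b) (cst 1))" by (rule Ber_ba[OF V b shol_sconst(3)])
  moreover have "eq_on V (star (cst b) 1) (cst b)"
   using eq_on_subset[OF star_one(2)[OF FF_const[OF shol_smooth(2)[OF b]]] V(2)] .
  ultimately show ?thesis unfolding mult_1_right fls_const_1 by (rule eq_on_trans)
 qed
qed

abbreviation D :: "('m, 'd) prod" where "D \<equiv> dual_star U Ber star"

lemma D_FF [simp]: "f \<in> FF ==> g \<in> FF ==> D f g \<in> FF" by (simp add: dual_star_def)

lemma Ber_D: "f \<in> FF ==> g \<in> FF ==> eq_on U (Ber (D f g)) (star (Ber f) (Ber g))"
 unfolding dual_star_def by (rule Ber_J) simp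

lemma D_unique:
 assumes "f \<in> FF" "g \<in> FF" "h \<in> FF" "open V" "V \<subseteq> U" "eq_on V (Ber h) (star (Ber f) (Ber g))"
 shows "eq_on V (D f g) h"
 unfolding dual_star_def by (rule J_unique[OF assms(3) _ assms(4-6)]) (use assms in simp)

lemma D_fdo: "f \<in> FF ==> fdo (D f)" and D_fdo_r: "g \<in> FF ==> fdo (\<lambda>f. D f g)"
proof -
 show "fdo (D f)" if "f \<in> FF"
  using fdo_comp[OF J_fdo fdo_comp[OF star_fdo[OF Ber_FF[OF that]] Ber_fdo]] by (simp add: dual_star_def[abs_def])
 show "fdo (\<lambda>f. D f g)" if "g \<in> FF"
  unfolding dual_star_def by (rule fdo_comp[OF J_fdo fdo_comp[OF star_fdo_r[OF Ber_FF[OF that]] Ber_fdo]])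
qed

text \<open>On products b a it is the parity invariance \<open>fpar_star\<close> of the star
  product.\<close>

lemma Ber_par:
 assumes "f \<in> FF"
 shows "eq_on U (fpar (Ber f)) (Ber (fpar f))"
proof (rule fdo_eq_on_poly[OF fdo_comp[OF fdo_fpar Ber_fdo] fdo_comp[OF Ber_fdo fdo_fpar] subset_refl oU assms])
 fix b a :: "('m, 'd) sfun" assume b: "santi U b" and a: "shol U a"
 have F: "cst b \<in> FF" "cst a \<in> FF" using shol_smooth(2)[OF b] shol_smooth(1)[OF a] by simp_all
 have "eq_on U (fpar (Ber (cst (b * a)))) (fpar (star (cst b) (cst a)))"
  by (rule fdo_cong_U[OF fdo_fpar _ _ Ber_ba[OF oU subset_refl b a]]) (use F shol_smooth(2)[OF b] shol_smooth(1)[OF a] in simp_all)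
 also have "eq_on U \<dots> (star (cst (spar b)) (cst (spar a)))"
  using fpar_star[OF F] unfolding fls_const_fops .
 also have "eq_on U \<dots> (Ber (cst (spar b * spar a)))"
  by (rule eq_on_sym[OF Ber_ba[OF oU subset_refl santi_sg[OF subset_refl b] shol_sg[OF subset_refl a]]])
 also have "spar b * spar a = spar (b * a)" by (simp add: sg_def gsg_mult fun_eq_iff)
 finally show "eq_on U (fpar (Ber (cst (b * a)))) (Ber (fpar (cst (b * a))))"
  unfolding fls_const_fops .
qed

lemma J_par:
 assumes "f \<in> FF"
 shows "eq_on U (J (fpar f)) (fpar (J f))"
proof (rule J_unique[OF _ _ oU subset_refl])
 show "eq_on U (Ber (fpar (J f))) (fpar f)"
  by (rule eq_on_trans[OF eq_on_sym[OF Ber_par] fdo_cong_U[OF fdo_fpar _ _ Ber_J]]) (use assms in simp_all)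
qed (use assms in simp_all)

lemma par_J:
 assumes "par q f" "f \<in> FF"
 shows "par q (J f)"
proof -
 have "eq_on U (J (fpar f)) (J (if q then - f else f))"
  by (rule fdo_cong_U[OF J_fdo _ _ assms(1)[unfolded par_def]]) (use assms in auto)
 moreover have "eq_on U (J (if q then - f else f)) (if q then - J f else J f)"
  using fdo_uminus_arg[OF J_fdo assms(2)] by simp
 ultimately show ?thesis unfolding par_def using eq_on_sym[OF J_par[OF assms(2)]] by (blast intro: eq_on_trans)
qed

text \<open>On products c a one has b star (c star a) = (b c) star a, and this is Ber of b c a. Such
  products, with c and a given on all of U, determine both operators, while \<open>b\<close> need
  only be antiholomorphic on \<open>V\<close>.\<close>

lemma D_anti:
 assumes V: "open V" "V \<subseteq> U" and b: "santi V b" and f: "f \<in> FF"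
 shows "eq_on V (D (cst b) f) (cst b * f)"
proof (rule fdo_eq_on_poly[OF D_fdo fdo_lmult V(2,1) f])
 show B: "cst b \<in> FF" "cst b \<in> FF" using shol_smooth(2)[OF b] by simp_all
 fix c a :: "('m, 'd) sfun" assume c: "santi U c" and a: "shol U a"
 have F: "cst c \<in> FF" "cst a \<in> FF" "cst (b * c) \<in> FF" "cst (c * a) \<in> FF"
  using shol_smooth(2)[OF c] shol_smooth(1)[OF a] shol_smooth(2)[OF b] by (simp_all only: FF_const sf_smooth_mult oU)
 show "eq_on V (D (cst b) (cst (c * a))) (cst b * cst (c * a))"
 proof (rule D_unique[OF B(1) F(4) _ V])
  have "eq_on V (star (Ber (cst b)) (Ber (cst (c * a)))) (star (cst b) (star (cst c) (cst a)))"
   by (rule star_cong[OF V _ _ _ _ Ber_one(2)[OF b V] eq_on_subset[OF Ber_ba[OF oU subset_refl c a] V(2)]]) (use B F in simp_all)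
  also have "eq_on V \<dots> (star (star (cst b) (cst c)) (cst a))"
   by (rule eq_on_subset[OF eq_on_sym[OF star_assoc] V(2)]) (use B F in simp_all)
  also have "eq_on V \<dots> (star (cst (b * c)) (cst a))"
   unfolding cst_mult[symmetric]
   by (rule eq_on_subset[OF star_cong_U[OF _ _ _ _ star_anti_U[OF c B(1)] eq_on_refl] V(2)]) (use B F in \<open>simp_all del: fls_const_mult_const\<close>)
  also have "eq_on V \<dots> (Ber (cst ((b * c) * a)))"
   by (rule eq_on_sym[OF Ber_ba[OF V santi_mult[OF V(2) b shol_mono(2)[OF c V(2)]] shol_mono(1)[OF a V(2)]]])
  finally show "eq_on V (Ber (cst b * cst (c * a))) (star (Ber (cst b)) (Ber (cst (c * a))))"
   unfolding cst_mult mult.assoc by (rule eq_on_sym)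
 qed (rule FF_mult[OF B(1) F(4)])
qed

lemma D_hol:
 assumes V: "open V" "V \<subseteq> U" and a: "shol V a" and f: "f \<in> FF"
 shows "eq_on V (D f (cst a)) (f * cst a)"
proof (rule fdo_eq_on_poly[OF D_fdo_r fdo_rmult V(2,1) f])
 show A: "cst a \<in> FF" "cst a \<in> FF" using shol_smooth(1)[OF a] by simp_all
 fix b c :: "('m, 'd) sfun" assume b: "santi U b" and c: "shol U c"
 have F: "cst c \<in> FF" "cst b \<in> FF" "cst (c * a) \<in> FF" "cst (b * c) \<in> FF"
  using shol_smooth(1)[OF c] shol_smooth(1)[OF a] shol_smooth(2)[OF b] by (simp_all only: FF_const sf_smooth_mult oU)
 show "eq_on V (D (cst (b * c)) (cst a)) (cst (b * c) * cst a)"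
 proof (rule D_unique[OF F(4) A(1) _ V])
  have "eq_on V (star (Ber (cst (b * c))) (Ber (cst a))) (star (star (cst b) (cst c)) (cst a))"
   by (rule star_cong[OF V _ _ _ _ eq_on_subset[OF Ber_ba[OF oU subset_refl b c] V(2)] Ber_one(1)[OF a V]]) (use A F in simp_all)
  also have "eq_on V \<dots> (star (cst b) (star (cst c) (cst a)))"
   by (rule eq_on_subset[OF star_assoc V(2)]) (use A F in simp_all)
  also have "eq_on V \<dots> (star (cst b) (cst (c * a)))"
   unfolding cst_mult[symmetric]
   by (rule eq_on_subset[OF star_cong_U[OF _ _ _ _ eq_on_refl star_hol_U[OF c A(1)]] V(2)]) (use A F in \<open>simp_all del: fls_const_mult_const\<close>)
  also have "eq_on V \<dots> (Ber (cst (b * (c * a))))"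
   by (rule eq_on_sym[OF Ber_ba[OF V shol_mono(2)[OF b V(2)] shol_mult[OF V(2) shol_mono(1)[OF c V(2)] a]]])
  finally show "eq_on V (Ber (cst (b * c) * cst a)) (star (Ber (cst (b * c))) (Ber (cst a)))"
   unfolding cst_mult mult.assoc by (rule eq_on_sym)
 qed (rule FF_mult[OF F(4) A(1)])
qed

lemma Ber_bmult:
 assumes b: "santi U b" and g: "g \<in> FF"
 shows "eq_on U (Ber (cst b * g)) (star (cst b) (Ber g))"
proof -
 have B: "cst b \<in> FF" using shol_smooth(2)[OF b] by simp
 have "eq_on U (Ber (cst b * g)) (Ber (D (cst b) g))"
  by (rule fdo_cong_U[OF Ber_fdo _ _ eq_on_sym[OF D_anti[OF oU subset_refl b g]]]) (use B g in simp_all)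
 also have "eq_on U \<dots> (star (Ber (cst b)) (Ber g))" by (rule Ber_D[OF B g])
 also have "eq_on U \<dots> (star (cst b) (Ber g))"
  by (rule star_cong_U[OF _ _ _ _ Ber_one(2)[OF b oU subset_refl] eq_on_refl]) (use B g in simp_all)
 finally show ?thesis .
qed

lemma Ber_multa:
 assumes a: "shol U a" and g: "g \<in> FF"
 shows "eq_on U (Ber (g * cst a)) (star (Ber g) (cst a))"
proof -
 have A: "cst a \<in> FF" using shol_smooth(1)[OF a] by simp
 have "eq_on U (Ber (g * cst a)) (Ber (D g (cst a)))"
  by (rule fdo_cong_U[OF Ber_fdo _ _ eq_on_sym[OF D_hol[OF oU subset_refl a g]]]) (use A g in simp_all)
 also have "eq_on U \<dots> (star (Ber g) (Ber (cst a)))" by (rule Ber_D[OF g A])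
 also have "eq_on U \<dots> (star (Ber g) (cst a))"
  by (rule star_cong_U[OF _ _ _ _ eq_on_refl Ber_one(1)[OF a oU subset_refl]]) (use A g in simp_all)
 finally show ?thesis .
qed

section \<open>The derivatives of the potential and their preimages under the Berezin
  transform\<close>

definition w :: "('m, 'd) dir \<Rightarrow> ('m, 'd) formal" where "w i = fpd i X"
definition y :: "('m, 'd) dir \<Rightarrow> ('m, 'd) formal" where "y i = J (w i)"

lemma X_FF [simp]: "X \<in> FF" and X_par: "par False X"
 and X_low: "n < - 1 ==> z \<in> U ==> (X $$ n) z = 0"
 using pot homogeneous_on_par[of 0 X] by (simp_all add: nondegenerate_potential_def)

lemma w_FF [simp]: "w i \<in> FF" and y_FF [simp]: "y i \<in> FF" by (simp_all add: w_def y_def)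

lemma w_par: "par (oddd i) (w i)" unfolding w_def by (rule par_fpd[OF X_par X_FF])
lemma y_par: "par (oddd i) (y i)" unfolding y_def by (rule par_J[OF w_par w_FF])

lemma Ber_y: "eq_on U (Ber (y i)) (w i)" unfolding y_def by (rule Ber_J) simp

lemma w_closed: "eq_on U (fpd i (w j)) (ssgn i j (fpd j (w i)))"
 unfolding w_def by (rule fpd_closed[OF X_FF])

lemma star_w_l: "holo i ==> f \<in> FF ==> eq_on U (star (w i) f) (w i * f + fpd i f)"
 using det unfolding determines_anti_wick_def f_d_fpd w_def by (cases i) auto

text \<open>The graded right multiplication is made ungraded by feeding it \<open>fsgd i f\<close>;
  the same twist cancels in the product with \<open>w i\<close> but stays inside the
  derivative.\<close>

lemma star_w_r:
 assumes i: "\<not> holo i" and f: "f \<in> FF"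
 shows "eq_on U (star f (w i)) (f * w i + fpd i (fsgd i f))"
proof -
 have "eq_on U (right_mult star (w i) (fsgd i f)) (star f (w i))"
 proof -
  have "eq_on U (right_mult star (w i) (fsgd i f)) (star (if oddd i then fpar (fsgd i f) else fsgd i f) (w i))"
   by (rule star_rm[OF w_FF w_par FF_fsgd[OF f]])
  moreover have "(if oddd i then fpar (fsgd i f) else fsgd i f) = f" by (simp add: fsgd_def)
  ultimately show ?thesis by (simp only:)
 qed
 moreover have "eq_on U (right_mult star (w i) (fsgd i f)) (w i * fsgd i f + fpd i (fsgd i f))"
  using det i FF_fsgd[OF f, of i] unfolding determines_anti_wick_def f_d_fpd w_def by (cases i) auto
 moreover have "eq_on U (w i * fsgd i f) (f * w i)"
  using par_comm[OF w_par, of i "fsgd i f"] by simp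
 ultimately show ?thesis
  by (meson eq_on_add eq_on_refl eq_on_sym eq_on_trans)
qed

text \<open>For f = b a, associativity reduces the claim to \<open>a\<close>. Moving
  \<open>a\<close> past \<open>y i\<close> gives Ber (a y_i) = w_i star a' with a' =
  \<open>sgd i a\<close>, which \<open>star_w_l\<close> evaluates to a w_i + d_i a'. The last term
  is holomorphic, hence fixed by \<open>Ber\<close>, so Ber (a y_i - d_i a') = a w_i = a star
  w_i.\<close>

lemma D_y_r:
 assumes i: "holo i" and f: "f \<in> FF"
 shows "eq_on U (D f (y i)) (f * y i - fpd i (fsgd i f))"
proof (rule fdo_eq_on_poly[OF D_fdo_r fdo_diff[OF fdo_rmult fdo_comp[OF fdo_fpd fdo_fsgd]] subset_refl oU f])
 fix b a :: "('m, 'd) sfun" assume b: "santi U b" and a: "shol U a"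
 define A where "A = cst a"
 define B where "B = cst b"
 define A' where "A' = fsgd i A"
 define P where "P = fpd i A'"
 have F: "A \<in> FF" "B \<in> FF" "A' \<in> FF" "P \<in> FF"
  using shol_smooth(1)[OF a] shol_smooth(2)[OF b] by (simp_all add: A_def B_def A'_def P_def)
 have a': "shol U (sgd i a)" "A' = cst (sgd i a)" "shol U (pd i (sgd i a))" "P = cst (pd i (sgd i a))"
  using shol_sgd[OF subset_refl a] shol_pd[OF oU subset_refl shol_sgd[OF subset_refl a]] by (simp_all only: P_def A'_def A_def fls_const_fops)
 have ba: "cst (b * a) = B * A" by (simp add: A_def B_def)
 \<comment> \<open>The derivative does not see \<open>b\<close>, which is antiholomorphic, and the
   twist of \<open>b\<close> is undone by the one in the Leibniz rule.\<close>
 have e1: "eq_on U (fpd i (fsgd i (B * A))) (B * P)"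
 proof -
  have "pd i (sgd i (b * a)) z = b z * pd i (sgd i a) z" if z: "z \<in> U" for z
  proof -
   have "sgd i (b * a) = sgd i b * sgd i a" by (simp add: sgd_def sg_def gsg_mult fun_eq_iff)
   moreover have "pd i (sgd i b * sgd i a) z = pd i (sgd i b) z * sgd i a z + sgd i (sgd i b) z * pd i (sgd i a) z"
    by (rule pd_mult[OF z]) (use shol_smooth(1)[OF a] shol_smooth(2)[OF b] in simp_all)
   moreover have "pd i (sgd i b) z = 0" using santi_sgd[OF subset_refl b, of i] i z by (simp add: santi_def)
   moreover have "sgd i (sgd i b) = b" by (simp add: sgd_def sg_def)
   ultimately show ?thesis by simp
  qed
  then show ?thesis unfolding a'(4) A_def B_def cst_mult fls_const_fops by (simp add: eq_on_def)
 qed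
 show "eq_on U (D (cst (b * a)) (y i)) (cst (b * a) * y i - fpd i (fsgd i (cst (b * a))))"
  unfolding ba
 proof (rule D_unique[OF _ _ _ oU subset_refl])
  have g: "eq_on U (Ber (A * y i - P)) (A * w i)"
  proof -
   have "eq_on U (Ber (A * y i - P)) (Ber (A * y i) - Ber P)"
    by (rule fdo_minus_arg[OF Ber_fdo]) (use F in simp_all)
   moreover have "eq_on U (Ber P) P" unfolding a'(4) by (rule Ber_one(1)[OF a'(3) oU subset_refl])
   moreover have "eq_on U (Ber (A * y i)) (A * w i + P)"
   proof -
    have "eq_on U (Ber (A * y i)) (Ber (y i * A'))"
     using fdo_cong_U[OF Ber_fdo _ _ eq_on_sym[OF par_comm[OF y_par, of i A']]] F by (simp add: A'_def)
    also have "eq_on U \<dots> (star (Ber (y i)) A')" unfolding a'(2) by (rule Ber_multa[OF a'(1) y_FF])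
    also have "eq_on U \<dots> (star (w i) A')"
     by (rule star_cong_U[OF _ _ _ _ Ber_y eq_on_refl]) (use F in simp_all)
    also have "eq_on U \<dots> (w i * A' + P)" unfolding P_def by (rule star_w_l[OF i F(3)])
    also have "eq_on U \<dots> (A * w i + P)"
     using eq_on_add[OF par_comm[OF w_par, of i A'] eq_on_refl[of U P]] by (simp add: A'_def)
    finally show ?thesis .
   qed
   ultimately have "eq_on U (Ber (A * y i - P)) (A * w i + P - P)"
    by (blast intro: eq_on_trans eq_on_diff)
   then show ?thesis by simp
  qed
  have "eq_on U (Ber (B * A * y i - fpd i (fsgd i (B * A)))) (Ber (B * (A * y i - P)))"
  proof (rule fdo_cong_U[OF Ber_fdo])
   show "eq_on U (B * A * y i - fpd i (fsgd i (B * A))) (B * (A * y i - P))"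
    using eq_on_diff[OF eq_on_refl[of U "B * A * y i"] e1] by (simp add: right_diff_distrib mult.assoc)
  qed (use F in simp_all)
  also have "eq_on U \<dots> (star B (Ber (A * y i - P)))"
   unfolding B_def by (rule Ber_bmult[OF b]) (use F in simp)
  also have "eq_on U \<dots> (star B (star A (w i)))"
  proof (rule star_cong_U[OF _ _ _ _ eq_on_refl])
   show "eq_on U (Ber (A * y i - P)) (star A (w i))"
    by (rule eq_on_trans[OF g]) (unfold A_def, rule eq_on_sym[OF star_hol_U[OF a w_FF]])
  qed (use F in simp_all)
  also have "eq_on U \<dots> (star (star B A) (w i))" by (rule eq_on_sym[OF star_assoc]) (use F in simp_all)
  also have "eq_on U \<dots> (star (Ber (B * A)) (Ber (y i)))"
   by (rule star_cong_U[OF _ _ _ _ _ eq_on_sym[OF Ber_y]])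
    (use F in simp_all, use Ber_ba[OF oU subset_refl b a] in \<open>simp add: A_def B_def eq_on_sym\<close>)
  finally show "eq_on U (Ber (B * A * y i - fpd i (fsgd i (B * A)))) (star (Ber (B * A)) (Ber (y i)))" .
 qed (use F in simp_all)
qed simp_all

text \<open>The mirror image of \<open>D_y_r\<close>: \<open>b\<close> takes the role of
  \<open>a\<close>, and \<open>w i\<close> acts by star multiplication from the right.\<close>

lemma D_y_l:
 assumes i: "\<not> holo i" and f: "f \<in> FF"
 shows "eq_on U (D (y i) f) (y i * f - fpd i f)"
proof (rule fdo_eq_on_poly[OF D_fdo fdo_diff[OF fdo_lmult fdo_fpd] subset_refl oU f])
 fix b a :: "('m, 'd) sfun" assume b: "santi U b" and a: "shol U a"
 define A where "A = cst a"
 define B where "B = cst b"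
 define B' where "B' = fsgd i B"
 define P where "P = fpd i B"
 have F: "A \<in> FF" "B \<in> FF" "B' \<in> FF" "P \<in> FF"
  using shol_smooth(1)[OF a] shol_smooth(2)[OF b] by (simp_all add: A_def B_def B'_def P_def)
 have b': "santi U (sgd i b)" "B' = cst (sgd i b)" "santi U (pd i b)" "P = cst (pd i b)"
  using santi_sgd[OF subset_refl b] santi_pd[OF oU subset_refl b] by (simp_all only: P_def B'_def B_def fls_const_fops)
 have ba: "cst (b * a) = B * A" by (simp add: A_def B_def)
 have e1: "eq_on U (fpd i (B * A)) (P * A)"
 proof -
  have "pd i (b * a) z = pd i b z * a z" if z: "z \<in> U" for z
  proof -
   have "pd i (b * a) z = pd i b z * a z + sgd i b z * pd i a z"
    by (rule pd_mult[OF z]) (use shol_smooth(1)[OF a] shol_smooth(2)[OF b] in simp_all)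
   moreover have "pd i a z = 0" using a i z by (simp add: shol_def)
   ultimately show ?thesis by simp
  qed
  then show ?thesis unfolding b'(4) A_def B_def cst_mult fls_const_fops by (simp add: eq_on_def)
 qed
 show "eq_on U (D (y i) (cst (b * a))) (y i * cst (b * a) - fpd i (cst (b * a)))"
  unfolding ba
 proof (rule D_unique[OF _ _ _ oU subset_refl])
  have g: "eq_on U (Ber (y i * B - P)) (w i * B)"
  proof -
   have "eq_on U (Ber (y i * B - P)) (Ber (y i * B) - Ber P)"
    by (rule fdo_minus_arg[OF Ber_fdo]) (use F in simp_all)
   moreover have "eq_on U (Ber P) P" unfolding b'(4) by (rule Ber_one(2)[OF b'(3) oU subset_refl])
   moreover have "eq_on U (Ber (y i * B)) (w i * B + P)"
   proof -
    have "eq_on U (Ber (y i * B)) (Ber (B' * y i))"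
     using fdo_cong_U[OF Ber_fdo _ _ par_comm[OF y_par, of i B]] F by (simp add: B'_def)
    also have "eq_on U \<dots> (star B' (Ber (y i)))" unfolding b'(2) by (rule Ber_bmult[OF b'(1) y_FF])
    also have "eq_on U \<dots> (star B' (w i))"
     by (rule star_cong_U[OF _ _ _ _ eq_on_refl Ber_y]) (use F in simp_all)
    also have "eq_on U \<dots> (B' * w i + P)" using star_w_r[OF i F(3)] by (simp add: P_def B'_def)
    also have "eq_on U \<dots> (w i * B + P)"
     unfolding B'_def by (rule eq_on_add[OF eq_on_sym[OF par_comm[OF w_par, of i B]] eq_on_refl])
    finally show ?thesis .
   qed
   ultimately have "eq_on U (Ber (y i * B - P)) (w i * B + P - P)"
    by (blast intro: eq_on_trans eq_on_diff)
   then show ?thesis by simp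
  qed
  have "eq_on U (Ber (y i * (B * A) - fpd i (B * A))) (Ber ((y i * B - P) * A))"
  proof (rule fdo_cong_U[OF Ber_fdo])
   show "eq_on U (y i * (B * A) - fpd i (B * A)) ((y i * B - P) * A)"
    using eq_on_diff[OF eq_on_refl[of U "y i * (B * A)"] e1] by (simp add: left_diff_distrib mult.assoc)
  qed (use F in simp_all)
  also have "eq_on U \<dots> (star (Ber (y i * B - P)) A)"
   unfolding A_def by (rule Ber_multa[OF a]) (use F in simp)
  also have "eq_on U \<dots> (star (star (w i) B) A)"
  proof (rule star_cong_U[OF _ _ _ _ _ eq_on_refl])
   show "eq_on U (Ber (y i * B - P)) (star (w i) B)"
    by (rule eq_on_trans[OF g]) (unfold B_def, rule eq_on_sym[OF star_anti_U[OF b w_FF]])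
  qed (use F in simp_all)
  also have "eq_on U \<dots> (star (w i) (star B A))" by (rule star_assoc) (use F in simp_all)
  also have "eq_on U \<dots> (star (Ber (y i)) (Ber (B * A)))"
   by (rule star_cong_U[OF _ _ _ _ eq_on_sym[OF Ber_y]])
    (use F in simp_all, use Ber_ba[OF oU subset_refl b a] in \<open>simp add: A_def B_def eq_on_sym\<close>)
  finally show "eq_on U (Ber (y i * (B * A) - fpd i (B * A))) (star (Ber (y i)) (Ber (B * A)))" .
 qed (use F in simp_all)
qed simp_all

text \<open>For holomorphic directions this is \<open>star_w_l\<close>. For antiholomorphic ones
  \<open>star_w_r\<close> yields d_j w_i, which closedness turns into d_i w_j.\<close>

lemma star_w_w:
 assumes "holo i = holo j"
 shows "eq_on U (star (w i) (w j)) (w i * w j + fpd i (w j))"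
proof (cases "holo i")
 case True
 show ?thesis by (rule star_w_l[OF True w_FF])
next
 case False
 have "eq_on U (fpd j (fsgd j (w i))) (fpd j (ssgn i j (w i)))"
  by (rule fdo_cong_U[OF fdo_fpd _ _ par_fsgd[OF w_par]]) (auto simp: ssgn_def)
 also have "eq_on U \<dots> (ssgn i j (fpd j (w i)))"
  using fdo_uminus_arg[OF fdo_fpd w_FF, of j i] by (simp add: ssgn_def)
 also have "eq_on U \<dots> (fpd i (w j))" by (rule eq_on_sym[OF w_closed])
 finally have "eq_on U (fpd j (fsgd j (w i))) (fpd i (w j))" .
 from eq_on_trans[OF star_w_r[of j "w i"] eq_on_add[OF eq_on_refl this]] show ?thesis using False assms by simp
qed

lemma par_swap:
 fixes i j :: "('m, 'd) dir" and f g :: "('m, 'd) formal"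
 assumes "par (oddd i) f" "par (oddd j) g"
 shows "eq_on U (f * g) (ssgn i j (g * f))"
proof -
 have "eq_on U (f * g) (fsgd i g * f)" by (rule par_comm[OF assms(1)])
 also have "eq_on U \<dots> (ssgn j i g * f)" by (rule eq_on_mult[OF par_fsgd[OF assms(2)] eq_on_refl])
 also have "ssgn j i g * f = ssgn i j (g * f)" by (simp add: ssgn_def conj_commute)
 finally show ?thesis .
qed

text \<open>By \<open>star_w_w\<close> and closedness the \<open>w\<close> of equal type
  supercommute for \<open>star\<close>; the inverse Berezin transform carries this over to
  \<open>y\<close>.\<close>

lemma D_y_y:
 assumes "holo i = holo j"
 shows "eq_on U (D (y i) (y j)) (ssgn i j (D (y j) (y i)))"
proof -
 have s: "eq_on U (D (y i) (y j)) (J (star (w i) (w j)))" for i j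
  unfolding dual_star_def
  by (rule fdo_cong_U[OF J_fdo _ _ star_cong_U[OF _ _ _ _ Ber_y Ber_y]]) simp_all
 have "eq_on U (star (w i) (w j)) (w i * w j + fpd i (w j))" by (rule star_w_w[OF assms])
 also have "eq_on U \<dots> (ssgn i j (w j * w i) + ssgn i j (fpd j (w i)))"
  by (rule eq_on_add[OF par_swap[OF w_par w_par] w_closed])
 also have "ssgn i j (w j * w i) + ssgn i j (fpd j (w i)) = ssgn i j (w j * w i + fpd j (w i))" by (simp add: ssgn_def)
 also have "eq_on U \<dots> (ssgn i j (star (w j) (w i)))"
  by (rule eq_on_ssgn[OF eq_on_sym[OF star_w_w]]) (use assms in simp)
 finally have "eq_on U (J (star (w i) (w j))) (J (ssgn i j (star (w j) (w i))))"
  by (rule fdo_cong_U[OF J_fdo, rotated 2]) (auto simp: ssgn_def)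
 also have "eq_on U \<dots> (ssgn i j (J (star (w j) (w i))))"
  using fdo_uminus_arg[OF J_fdo star_FF[OF w_FF w_FF], of j i] by (simp add: ssgn_def)
 also have "eq_on U \<dots> (ssgn i j (D (y j) (y i)))" by (rule eq_on_ssgn[OF eq_on_sym[OF s]])
 finally show ?thesis by (rule eq_on_trans[OF s])
qed

lemma fpd_fsgd_y: "eq_on U (fpd j (fsgd j (y i))) (ssgn i j (fpd j (y i)))"
proof -
 have "eq_on U (fpd j (fsgd j (y i))) (fpd j (ssgn i j (y i)))"
  by (rule fdo_cong_U[OF fdo_fpd _ _ par_fsgd[OF y_par]]) (auto simp: ssgn_def)
 also have "eq_on U \<dots> (ssgn i j (fpd j (y i)))"
  using fdo_uminus_arg[OF fdo_fpd y_FF, of j i] by (simp add: ssgn_def)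
 finally show ?thesis .
qed

text \<open>For directions of different type, one and the same dual product of two \<open>y\<close>
  is evaluated by both \<open>D_y_r\<close> and \<open>D_y_l\<close>, and the derivative terms are
  compared. For equal type, the two orders of the product are evaluated by one of these rules and
  compared through \<open>D_y_y\<close>.\<close>

lemma y_closed: "eq_on U (fpd i (y j)) (ssgn i j (fpd j (y i)))"
proof -
 have mixed: "eq_on U (fpd j (y i)) (ssgn j i (fpd i (y j)))" if ij: "holo i" "\<not> holo j" for i j
 proof (rule eq_onI)
  fix n z assume z: "z \<in> U"
  show "(fpd j (y i) $$ n) z = (ssgn j i (fpd i (y j)) $$ n) z"
   using eq_onD[OF D_y_r[OF ij(1) y_FF, of j] z, of n] eq_onD[OF D_y_l[OF ij(2) y_FF, of i] z, of n]
    eq_onD[OF fpd_fsgd_y[of i j] z, of n] by simp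
 qed
 show ?thesis
 proof (rule eq_onI)
  fix n z assume z: "z \<in> U"
  note s = eq_onD[OF par_swap[OF y_par y_par, of i j] z, of n]
  show "(fpd i (y j) $$ n) z = (ssgn i j (fpd j (y i)) $$ n) z"
  proof (cases "holo i = holo j")
   case True
   note d = eq_onD[OF D_y_y[OF True] z, of n]
   show ?thesis
   proof (cases "holo i")
    case h: True
    have hj: "holo j" using True h by simp
    show ?thesis
     using eq_onD[OF D_y_r[OF hj y_FF, of i] z, of n] eq_onD[OF D_y_r[OF h y_FF, of j] z, of n]
      eq_onD[OF fpd_fsgd_y[of j i] z, of n] eq_onD[OF fpd_fsgd_y[of i j] z, of n] d s
     by (cases "oddd i \<and> oddd j") (auto simp: ssgn_def)
   next
    case h: False
    have hj: "\<not> holo j" using True h by simp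
    show ?thesis
     using eq_onD[OF D_y_l[OF h y_FF, of j] z, of n] eq_onD[OF D_y_l[OF hj y_FF, of i] z, of n] d s
     by (cases "oddd i \<and> oddd j") (auto simp: ssgn_def)
   qed
  next
   case False
   show ?thesis
   proof (cases "holo i")
    case h: True
    have "(fpd j (y i) $$ n) z = (ssgn j i (fpd i (y j)) $$ n) z"
     by (rule eq_onD[OF mixed z]) (use False h in auto)
    then show ?thesis by (cases "oddd i \<and> oddd j") (auto simp: ssgn_def)
   next
    case h: False
    show ?thesis by (rule eq_onD[OF mixed z]) (use False h in auto)
   qed
  qed
 qed
qed

end

text \<open>The last assumption, that the poles of \<open>X\<close> and \<open>X'\<close> cancel on
  U, is the normalisation of the free constants under which \<open>formal_exp (X + X')\<close> is a
  formal function.\<close>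

locale bdens = bstar U star X Ber for U :: "(complex^'m::finite) set"
  and star :: "('m, 'd::{finite,linorder}) prod" and X Ber +
 fixes X' :: "('m, 'd::{finite,linorder}) formal"
 assumes X'_FF [simp]: "X' \<in> FF" and X'_par: "par False X'" and fpd_X': "eq_on U (fpd i X') (- y i)"
  and X_X': "n < 0 ==> z \<in> U ==> ((X + X') $$ n) z = 0"

section \<open>The dual potential\<close>

context bstar
begin

text \<open>\<open>star_expansion\<close> sums from \<open>fls_subdegree\<close>, which also depends
  on values off U. Both factors are therefore replaced by truncations \<open>tr\<close>, equal to
  them on U and without negative powers anywhere.\<close>

lemma star_low:
 assumes f: "f \<in> FF" "!!j z. j < 0 ==> z \<in> U ==> (f $$ j) z = 0"
  and g: "g \<in> FF" "!!j z. j < 0 ==> z \<in> U ==> (g $$ j) z = 0" and z: "z \<in> U"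
 shows "n < 0 ==> (star f g $$ n) z = 0" "(star f g $$ 0) z = (f $$ 0) z * (g $$ 0) z"
proof -
 define tr :: "('m, 'd) formal \<Rightarrow> ('m, 'd) formal" where "tr h = Abs_fls (\<lambda>n. if n < 0 then 0 else h $$ n)" for h
 have tr: "tr h $$ n = (if n < 0 then 0 else h $$ n)" for h n
  unfolding tr_def by (rule nth_Abs_fls_lower_bound[of 0]) simp
 have trF: "tr h \<in> FF" if "h \<in> FF" for h
 proof -
  have "tr h $$ n \<in> sf_smooth U" for n unfolding tr using FF_nth[OF that, of n] by (cases "n < 0") (simp_all only: if_True if_False sf_smooth_0)
  then show ?thesis unfolding formal_funs_def by (intro CollectI allI)
 qed
 have e: "eq_on U f (tr f)" "eq_on U g (tr g)" using f(2) g(2) by (auto simp: eq_on_def tr)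
 have s0: "0 \<le> fls_subdegree (tr h)" for h by (rule fls_subdegree_ge0I) (simp add: tr)
 have st: "(star f g $$ n) z = (star (tr f) (tr g) $$ n) z" for n
  by (rule eq_onD[OF star_cong_U[OF f(1) trF[OF f(1)] g(1) trF[OF g(1)] e] z])
 have "\<exists>C. star_expansion U C star \<and> (\<forall>f\<in>sf_smooth U. \<forall>g\<in>sf_smooth U. \<forall>z\<in>U. C 0 f g z = f z * g z)"
  using sp unfolding star_product_def by (elim conjE)
 then obtain C where C: "star_expansion U C star"
  and C0: "\<forall>f\<in>sf_smooth U. \<forall>g\<in>sf_smooth U. \<forall>z\<in>U. C 0 f g z = f z * g z"
  by (elim exE conjE)
 define I where "I n = {(i, j). fls_subdegree (tr f) \<le> i \<and> fls_subdegree (tr g) \<le> j \<and> i + j \<le> n}" for n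
 have x: "(star (tr f) (tr g) $$ n) z = (\<Sum>(i, j)\<in>I n. C (nat (n - i - j)) (tr f $$ i) (tr g $$ j) z)" for n
  unfolding I_def by (rule C[unfolded star_expansion_def, rule_format, OF trF[OF f(1)] trF[OF g(1)] z])
 show "(star f g $$ n) z = 0" if "n < 0"
 proof -
  have "p \<notin> I n" for p using s0[of f] s0[of g] that by (cases p) (simp add: I_def)
  then have "I n = {}" by blast
  then show ?thesis unfolding st x by simp
 qed
 show "(star f g $$ 0) z = (f $$ 0) z * (g $$ 0) z"
 proof (cases "fls_subdegree (tr f) = 0 \<and> fls_subdegree (tr g) = 0")
  case True
  have "p \<in> I 0 \<longleftrightarrow> p = (0, 0)" for p using True by (cases p) (auto simp: I_def)
  then have "I 0 = {(0, 0)}" by blast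
  then show ?thesis unfolding st x using C0[rule_format, OF FF_nth[OF f(1)] FF_nth[OF g(1)] z] by (simp add: tr)
 next
  case False
  have "p \<notin> I 0" for p using s0[of f] s0[of g] False by (cases p) (auto simp: I_def)
  then have "I 0 = {}" by blast
  moreover have "tr f $$ 0 = 0 \<or> tr g $$ 0 = 0"
   using False s0[of f] s0[of g] by (metis fls_eq0_below_subdegree order_le_less)
  then have "(f $$ 0) z * (g $$ 0) z = 0" unfolding tr by auto
  ultimately show ?thesis unfolding st x by simp
 qed
qed

lemma Ber_const:
 assumes f: "f \<in> sf_smooth U" and z: "z \<in> U"
 shows "j < 0 ==> (Ber (cst f) $$ j) z = 0" "(Ber (cst f) $$ 0) z = f z"
 using fdo_with_const[OF DB(1) f z] DB(2) by simp_all

lemma D_const_low: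
 assumes f: "f \<in> sf_smooth U" and g: "g \<in> sf_smooth U" and z: "z \<in> U"
 shows "r < 0 ==> (D (cst f) (cst g) $$ r) z = 0"
  "(D (cst f) (cst g) $$ 0) z = f z * g z"
proof -
 define H where "H = star (Ber (cst f)) (Ber (cst g))"
 have F: "Ber (cst f) \<in> FF" "Ber (cst g) \<in> FF" using f g by simp_all
 then have HF: "H \<in> FF" by (simp add: H_def)
 note sl = star_low[OF F(1) Ber_const(1)[OF f] F(2) Ber_const(1)[OF g], folded H_def]
 have l: "(H $$ j) z = 0" if "j < 0" "z \<in> U" for j z using sl(1)[of z j] that by blast
 have e: "D (cst f) (cst g) = J H" by (simp add: dual_star_def H_def)
 show "r < 0 ==> (D (cst f) (cst g) $$ r) z = 0"
  unfolding e by (rule J_low(1)[OF HF l z])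
 have "(J H $$ 0) z = (H $$ 0) z" by (rule J_low(2)[OF HF l z])
 also have "\<dots> = (Ber (cst f) $$ 0) z * (Ber (cst g) $$ 0) z" using sl(2)[of z] z by blast
 finally show "(D (cst f) (cst g) $$ 0) z = f z * g z"
  unfolding e Ber_const(2)[OF f z] Ber_const(2)[OF g z] .
qed

lemma par_Ber:
 assumes "par q f" "f \<in> FF"
 shows "par q (Ber f)"
proof -
 have "eq_on U (Ber (fpar f)) (Ber (if q then - f else f))"
  by (rule fdo_cong_U[OF Ber_fdo _ _ assms(1)[unfolded par_def]]) (use assms in auto)
 moreover have "eq_on U (Ber (if q then - f else f)) (if q then - Ber f else Ber f)"
  using fdo_uminus_arg[OF Ber_fdo assms(2)] by simp
 ultimately show ?thesis unfolding par_def using Ber_par[OF assms(2)] by (blast intro: eq_on_trans)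
qed

lemma star_product_dual: "star_product U D"
 unfolding star_product_def
proof (intro conjI ballI allI impI)
 fix f g :: "('m, 'd) formal" assume F: "f \<in> FF" "g \<in> FF"
 show "D f g \<in> FF" using F by simp
 show "eq_on U (D (f_scalar c * f) g) (f_scalar c * D f g)" for c
  by (rule fdo_f_scalar[OF D_fdo_r F(1)]) (rule F)
 show "eq_on U (D f (f_scalar c * g)) (f_scalar c * D f g)" for c
  by (rule fdo_f_scalar[OF D_fdo F(2)]) (rule F)
 show "homogeneous_on U (p + q) (D f g)" if "homogeneous_on U p f \<and> homogeneous_on U q g" for p q
 proof -
  have "par (odd p \<noteq> odd q) (star (Ber f) (Ber g))"
   by (rule star_par_homogeneous[OF par_Ber par_Ber]) (use that F in \<open>simp_all add: homogeneous_on_par\<close>)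
  from par_J[OF this] F show ?thesis unfolding homogeneous_on_par dual_star_def by simp
 qed
 fix h :: "('m, 'd) formal" assume h: "h \<in> FF"
 show "eq_on U (D (f + g) h) (D f h + D g h)" by (rule fdo_additive[OF D_fdo_r[OF h] F])
 show "eq_on U (D f (g + h)) (D f g + D f h)" by (rule fdo_additive[OF D_fdo[OF F(1)] F(2) h])
 show "eq_on U (D (D f g) h) (D f (D g h))"
 proof (rule D_unique[OF _ h _ oU subset_refl])
  have "eq_on U (Ber (D f (D g h))) (star (Ber f) (Ber (D g h)))" by (rule Ber_D) (use F h in simp_all)
  also have "eq_on U \<dots> (star (Ber f) (star (Ber g) (Ber h)))"
   by (rule star_cong_U[OF _ _ _ _ eq_on_refl Ber_D]) (use F h in simp_all)
  also have "eq_on U \<dots> (star (star (Ber f) (Ber g)) (Ber h))"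
   by (rule eq_on_sym[OF star_assoc]) (use F h in simp_all)
  also have "eq_on U \<dots> (star (Ber (D f g)) (Ber h))"
   by (rule star_cong_U[OF _ _ _ _ eq_on_sym[OF Ber_D] eq_on_refl]) (use F h in simp_all)
  finally show "eq_on U (Ber (D f (D g h))) (star (Ber (D f g)) (Ber h))" .
 qed (use F h in simp_all)
next
 \<comment> \<open>The coefficient operators are read off from products of functions constant in nu;
   \<open>product_expand\<close> does the rest.\<close>
 define C where "C r f g = D (cst f) (cst g) $$ int r" for r f g
 have "star_expansion U C D"
  unfolding star_expansion_def
 proof (intro ballI allI)
  fix f g :: "('m, 'd) formal" and n z assume F: "f \<in> FF" "g \<in> FF" and z: "z \<in> U"
  have "(D f g $$ n) z = (\<Sum>(i, j) | fls_subdegree f \<le> i \<and> fls_subdegree g \<le> j \<and> i + j \<le> n.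
     (D (cst (f $$ i)) (cst (g $$ j)) $$ (n - i - j)) z)"
   by (rule product_expand[OF D_fdo D_fdo_r D_const_low(1) F z])
  also have "\<dots> = (\<Sum>(i, j) | fls_subdegree f \<le> i \<and> fls_subdegree g \<le> j \<and> i + j \<le> n.
     C (nat (n - i - j)) (f $$ i) (g $$ j) z)"
   by (intro sum.cong refl) (auto simp: C_def)
  finally show "(D f g $$ n) z = (\<Sum>(i, j) | fls_subdegree f \<le> i \<and> fls_subdegree g \<le> j \<and> i + j \<le> n.
     C (nat (n - i - j)) (f $$ i) (g $$ j) z)" .
 qed
 moreover have "\<forall>f\<in>sf_smooth U. \<forall>g\<in>sf_smooth U. \<forall>z\<in>U. C 0 f g z = f z * g z"
  using D_const_low(2) by (simp add: C_def)
 ultimately show "\<exists>C. star_expansion U C D \<and> (\<forall>f\<in>sf_smooth U. \<forall>g\<in>sf_smooth U. \<forall>z\<in>U. C 0 f g z = f z * g z)"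
  by (intro exI[of _ C] conjI)
next
 fix f :: "('m, 'd) formal" assume f: "f \<in> FF"
 show "eq_on U (D 1 f) f" using D_anti[OF oU subset_refl shol_sconst(4) f] by simp
 show "eq_on U (D f 1) f" using D_hol[OF oU subset_refl shol_sconst(3) f] by simp
 show "formal_diff_op U (D f)" using D_fdo[OF f] by (simp only: fdo_iff)
 show "formal_diff_op U (right_mult D f)" using fdo_right_mult[OF D_fdo_r f] by (simp only: fdo_iff)
qed

lemma wick_dual: "wick U D"
 unfolding wick_def
proof (intro allI impI conjI ballI)
 fix V and a :: "('m, 'd) sfun" and f :: "('m, 'd) formal" assume V: "open V \<and> V \<subseteq> U" and a: "a \<in> sf_smooth U" and f: "f \<in> FF"
 show "eq_on V (D (cst a) f) (cst a * f)" if "sf_antihol V a"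
  by (rule D_anti[OF conjunct1[OF V] conjunct2[OF V] _ f]) (simp only: santi_sf_antihol[OF conjunct1[OF V] conjunct2[OF V] a] that)
 show "eq_on V (D f (cst a)) (f * cst a)" if "sf_hol V a"
  by (rule D_hol[OF conjunct1[OF V] conjunct2[OF V] _ f]) (simp only: shol_sf_hol[OF conjunct1[OF V] conjunct2[OF V] a] that)
qed

end

context bdens
begin

text \<open>The minus sign between \<open>X'\<close> and \<open>y\<close> turns the derivative term
  of \<open>D_y_r\<close> into the one with the sign required of a potential of Wick type.\<close>

lemma D_X'_r:
 assumes i: "holo i" and f: "f \<in> FF"
 shows "eq_on U (right_mult D (fpd i X') f) (fpd i X' * f + fpd i f)"
proof -
 have F: "fpd i X' \<in> FF" "fsgd i f \<in> FF" using f by simp_all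
 have p: "par (oddd i) (fpd i X')" by (rule par_fpd[OF X'_par X'_FF])
 have e: "(if oddd i then fpar f else f) = fsgd i f" by (simp add: fsgd_def)
 have "eq_on U (right_mult D (fpd i X') f) (D (fsgd i f) (fpd i X'))"
  unfolding e[symmetric] by (rule right_mult_par[OF fdo_additive[OF D_fdo_r] D_fdo F(1) p f])
 also have "eq_on U \<dots> (D (fsgd i f) (- y i))"
  by (rule fdo_cong_U[OF D_fdo[OF F(2)] F(1) _ fpd_X']) simp
 also have "eq_on U \<dots> (- D (fsgd i f) (y i))" by (rule fdo_uminus_arg[OF D_fdo[OF F(2)] y_FF])
 also have "eq_on U \<dots> (- (fsgd i f * y i - fpd i f))"
  using eq_on_uminus[OF D_y_r[OF i F(2)]] by simp
 also have "- (fsgd i f * y i - fpd i f) = fsgd i f * (- y i) + fpd i f" by simp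
 also have "eq_on U \<dots> (fsgd i f * fpd i X' + fpd i f)"
  by (rule eq_on_add[OF eq_on_mult[OF eq_on_refl eq_on_sym[OF fpd_X']] eq_on_refl])
 also have "eq_on U \<dots> (fpd i X' * f + fpd i f)"
  by (rule eq_on_add[OF eq_on_sym[OF par_comm[OF p]] eq_on_refl])
 finally show ?thesis .
qed

lemma D_X'_l:
 assumes i: "\<not> holo i" and f: "f \<in> FF"
 shows "eq_on U (D (fpd i X') f) (fpd i X' * f + fpd i f)"
proof -
 have "eq_on U (D (fpd i X') f) (D (- y i) f)"
  by (rule fdo_cong_U[OF D_fdo_r[OF f] _ _ fpd_X']) simp_all
 also have "eq_on U \<dots> (- D (y i) f)" by (rule fdo_uminus_arg[OF D_fdo_r[OF f] y_FF])
 also have "eq_on U \<dots> (- (y i * f - fpd i f))" by (rule eq_on_uminus[OF D_y_l[OF i f]])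
 also have "- (y i * f - fpd i f) = (- y i) * f + fpd i f" by simp
 also have "eq_on U \<dots> (fpd i X' * f + fpd i f)"
  by (rule eq_on_add[OF eq_on_mult[OF eq_on_sym[OF fpd_X'] eq_on_refl] eq_on_refl])
 finally show ?thesis .
qed

lemma determines_wick_dual: "determines_wick U X' D"
 unfolding determines_wick_def f_d_fpd
 using star_product_dual wick_dual D_X'_r[of "DZ _"] D_X'_r[of "DT _"] D_X'_l[of "DZb _"] D_X'_l[of "DTb _"] by simp

end

context bstar
begin

lemma y_low:
 assumes z: "z \<in> U"
 shows "n < - 1 ==> (y i $$ n) z = 0" "(y i $$ (- 1)) z = (w i $$ (- 1)) z"
proof -
 have l: "(w i $$ j) z = 0" if "j < - 1" "z \<in> U" for j z
 proof -
  have "pd i (X $$ j) z = pd i 0 z" by (rule pd_cong[OF oU that(2)]) (use X_low that in simp)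
  then show ?thesis by (simp add: w_def)
 qed
 show "n < - 1 ==> (y i $$ n) z = 0" unfolding y_def by (rule J_low(1)[OF w_FF l z])
 show "(y i $$ (- 1)) z = (w i $$ (- 1)) z" unfolding y_def by (rule J_low(2)[OF w_FF l z])
qed

lemma dual_potential:
 assumes con: "contractible U"
 shows "\<exists>X'. nondegenerate_potential U X' \<and> bdens U star X Ber X'"
proof -
 have "\<exists>G\<in>sf_smooth U. (\<forall>z\<in>U. gpar (G z) = G z) \<and> (\<forall>i. \<forall>z\<in>U. pd i G z = (- (y i $$ n)) z)" for n
 proof (rule super_poincare_even[OF con])
  show "- (y i $$ n) \<in> sf_smooth U" for i by simp
  show "pd i (- (y j $$ n)) z = ssgn i j (pd j (- (y i $$ n)) z)" if z: "z \<in> U" for i j z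
   unfolding pd_uminus[OF z FF_nth[OF y_FF]] using eq_onD[OF y_closed[of i j] z, of n] by (simp add: ssgn_def)
  show "gpar ((- (y i $$ n)) z) = (if oddd i then - (- (y i $$ n)) z else (- (y i $$ n)) z)" if z: "z \<in> U" for i z
   using parD[OF y_par z, of i n] by simp
 qed
 then have "\<forall>n. \<exists>G. G \<in> sf_smooth U \<and> (\<forall>z\<in>U. gpar (G z) = G z) \<and> (\<forall>i. \<forall>z\<in>U. pd i G z = (- (y i $$ n)) z)" by blast
 from choice[OF this] obtain G where G: "!!n. G n \<in> sf_smooth U" "!!n z. z \<in> U ==> gpar (G n z) = G n z"
  "!!n i z. z \<in> U ==> pd i (G n) z = (- (y i $$ n)) z" by blast
 \<comment> \<open>By \<open>y_low\<close> the families \<open>y\<close> and \<open>w\<close> agree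
   at nu^(-1), so - X_{-1} is a primitive there. A chosen primitive could differ from it by a
   constant and leave a pole in X + X'. The explicit choice also inherits nondegeneracy from
   X.\<close>
 define X' where "X' = Abs_fls (\<lambda>n. if n < - 1 then 0 else if n = - 1 then - (X $$ (- 1)) else G n)"
 have nth: "X' $$ n = (if n < - 1 then 0 else if n = - 1 then - (X $$ (- 1)) else G n)" for n
  unfolding X'_def by (rule nth_Abs_fls_lower_bound[of "- 1"]) simp
 have cases: "n < - 1 \<and> X' $$ n = 0 \<or> n = - 1 \<and> X' $$ n = - (X $$ (- 1)) \<or> n > - 1 \<and> X' $$ n = G n" for n
  unfolding nth by auto
 have F: "X' \<in> FF"
 proof -
  have "X' $$ n \<in> sf_smooth U" for n
   using cases[of n] G(1)[of n] sf_smooth_uminus[OF oU FF_nth[OF X_FF, of "- 1"]] sf_smooth_0(1)[of U]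
   by (elim disjE conjE) (simp_all only:)
  then show ?thesis unfolding formal_funs_def by (intro CollectI allI)
 qed
 have p: "par False X'"
 proof (rule parI)
  fix n z assume z: "z \<in> U"
  show "gpar ((X' $$ n) z) = (if False then - (X' $$ n) z else (X' $$ n) z)"
   using cases[of n] G(2)[OF z, of n] parD[OF X_par z, of "- 1"] by (elim disjE conjE) simp_all
 qed
 have d: "eq_on U (fpd i X') (- y i)" for i
 proof (rule eq_onI)
  fix n z assume z: "z \<in> U"
  consider "n < - 1" "X' $$ n = 0" | "n = - 1" "X' $$ n = - (X $$ (- 1))" | "X' $$ n = G n" using cases[of n] by blast
  then show "(fpd i X' $$ n) z = (- y i $$ n) z"
  proof cases
   case 1
   then show ?thesis using y_low(1)[OF z, of n i] by simp
  next
   case 2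
   then show ?thesis using y_low(2)[OF z, of i] pd_uminus[OF z FF_nth[OF X_FF, of "- 1"], of i] by (simp add: w_def)
  next
   case 3
   then show ?thesis using G(3)[OF z, of i n] by simp
  qed
 qed
 have X1: "X' $$ (- 1) = - (X $$ (- 1))" unfolding nth by simp
 have "bdens U star X Ber X'"
 proof (intro bdens.intro bdens_axioms.intro F p d)
  show "bstar U star X Ber" by unfold_locales
  fix n :: int and z assume n: "n < 0" and z: "z \<in> U"
  from n consider "n < - 1" | "n = - 1" by linarith
  then show "((X + X') $$ n) z = 0"
   using X_low[of n z] z by cases (simp_all add: nth)
 qed
 moreover have "nondegenerate_potential U X'"
  unfolding nondegenerate_potential_def
 proof (intro conjI F ballI allI impI)
  show "homogeneous_on U 0 X'" using p by (simp add: homogeneous_on_par)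
  show "(X' $$ n) x = 0" if "n < - 1" for n x using that by (simp add: nth)
  fix x assume x: "x \<in> U"
  define A where "A = ((\<chi> k l. wirt k (wirt_bar l (sf_coeff (X $$ (-1)) {} {})) x) :: complex^'m^'m)"
  have sm: "smooth_on U (sf_coeff (X $$ (-1)) {} {})" using sf_smoothD[OF FF_nth[OF X_FF]] by (simp add: sf_coeff_def)
  have c: "sf_coeff (X' $$ (-1)) {} {} = (\<lambda>z. (- 1) * sf_coeff (X $$ (-1)) {} {} z)" by (simp add: X1 sf_coeff_def)
  have "wirt k (wirt_bar l (sf_coeff (X' $$ (-1)) {} {})) x = - wirt k (wirt_bar l (sf_coeff (X $$ (-1)) {} {})) x" for k l
  proof -
   have "wd (- \<i>) k (wd \<i> l (\<lambda>z. (- 1) * sf_coeff (X $$ (-1)) {} {} z)) x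
     = wd (- \<i>) k (\<lambda>z. (- 1) * wd \<i> l (sf_coeff (X $$ (-1)) {} {}) z) x"
    by (rule wd_cong[OF oU x]) (rule wd_cmult[OF smooth_on_differentiable[OF sm]])
   also have "\<dots> = (- 1) * wd (- \<i>) k (wd \<i> l (sf_coeff (X $$ (-1)) {} {})) x"
    by (rule wd_cmult[OF smooth_on_differentiable[OF smooth_on_wd[OF oU sm] x]])
   finally show ?thesis unfolding c wirt_wd by simp
  qed
  then have "(\<chi> k l. wirt k (wirt_bar l (sf_coeff (X' $$ (-1)) {} {})) x) = - A" by (simp add: A_def vec_eq_iff)
  moreover have "invertible A" using pot x unfolding nondegenerate_potential_def A_def by blast
  ultimately show "invertible ((\<chi> k l. wirt k (wirt_bar l (sf_coeff (X' $$ (-1)) {} {})) x) :: complex^'m^'m)"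
   using invertible_uminus by simp
  define Q where "Q = ((\<chi> \<alpha> \<beta>. gcoeff (gdtheta \<alpha> (gdthetabar_right \<beta> (gnil ((X $$ (-1)) x)))) {} {}) :: ((complex, 'd) vec, 'd) vec)"
  have "(\<chi> \<alpha> \<beta>. gcoeff (gdtheta \<alpha> (gdthetabar_right \<beta> (gnil ((X' $$ (-1)) x)))) {} {}) = - Q"
   unfolding X1 by (simp add: Q_def vec_eq_iff gdtheta_def gdthetabar_right_def gnil_def)
  moreover have "invertible Q" using pot x unfolding nondegenerate_potential_def Q_def by blast
  ultimately show "invertible ((\<chi> \<alpha> \<beta>. gcoeff (gdtheta \<alpha> (gdthetabar_right \<beta> (gnil ((X' $$ (-1)) x)))) {} {}) :: ((complex, 'd) vec, 'd) vec)"
   using invertible_uminus by simp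
 qed
 ultimately show ?thesis by blast
qed

end

section \<open>Densities of bidifferential functionals\<close>

lemma super_swap:
 fixes x y :: "'d::{finite,linorder} grass"
 shows "x * y = y * (gconst (1/2) * (x + gpar x)) + gpar y * (gconst (1/2) * (x - gpar x))"
proof -
 have "x * y = (geven x + godd x) * y" by (simp only: geven_godd[symmetric])
 also have "\<dots> = y * geven x + gpar y * godd x"
  by (simp only: distrib_right geven_commute[OF gsg_geven(1)] godd_commute[OF gsg_geven(2)])
 finally show ?thesis by (simp only: geven_def godd_def)
qed

lemma gpar_odd_body:
 fixes x :: "'d::{finite,linorder} grass"
 assumes "gpar x = - x"
 shows "gcoeff x {} {} = 0"
proof -
 have "gcoeff (gpar x) {} {} = gcoeff (- x) {} {}" using assms by (rule arg_cong)
 then have "gcoeff x {} {} = - gcoeff x {} {}" by simp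
 then show ?thesis by (simp add: complex_eq_iff)
qed

lemma bidiff_swap:
 assumes "bidiff U B"
 shows "\<exists>B'. bidiff U B' \<and> (\<forall>h g. B' h g = B g h)"
 using assms
proof induction
 case (prod P Q)
 have d: "diff_op U (\<lambda>g. sconst (1/2) * (P g + spar (P g)))" "diff_op U (\<lambda>g. sconst (1/2) * (P g - spar (P g)))" "diff_op U (\<lambda>h. spar (Q h))"
  using diff_op.intros(7)[OF diff_op_sconst[of U "1/2"] diff_op.intros(6)[OF prod(1) diff_op.intros(7)[OF diff_op_sg prod(1)]]]
   diff_op.intros(7)[OF diff_op_sconst[of U "1/2"] diff_op_minus[OF prod(1) diff_op.intros(7)[OF diff_op_sg prod(1)]]]
   diff_op.intros(7)[OF diff_op_sg prod(2)] by blast+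
 have e: "Q h * (sconst (1/2) * (P g + spar (P g))) + spar (Q h) * (sconst (1/2) * (P g - spar (P g))) = P g * Q h" for h g
  unfolding fun_eq_iff plus_fun_apply times_fun_apply minus_apply sg_def sconst_apply by (intro allI super_swap[symmetric])
 have b: "bidiff U (\<lambda>h g. Q h * (sconst (1/2) * (P g + spar (P g))) + spar (Q h) * (sconst (1/2) * (P g - spar (P g))))"
  by (rule bidiff.add[OF bidiff.prod[OF prod(2) d(1)] bidiff.prod[OF d(3) d(2)]])
 show ?case using b e by blast
next
 case (add A B)
 then obtain A' B' where b: "bidiff U A'" "bidiff U B'" and e: "\<forall>h g. A' h g = A g h" "\<forall>h g. B' h g = B g h" by blast
 have "\<forall>h g. A' h g + B' h g = A g h + B g h" using e by (intro allI) (simp only:)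
 then show ?case using bidiff.add[OF b] by (intro exI[of _ "\<lambda>h g. A' h g + B' h g"] conjI)
next
 case (op D B)
 then obtain B' where "bidiff U B'" "\<forall>h g. B' h g = B g h" by blast
 then show ?case using bidiff.op[OF op(1), of B'] by (intro exI[of _ "\<lambda>h g. D (B' h g)"]) simp
qed

lemma fpar_power: "eq_on V (fpar Z) Z ==> eq_on V (fpar (Z ^ k)) (Z ^ k)"
proof (induction k)
 case 0
 show ?case
 proof (rule eq_onI)
  fix n z
  show "(fpar (Z ^ 0) $$ n) z = ((Z ^ 0) $$ n) z" by (cases "n = 0") (simp_all add: sg_def)
 qed
next
 case (Suc k)
 have "eq_on V (fpar (Z * Z ^ k)) (fpar Z * fpar (Z ^ k))" by (rule dom.fpar_mult[OF dom.intro[OF open_UNIV]])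
 from eq_on_trans[OF this eq_on_mult[OF Suc.prems Suc.IH[OF Suc.prems]]] show ?case by simp
qed

context dom
begin

lemma par_formal_exp:
 fixes Z :: "('m, 'b::{finite,linorder}) formal"
 assumes "par False Z"
 shows "par False (formal_exp Z)"
proof (rule parI)
 fix n z assume z: "z \<in> U"
 have p: "gpar (((Z ^ k) $$ n) z) = ((Z ^ k) $$ n) z" for k n
  using eq_onD[OF fpar_power[of U Z k] z, of n] assms by (simp add: par_def sg_def)
 have "gpar ((formal_exp Z $$ n) z) = (formal_exp Z $$ n) z"
 proof (cases "n < 0")
  case True
  then show ?thesis by (simp add: formal_exp_def)
 next
  case False
  show ?thesis
  proof (rule grass_eqI)
   fix I J :: "'b set"
   have "gcoeff (((Z ^ k) $$ n) z) I J = 0" if "odd (card I + card J)" for k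
   proof -
    have "gcoeff (gpar (((Z ^ k) $$ n) z)) I J = gcoeff (((Z ^ k) $$ n) z) I J" by (simp only: p)
    then show ?thesis using that by (simp add: minus_one_power_iff complex_eq_iff)
   qed
   then show "gcoeff (gpar ((formal_exp Z $$ n) z)) I J = gcoeff ((formal_exp Z $$ n) z) I J"
    using False by (auto simp: formal_exp_def minus_one_power_iff)
  qed
 qed
 then show "gpar ((formal_exp Z $$ n) z) = (if False then - (formal_exp Z $$ n) z else (formal_exp Z $$ n) z)" by simp
qed

lemma csup_fdo:
 fixes A :: "('m, 'b::{finite,linorder}) formal \<Rightarrow> ('m, 'b) formal"
 assumes "fdo A" "h \<in> sf_smooth U" "csup h"
 shows "csup (A (cst h) $$ r)"
proof -
 obtain r0 D where D: "fdo_with r0 D A" using assms(1) by (auto simp: fdo_def)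
 show ?thesis
 proof (cases "r < r0")
  case True
  show ?thesis by (rule csup_cong[OF csup_0]) (simp add: fdo_with_const[OF D assms(2)] True)
 next
  case False
  show ?thesis by (rule csup_cong[OF csup_diff_op[OF fdo_with_diff_op[OF D] assms(3)]]) (simp add: fdo_with_const[OF D assms(2)] False)
 qed
qed

lemma csup_fdo_formal:
 fixes A :: "('m, 'b::{finite,linorder}) formal \<Rightarrow> ('m, 'b) formal"
 assumes "fdo A" "f \<in> FF" "!!n. csup (f $$ n)"
 shows "csup (A f $$ n)"
proof -
 obtain r0 D where D: "fdo_with r0 D A" using assms(1) by (auto simp: fdo_def)
 define S where "S = {fls_subdegree f..n - r0}"
 have c: "csup (\<Sum>j\<in>S. D (n - j) (f $$ j))"
  by (rule bint_sum[THEN conjunct2])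
   (use assms(2,3) in \<open>simp_all add: diff_op_smooth[OF oU fdo_with_diff_op[OF D]] csup_diff_op[OF fdo_with_diff_op[OF D]]\<close>)
 show ?thesis
 proof (rule csup_cong[OF c])
  fix z assume z: "z \<in> U"
  have "(A f $$ n) z = (\<Sum>j = fls_subdegree f..n - r0. D (n - j) (f $$ j) z)"
   by (rule fdo_withD[OF D assms(2) _ z]) simp
  then show "(\<Sum>j\<in>S. D (n - j) (f $$ j)) z = (A f $$ n) z" by (simp add: sum_fun_apply S_def)
 qed
qed

lemma bint_eq_on: "eq_on U f g ==> bint (f $$ n) = bint (g $$ n)"
 by (rule bint_cong) (simp add: eq_on_def)

text \<open>Both products expand by \<open>product_expand\<close> into finitely many values on
  functions constant in nu, with compact supports preserved, so the integral identity for smooth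
  functions extends termwise.\<close>

lemma bint_product_cong:
 fixes P Q :: "('m, 'b::{finite,linorder}) prod"
 assumes P: "!!f. f \<in> FF ==> fdo (P f)" "!!g. g \<in> FF ==> fdo (\<lambda>f. P f g)"
  and Pn: "!!f g r z. f \<in> sf_smooth U ==> g \<in> sf_smooth U ==> z \<in> U ==> r < 0 ==> (P (cst f) (cst g) $$ r) z = 0"
  and Q: "!!f. f \<in> FF ==> fdo (Q f)" "!!g. g \<in> FF ==> fdo (\<lambda>f. Q f g)"
  and Qn: "!!f g r z. f \<in> sf_smooth U ==> g \<in> sf_smooth U ==> z \<in> U ==> r < 0 ==> (Q (cst f) (cst g) $$ r) z = 0"
  and e: "!!h g r. h \<in> sf_smooth U ==> g \<in> sf_smooth U ==> csup h \<or> csup g ==>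
   bint (P (cst h) (cst g) $$ r) = bint (Q (cst h) (cst g) $$ r)"
  and f: "f \<in> FF" and g: "g \<in> FF" and c: "(\<forall>n. csup (f $$ n)) \<or> (\<forall>n. csup (g $$ n))"
 shows "bint (P f g $$ n) = bint (Q f g $$ n)"
proof -
 define S where "S = {(i, j). fls_subdegree f \<le> i \<and> fls_subdegree g \<le> j \<and> i + j \<le> n}"
 have ex: "bint (R f g $$ n) = (\<Sum>p\<in>S. bint (R (cst (f $$ fst p)) (cst (g $$ snd p)) $$ (n - fst p - snd p)))"
  if R: "!!f. f \<in> FF ==> fdo (R f)" "!!g. g \<in> FF ==> fdo (\<lambda>f. R f g)"
   and Rn: "!!f g r z. f \<in> sf_smooth U ==> g \<in> sf_smooth U ==> z \<in> U ==> r < 0 ==> (R (cst f) (cst g) $$ r) z = 0"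
  for R :: "('m, 'b) prod"
 proof -
  define t where "t p = R (cst (f $$ fst p)) (cst (g $$ snd p)) $$ (n - fst p - snd p)" for p
  have "bint (R f g $$ n) = bint (\<Sum>p\<in>S. t p)"
  proof (rule bint_cong)
   fix z assume z: "z \<in> U"
   have "(R f g $$ n) z = (\<Sum>(i, j)\<in>S. (R (cst (f $$ i)) (cst (g $$ j)) $$ (n - i - j)) z)"
    unfolding S_def by (rule product_expand[OF R Rn f g z])
   then show "gtop ((R f g $$ n) z) = gtop ((\<Sum>p\<in>S. t p) z)"
    by (simp add: sum_fun_apply t_def case_prod_unfold)
  qed
  also have "\<dots> = (\<Sum>p\<in>S. bint (t p))"
  proof (rule bint_sum[THEN conjunct1])
   fix p
   show "t p \<in> sf_smooth U" unfolding t_def by (rule FF_nth, rule fdo_closed[OF R(1)]) (use f g in simp_all)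
   show "csup (t p)"
    unfolding t_def using c
   proof
    assume "\<forall>n. csup (f $$ n)"
    then show "csup (R (cst (f $$ fst p)) (cst (g $$ snd p)) $$ (n - fst p - snd p))"
     by (intro csup_fdo[OF R(2)]) (use f g in simp_all)
   next
    assume "\<forall>n. csup (g $$ n)"
    then show "csup (R (cst (f $$ fst p)) (cst (g $$ snd p)) $$ (n - fst p - snd p))"
     by (intro csup_fdo[OF R(1)]) (use f g in simp_all)
   qed
  qed
  finally show ?thesis unfolding t_def .
 qed
 have "bint (P f g $$ n) = (\<Sum>p\<in>S. bint (P (cst (f $$ fst p)) (cst (g $$ snd p)) $$ (n - fst p - snd p)))"
  by (rule ex[OF P Pn])
 also have "\<dots> = (\<Sum>p\<in>S. bint (Q (cst (f $$ fst p)) (cst (g $$ snd p)) $$ (n - fst p - snd p)))"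
  by (intro sum.cong refl e FF_nth f g) (use c in blast)
 also have "\<dots> = bint (Q f g $$ n)"
  by (rule ex[OF Q Qn, symmetric])
 finally show ?thesis .
qed

text \<open>Integration by parts moves all derivatives off \<open>g\<close>, turning \<open>g \<mapsto> \<integral>P(h,g)\<rho>\<close> into the density of an operator in \<open>h\<close>.\<close>

lemma product_transpose:
 fixes P :: "('m, 'b::{finite,linorder}) prod"
 assumes P: "!!f. f \<in> FF ==> fdo (P f)" "!!g. g \<in> FF ==> fdo (\<lambda>f. P f g)"
  and B: "!!r. bidiff U (B r)"
  and PB: "!!h g r z. h \<in> sf_smooth U ==> g \<in> sf_smooth U ==> z \<in> U ==>
   (P (cst h) (cst g) $$ r) z = (if r < 0 then 0 else B r h g z)"
  and \<rho>: "\<rho> \<in> FF" "!!n z. n < 0 ==> z \<in> U ==> (\<rho> $$ n) z = 0"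
 shows "\<exists>K. (\<forall>r. diff_op U (K r)) \<and> (\<forall>h\<in>FF. \<forall>g\<in>FF. (\<forall>n. csup (h $$ n)) \<or> (\<forall>n. csup (g $$ n)) -->
  (\<forall>n. bint ((P h g * \<rho>) $$ n) = bint ((op_of K h * g) $$ n)))"
proof -
 define tp where "tp r s K \<longleftrightarrow> diff_op U K \<and> (\<forall>h\<in>sf_smooth U. \<forall>g\<in>sf_smooth U. csup h \<or> csup g -->
  bint (B r h g * \<rho> $$ s) = bint (K h * g))" for r s K
 define K0 where "K0 r s = (SOME K. tp r s K)" for r s
 have K0: "tp r s (K0 r s)" for r s
 proof -
  have "\<exists>K. tp r s K" unfolding tp_def by (rule bidiff_transpose[OF B FF_nth[OF \<rho>(1)]])
  then show ?thesis unfolding K0_def by (rule someI_ex)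
 qed
 have dK0: "diff_op U (K0 r s)" for r s using K0[of r s] by (simp add: tp_def)
 have bK0: "bint (B r h g * \<rho> $$ s) = bint (K0 r s h * g)" if "h \<in> sf_smooth U" "g \<in> sf_smooth U" "csup h \<or> csup g" for r s h g
  using K0[of r s] that unfolding tp_def by blast
 \<comment> \<open>Collects the pairs r + s = n of a coefficient of the product and a coefficient of
   the density.\<close>
 define K where "K n = (\<lambda>h. \<Sum>r\<in>{0..n}. K0 r (n - r) h)" for n
 have K: "diff_op U (K r)" for r unfolding K_def by (rule diff_op_sum) (rule dK0)
 have kf: "fdo_with 0 K (op_of K)" by (rule fdo_with_op_of[OF K])
 then have kfd: "fdo (op_of K)" by (auto simp: fdo_def)
 have "bint ((P h g * \<rho>) $$ n) = bint ((op_of K h * g) $$ n)"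
  if h: "h \<in> FF" and g: "g \<in> FF" and c: "(\<forall>n. csup (h $$ n)) \<or> (\<forall>n. csup (g $$ n))" for h g n
 proof (rule bint_product_cong[where P = "\<lambda>h g. P h g * \<rho>" and Q = "\<lambda>h g. op_of K h * g", OF _ _ _ _ _ _ _ h g c])
  show "fdo (\<lambda>g. P f g * \<rho>)" if "f \<in> FF" for f by (rule fdo_comp[OF fdo_rmult[OF \<rho>(1)] P(1)[OF that]])
  show "fdo (\<lambda>f. P f g * \<rho>)" if "g \<in> FF" for g by (rule fdo_comp[OF fdo_rmult[OF \<rho>(1)] P(2)[OF that]])
  show "fdo (\<lambda>g. op_of K f * g)" if "f \<in> FF" for f by (rule fdo_lmult[OF fdo_closed[OF kfd that]])
  show "fdo (\<lambda>f. op_of K f * g)" if "g \<in> FF" for g by (rule fdo_comp[OF fdo_rmult[OF that] kfd])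
  have ex: "((P (cst u) (cst v) * \<rho>) $$ r) z = (\<Sum>j = 0..r. B (r - j) u v z * (\<rho> $$ j) z)"
   if "u \<in> sf_smooth U" "v \<in> sf_smooth U" "z \<in> U" for u v r z
  proof -
   have "((P (cst u) (cst v) * \<rho>) $$ r) z = (\<Sum>j = 0..r - 0. (P (cst u) (cst v) $$ (r - j)) z * (\<rho> $$ j) z)"
    by (rule fls_mult_nth_at) (use \<rho>(2)[OF _ that(3)] PB[OF that] in simp_all)
   then show ?thesis using PB[OF that] by simp
  qed
  have kc: "(op_of K (cst u) * cst v) $$ r = op_of K (cst u) $$ r * v" for u v r by simp
  show "((P (cst u) (cst v) * \<rho>) $$ r) z = 0" if "u \<in> sf_smooth U" "v \<in> sf_smooth U" "z \<in> U" "r < 0" for u v r z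
   using ex[OF that(1-3), of r] that(4) by simp
  show "((op_of K (cst u) * cst v) $$ r) z = 0" if "u \<in> sf_smooth U" "v \<in> sf_smooth U" "z \<in> U" "r < 0" for u v r z
   unfolding kc times_fun_apply fdo_with_const[OF kf that(1,3)] using that(4) by simp
  fix u v :: "('m, 'b) sfun" and r assume uv: "u \<in> sf_smooth U" "v \<in> sf_smooth U" "csup u \<or> csup v"
  have s: "B q u v * \<rho> $$ (r - q) \<in> sf_smooth U" "csup (B q u v * \<rho> $$ (r - q))" for q
   using sf_smooth_bidiff[OF B uv(1,2), of q] csup_rmult[OF csup_bidiff[OF B uv(3), of q]] \<rho>(1) by simp_all
  have s': "K0 q (r - q) u * v \<in> sf_smooth U" "csup (K0 q (r - q) u * v)" for q
   using diff_op_smooth[OF oU dK0 uv(1)] uv(2) csup_rmult[OF csup_diff_op[OF dK0]] csup_lmult[of v] uv(3) by auto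
  have "bint ((P (cst u) (cst v) * \<rho>) $$ r) = bint (\<Sum>q = 0..r. B q u v * \<rho> $$ (r - q))"
  proof (rule bint_cong)
   fix z assume z: "z \<in> U"
   have "(\<Sum>j = 0..r. B (r - j) u v z * (\<rho> $$ j) z) = (\<Sum>q = 0..r. B q u v z * (\<rho> $$ (r - q)) z)"
    by (rule sum.reindex_bij_witness[where i = "\<lambda>j. r - j" and j = "\<lambda>j. r - j"]) auto
   then show "gtop (((P (cst u) (cst v) * \<rho>) $$ r) z) = gtop ((\<Sum>q = 0..r. B q u v * \<rho> $$ (r - q)) z)"
    unfolding ex[OF uv(1,2) z] sum_fun_apply times_fun_apply by (rule arg_cong)
  qed
  also have "\<dots> = (\<Sum>q = 0..r. bint (B q u v * \<rho> $$ (r - q)))"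
   by (rule bint_sum[THEN conjunct1]) (rule s)+
  also have "\<dots> = (\<Sum>q = 0..r. bint (K0 q (r - q) u * v))"
   by (intro sum.cong refl bK0 uv)
  also have "\<dots> = bint (\<Sum>q = 0..r. K0 q (r - q) u * v)"
   by (rule bint_sum[THEN conjunct1, symmetric]) (rule s')+
  also have "\<dots> = bint ((op_of K (cst u) * cst v) $$ r)"
  proof (rule bint_cong)
   fix z assume z: "z \<in> U"
   show "gtop ((\<Sum>q = 0..r. K0 q (r - q) u * v) z) = gtop (((op_of K (cst u) * cst v) $$ r) z)"
    unfolding kc times_fun_apply fdo_with_const[OF kf uv(1) z] sum_fun_apply
    by (simp add: K_def sum_fun_apply sum_distrib_right)
  qed
  finally show "bint ((P (cst u) (cst v) * \<rho>) $$ r) = bint ((op_of K (cst u) * cst v) $$ r)" .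
 qed
 then show ?thesis using K by blast
qed

lemma eq_on_of_bint:
 fixes f f' :: "('m, 'b::{finite,linorder}) formal"
 assumes f: "f \<in> FF" and f': "f' \<in> FF"
  and e: "!!g n. g \<in> sf_smooth U ==> csup g ==> bint (f $$ n * g) = bint (f' $$ n * g)"
 shows "eq_on U f f'"
proof (rule eq_onI)
 fix n z assume z: "z \<in> U"
 have "(f $$ n - f' $$ n) z = 0"
 proof (rule bint_separates[OF _ _ z])
  fix g :: "('m, 'b) sfun" assume g: "g \<in> sf_smooth U" "csup g"
  have "(f $$ n - f' $$ n) * g = f $$ n * g + - (f' $$ n * g)" by (simp add: left_diff_distrib)
  moreover have "bint (f $$ n * g + - (f' $$ n * g)) = bint (f $$ n * g) + bint (- (f' $$ n * g))"
  proof (rule bint_add)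
   show "csup (- (f' $$ n * g))" by (rule csup_mono[OF csup_lmult[OF g(2), of "f' $$ n"]]) simp
  qed (use f f' g csup_lmult in simp_all)
  ultimately show "bint ((f $$ n - f' $$ n) * g) = 0" using e[OF g] by (simp add: bint_uminus)
 qed (rule sf_smooth_diff[OF oU FF_nth[OF f] FF_nth[OF f']])
 then show "(f $$ n) z = (f' $$ n) z" by simp
qed

lemma eq_on_of_bint_left:
 fixes f f' :: "('m, 'b::{finite,linorder}) formal"
 assumes f: "f \<in> FF" and f': "f' \<in> FF"
  and e: "!!g n. g \<in> sf_smooth U ==> csup g ==> bint (g * f $$ n) = bint (g * f' $$ n)"
 shows "eq_on U f f'"
proof (rule eq_on_of_bint[OF f f'])
 fix g :: "('m, 'b) sfun" and n assume g: "g \<in> sf_smooth U" "csup g"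
 have s: "spar (spar g) = g" by (simp add: sg_def)
 have "bint (spar g * f $$ n) = bint (spar g * f' $$ n)"
  by (rule e) (use g csup_diff_op[OF diff_op_sg g(2)] in simp_all)
 then show "bint (f $$ n * g) = bint (f' $$ n * g)" unfolding bint_swap[of "spar g"] s .
qed

lemma bint_swap_formal:
 fixes f g :: "('m, 'b::{finite,linorder}) formal"
 shows "bint ((f * g) $$ n) = bint ((g * fpar f) $$ n)"
proof (rule bint_cong)
 fix z
 define r s where "r = fls_subdegree f" and "s = fls_subdegree g"
 have gs: "gtop (\<Sum>j\<in>S. h j) = (\<Sum>j\<in>S. gtop (h j))" for S and h :: "int \<Rightarrow> 'b grass"
  by (simp add: gtop_def gcoeff_sum)
 have "((f * g) $$ n) z = (\<Sum>j = s..n - r. (f $$ (n - j)) z * (g $$ j) z)"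
  by (rule fls_mult_nth_at) (simp_all add: r_def s_def)
 then have "gtop (((f * g) $$ n) z) = (\<Sum>j = s..n - r. gtop ((f $$ (n - j)) z * (g $$ j) z))"
  by (simp only: gs)
 also have "\<dots> = (\<Sum>j = s..n - r. gtop ((g $$ j) z * gpar ((f $$ (n - j)) z)))"
  by (intro sum.cong refl gtop_swap)
 also have "\<dots> = (\<Sum>j = r..n - s. gtop ((g $$ (n - j)) z * gpar ((f $$ j) z)))"
  by (rule sum.reindex_bij_witness[where i = "\<lambda>j. n - j" and j = "\<lambda>j. n - j"]) auto
 also have "\<dots> = gtop (((g * fpar f) $$ n) z)"
 proof -
  have "((g * fpar f) $$ n) z = (\<Sum>j = r..n - s. (g $$ (n - j)) z * (fpar f $$ j) z)"
   by (rule fls_mult_nth_at) (simp_all add: r_def s_def)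
  then show ?thesis by (simp only: gs fpar_nth sg_def)
 qed
 finally show "gtop (((f * g) $$ n) z) = gtop (((g * fpar f) $$ n) z)" .
qed

lemma sum_dir_class:
 "(\<Sum>i | holo i. f i) = (\<Sum>k\<in>UNIV. f (DZ k)) + (\<Sum>\<alpha>\<in>UNIV. f (DT \<alpha>))"
 "(\<Sum>i | \<not> holo i. f i) = (\<Sum>k\<in>UNIV. f (DZb k)) + (\<Sum>\<alpha>\<in>UNIV. f (DTb \<alpha>))"
 for f :: "('n::finite, 'd::finite) dir \<Rightarrow> 'c::comm_monoid_add"
proof -
 have "i \<in> {i. holo i} \<longleftrightarrow> i \<in> range DZ \<union> range DT" "i \<in> {i. \<not> holo i} \<longleftrightarrow> i \<in> range DZb \<union> range DTb" for i :: "('n, 'd) dir"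
  by (cases i; auto)+
 then have e: "{i :: ('n, 'd) dir. holo i} = range DZ \<union> range DT" "{i :: ('n, 'd) dir. \<not> holo i} = range DZb \<union> range DTb" by blast+
 have u: "(\<Sum>i\<in>range DZ \<union> range DT. f i) = (\<Sum>i\<in>range DZ. f i) + (\<Sum>i\<in>range DT. f i)"
  "(\<Sum>i\<in>range DZb \<union> range DTb. f i) = (\<Sum>i\<in>range DZb. f i) + (\<Sum>i\<in>range DTb. f i)"
  by (rule sum.union_disjoint; auto)+
 have r: "(\<Sum>i\<in>range DZ. f i) = (\<Sum>k\<in>UNIV. f (DZ k))" "(\<Sum>i\<in>range DT. f i) = (\<Sum>k\<in>UNIV. f (DT k))"
  "(\<Sum>i\<in>range DZb. f i) = (\<Sum>k\<in>UNIV. f (DZb k))" "(\<Sum>i\<in>range DTb. f i) = (\<Sum>k\<in>UNIV. f (DTb k))"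
  by (subst sum.reindex, simp_all add: inj_on_def)+
 show "(\<Sum>i | holo i. f i) = (\<Sum>k\<in>UNIV. f (DZ k)) + (\<Sum>\<alpha>\<in>UNIV. f (DT \<alpha>))"
  "(\<Sum>i | \<not> holo i. f i) = (\<Sum>k\<in>UNIV. f (DZb k)) + (\<Sum>\<alpha>\<in>UNIV. f (DTb \<alpha>))"
  unfolding e u r by (rule refl)+
qed

end

text \<open>Pairs each direction with its conjugate: the coordinate in direction j will be traded
  for the derivative of X_{-1} in direction \<open>bar j\<close>.\<close>

fun bar :: "('m, 'd) dir \<Rightarrow> ('m, 'd) dir" where
 "bar (DZ k) = DZb k" | "bar (DZb k) = DZ k" | "bar (DT \<alpha>) = DTb \<alpha>" | "bar (DTb \<alpha>) = DT \<alpha>"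

lemma holo_bar [simp]: "holo (bar i) \<longleftrightarrow> \<not> holo i" by (cases i) auto

section \<open>Nondegeneracy of the Hessian as a generation property\<close>

context bstar
begin

definition u :: "('m, 'd) dir \<Rightarrow> ('m, 'd) sfun" where "u i = w i $$ (- 1)"

lemma u_eq: "u i = pd i (X $$ (- 1))" by (simp add: u_def w_def)

lemma u_smooth [simp]: "u i \<in> sf_smooth U" by (simp add: u_def)

lemma u_par: "z \<in> U ==> gpar (u i z) = (if oddd i then - u i z else u i z)"
 unfolding u_def by (rule parD[OF w_par])

definition H :: "complex^'m \<Rightarrow> ('m, 'd) dir \<Rightarrow> ('m, 'd) dir \<Rightarrow> complex" where
 "H x k m = gcoeff (pd m (u k) x) {} {}"

text \<open>If exactly one of the two directions is odd, the second derivative of the even function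
  X_{-1} is odd and has no numerical part.\<close>

lemma H_cross:
 assumes x: "x \<in> U" and "oddd k \<noteq> oddd m"
 shows "H x k m = 0"
 unfolding H_def
proof (rule gpar_odd_body)
 have "pd m (spar (u k)) x = pd m (if oddd k then - u k else u k) x"
  by (rule pd_cong[OF oU x]) (simp add: sg_def u_par)
 then have "(if oddd m then - gpar (pd m (u k) x) else gpar (pd m (u k) x)) = (if oddd k then - pd m (u k) x else pd m (u k) x)"
  unfolding pd_spar[OF x u_smooth] by (simp add: sg_def pd_uminus[OF x u_smooth] split: if_splits)
 then show "gpar (pd m (u k) x) = - pd m (u k) x" using assms(2) by (auto split: if_splits) (metis minus_minus)
qed

text \<open>By \<open>H_cross\<close> the relevant part of the Hessian splits into an even block,
  the complex Hessian of the numerical part of X_{-1}, and an odd block given by its coefficients at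
  theta^alpha theta-bar^beta. Both are invertible by nondegeneracy. \<open>e\<close> names the type
  of directions that are left out.\<close>

lemma hessian_inverse:
 assumes x: "x \<in> U"
 shows "\<exists>N. \<forall>i m. holo i \<noteq> e --> holo m \<noteq> e --> (\<Sum>k | holo k \<noteq> e. N i k * H x (bar k) m) = (if i = m then 1 else 0 :: complex)"
proof -
 define f where "f = sf_coeff (X $$ (-1)) {} {}"
 have sm: "smooth_on U f" using sf_smoothD[OF FF_nth[OF X_FF]] by (simp add: f_def sf_coeff_def)
 define G where "G = ((\<chi> k l. wirt k (wirt_bar l f) x) :: complex^'m^'m)"
 define Q where "Q = ((\<chi> \<alpha> \<beta>. gcoeff (gdtheta \<alpha> (gdthetabar_right \<beta> (gnil ((X $$ (-1)) x)))) {} {}) :: ((complex, 'd) vec, 'd) vec)"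
 have "invertible G" "invertible Q" using pot x unfolding nondegenerate_potential_def G_def Q_def f_def by blast+
 then obtain B R where B: "G ** B = mat 1" "B ** G = mat 1" and R: "Q ** R = mat 1" "R ** Q = mat 1"
  by (auto simp: invertible_def)
 have G: "vec_nth (vec_nth G k) l = wd (- \<i>) k (wd \<i> l f) x" for k l by (simp add: G_def wirt_wd)
 have Q: "vec_nth (vec_nth Q \<alpha>) \<beta> = gcoeff ((X $$ (-1)) x) {\<alpha>} {\<beta>}" for \<alpha> \<beta>
  by (simp add: Q_def gdtheta_def gdthetabar_right_def gnil_def)
 have h1: "H x (DZb l) (DZ k) = vec_nth (vec_nth G k) l" for k l
  unfolding H_def u_eq pd_epd gcoeff_epd G by (simp add: f_def sf_coeff_def)
 have h2: "H x (DZ k) (DZb l) = vec_nth (vec_nth G k) l" for k l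
 proof -
  have "H x (DZ k) (DZb l) = wd \<i> l (wd (- \<i>) k f) x"
   unfolding H_def u_eq pd_epd gcoeff_epd by (simp add: f_def sf_coeff_def)
  then show ?thesis unfolding G wd_commute[OF oU x sm, of "- \<i>" k \<i> l] .
 qed
 \<comment> \<open>The relative sign is the anticommutation of the two odd derivatives; it reappears
   in the second choice of \<open>N\<close>.\<close>
 have h3: "H x (DT \<alpha>) (DTb \<beta>) = vec_nth (vec_nth Q \<alpha>) \<beta>" "H x (DTb \<beta>) (DT \<alpha>) = - vec_nth (vec_nth Q \<alpha>) \<beta>" for \<alpha> \<beta>
  unfolding H_def u_eq Q by (simp_all add: sf_dtheta_def sf_dthetabar_def gdtheta_def gdthetabar_def)
 have cr: "H x (DZ k) (DTb \<beta>) = 0" "H x (DT \<beta>) (DZb k) = 0" "H x (DZb k) (DT \<beta>) = 0" "H x (DTb \<beta>) (DZ k) = 0" for k \<beta>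
  by (rule H_cross[OF x], simp)+
 have inv: "(\<Sum>k\<in>UNIV. vec_nth (vec_nth B i) k * vec_nth (vec_nth G k) m) = (if i = m then 1 else 0)"
  "(\<Sum>k\<in>UNIV. vec_nth (vec_nth B k) i * vec_nth (vec_nth G m) k) = (if i = m then 1 else 0)" for i m
  using arg_cong[OF B(2), of "\<lambda>M. vec_nth (vec_nth M i) m"] arg_cong[OF B(1), of "\<lambda>M. vec_nth (vec_nth M m) i"]
  by (simp_all add: matrix_matrix_mult_def mat_def mult.commute eq_commute)
 have invR: "(\<Sum>k\<in>UNIV. vec_nth (vec_nth R i) k * vec_nth (vec_nth Q k) m) = (if i = m then 1 else 0)"
  "(\<Sum>k\<in>UNIV. vec_nth (vec_nth R k) i * vec_nth (vec_nth Q m) k) = (if i = m then 1 else 0)" for i m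
  using arg_cong[OF R(2), of "\<lambda>M. vec_nth (vec_nth M i) m"] arg_cong[OF R(1), of "\<lambda>M. vec_nth (vec_nth M m) i"]
  by (simp_all add: matrix_matrix_mult_def mat_def mult.commute eq_commute)
 show ?thesis
 proof (cases e)
  case True
  define N :: "('m, 'd) dir \<Rightarrow> ('m, 'd) dir \<Rightarrow> complex" where
   "N i k = (case i of DZb l \<Rightarrow> (case k of DZb j \<Rightarrow> vec_nth (vec_nth B l) j | _ \<Rightarrow> 0)
    | DTb \<beta> \<Rightarrow> (case k of DTb \<alpha> \<Rightarrow> vec_nth (vec_nth R \<beta>) \<alpha> | _ \<Rightarrow> 0) | _ \<Rightarrow> 0)" for i k
  have "(\<Sum>k | \<not> holo k. N i k * H x (bar k) m) = (if i = m then 1 else 0)" if "\<not> holo i" "\<not> holo m" for i m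
   unfolding sum_dir_class using that by (cases i; cases m) (simp_all add: N_def h2 h3 cr inv invR)
  then show ?thesis using True by (intro exI[of _ N] allI impI) simp
 next
  case False
  define N :: "('m, 'd) dir \<Rightarrow> ('m, 'd) dir \<Rightarrow> complex" where
   "N i k = (case i of DZ l \<Rightarrow> (case k of DZ j \<Rightarrow> vec_nth (vec_nth B j) l | _ \<Rightarrow> 0)
    | DT \<beta> \<Rightarrow> (case k of DT \<alpha> \<Rightarrow> - vec_nth (vec_nth R \<alpha>) \<beta> | _ \<Rightarrow> 0) | _ \<Rightarrow> 0)" for i k
  have "(\<Sum>k | holo k. N i k * H x (bar k) m) = (if i = m then 1 else 0)" if "holo i" "holo m" for i m
   unfolding sum_dir_class using that by (cases i; cases m) (simp_all add: N_def h1 h3 cr inv invR)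
  then show ?thesis using False by (intro exI[of _ N] allI impI) simp
 qed
qed

definition uc :: "complex^'m \<Rightarrow> ('m, 'd) dir \<Rightarrow> ('m, 'd) sfun" where
 "uc x i = u i - sconst (gcoeff (u i x) {} {})"

lemma uc_smooth [simp]: "uc x i \<in> sf_smooth U" by (simp add: uc_def)

lemma pd_uc: "z \<in> U ==> pd m (uc x i) z = pd m (u i) z"
 unfolding uc_def using pd_diff[OF oU, of z "u i" "sconst (gcoeff (u i x) {} {})" m] by simp

lemma uc_body: "gcoeff (uc x i x) {} {} = 0" by (simp add: uc_def)

lemma van_uc: "x \<in> U ==> van (Suc 0) x (uc x i)" by (simp add: uc_body van.simps(2))

text \<open>The coordinates of type \<open>e\<close> together with the centred derivatives
  \<open>uc x (bar j)\<close>, one for each direction j of the other type, have an invertible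
  Jacobian at \<open>x\<close>; hence they generate the functions of order one modulo order
  two.\<close>

lemma hessian_nakayama:
 assumes x: "x \<in> U" and t: "diff_op U t" and t1: "!!z. z \<in> U ==> t 1 z = 0"
  and s1: "!!i F M. holo i = e ==> F \<in> sf_smooth U ==> (!!G. G \<in> sf_smooth U ==> van M x (t G)) ==> van (Suc M) x (t (lcoord x i * F))"
  and s2: "!!i F M. holo i = e ==> F \<in> sf_smooth U ==> (!!G. G \<in> sf_smooth U ==> van M x (t G)) ==> van (Suc M) x (t (uc x i * F))"
  and F: "F \<in> sf_smooth U"
 shows "t F x = 0"
proof -
 obtain N where N: "!!i m. holo i \<noteq> e ==> holo m \<noteq> e ==> (\<Sum>k | holo k \<noteq> e. N i k * H x (bar k) m) = (if i = m then 1 else 0)"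
  using hessian_inverse[OF x, of e] by blast
 define g where "g j = (if holo j = e then lcoord x j else uc x (bar j))" for j
 \<comment> \<open>The inverse of a block triangular Jacobian: its rows are those of the identity
   for type \<open>e\<close> and Hessian rows otherwise.\<close>
 define A where "A i j = (if holo i = e then if i = j then 1 else 0
  else if holo j = e then - (\<Sum>k | holo k \<noteq> e. N i k * H x (bar k) j) else N i j)" for i j
 have gs: "g j \<in> sf_smooth U" for j by (simp add: g_def)
 have gp: "gcoeff (pd m (g j) x) {} {} = (if holo j = e then if m = j then 1 else 0 else H x (bar j) m)" for m j
  by (simp add: g_def pd_lcoord[OF x] pd_uc[OF x] H_def)
 have split: "(\<Sum>j\<in>UNIV. h j) = (\<Sum>j | holo j = e. h j) + (\<Sum>j | holo j \<noteq> e. h j)" for h :: "('m, 'd) dir \<Rightarrow> complex"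
 proof -
  have "UNIV = {j :: ('m, 'd) dir. holo j = e} \<union> {j. holo j \<noteq> e}" by auto
  then show ?thesis using sum.union_disjoint[of "{j. holo j = e}" "{j. holo j \<noteq> e}" h] by auto
 qed
 have key: "(\<Sum>j\<in>UNIV. A i j * gcoeff (pd m (g j) x) {} {}) = (if m = i then 1 else 0)" for i m
 proof -
  have "(\<Sum>j\<in>UNIV. A i j * gcoeff (pd m (g j) x) {} {})
    = (\<Sum>j | holo j = e. A i j * (if m = j then 1 else 0)) + (\<Sum>j | holo j \<noteq> e. A i j * H x (bar j) m)"
   unfolding split by (intro arg_cong2[where f = "(+)"] sum.cong) (auto simp: gp)
  also have "(\<Sum>j | holo j = e. A i j * (if m = j then 1 else 0)) = (if holo m = e then A i m else 0)"
  proof -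
   have "(\<Sum>j | holo j = e. A i j * (if m = j then 1 else 0)) = (\<Sum>j\<in>{j. holo j = e}. if m = j then A i j else 0)"
    by (intro sum.cong) auto
   then show ?thesis by (simp only: sum.delta'[OF finite_dir] mem_Collect_eq)
  qed
  also have "(\<Sum>j | holo j \<noteq> e. A i j * H x (bar j) m) = (if holo i = e then 0 else \<Sum>k | holo k \<noteq> e. N i k * H x (bar k) m)"
  proof (cases "holo i = e")
   case True
   have "A i j = 0" if "holo j \<noteq> e" for j using True that by (auto simp: A_def)
   then have "(\<Sum>j | holo j \<noteq> e. A i j * H x (bar j) m) = 0" by (intro sum.neutral) simp
   then show ?thesis using True by simp
  next
   case False
   have "A i j = N i j" if "holo j \<noteq> e" for j using False that by (simp add: A_def)
   then have "(\<Sum>j | holo j \<noteq> e. A i j * H x (bar j) m) = (\<Sum>k | holo k \<noteq> e. N i k * H x (bar k) m)"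
    by (intro sum.cong) auto
   then show ?thesis using False by simp
  qed
  finally show ?thesis using N[of i m] by (auto simp: A_def)
 qed
 have gen: "van 2 x (lcoord x i - (\<Sum>j\<in>UNIV. sconst (A i j) * g j))" for i
 proof -
  have S: "(\<Sum>j\<in>UNIV. sconst (A i j) * g j) \<in> sf_smooth U" by (intro sf_smooth_sum oU) (simp add: gs)
  have b: "gcoeff ((lcoord x i - (\<Sum>j\<in>UNIV. sconst (A i j) * g j)) x) {} {} = 0"
  proof -
   have "gcoeff (g j x) {} {} = 0" for j by (cases "holo j = e") (simp_all add: g_def uc_body)
   then show ?thesis by (simp add: sum_fun_apply gcoeff_sum)
  qed
  have "gcoeff (pd m (lcoord x i - (\<Sum>j\<in>UNIV. sconst (A i j) * g j)) x) {} {} = 0" for m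
  proof -
   have "pd m (\<Sum>j\<in>UNIV. sconst (A i j) * g j) x = (\<Sum>j\<in>UNIV. gconst (A i j) * pd m (g j) x)"
    using pd_sum[OF oU x, of UNIV "\<lambda>j. sconst (A i j) * g j" m] pd_cmult[OF x gs] gs by simp
   then show ?thesis
    unfolding pd_diff[OF oU x lcoord_smooth S] pd_lcoord[OF x] using key[of i m] by (simp add: gcoeff_sum)
  qed
  then show ?thesis using b by (simp add: numeral_2_eq_2 van.simps(2))
 qed
 show ?thesis
 proof (rule diff_op_nakayama[OF t x gs t1 gen _ F])
  fix j and F :: "('m, 'd) sfun" and M assume "F \<in> sf_smooth U" "!!G. G \<in> sf_smooth U ==> van M x (t G)"
  then show "van (Suc M) x (t (g j * F))"
   using s1[of j F M] s2[of "bar j" F M] by (cases "holo j = e") (auto simp: g_def)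
 qed
qed

text \<open>Induction on the power of nu, started by \<open>neg\<close>. Once the coefficients of T
  below n vanish, its coefficient at n is a differential operator to which
  \<open>hessian_nakayama\<close> applies; \<open>step\<close> may use that vanishing to pass to
  leading terms.\<close>

lemma formal_nakayama:
 fixes T :: "('m, 'd) formal \<Rightarrow> ('m, 'd) formal"
 assumes T: "fdo T" and neg: "!!g r z. g \<in> sf_smooth U ==> z \<in> U ==> r < 0 ==> (T (cst g) $$ r) z = 0"
  and T1: "eq_on U (T 1) 0"
  and step: "!!n x i F M. x \<in> U ==> holo i = e ==>
   (!!g r z. g \<in> sf_smooth U ==> z \<in> U ==> r < n ==> (T (cst g) $$ r) z = 0) ==> F \<in> sf_smooth U ==>
   (!!G. G \<in> sf_smooth U ==> van M x (T (cst G) $$ n)) ==>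
   van (Suc M) x (T (cst (lcoord x i * F)) $$ n) \<and> van (Suc M) x (T (cst (uc x i * F)) $$ n)"
  and f: "f \<in> FF"
 shows "eq_on U (T f) 0"
proof -
 obtain r0 Dt where Dt: "fdo_with r0 Dt T" using T by (auto simp: fdo_def)
 define tt where "tt n = (if n < r0 then (\<lambda>h. 0) else Dt n)" for n
 have dt: "diff_op U (tt n)" for n by (cases "n < r0") (simp_all add: tt_def diff_op_zero fdo_with_diff_op[OF Dt])
 have t: "(T (cst g) $$ n) z = tt n g z" if "g \<in> sf_smooth U" "z \<in> U" for g n z
  using fdo_with_const[OF Dt that, of n] by (simp add: tt_def)
 have vt: "van M x (tt n g) = van M x (T (cst g) $$ n)" if "x \<in> U" "g \<in> sf_smooth U" for M x g n
  by (rule van_cong[OF that(1)]) (simp add: t that(2))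
 have "\<forall>g\<in>sf_smooth U. \<forall>x\<in>U. (T (cst g) $$ int n) x = 0" for n
 proof (induction n rule: less_induct)
  case (less n)
  have low: "(T (cst g) $$ r) z = 0" if "g \<in> sf_smooth U" "z \<in> U" "r < int n" for g r z
  proof (cases "r < 0")
   case False
   then show ?thesis using less.IH[of "nat r"] that by simp
  qed (use neg that in blast)
  show ?case
  proof (intro ballI)
   fix g :: "('m, 'd) sfun" and x assume g: "g \<in> sf_smooth U" and x: "x \<in> U"
   have st: "van (Suc M) x (tt (int n) (lcoord x i * F)) \<and> van (Suc M) x (tt (int n) (uc x i * F))"
    if i: "holo i = e" and F: "F \<in> sf_smooth U" and v: "!!G. G \<in> sf_smooth U ==> van M x (tt (int n) G)" for i F M
   proof -
    have "van M x (T (cst G) $$ int n)" if "G \<in> sf_smooth U" for G using v[OF that] vt[OF x that] by blast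
    from step[OF x i low F this] show ?thesis
     using vt[OF x, of "lcoord x i * F" "Suc M"] vt[OF x, of "uc x i * F" "Suc M"] F by simp
   qed
   have "tt (int n) g x = 0"
   proof (rule hessian_nakayama[where t = "tt (int n)" and e = e, OF x dt _ _ _ g])
    show "tt (int n) 1 z = 0" if "z \<in> U" for z
     using eq_onD[OF T1 that, of "int n"] t[OF sf_smooth_0(2) that] by simp
    show "van (Suc M) x (tt (int n) (lcoord x i * F))" if "holo i = e" "F \<in> sf_smooth U" "!!G. G \<in> sf_smooth U ==> van M x (tt (int n) G)" for i F M
     by (rule conjunct1[OF st[OF that]])
    show "van (Suc M) x (tt (int n) (uc x i * F))" if "holo i = e" "F \<in> sf_smooth U" "!!G. G \<in> sf_smooth U ==> van M x (tt (int n) G)" for i F M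
     by (rule conjunct2[OF st[OF that]])
   qed
   then show "(T (cst g) $$ int n) x = 0" using t[OF g x] by simp
  qed
 qed
 note nonneg = this
 have z: "(T (cst g) $$ r) x = 0" if "g \<in> sf_smooth U" "x \<in> U" for g r x
 proof (cases "r < 0")
  case False
  then show ?thesis using nonneg[rule_format, of g x "nat r"] that by simp
 qed (use neg that in blast)
 have "fdo (\<lambda>f :: ('m, 'd) formal. 0 * f)" by (rule fdo_lmult) simp
 then have "eq_on U (T f) (0 * f)"
  by (rule fdo_eq_on_const[OF T _ _ f]) (simp add: eq_on_def z)
 then show ?thesis by simp
qed

lemma expand_low:
 assumes A: "fdo A" and f: "f \<in> FF" and z: "z \<in> U" and s: "!!j z. j < 0 ==> z \<in> U ==> (f $$ j) z = 0"
  and t: "!!g r z. g \<in> sf_smooth U ==> z \<in> U ==> r < 0 ==> (A (cst g) $$ r) z = 0"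
 shows "(A f $$ n) z = (\<Sum>j = 0..n. (A (cst (f $$ j)) $$ (n - j)) z)"
 using fdo_expand_const[where A = A and f = f and s = 0 and t = 0 and n = n and z = z] A f z s t DB by simp

text \<open>For h = b a the product is b star (a g) = Ber (b J(a g)), which
  \<open>diff_op_leibniz\<close> makes bidifferential in h and g. For fixed g both sides are
  differential operators in h, so agreement on products b a is enough.\<close>

lemma star_Ber_bidiff:
 "\<exists>B. (\<forall>r. bidiff U (B r)) \<and> (\<forall>h\<in>sf_smooth U. \<forall>g\<in>sf_smooth U. \<forall>z\<in>U. \<forall>r.
   (star (Ber (cst h)) (cst g) $$ r) z = (if r < 0 then 0 else B r h g z))"
proof -
 obtain E where E: "fdo_with 0 E J" using J_fdo_with by blast
 define lb where "lb j Bd \<longleftrightarrow> bidiff U Bd \<and> (\<forall>b a g. santi U b --> shol U a --> g \<in> sf_smooth U -->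
   (\<forall>z\<in>U. (b * E j (a * g)) z = Bd (b * a) g z))" for j Bd
 define L where "L j = (SOME Bd. lb j Bd)" for j
 have L: "lb j (L j)" for j
 proof -
  have "\<exists>Bd. lb j Bd" unfolding lb_def by (rule diff_op_leibniz[OF fdo_with_diff_op[OF E]])
  then show ?thesis unfolding L_def by (rule someI_ex)
 qed
 have Lb: "bidiff U (L j)" for j using L[of j] by (simp add: lb_def)
 have Le: "b z * E j (a * g) z = L j (b * a) g z" if "santi U b" "shol U a" "g \<in> sf_smooth U" "z \<in> U" for j b a g z
  using L[of j] that unfolding lb_def by simp
 define B where "B r = (\<lambda>h g. \<Sum>j\<in>{0..r}. DB (r - j) (L j h g))" for r
 have Bb: "bidiff U (B r)" for r
  unfolding B_def by (rule bidiff_sum) (rule bidiff.op[OF fdo_with_diff_op[OF DB(1)] Lb])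
 have "(star (Ber (cst h)) (cst g) $$ r) z = (if r < 0 then 0 else B r h g z)"
  if h: "h \<in> sf_smooth U" and g: "g \<in> sf_smooth U" and z: "z \<in> U" for h g r z
 proof -
  have gF: "cst g \<in> FF" using g by simp
  have Af: "fdo (\<lambda>f. star (Ber f) (cst g))" by (rule fdo_comp[OF star_fdo_r[OF gF] Ber_fdo])
  then obtain r0 DA where DA: "fdo_with r0 DA (\<lambda>f. star (Ber f) (cst g))" by (auto simp: fdo_def)
  define A1 where "A1 = (if r < r0 then (\<lambda>h. 0) else DA r)"
  define A2 where "A2 = (if r < 0 then (\<lambda>h. 0) else (\<lambda>h. B r h g))"
  have d: "diff_op U A1" "diff_op U A2"
   by (cases "r < r0"; simp add: A1_def diff_op_zero fdo_with_diff_op[OF DA])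
    (cases "r < 0"; simp add: A2_def diff_op_zero bidiff_left[OF Bb g])
  have A1: "(star (Ber (cst h)) (cst g) $$ r) z = A1 h z" if "h \<in> sf_smooth U" "z \<in> U" for h z
   using fdo_with_const[OF DA that, of r] by (simp add: A1_def)
  have "(\<lambda>h. A1 h - A2 h) h z = 0"
  proof (rule diff_op_zero_on_poly[OF diff_op_minus[OF d] z h])
   fix b a :: "('m, 'd) sfun" assume b: "santi U b" and a: "shol U a"
   have ba: "b \<in> sf_smooth U" "a \<in> sf_smooth U" "b * a \<in> sf_smooth U" "a * g \<in> sf_smooth U"
    using shol_smooth(2)[OF b] shol_smooth(1)[OF a] g by simp_all
   define G where "G = cst b * J (cst (a * g))"
   have GF: "G \<in> FF" unfolding G_def using ba by (intro FF_mult J_FF FF_const)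
   have F: "cst b \<in> FF" "cst a \<in> FF" "cst (a * g) \<in> FF" "J (cst (a * g)) \<in> FF" "cst (b * a) \<in> FF"
    using ba by (simp_all only: FF_const J_FF)
   have Gn: "(G $$ j) y = (if j < 0 then 0 else L j (b * a) g y)" if "y \<in> U" for j y
    using fdo_with_const[OF E ba(4) that, of j] Le[OF b a g that, of j] by (simp add: G_def)
   have "eq_on U (star (Ber (cst (b * a))) (cst g)) (star (star (cst b) (cst a)) (cst g))"
    by (rule star_cong_U[OF _ _ _ _ Ber_ba[OF oU subset_refl b a] eq_on_refl]) (use F gF in simp_all)
   also have "eq_on U \<dots> (star (cst b) (star (cst a) (cst g)))" by (rule star_assoc[OF F(1,2) gF])
   also have "eq_on U \<dots> (star (cst b) (Ber (J (cst (a * g)))))"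
   proof (rule star_cong_U[OF _ _ _ _ eq_on_refl])
    have "eq_on U (star (cst a) (cst g)) (cst (a * g))"
     using star_hol_U[OF a gF] unfolding cst_mult .
    from eq_on_trans[OF this eq_on_sym[OF Ber_J[OF F(3)]]]
    show "eq_on U (star (cst a) (cst g)) (Ber (J (cst (a * g))))" .
   qed (use F gF in \<open>simp_all only: star_FF Ber_FF\<close>)
   also have "eq_on U \<dots> (Ber G)" unfolding G_def by (rule eq_on_sym[OF Ber_bmult[OF b F(4)]])
   finally have "(star (Ber (cst (b * a))) (cst g) $$ r) z = (Ber G $$ r) z" by (rule eq_onD[OF _ z])
   also have "\<dots> = (\<Sum>j = 0..r - 0. DB (r - j) (G $$ j) z)"
    by (rule fdo_withD[OF DB(1) GF _ z]) (simp add: Gn)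
   also have "\<dots> = (\<Sum>j = 0..r. DB (r - j) (L j (b * a) g) z)"
    by (intro sum.cong) (auto intro!: diff_op_cong[OF fdo_with_diff_op[OF DB(1)] oU z] simp: Gn)
   also have "\<dots> = A2 (b * a) z" by (simp add: A2_def B_def sum_fun_apply)
   finally show "(\<lambda>h. A1 h - A2 h) (b * a) z = 0" using A1[OF ba(3) z] by simp
  qed
  then have "A1 h z = A2 h z" by simp
  then show ?thesis unfolding A1[OF h z] by (simp add: A2_def)
 qed
 then show ?thesis using Bb by blast
qed

text \<open>Writing p = Ber (J p) in \<open>star_Ber_bidiff\<close> shows that the star product
  itself is bidifferential. Then the arguments are exchanged by \<open>bidiff_swap\<close> and
  \<open>Ber\<close> is composed into the second factor.\<close>

lemma star_Ber_bidiff':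
 "\<exists>B. (\<forall>r. bidiff U (B r)) \<and> (\<forall>h\<in>sf_smooth U. \<forall>g\<in>sf_smooth U. \<forall>z\<in>U. \<forall>r.
   (star (cst g) (Ber (cst h)) $$ r) z = (if r < 0 then 0 else B r h g z))"
proof -
 obtain E where E: "fdo_with 0 E J" using J_fdo_with by blast
 obtain B where Bb: "!!r. bidiff U (B r)" and B: "!!h g z r. h \<in> sf_smooth U ==> g \<in> sf_smooth U ==> z \<in> U ==>
   (star (Ber (cst h)) (cst g) $$ r) z = (if r < 0 then 0 else B r h g z)"
  using star_Ber_bidiff by blast
 define S where "S r = (\<lambda>u v. \<Sum>j\<in>{0..r}. B (r - j) (E j u) v)" for r
 have Sb: "bidiff U (S r)" for r
  unfolding S_def by (rule bidiff_sum) (rule bidiff_comp[OF Bb fdo_with_diff_op[OF E] diff_op_id])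
 have S: "(star (cst p) (cst v) $$ r) z = (if r < 0 then 0 else S r p v z)"
  if p: "p \<in> sf_smooth U" and v: "v \<in> sf_smooth U" and z: "z \<in> U" for p v r z
 proof -
  have F: "cst p \<in> FF" "cst v \<in> FF" "J (cst p) \<in> FF" using p v by simp_all
  have "(star (cst p) (cst v) $$ r) z = (star (Ber (J (cst p))) (cst v) $$ r) z"
   by (rule eq_onD[OF star_cong_U[OF _ _ _ _ eq_on_sym[OF Ber_J] eq_on_refl] z]) (use F in simp_all)
  also have "\<dots> = (\<Sum>j = 0..r. (star (Ber (cst (J (cst p) $$ j))) (cst v) $$ (r - j)) z)"
   by (rule expand_low[OF fdo_comp[OF star_fdo_r[OF F(2)] Ber_fdo] F(3) z])
    (simp_all add: fdo_with_const[OF E p] B v)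
  also have "\<dots> = (\<Sum>j = 0..r. B (r - j) (E j p) v z)"
  proof (rule sum.cong[OF refl])
   fix j assume j: "j \<in> {0..r}"
   have "B (r - j) (J (cst p) $$ j) v z = B (r - j) (E j p) v z"
    by (rule bidiff_cong[OF Bb oU z]) (use j in \<open>simp_all add: fdo_with_const[OF E p]\<close>)
   then show "(star (Ber (cst (J (cst p) $$ j))) (cst v) $$ (r - j)) z = B (r - j) (E j p) v z"
    using j B[OF FF_nth[OF F(3)] v z, of j "r - j"] by simp
  qed
  finally show ?thesis by (simp add: S_def sum_fun_apply)
 qed
 define S' where "S' r = (SOME B'. bidiff U B' \<and> (\<forall>h g. B' h g = S r g h))" for r
 have S': "bidiff U (S' r) \<and> (\<forall>h g. S' r h g = S r g h)" for r
  unfolding S'_def by (rule someI_ex[OF bidiff_swap[OF Sb]])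
 define C where "C r = (\<lambda>h g. \<Sum>j\<in>{0..r}. S' (r - j) (DB j h) g)" for r
 have Cb: "bidiff U (C r)" for r
  unfolding C_def by (rule bidiff_sum) (rule bidiff_comp[OF conjunct1[OF S'] fdo_with_diff_op[OF DB(1)] diff_op_id])
 have "(star (cst g) (Ber (cst h)) $$ r) z = (if r < 0 then 0 else C r h g z)"
  if h: "h \<in> sf_smooth U" and g: "g \<in> sf_smooth U" and z: "z \<in> U" for h g r z
 proof -
  have F: "cst h \<in> FF" "cst g \<in> FF" "Ber (cst h) \<in> FF" using h g by simp_all
  have "(star (cst g) (Ber (cst h)) $$ r) z = (\<Sum>j = 0..r. (star (cst g) (cst (Ber (cst h) $$ j)) $$ (r - j)) z)"
   by (rule expand_low[OF star_fdo[OF F(2)] F(3) z]) (simp_all add: fdo_with_const[OF DB(1) h] S g)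
  also have "\<dots> = (\<Sum>j = 0..r. S (r - j) g (DB j h) z)"
  proof (rule sum.cong[OF refl])
   fix j assume j: "j \<in> {0..r}"
   have "S (r - j) g (Ber (cst h) $$ j) z = S (r - j) g (DB j h) z"
    by (rule bidiff_cong[OF Sb oU z]) (use j in \<open>simp_all add: fdo_with_const[OF DB(1) h]\<close>)
   then show "(star (cst g) (cst (Ber (cst h) $$ j)) $$ (r - j)) z = S (r - j) g (DB j h) z"
    using j S[OF g FF_nth[OF F(3)] z, of j "r - j"] by simp
  qed
  finally show ?thesis using conjunct2[OF S'] by (simp add: C_def sum_fun_apply)
 qed
 then show ?thesis using Cb by blast
qed

end

section \<open>The supertrace density\<close>

context dom
begin

lemma bint_diff:
 assumes "f \<in> sf_smooth U" "csup f" "g \<in> sf_smooth U" "csup g"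
 shows "bint (f - g) = bint f - bint g"
proof -
 have "bint (f + - g) = bint f + bint (- g)"
 proof (rule bint_add)
  show "csup (- g)" by (rule csup_mono[OF assms(4)]) simp
 qed (use assms in simp_all)
 moreover have "f - g = f + - g" by simp
 ultimately have "bint (f - g) = bint f + - bint g" by (simp only: bint_uminus)
 then show ?thesis by simp
qed

lemma csup_const: "csup g ==> csup (cst g $$ n)"
 by (cases "n = 0") (simp_all add: csup_0)

end

context bstar
begin

lemma w_low:
 assumes "j < - 1" "z \<in> U"
 shows "(w i $$ j) z = 0"
proof -
 have "pd i (X $$ j) z = pd i 0 z" by (rule pd_cong[OF oU assms(2)]) (use X_low assms in simp)
 then show ?thesis by (simp add: w_def)
qed

lemma y_leading: "z \<in> U ==> (y i $$ (- 1)) z = u i z"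
 using y_low(2) by (simp add: u_def)

text \<open>On functions constant in nu the values of T start at order n, so at nu^(n-1) only the
  simple pole of \<open>h\<close> can contribute.\<close>

lemma lead_const:
 assumes T: "fdo T" and low: "!!g r z. g \<in> sf_smooth U ==> z \<in> U ==> r < n ==> (T (cst g) $$ r) z = 0"
  and h: "h \<in> FF" "!!j z. j < - 1 ==> z \<in> U ==> (h $$ j) z = 0" and v: "v \<in> sf_smooth U" "!!z. z \<in> U ==> (h $$ (- 1)) z = v z"
  and z: "z \<in> U"
 shows "(T h $$ (n - 1)) z = (T (cst v) $$ n) z"
proof -
 have e: "{- 1..n - 1 - n} = {- 1 :: int}" by auto
 have "(T h $$ (n - 1)) z = (\<Sum>j = - 1..n - 1 - n. (T (cst (h $$ j)) $$ (n - 1 - j)) z)"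
  using fdo_expand_const[where A = T and f = h and s = "- 1" and t = n and n = "n - 1" and z = z] T h z low DB by blast
 also have "\<dots> = (T (cst (h $$ (- 1))) $$ n) z" unfolding e by simp
 also have "\<dots> = (T (cst v) $$ n) z"
  by (rule eq_onD[OF fdo_cong_U[OF T] z]) (use h(1) v in \<open>simp_all add: eq_on_def\<close>)
 finally show ?thesis .
qed

lemma pd_zero_on: "z \<in> U ==> (!!z. z \<in> U ==> f z = 0) ==> pd i f z = 0"
 using pd_cong[OF oU, of z f 0 i] by simp

text \<open>For odd \<open>i\<close> the function \<open>u i\<close> is odd and has no numerical
  part, so centring does not spoil its parity; for even \<open>i\<close> constants are even.\<close>

lemma uc_comm:
 assumes z: "z \<in> U" and x: "x \<in> U"
 shows "uc x i z * f z = sgd i f z * uc x i z"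
proof (cases "oddd i")
 case True
 have "gpar (u i x) = - u i x" using u_par[OF x, of i] True by simp
 then have "uc x i z = u i z" by (simp add: uc_def gpar_odd_body)
 then show ?thesis using godd_commute[of "u i z" "f z"] u_par[OF z, of i] True by (simp add: sgd_def sg_def)
next
 case False
 have "gpar (uc x i z) = uc x i z" using u_par[OF z, of i] False by (simp add: uc_def)
 then show ?thesis using geven_commute[of "uc x i z" "f z"] False by (simp add: sgd_def)
qed

end

section \<open>The density exp(X + X') and the two trace identities\<close>

context bdens
begin

definition \<rho> :: "('m, 'd) formal" where "\<rho> = formal_exp (X + X')"

lemma XX'_par: "par False (X + X')"
 by (rule parI) (simp add: parD[OF X_par, simplified] parD[OF X'_par, simplified])

lemma rho_FF [simp]: "\<rho> \<in> FF"
 unfolding \<rho>_def by (rule formal_exp_FF) (use X_X' XX'_par in \<open>simp_all add: par_def\<close>)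

lemma rho_par: "par False \<rho>" unfolding \<rho>_def by (rule par_formal_exp[OF XX'_par])

lemma rho_neg: "n < 0 ==> (\<rho> $$ n) z = 0" by (simp add: \<rho>_def formal_exp_def)

lemma rho_comm: "eq_on U (\<rho> * f) (f * \<rho>)"
 by (rule fls_mult_commute_even) (use rho_par in \<open>simp add: par_def\<close>)

lemma fpd_rho: "eq_on U (fpd i \<rho>) ((w i - y i) * \<rho>)"
proof -
 have "eq_on U (fpd i \<rho>) (fpd i (X + X') * \<rho>)"
  unfolding \<rho>_def by (rule fpd_formal_exp) (use X_X' XX'_par in \<open>simp_all add: par_def\<close>)
 moreover have "eq_on U (fpd i (X + X')) (fpd i X + fpd i X')" by (rule fdo_additive[OF fdo_fpd]) simp_all
 moreover have "eq_on U (fpd i X + fpd i X') (w i + - y i)" unfolding w_def by (rule eq_on_add[OF eq_on_refl fpd_X'])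
 ultimately have "eq_on U (fpd i \<rho>) ((w i + - y i) * \<rho>)"
  by (blast intro: eq_on_trans eq_on_mult eq_on_refl)
 then show ?thesis by simp
qed

lemma fsgd_rho: "eq_on U (fsgd i (h * \<rho>)) (fsgd i h * \<rho>)"
proof (cases "oddd i")
 case True
 have "eq_on U (fpar h * fpar \<rho>) (fpar h * \<rho>)"
  by (rule eq_on_mult[OF eq_on_refl]) (use rho_par in \<open>simp add: par_def\<close>)
 from eq_on_trans[OF fpar_mult this] show ?thesis using True by (simp add: fsgd_def)
qed (simp add: fsgd_def)

text \<open>With f = Ber h, this converts star multiplication under the integral into pointwise
  multiplication by h. It amounts to identifying the transposed operator \<open>\<kappa>\<close>
  with right multiplication by \<open>\<rho>\<close>.\<close>

lemma trace_right:
 assumes h: "h \<in> FF" and g: "g \<in> FF" and c: "(\<forall>n. csup (h $$ n)) \<or> (\<forall>n. csup (g $$ n))"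
 shows "bint ((star (Ber h) g * \<rho>) $$ n) = bint ((h * g * \<rho>) $$ n)"
proof -
 obtain B where Bb: "!!r. bidiff U (B r)" and B: "!!h g z r. h \<in> sf_smooth U ==> g \<in> sf_smooth U ==> z \<in> U ==>
   (star (Ber (cst h)) (cst g) $$ r) z = (if r < 0 then 0 else B r h g z)"
  using star_Ber_bidiff by blast
 have "\<exists>K. (\<forall>r. diff_op U (K r)) \<and> (\<forall>h\<in>FF. \<forall>g\<in>FF. (\<forall>n. csup (h $$ n)) \<or> (\<forall>n. csup (g $$ n)) -->
  (\<forall>n. bint ((star (Ber h) g * \<rho>) $$ n) = bint ((op_of K h * g) $$ n)))"
  by (rule product_transpose[where P = "\<lambda>h g. star (Ber h) g", OF star_fdo[OF Ber_FF] fdo_comp[OF star_fdo_r Ber_fdo] Bb B rho_FF rho_neg])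
 then obtain K where K: "!!r. diff_op U (K r)" and
  kb: "\<forall>h\<in>FF. \<forall>g\<in>FF. (\<forall>n. csup (h $$ n)) \<or> (\<forall>n. csup (g $$ n)) -->
  (\<forall>n. bint ((star (Ber h) g * \<rho>) $$ n) = bint ((op_of K h * g) $$ n))" by blast
 define \<kappa> where "\<kappa> = op_of K"
 have kf: "fdo_with 0 K \<kappa>" unfolding \<kappa>_def by (rule fdo_with_op_of[OF K])
 then have kd: "fdo \<kappa>" by (auto simp: fdo_def)
 have kF [simp]: "\<kappa> h \<in> FF" if "h \<in> FF" for h by (rule fdo_closed[OF kd that])
 have kb: "bint ((star (Ber h) g * \<rho>) $$ n) = bint ((\<kappa> h * g) $$ n)"
  if "h \<in> FF" "g \<in> FF" "(\<forall>n. csup (h $$ n)) \<or> (\<forall>n. csup (g $$ n))" for h g n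
  unfolding \<kappa>_def using kb that by blast
 \<comment> \<open>The integral pairing is nondegenerate, so \<open>\<kappa> h\<close> is identified
   by testing against compactly supported functions constant in nu.\<close>
 have kt: "eq_on U (\<kappa> h) F"
  if h: "h \<in> FF" and F: "F \<in> FF"
   and e: "!!g n. g \<in> sf_smooth U ==> csup g ==> bint ((star (Ber h) (cst g) * \<rho>) $$ n) = bint (F $$ n * g)" for h F
 proof (rule eq_on_of_bint[OF kF[OF h] F])
  fix g :: "('m, 'd) sfun" and n assume g: "g \<in> sf_smooth U" "csup g"
  have "bint ((star (Ber h) (cst g) * \<rho>) $$ n) = bint ((\<kappa> h * cst g) $$ n)"
   by (rule kb[OF h FF_const[OF g(1)]]) (use csup_const[OF g(2)] in blast)
  moreover have "(\<kappa> h * cst g) $$ n = \<kappa> h $$ n * g" by simp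
  ultimately show "bint (\<kappa> h $$ n * g) = bint (F $$ n * g)" using e[OF g, of n] by simp
 qed
 have k1: "eq_on U (\<kappa> 1) \<rho>"
 proof (rule kt)
  fix g :: "('m, 'd) sfun" and n assume g: "g \<in> sf_smooth U" "csup g"
  have b1: "eq_on U (Ber 1) 1" using Ber_one(1)[OF shol_sconst(3) oU subset_refl] by (simp only: fls_const_1)
  have "eq_on U (star (Ber 1) (cst g)) (star 1 (cst g))"
   by (rule star_cong_U[OF _ _ _ _ b1 eq_on_refl]) (use g in simp_all)
  also have "eq_on U \<dots> (cst g)" by (rule star_one(1)) (use g in simp)
  finally have "eq_on U (star (Ber 1) (cst g) * \<rho>) (cst g * \<rho>)" by (rule eq_on_mult[OF _ eq_on_refl])
  from bint_eq_on[OF eq_on_trans[OF this eq_on_sym[OF rho_comm]], of n]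
  show "bint ((star (Ber 1) (cst g) * \<rho>) $$ n) = bint (\<rho> $$ n * g)" by simp
 qed simp_all
 have ka: "eq_on U (\<kappa> (h * cst a)) (\<kappa> h * cst a)" if a: "shol U a" and h: "h \<in> FF" for a h
 proof (rule kt)
  have A: "cst a \<in> FF" using shol_smooth(1)[OF a] by simp
  show "h * cst a \<in> FF" by (rule FF_mult[OF h A])
  show "\<kappa> h * cst a \<in> FF" by (rule FF_mult[OF kF[OF h] A])
  fix g :: "('m, 'd) sfun" and n assume g: "g \<in> sf_smooth U" "csup g"
  have ag: "a * g \<in> sf_smooth U" using shol_smooth(1)[OF a] g by simp
  have G: "cst g \<in> FF" using g by simp
  have "eq_on U (star (Ber (h * cst a)) (cst g)) (star (star (Ber h) (cst a)) (cst g))"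
   by (rule star_cong_U[OF _ _ _ _ Ber_multa[OF a h] eq_on_refl]) (use h A G in \<open>simp_all only: Ber_FF star_FF FF_mult\<close>)
  also have "eq_on U \<dots> (star (Ber h) (star (cst a) (cst g)))" by (rule star_assoc[OF Ber_FF[OF h] A G])
  also have "eq_on U \<dots> (star (Ber h) (cst (a * g)))"
   unfolding cst_mult[symmetric]
   by (rule star_cong_U[OF _ _ _ _ eq_on_refl star_hol_U[OF a G]]) (use h A G in \<open>simp_all only: Ber_FF star_FF FF_mult\<close>)
  finally have "bint ((star (Ber (h * cst a)) (cst g) * \<rho>) $$ n) = bint ((star (Ber h) (cst (a * g)) * \<rho>) $$ n)"
   by (intro bint_eq_on eq_on_mult eq_on_refl)
  also have "\<dots> = bint ((\<kappa> h * cst (a * g)) $$ n)"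
   by (rule kb[OF h FF_const[OF ag]]) (use csup_const[OF csup_lmult[OF g(2)]] in blast)
  also have "(\<kappa> h * cst (a * g)) $$ n = (\<kappa> h * cst a) $$ n * g" by (simp add: mult.assoc)
  finally show "bint ((star (Ber (h * cst a)) (cst g) * \<rho>) $$ n) = bint ((\<kappa> h * cst a) $$ n * g)" .
 qed
 have ky: "eq_on U (\<kappa> (h * y i - fpd i (fsgd i h))) (\<kappa> h * w i - fpd i (fsgd i (\<kappa> h)))" if i: "holo i" and h: "h \<in> FF" for i h
 proof (rule kt)
  show hF: "h * y i - fpd i (fsgd i h) \<in> FF" "\<kappa> h * w i - fpd i (fsgd i (\<kappa> h)) \<in> FF" using h by simp_all
  fix g :: "('m, 'd) sfun" and n assume g: "g \<in> sf_smooth U" "csup g"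
  have G: "cst g \<in> FF" using g by simp
  \<comment> \<open>This is the star product of \<open>w i\<close> with g. Its derivative of g is
    moved onto \<open>\<kappa> h\<close> by integration by parts.\<close>
  define q where "q = w i * cst g + fpd i (cst g)"
  have qF: "q \<in> FF" unfolding q_def by (intro FF_add FF_mult w_FF FF_fpd G)
  have qn: "q $$ n = w i $$ n * g + (if n = 0 then pd i g else 0)" for n by (simp add: q_def)
  have cpd: "csup (pd i g)" by (rule csup_diff_op[OF diff_op_pd g(2)])
  have qc: "csup (q $$ n)" for n unfolding qn by (intro csup_add csup_lmult g) (cases "n = 0"; simp add: cpd csup_0)
  have "eq_on U (Ber (h * y i - fpd i (fsgd i h))) (Ber (D h (y i)))"
   by (rule fdo_cong_U[OF Ber_fdo hF(1) _ eq_on_sym[OF D_y_r[OF i h]]]) (use h in simp)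
  also have "eq_on U \<dots> (star (Ber h) (Ber (y i)))" by (rule Ber_D[OF h y_FF])
  also have "eq_on U \<dots> (star (Ber h) (w i))" by (rule star_cong_U[OF _ _ _ _ eq_on_refl Ber_y]) (use h in simp_all)
  finally have e: "eq_on U (Ber (h * y i - fpd i (fsgd i h))) (star (Ber h) (w i))" .
  have "eq_on U (star (Ber (h * y i - fpd i (fsgd i h))) (cst g)) (star (star (Ber h) (w i)) (cst g))"
   by (rule star_cong_U[OF _ _ _ _ e eq_on_refl]) (use h hF G in simp_all)
  also have "eq_on U \<dots> (star (Ber h) (star (w i) (cst g)))" by (rule star_assoc[OF Ber_FF[OF h] w_FF G])
  also have "eq_on U \<dots> (star (Ber h) q)"
   unfolding q_def by (rule star_cong_U[OF _ _ _ _ eq_on_refl star_w_l[OF i G]]) (use h G in simp_all)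
  finally have "bint ((star (Ber (h * y i - fpd i (fsgd i h))) (cst g) * \<rho>) $$ n) = bint ((star (Ber h) q * \<rho>) $$ n)"
   by (intro bint_eq_on eq_on_mult eq_on_refl)
  also have "\<dots> = bint ((\<kappa> h * q) $$ n)" by (rule kb[OF h qF]) (use qc in blast)
  also have "(\<kappa> h * q) $$ n = (\<kappa> h * w i) $$ n * g + \<kappa> h $$ n * pd i g"
  proof -
   have "\<kappa> h * q = \<kappa> h * w i * cst g + \<kappa> h * cst (pd i g)"
    unfolding q_def fls_const_fops by (simp only: distrib_left mult.assoc)
   then show ?thesis by simp
  qed
  also have "bint \<dots> = bint ((\<kappa> h * w i) $$ n * g) + bint (\<kappa> h $$ n * pd i g)"
   by (rule bint_add) (use h g csup_lmult[OF g(2)] csup_lmult[OF cpd] FF_nth[OF FF_mult[OF kF[OF h] w_FF]] in simp_all)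
  also have "bint (\<kappa> h $$ n * pd i g) = - bint (pd i (sgd i (\<kappa> h $$ n)) * g)"
  proof -
   have s: "sgd i (sgd i (\<kappa> h $$ n)) = \<kappa> h $$ n" by (simp add: sgd_def sg_def)
   have "bint (pd i (sgd i (\<kappa> h $$ n)) * g) = - bint (sgd i (sgd i (\<kappa> h $$ n)) * pd i g)"
    by (rule bint_parts) (use h g in simp_all)
   then show ?thesis unfolding s by simp
  qed
  also have "bint ((\<kappa> h * w i) $$ n * g) + - bint (pd i (sgd i (\<kappa> h $$ n)) * g)
    = bint ((\<kappa> h * w i) $$ n * g - pd i (sgd i (\<kappa> h $$ n)) * g)"
   using bint_diff[of "(\<kappa> h * w i) $$ n * g" "pd i (sgd i (\<kappa> h $$ n)) * g"] h g csup_lmult[OF g(2)]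
    FF_nth[OF FF_mult[OF kF[OF h] w_FF]] by simp
  also have "(\<kappa> h * w i) $$ n * g - pd i (sgd i (\<kappa> h $$ n)) * g = (\<kappa> h * w i - fpd i (fsgd i (\<kappa> h))) $$ n * g"
   by (simp add: left_diff_distrib)
  finally show "bint ((star (Ber (h * y i - fpd i (fsgd i h))) (cst g) * \<rho>) $$ n)
    = bint ((\<kappa> h * w i - fpd i (fsgd i (\<kappa> h))) $$ n * g)" .
 qed
 \<comment> \<open>Right multiplication by \<open>\<rho>\<close> satisfies the same two relations as
   \<open>\<kappa>\<close>, the one for \<open>y\<close> by d_i rho = (w_i - y_i) rho, so the
   difference \<open>T\<close> inherits them and in addition kills 1.\<close>
 define T where "T h = \<kappa> h - h * \<rho>" for h
 have Td: "fdo T" unfolding T_def[abs_def] by (rule fdo_diff[OF kd fdo_rmult[OF rho_FF]])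
 have TF: "T h \<in> FF" if "h \<in> FF" for h by (rule fdo_closed[OF Td that])
 have Ta: "eq_on U (T (h * cst a)) (T h * cst a)" if a: "shol U a" and h: "h \<in> FF" for a h
 proof -
  have "eq_on U (h * (cst a * \<rho>)) (h * (\<rho> * cst a))"
   by (rule eq_on_mult[OF eq_on_refl eq_on_sym[OF rho_comm]])
  from eq_on_diff[OF ka[OF a h] this] show ?thesis by (simp only: T_def left_diff_distrib mult.assoc)
 qed
 have Ty: "eq_on U (T (h * y i - fpd i (fsgd i h))) (T h * w i - fpd i (fsgd i (T h)))" if i: "holo i" and h: "h \<in> FF" for i h
 proof -
  have F: "h * \<rho> \<in> FF" "\<kappa> h \<in> FF" "fsgd i h \<in> FF" using h by simp_all
  have fd: "fdo (\<lambda>f. f * w i - fpd i (fsgd i f))" by (rule fdo_diff[OF fdo_rmult[OF w_FF] fdo_comp[OF fdo_fpd fdo_fsgd]])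
  have "eq_on U (fpd i (fsgd i (h * \<rho>))) (fpd i (fsgd i h * \<rho>))"
   by (rule fdo_cong_U[OF fdo_fpd _ _ fsgd_rho]) (use F in simp_all)
  also have "eq_on U \<dots> (fpd i (fsgd i h) * \<rho> + h * fpd i \<rho>)" using fpd_mult[OF F(3) rho_FF, of i] by simp
  also have "eq_on U \<dots> (fpd i (fsgd i h) * \<rho> + h * ((w i - y i) * \<rho>))"
   by (intro eq_on_add eq_on_mult eq_on_refl fpd_rho)
  finally have e1: "eq_on U (fpd i (fsgd i (h * \<rho>))) (fpd i (fsgd i h) * \<rho> + h * ((w i - y i) * \<rho>))" .
  have e2: "eq_on U (h * \<rho> * w i) (h * (w i * \<rho>))"
   unfolding mult.assoc by (rule eq_on_mult[OF eq_on_refl rho_comm])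
  have "eq_on U (h * \<rho> * w i - fpd i (fsgd i (h * \<rho>))) (h * (w i * \<rho>) - (fpd i (fsgd i h) * \<rho> + h * ((w i - y i) * \<rho>)))"
   by (rule eq_on_diff[OF e2 e1])
  also have "h * (w i * \<rho>) - (fpd i (fsgd i h) * \<rho> + h * ((w i - y i) * \<rho>)) = (h * y i - fpd i (fsgd i h)) * \<rho>"
   by (simp add: left_diff_distrib right_diff_distrib mult.assoc)
  finally have "eq_on U ((\<kappa> h * w i - fpd i (fsgd i (\<kappa> h))) - (h * \<rho> * w i - fpd i (fsgd i (h * \<rho>)))) (T (h * y i - fpd i (fsgd i h)))"
   unfolding T_def by (rule eq_on_diff[OF eq_on_sym[OF ky[OF i h]]])
  from eq_on_trans[OF fdo_minus_arg[OF fd F(2,1)] this] show ?thesis unfolding T_def by (rule eq_on_sym)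
 qed
 have T0: "eq_on U (T h) 0"
 proof (rule formal_nakayama[where e = True, OF Td _ _ _ h])
  show "(T (cst g) $$ r) z = 0" if "g \<in> sf_smooth U" "z \<in> U" "r < 0" for g r z
   using fdo_with_const[OF kf that(1,2), of r] that(3) by (simp add: T_def rho_neg)
  show "eq_on U (T 1) 0" using eq_on_diff[OF k1 eq_on_refl[of U \<rho>]] by (simp add: T_def)
  fix n x and i :: "('m, 'd) dir" and F :: "('m, 'd) sfun" and M
  assume x: "x \<in> U" and i: "holo i = True" and low: "!!g r z. g \<in> sf_smooth U ==> z \<in> U ==> r < n ==> (T (cst g) $$ r) z = 0"
   and F: "F \<in> sf_smooth U" and v: "!!G. G \<in> sf_smooth U ==> van M x (T (cst G) $$ n)"
  have i: "holo i" using i by simp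
  \<comment> \<open>The relations for \<open>T\<close> concern factors on the right, while the
    generators stand to the left of F; exchanging them costs the twist \<open>sgd i\<close>.\<close>
  define F' where "F' = sgd i F"
  have F': "F' \<in> sf_smooth U" using F by (simp add: F'_def)
  have C: "cst F' \<in> FF" using F' by simp
  have ca: "(T (cst (F' * a)) $$ n) z = (T (cst F') $$ n) z * a z" if "shol U a" "z \<in> U" for a z
   using eq_onD[OF Ta[OF that(1) C] that(2), of n] unfolding cst_mult by simp
  have cu: "(T (cst (F' * u i)) $$ n) z = (T (cst F') $$ n) z * u i z" if z: "z \<in> U" for z
  proof -
   \<comment> \<open>The relation \<open>Ty\<close> is read at nu^(n-1). There the derivative of
     \<open>T\<close> vanishes by \<open>low\<close>, and the poles of \<open>y i\<close> and
     \<open>w i\<close> contribute their common leading coefficient \<open>u i\<close>.\<close>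
   define q where "q = cst F' * y i - fpd i (fsgd i (cst F'))"
   have qF: "q \<in> FF" using C by (simp only: q_def FF_diff FF_mult y_FF FF_fpd FF_fsgd)
   have qn: "(q $$ j) z = F' z * (y i $$ j) z" if "j < 0" for j z using that by (simp add: q_def fls_const_fops)
   have "(T q $$ (n - 1)) z = (T (cst (F' * u i)) $$ n) z"
    by (rule lead_const[OF Td low qF _ _ _ z]) (use F' in \<open>simp_all add: qn y_low(1) y_leading\<close>)
   moreover have "(T q $$ (n - 1)) z = ((T (cst F') * w i) $$ (n - 1)) z - (fpd i (fsgd i (T (cst F'))) $$ (n - 1)) z"
    using eq_onD[OF Ty[OF i C] z, of "n - 1"] by (simp add: q_def)
   moreover have "(fpd i (fsgd i (T (cst F'))) $$ (n - 1)) z = 0"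
    unfolding fpd_nth fsgd_nth by (rule pd_zero_on[OF z]) (simp add: sgd_def sg_def low[OF F'])
   moreover have "((T (cst F') * w i) $$ (n - 1)) z = (T (cst F') $$ n) z * u i z"
   proof -
    have e: "{- 1..n - 1 - n} = {- 1 :: int}" by auto
    have "((T (cst F') * w i) $$ (n - 1)) z = (\<Sum>j = - 1..n - 1 - n. (T (cst F') $$ (n - 1 - j)) z * (w i $$ j) z)"
     by (rule fls_mult_nth_at) (simp_all add: w_low[OF _ z] low[OF F' z])
    then show ?thesis unfolding e by (simp add: u_def)
   qed
   ultimately show ?thesis by simp
  qed
  have S: "T (cst F') $$ n \<in> sf_smooth U" by (rule FF_nth[OF TF[OF C]])
  show "van (Suc M) x (T (cst (lcoord x i * F)) $$ n) \<and> van (Suc M) x (T (cst (uc x i * F)) $$ n)"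
  proof
   have l: "shol U (lcoord x i)" by (rule shol_lcoord(1)[OF subset_refl i])
   have "van (M + Suc 0) x ((T (cst F') $$ n) * lcoord x i)"
    by (rule van_mult[OF x S lcoord_smooth v[OF F'] van_lcoord[OF x]])
   moreover have "van (M + Suc 0) x ((T (cst F') $$ n) * lcoord x i) = van (M + Suc 0) x (T (cst (lcoord x i * F)) $$ n)"
    by (rule van_cong[OF x]) (simp only: lcoord_mult F'_def[symmetric] ca[OF l] times_fun_apply)
   ultimately show "van (Suc M) x (T (cst (lcoord x i * F)) $$ n)" by simp
   define c where "c = gcoeff (u i x) {} {}"
   have r: "(T (cst (uc x i * F)) $$ n) z = (T (cst F') $$ n) z * uc x i z" if z: "z \<in> U" for z
   proof -
    have "eq_on U (cst (uc x i * F)) (cst (F' * u i) - cst (F' * sconst c))"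
    proof (rule eq_onI)
     fix m z assume z: "z \<in> U"
     show "(cst (uc x i * F) $$ m) z = ((cst (F' * u i) - cst (F' * sconst c)) $$ m) z"
      using uc_comm[OF z x, of i F] by (cases "m = 0") (simp_all add: F'_def[symmetric] uc_def c_def right_diff_distrib)
    qed
    then have "eq_on U (T (cst (uc x i * F))) (T (cst (F' * u i) - cst (F' * sconst c)))"
     by (rule fdo_cong_U[OF Td, rotated 2]) (intro FF_const FF_diff sf_smooth_mult oU uc_smooth F F' u_smooth sf_smooth_sconst)+
    also have "eq_on U \<dots> (T (cst (F' * u i)) - T (cst (F' * sconst c)))"
     by (rule fdo_minus_arg[OF Td]) (intro FF_const sf_smooth_mult oU F' u_smooth sf_smooth_sconst)+
    finally show ?thesis
     by (drule_tac eq_onD[OF _ z, of _ _ n]) (simp add: cu[OF z] ca[OF shol_sconst(1) z] uc_def c_def right_diff_distrib)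
   qed
   have "van (M + Suc 0) x ((T (cst F') $$ n) * uc x i)"
    by (rule van_mult[OF x S uc_smooth v[OF F'] van_uc[OF x]])
   moreover have "van (M + Suc 0) x ((T (cst F') $$ n) * uc x i) = van (M + Suc 0) x (T (cst (uc x i * F)) $$ n)"
    by (rule van_cong[OF x]) (simp only: r times_fun_apply)
   ultimately show "van (Suc M) x (T (cst (uc x i * F)) $$ n)" by simp
  qed
 qed
 have "eq_on U (\<kappa> h) (h * \<rho>)"
 proof (rule eq_onI)
  fix n z assume "z \<in> U"
  from eq_onD[OF T0 this, of n] show "(\<kappa> h $$ n) z = ((h * \<rho>) $$ n) z" by (simp add: T_def)
 qed
 then have "eq_on U (\<kappa> h * g) (h * \<rho> * g)" by (rule eq_on_mult[OF _ eq_on_refl])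
 also have "eq_on U (h * \<rho> * g) (h * g * \<rho>)" unfolding mult.assoc by (rule eq_on_mult[OF eq_on_refl rho_comm])
 finally show ?thesis using kb[OF h g c] bint_eq_on by simp
qed

lemma trace_left:
 assumes h: "h \<in> FF" and g: "g \<in> FF" and c: "(\<forall>n. csup (h $$ n)) \<or> (\<forall>n. csup (g $$ n))"
 shows "bint ((star g (Ber h) * \<rho>) $$ n) = bint ((g * h * \<rho>) $$ n)"
proof -
 obtain B where Bb: "!!r. bidiff U (B r)" and B: "!!h g z r. h \<in> sf_smooth U ==> g \<in> sf_smooth U ==> z \<in> U ==>
   (star (cst g) (Ber (cst h)) $$ r) z = (if r < 0 then 0 else B r h g z)"
  using star_Ber_bidiff' by blast
 have "\<exists>K. (\<forall>r. diff_op U (K r)) \<and> (\<forall>h\<in>FF. \<forall>g\<in>FF. (\<forall>n. csup (h $$ n)) \<or> (\<forall>n. csup (g $$ n)) -->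
  (\<forall>n. bint ((star g (Ber h) * \<rho>) $$ n) = bint ((op_of K h * g) $$ n)))"
  by (rule product_transpose[where P = "\<lambda>h g. star g (Ber h)", OF star_fdo_r[OF Ber_FF] fdo_comp[OF star_fdo Ber_fdo] Bb B rho_FF rho_neg])
 then obtain K where K: "!!r. diff_op U (K r)" and
  kb: "\<forall>h\<in>FF. \<forall>g\<in>FF. (\<forall>n. csup (h $$ n)) \<or> (\<forall>n. csup (g $$ n)) -->
  (\<forall>n. bint ((star g (Ber h) * \<rho>) $$ n) = bint ((op_of K h * g) $$ n))" by blast
 \<comment> \<open>Parity compensates for moving the transposed operator from the left of
   \<open>g\<close> to its right under the integral, by \<open>bint_swap_formal\<close>.\<close>
 define \<kappa> where "\<kappa> h = fpar (op_of K h)" for h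
 have kf: "fdo_with 0 K (op_of K)" by (rule fdo_with_op_of[OF K])
 then have "fdo (op_of K)" by (auto simp: fdo_def)
 then have kd: "fdo \<kappa>" unfolding \<kappa>_def[abs_def] by (rule fdo_comp[OF fdo_fpar])
 have kF [simp]: "\<kappa> h \<in> FF" if "h \<in> FF" for h by (rule fdo_closed[OF kd that])
 have kb: "bint ((star g (Ber h) * \<rho>) $$ n) = bint ((g * \<kappa> h) $$ n)"
  if "h \<in> FF" "g \<in> FF" "(\<forall>n. csup (h $$ n)) \<or> (\<forall>n. csup (g $$ n))" for h g n
  unfolding \<kappa>_def bint_swap_formal[symmetric] using kb that by blast
 have kt: "eq_on U (\<kappa> h) F"
  if h: "h \<in> FF" and F: "F \<in> FF"
   and e: "!!g n. g \<in> sf_smooth U ==> csup g ==> bint ((star (cst g) (Ber h) * \<rho>) $$ n) = bint (g * F $$ n)" for h F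
 proof (rule eq_on_of_bint_left[OF kF[OF h] F])
  fix g :: "('m, 'd) sfun" and n assume g: "g \<in> sf_smooth U" "csup g"
  have "bint ((star (cst g) (Ber h) * \<rho>) $$ n) = bint ((cst g * \<kappa> h) $$ n)"
   by (rule kb[OF h FF_const[OF g(1)]]) (use csup_const[OF g(2)] in blast)
  moreover have "(cst g * \<kappa> h) $$ n = g * \<kappa> h $$ n" by simp
  ultimately show "bint (g * \<kappa> h $$ n) = bint (g * F $$ n)" using e[OF g, of n] by simp
 qed
 have k1: "eq_on U (\<kappa> 1) \<rho>"
 proof (rule kt)
  fix g :: "('m, 'd) sfun" and n assume g: "g \<in> sf_smooth U" "csup g"
  have b1: "eq_on U (Ber 1) 1" using Ber_one(1)[OF shol_sconst(3) oU subset_refl] by (simp only: fls_const_1)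
  have "eq_on U (star (cst g) (Ber 1)) (star (cst g) 1)"
   by (rule star_cong_U[OF _ _ _ _ eq_on_refl b1]) (use g in simp_all)
  also have "eq_on U \<dots> (cst g)" by (rule star_one(2)) (use g in simp)
  finally have "eq_on U (star (cst g) (Ber 1) * \<rho>) (cst g * \<rho>)" by (rule eq_on_mult[OF _ eq_on_refl])
  from bint_eq_on[OF this, of n]
  show "bint ((star (cst g) (Ber 1) * \<rho>) $$ n) = bint (g * \<rho> $$ n)" by simp
 qed simp_all
 have ka: "eq_on U (\<kappa> (cst b * h)) (cst b * \<kappa> h)" if b: "santi U b" and h: "h \<in> FF" for b h
 proof (rule kt)
  have A: "cst b \<in> FF" using shol_smooth(2)[OF b] by simp
  show "cst b * h \<in> FF" by (rule FF_mult[OF A h])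
  show "cst b * \<kappa> h \<in> FF" by (rule FF_mult[OF A kF[OF h]])
  fix g :: "('m, 'd) sfun" and n assume g: "g \<in> sf_smooth U" "csup g"
  have gb: "g * b \<in> sf_smooth U" using shol_smooth(2)[OF b] g by simp
  have G: "cst g \<in> FF" using g by simp
  have "eq_on U (star (cst g) (Ber (cst b * h))) (star (cst g) (star (cst b) (Ber h)))"
   by (rule star_cong_U[OF _ _ _ _ eq_on_refl Ber_bmult[OF b h]]) (use h A G in \<open>simp_all only: Ber_FF star_FF FF_mult\<close>)
  also have "eq_on U \<dots> (star (star (cst g) (cst b)) (Ber h))" by (rule eq_on_sym[OF star_assoc[OF G A Ber_FF[OF h]]])
  also have "eq_on U \<dots> (star (cst (g * b)) (Ber h))"
   unfolding cst_mult[symmetric]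
   by (rule star_cong_U[OF _ _ _ _ star_anti_U[OF b G] eq_on_refl]) (use h A G in \<open>simp_all only: Ber_FF star_FF FF_mult\<close>)
  finally have "bint ((star (cst g) (Ber (cst b * h)) * \<rho>) $$ n) = bint ((star (cst (g * b)) (Ber h) * \<rho>) $$ n)"
   by (intro bint_eq_on eq_on_mult eq_on_refl)
  also have "\<dots> = bint ((cst (g * b) * \<kappa> h) $$ n)"
   by (rule kb[OF h FF_const[OF gb]]) (use csup_const[OF csup_rmult[OF g(2)]] in blast)
  also have "(cst (g * b) * \<kappa> h) $$ n = g * (cst b * \<kappa> h) $$ n" by (simp add: mult.assoc)
  finally show "bint ((star (cst g) (Ber (cst b * h)) * \<rho>) $$ n) = bint (g * (cst b * \<kappa> h) $$ n)" .
 qed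
 have ky: "eq_on U (\<kappa> (y i * h - fpd i h)) (w i * \<kappa> h - fpd i (\<kappa> h))" if i: "\<not> holo i" and h: "h \<in> FF" for i h
 proof (rule kt)
  show hF: "y i * h - fpd i h \<in> FF" "w i * \<kappa> h - fpd i (\<kappa> h) \<in> FF" using h by simp_all
  fix g :: "('m, 'd) sfun" and n assume g: "g \<in> sf_smooth U" "csup g"
  have G: "cst g \<in> FF" using g by simp
  define q where "q = cst g * w i + fpd i (fsgd i (cst g))"
  have qF: "q \<in> FF" unfolding q_def by (intro FF_add FF_mult w_FF FF_fpd FF_fsgd G)
  have qn: "q $$ n = g * w i $$ n + (if n = 0 then pd i (sgd i g) else 0)" for n by (simp add: q_def fls_const_fops)
  have cpd: "csup (pd i (sgd i g))" by (rule csup_diff_op[OF diff_op_pd csup_diff_op[OF diff_op_sgd g(2)]])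
  have qc: "csup (q $$ n)" for n unfolding qn by (intro csup_add csup_rmult g) (cases "n = 0"; simp add: cpd csup_0)
  have "eq_on U (Ber (y i * h - fpd i h)) (Ber (D (y i) h))"
   by (rule fdo_cong_U[OF Ber_fdo hF(1) _ eq_on_sym[OF D_y_l[OF i h]]]) (use h in simp)
  also have "eq_on U \<dots> (star (Ber (y i)) (Ber h))" by (rule Ber_D[OF y_FF h])
  also have "eq_on U \<dots> (star (w i) (Ber h))" by (rule star_cong_U[OF _ _ _ _ Ber_y eq_on_refl]) (use h in simp_all)
  finally have e: "eq_on U (Ber (y i * h - fpd i h)) (star (w i) (Ber h))" .
  have "eq_on U (star (cst g) (Ber (y i * h - fpd i h))) (star (cst g) (star (w i) (Ber h)))"
   by (rule star_cong_U[OF _ _ _ _ eq_on_refl e]) (use h hF G in simp_all)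
  also have "eq_on U \<dots> (star (star (cst g) (w i)) (Ber h))" by (rule eq_on_sym[OF star_assoc[OF G w_FF Ber_FF[OF h]]])
  also have "eq_on U \<dots> (star q (Ber h))"
   unfolding q_def by (rule star_cong_U[OF _ _ _ _ star_w_r[OF i G] eq_on_refl]) (use h G in simp_all)
  finally have "bint ((star (cst g) (Ber (y i * h - fpd i h)) * \<rho>) $$ n) = bint ((star q (Ber h) * \<rho>) $$ n)"
   by (intro bint_eq_on eq_on_mult eq_on_refl)
  also have "\<dots> = bint ((q * \<kappa> h) $$ n)" by (rule kb[OF h qF]) (use qc in blast)
  also have "(q * \<kappa> h) $$ n = g * (w i * \<kappa> h) $$ n + pd i (sgd i g) * \<kappa> h $$ n"
  proof -
   have "q * \<kappa> h = cst g * (w i * \<kappa> h) + cst (pd i (sgd i g)) * \<kappa> h"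
    unfolding q_def fls_const_fops by (simp only: distrib_right mult.assoc)
   then show ?thesis by simp
  qed
  also have "bint \<dots> = bint (g * (w i * \<kappa> h) $$ n) + bint (pd i (sgd i g) * \<kappa> h $$ n)"
   by (rule bint_add) (use h g csup_rmult[OF g(2)] csup_rmult[OF cpd] FF_nth[OF FF_mult[OF w_FF kF[OF h]]] in simp_all)
  also have "bint (pd i (sgd i g) * \<kappa> h $$ n) = - bint (g * pd i (\<kappa> h $$ n))"
  proof -
   have s: "sgd i (sgd i g) = g" by (simp add: sgd_def sg_def)
   have "bint (pd i (sgd i g) * \<kappa> h $$ n) = - bint (sgd i (sgd i g) * pd i (\<kappa> h $$ n))"
    by (rule bint_parts) (use h g csup_diff_op[OF diff_op_sgd g(2)] in simp_all)
   then show ?thesis unfolding s .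
  qed
  also have "bint (g * (w i * \<kappa> h) $$ n) + - bint (g * pd i (\<kappa> h $$ n))
    = bint (g * (w i * \<kappa> h) $$ n - g * pd i (\<kappa> h $$ n))"
   using bint_diff[of "g * (w i * \<kappa> h) $$ n" "g * pd i (\<kappa> h $$ n)"] h g csup_rmult[OF g(2)]
    FF_nth[OF FF_mult[OF w_FF kF[OF h]]] by simp
  also have "g * (w i * \<kappa> h) $$ n - g * pd i (\<kappa> h $$ n) = g * (w i * \<kappa> h - fpd i (\<kappa> h)) $$ n"
   by (simp add: right_diff_distrib)
  finally show "bint ((star (cst g) (Ber (y i * h - fpd i h)) * \<rho>) $$ n)
    = bint (g * (w i * \<kappa> h - fpd i (\<kappa> h)) $$ n)" .
 qed
 define T where "T h = \<kappa> h - h * \<rho>" for h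
 have Td: "fdo T" unfolding T_def[abs_def] by (rule fdo_diff[OF kd fdo_rmult[OF rho_FF]])
 have TF: "T h \<in> FF" if "h \<in> FF" for h by (rule fdo_closed[OF Td that])
 have Ta: "eq_on U (T (cst b * h)) (cst b * T h)" if b: "santi U b" and h: "h \<in> FF" for b h
  using eq_on_diff[OF ka[OF b h] eq_on_refl[of U "cst b * (h * \<rho>)"]] by (simp only: T_def right_diff_distrib mult.assoc)
 have Ty: "eq_on U (T (y i * h - fpd i h)) (w i * T h - fpd i (T h))" if i: "\<not> holo i" and h: "h \<in> FF" for i h
 proof -
  have F: "h * \<rho> \<in> FF" "\<kappa> h \<in> FF" "fsgd i h \<in> FF" using h by simp_all
  have fd: "fdo (\<lambda>f. w i * f - fpd i f)" by (rule fdo_diff[OF fdo_lmult[OF w_FF] fdo_fpd])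
  have p: "par (oddd i) (w i - y i)"
   by (rule parI) (simp add: parD[OF w_par] parD[OF y_par])
  have "eq_on U (fpd i (h * \<rho>)) (fpd i h * \<rho> + fsgd i h * fpd i \<rho>)" by (rule fpd_mult[OF h rho_FF])
  also have "eq_on U \<dots> (fpd i h * \<rho> + fsgd i h * ((w i - y i) * \<rho>))"
   by (intro eq_on_add eq_on_mult eq_on_refl fpd_rho)
  also have "eq_on U \<dots> (fpd i h * \<rho> + (w i - y i) * h * \<rho>)"
   unfolding mult.assoc[of "fsgd i h", symmetric]
   by (intro eq_on_add eq_on_mult eq_on_refl eq_on_sym[OF par_comm[OF p]])
  finally have e1: "eq_on U (fpd i (h * \<rho>)) (fpd i h * \<rho> + (w i - y i) * h * \<rho>)" .
  have "eq_on U (w i * (h * \<rho>) - fpd i (h * \<rho>)) (w i * (h * \<rho>) - (fpd i h * \<rho> + (w i - y i) * h * \<rho>))"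
   by (rule eq_on_diff[OF eq_on_refl e1])
  also have "w i * (h * \<rho>) - (fpd i h * \<rho> + (w i - y i) * h * \<rho>) = (y i * h - fpd i h) * \<rho>"
   by (simp add: left_diff_distrib right_diff_distrib mult.assoc)
  finally have "eq_on U ((w i * \<kappa> h - fpd i (\<kappa> h)) - (w i * (h * \<rho>) - fpd i (h * \<rho>))) (T (y i * h - fpd i h))"
   unfolding T_def by (rule eq_on_diff[OF eq_on_sym[OF ky[OF i h]]])
  from eq_on_trans[OF fdo_minus_arg[OF fd F(2,1)] this] show ?thesis unfolding T_def by (rule eq_on_sym)
 qed
 have T0: "eq_on U (T h) 0"
 proof (rule formal_nakayama[where e = False, OF Td _ _ _ h])
  show "(T (cst g) $$ r) z = 0" if "g \<in> sf_smooth U" "z \<in> U" "r < 0" for g r z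
   using fdo_with_const[OF kf that(1,2), of r] that(3) by (simp add: T_def rho_neg \<kappa>_def sg_def)
  show "eq_on U (T 1) 0" using eq_on_diff[OF k1 eq_on_refl[of U \<rho>]] by (simp add: T_def)
  fix n x and i :: "('m, 'd) dir" and F :: "('m, 'd) sfun" and M
  assume x: "x \<in> U" and i: "holo i = False" and low: "!!g r z. g \<in> sf_smooth U ==> z \<in> U ==> r < n ==> (T (cst g) $$ r) z = 0"
   and F: "F \<in> sf_smooth U" and v: "!!G. G \<in> sf_smooth U ==> van M x (T (cst G) $$ n)"
  have i: "\<not> holo i" using i by simp
  have C: "cst F \<in> FF" using F by simp
  have ca: "(T (cst (b * F)) $$ n) z = b z * (T (cst F) $$ n) z" if "santi U b" "z \<in> U" for b z
   using eq_onD[OF Ta[OF that(1) C] that(2), of n] unfolding cst_mult by simp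
  have cu: "(T (cst (u i * F)) $$ n) z = u i z * (T (cst F) $$ n) z" if z: "z \<in> U" for z
  proof -
   define q where "q = y i * cst F - fpd i (cst F)"
   have qF: "q \<in> FF" using C by (simp only: q_def FF_diff FF_mult y_FF FF_fpd)
   have qn: "(q $$ j) z = (y i $$ j) z * F z" if "j < 0" for j z using that by (simp add: q_def fls_const_fops)
   have "(T q $$ (n - 1)) z = (T (cst (u i * F)) $$ n) z"
    by (rule lead_const[OF Td low qF _ _ _ z]) (use F in \<open>simp_all add: qn y_low(1) y_leading\<close>)
   moreover have "(T q $$ (n - 1)) z = ((w i * T (cst F)) $$ (n - 1)) z - (fpd i (T (cst F)) $$ (n - 1)) z"
    using eq_onD[OF Ty[OF i C] z, of "n - 1"] by (simp add: q_def)
   moreover have "(fpd i (T (cst F)) $$ (n - 1)) z = 0"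
    unfolding fpd_nth by (rule pd_zero_on[OF z]) (simp add: low[OF F])
   moreover have "((w i * T (cst F)) $$ (n - 1)) z = u i z * (T (cst F) $$ n) z"
   proof -
    have e: "{n..n - 1 - - 1} = {n :: int}" by auto
    have "((w i * T (cst F)) $$ (n - 1)) z = (\<Sum>j = n..n - 1 - - 1. (w i $$ (n - 1 - j)) z * (T (cst F) $$ j) z)"
     by (rule fls_mult_nth_at) (simp_all add: w_low[OF _ z] low[OF F z])
    then show ?thesis unfolding e by (simp add: u_def)
   qed
   ultimately show ?thesis by simp
  qed
  have S: "T (cst F) $$ n \<in> sf_smooth U" by (rule FF_nth[OF TF[OF C]])
  show "van (Suc M) x (T (cst (lcoord x i * F)) $$ n) \<and> van (Suc M) x (T (cst (uc x i * F)) $$ n)"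
  proof
   have l: "santi U (lcoord x i)" by (rule shol_lcoord(2)[OF subset_refl i])
   have "van (Suc 0 + M) x (lcoord x i * (T (cst F) $$ n))"
    by (rule van_mult[OF x lcoord_smooth S van_lcoord[OF x] v[OF F]])
   moreover have "van (Suc 0 + M) x (lcoord x i * (T (cst F) $$ n)) = van (Suc 0 + M) x (T (cst (lcoord x i * F)) $$ n)"
    by (rule van_cong[OF x]) (simp only: ca[OF l] times_fun_apply)
   ultimately show "van (Suc M) x (T (cst (lcoord x i * F)) $$ n)" by simp
   define c where "c = gcoeff (u i x) {} {}"
   have r: "(T (cst (uc x i * F)) $$ n) z = uc x i z * (T (cst F) $$ n) z" if z: "z \<in> U" for z
   proof -
    have "cst (uc x i * F) = cst (u i * F) - cst (sconst c * F)"
     unfolding uc_def c_def[symmetric] left_diff_distrib by (rule fls_eqI) simp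
    moreover have "eq_on U (T (cst (u i * F) - cst (sconst c * F))) (T (cst (u i * F)) - T (cst (sconst c * F)))"
     by (rule fdo_minus_arg[OF Td]) (intro FF_const sf_smooth_mult oU F u_smooth sf_smooth_sconst)+
    ultimately have "eq_on U (T (cst (uc x i * F))) (T (cst (u i * F)) - T (cst (sconst c * F)))" by (simp only:)
    from eq_onD[OF this z, of n] show ?thesis
     by (simp add: cu[OF z] ca[OF shol_sconst(2) z] uc_def c_def left_diff_distrib)
   qed
   have "van (Suc 0 + M) x (uc x i * (T (cst F) $$ n))"
    by (rule van_mult[OF x uc_smooth S van_uc[OF x] v[OF F]])
   moreover have "van (Suc 0 + M) x (uc x i * (T (cst F) $$ n)) = van (Suc 0 + M) x (T (cst (uc x i * F)) $$ n)"
    by (rule van_cong[OF x]) (simp only: r times_fun_apply)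
   ultimately show "van (Suc M) x (T (cst (uc x i * F)) $$ n)" by simp
  qed
 qed
 have "eq_on U (\<kappa> h) (h * \<rho>)"
 proof (rule eq_onI)
  fix n z assume "z \<in> U"
  from eq_onD[OF T0 this, of n] show "(\<kappa> h $$ n) z = ((h * \<rho>) $$ n) z" by (simp add: T_def)
 qed
 then have "eq_on U (g * \<kappa> h) (g * (h * \<rho>))" by (rule eq_on_mult[OF eq_on_refl])
 from kb[OF h g c, of n] bint_eq_on[OF this, of n] show ?thesis by (simp only: mult.assoc)
qed

text \<open>With f = Ber h, both orders of the star product reduce under the integral to pointwise
  products of h and g, which supercommute.\<close>

lemma supertrace: "supertrace_density U star \<rho>"
 unfolding supertrace_density_def berezin_integral_bint
proof (intro conjI rho_FF ballI allI impI)
 fix f g :: "('m, 'd) formal" and p q n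
 assume f: "f \<in> FF" and g: "g \<in> FF"
  and a: "homogeneous_on U p f \<and> homogeneous_on U q g \<and> (compact_supp_on U f \<or> compact_supp_on U g)"
 define h where "h = J f"
 have h: "h \<in> FF" using f by (simp add: h_def)
 have cs: "compact_supp_on U k \<longleftrightarrow> (\<forall>n. csup (k $$ n))" for k :: "('m, 'd) formal"
  by (simp add: compact_supp_on_def csup_def)
 \<comment> \<open>The inverse Berezin transform is a formal differential operator, so h inherits
   compact support from f.\<close>
 have c: "(\<forall>n. csup (h $$ n)) \<or> (\<forall>n. csup (g $$ n))"
  using a csup_fdo_formal[OF J_fdo f] unfolding cs h_def by blast
 have ph: "par (odd p) h" unfolding h_def using a f par_J by (simp add: homogeneous_on_par)
 have pg: "par (odd q) g" using a by (simp add: homogeneous_on_par)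
 have e: "eq_on U (Ber h) f" unfolding h_def by (rule Ber_J[OF f])
 have "eq_on U (star f g) (star (Ber h) g)"
  by (rule star_cong_U[OF _ _ _ _ eq_on_sym[OF e] eq_on_refl]) (use f g h in simp_all)
 then have "bint ((star f g * \<rho>) $$ n) = bint ((star (Ber h) g * \<rho>) $$ n)"
  by (intro bint_eq_on eq_on_mult eq_on_refl)
 also have "\<dots> = bint ((h * g * \<rho>) $$ n)" by (rule trace_right[OF h g c])
 also have "\<dots> = (- 1) ^ (p * q) * bint ((g * h * \<rho>) $$ n)"
 proof (cases "odd p")
  case True
  have "eq_on U (h * g) (fpar g * h)" by (rule fls_mult_commute_odd) (use ph True in \<open>simp add: par_def\<close>)
  also have "eq_on U \<dots> ((if odd q then - g else g) * h)"
   by (rule eq_on_mult[OF pg[unfolded par_def] eq_on_refl])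
  finally have "eq_on U (h * g * \<rho>) ((if odd q then - g else g) * h * \<rho>)" by (rule eq_on_mult[OF _ eq_on_refl])
  from bint_eq_on[OF this, of n] show ?thesis using True by (cases "odd q") (simp_all add: bint_uminus)
 next
  case False
  have "eq_on U (h * g) (g * h)" by (rule fls_mult_commute_even) (use ph False in \<open>simp add: par_def\<close>)
  from bint_eq_on[OF eq_on_mult[OF this eq_on_refl]] show ?thesis using False by simp
 qed
 also have "bint ((g * h * \<rho>) $$ n) = bint ((star g (Ber h) * \<rho>) $$ n)" by (rule trace_left[OF h g c, symmetric])
 also have "\<dots> = bint ((star g f * \<rho>) $$ n)"
  by (intro bint_eq_on eq_on_mult eq_on_refl star_cong_U[OF _ _ _ _ eq_on_refl e]) (use f g h in simp_all)
 finally show "bint ((star f g * \<rho>) $$ n) = (- 1) ^ (p * q) * bint ((star g f * \<rho>) $$ n)" .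
qed

end

text \<open>The differential equations determine each coefficient of X' only up to a constant. The
  vanishing of the negative powers of X + X' on U is therefore part of the statement; it is what
  gives \<open>formal_exp (X + X')\<close> its meaning.\<close>

theorem theorem4:
  fixes U :: "(complex^'m::finite) set"
    and star :: "('m, 'd::{finite,linorder}) prod"
    and X :: "('m, 'd) formal"
    and Ber :: "('m, 'd) formal \<Rightarrow> ('m, 'd) formal"
  assumes "open U" and "contractible U"
    and "nondegenerate_potential U X"
    and "nondegenerate_star U star"
    and "determines_anti_wick U X star"
    and "berezin_transform U star Ber"
  shows "\<exists>X'. nondegenerate_potential U X' \<and>
     determines_wick U X' (dual_star U Ber star) \<and>
     (\<forall>k. eq_on U (f_dz k X') (- op_inv U Ber (f_dz k X))) \<and>
     (\<forall>\<alpha>. eq_on U (f_dtheta \<alpha> X') (- op_inv U Ber (f_dtheta \<alpha> X))) \<and>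
     (\<forall>l. eq_on U (f_dzbar l X') (- op_inv U Ber (f_dzbar l X))) \<and>
     (\<forall>\<beta>. eq_on U (f_dthetabar \<beta> X') (- op_inv U Ber (f_dthetabar \<beta> X))) \<and>
     (\<forall>n<0. \<forall>z\<in>U. ((X + X') $$ n) z = 0) \<and>
     supertrace_density U star (formal_exp (X + X'))"
proof -
  interpret bstar U star X Ber by unfold_locales (use assms in simp_all)
  obtain X' where pot': "nondegenerate_potential U X'" and bd: "bdens U star X Ber X'"
    using dual_potential[OF assms(2)] by blast
  interpret bdens U star X Ber X' by (rule bd)
  have d: "eq_on U (fpd i X') (- op_inv U Ber (fpd i X))" for i
    using fpd_X'[of i] by (simp only: y_def w_def)
  show ?thesis
    unfolding f_d_fpd
    using pot' determines_wick_dual d X_X' supertrace[unfolded \<rho>_def] by blast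
qed

end
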